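(* Let $(\mathcal C,\otimes,[-,-],I,\phi)$ be a monoidal skew closed category, with $\mathcal C$ a model category, satisfying Axiom MC. Then the left derived skew monoidal structure $(\mathrm{Ho}(\mathcal C),\otimes_l,I)$ and the right derived skew closed structure $(\mathrm{Ho}(\mathcal C),[-,-]_r,I)$, together with the isomorphisms $$\phi^d:\mathrm{Ho}(\mathcal C)(QA\otimes QB,C)\cong \mathrm{Ho}(\mathcal C)(A,[QB,RC]),$$ form a monoidal skew closed structure on $\mathrm{Ho}(\mathcal C)$.
   Context: **Skew monoidal category** $(\mathcal C,\otimes,I,\alpha,l,r)$: a functor $\otimes:\mathcal C\times\mathcal C\to\mathcal C$, an object $I$, and natural (not necessarily invertible) maps $\alpha_{A,B,C}:(A\otimes B)\otimes C\to A\otimes(B\otimes C)$, $l_A:I\otimes A\to A$, $r_A:A\to A\otimes I$ with: $(1\otimes\alpha_{B,C,D})\alpha_{A,B\otimes C,D}(\alpha_{A,B,C}\otimes1)=\alpha_{A,B,C\otimes D}\alpha_{A\otimes B,C,D}$; $l_{B\otimes C}\alpha_{I,B,C}=l_B\otimes1$; $(1\otimes l_C)\alpha_{A,I,C}(r_A\otimes1)=1$; $\alpha_{A,B,I}r_{A\otimes B}=1\otimes r_B$; $l_Ir_I=1$. **Skew closed category** $(\mathcal C,[-,-],I,L,i,j)$: a bifunctor $[-,-]:\mathcal C^{op}\times\mathcal C\to\mathcal C$, an object $I$, maps $L=L^A_{B,C}:[B,C]\to[[A,B],[A,C]]$ natural in $B,C$ and extranatural in $A$, a natural $i_A:[I,A]\to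 A$, and an extranatural $j_A:I\to[A,A]$, with: (C1) $[L^A_{B,C},1]\circ L^{[A,B]}_{[A,C],[A,D]}\circ L^A_{C,D}=[1,L^A_{B,D}]\circ L^B_{C,D}$; (C2) $i_{[A,C]}\circ[j_A,1]\circ L^A_{A,C}=1$; (C3) $L^A_{B,B}\circ j_B=j_{[A,B]}$; (C4) $[1,i_C]\circ L^I_{B,C}=[i_B,1]$; (C5) $i_I\circ j_I=1$. **Monoidal skew closed category** $(\mathcal C,\otimes,[-,-],I,\phi)$: a skew monoidal and a skew closed structure on $\mathcal C$ with the same $I$ and isomorphisms $\phi:\mathcal C(A\otimes B,C)\cong\mathcal C(A,[B,C])$ natural in each variable, such that: $\phi(f\circ l_A)=[1,f]\circ j_A$ for $f:A\to B$; $g\circ r_A=i_B\circ\phi(g)$ for $g:A\otimes I\to B$; and $\phi(\phi(h\circ\alpha))=t\circ\phi(h)$ for $h:A\otimes(B\otimes C)\to D$. Here $u:A\to[B,A\otimes B]$ is $\phi(1_{A\otimes B})$ and $t_{A,B,C}=[u,1]\circ L:[A\otimes B,C]\to[[B,A\otimes B],[B,C]]\to[A,[B,C]]$. **Model category conventions.** Model categories have functorial factorisations, giving cofibrant and fibrant replacement functors $Q,R$ with natural trivial fibrations $p_A:QA\to A$ and trivial cofibrations $q_A:A\to RA$. Maps of $\mathcal C$ and their images in $\mathrm{Ho}(\mathcal C)$ are denoted alike. **Axiom MC**: for cofibrant $X$ the functor $-\otimes X$ is left Quillen (equivalently $[X,-]$ is right Quillen); for each cofibrant $Y$ the functor $Y\otimes-$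 preserves weak equivalences between cofibrant objects (equivalently, in the presence of the first condition, for each fibrant $Y$ the functor $[-,Y]$ preserves weak equivalences between cofibrant objects); and $I$ is cofibrant. **Left derived skew monoidal structure** $(\mathrm{Ho}(\mathcal C),\otimes_l,I,\alpha_l,l_l,r_l)$: $A\otimes_lB=QA\otimes QB$, unit $I$, and in $\mathrm{Ho}(\mathcal C)$ - $\alpha_l=(1\otimes p)^{-1}\circ\alpha_{QA,QB,QC}\circ(p\otimes1):Q(QA\otimes QB)\otimes QC\to QA\otimes Q(QB\otimes QC)$; - $l_l=p_A\circ l_{QA}\circ(p_I\otimes1):QI\otimes QA\to A$; - $r_l=(1\otimes p_I)^{-1}\circ r_{QA}\circ p_A^{-1}:A\to QA\otimes QI$. **Right derived skew closed structure** $(\mathrm{Ho}(\mathcal C),[-,-]_r,I,L_r,i_r,j_r)$: $[A,B]_r=[QA,RB]$, unit $I$. For cofibrant $A$ let $k_{A,B}:Q[A,B]\to[A,QB]$ be a chosen lifting with $[1,p_B]\circ k_{A,B}=p_{[A,B]}$, and let $e:I\to QI$ be a chosen map with $p_Ie=1$. Then in $\mathrm{Ho}(\mathcal C)$ - $L_r=[1,q]\circ[k_{QC,RA},1]\circ L^{QC}_{QRA,RB}\circ[Qq_A,1]^{-1}:[QA,RB]\to[Q[QC,RA],R[QC,RB]]$; - $i_r=q_A^{-1}\circ i_{RA}\circ[e,1]:[QI,RA]\to A$; - $j_r=[1,q_A]\circ[p_A,1]\circ j_A:I\to[QA,RA]$. **The isomorphism $\phi^d$.** For cofibrant $X,Y$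 and fibrant $Z$, $\phi$ respects homotopy classes and induces $\phi:\mathrm{Ho}(\mathcal C)(X\otimes Y,Z)\cong\mathrm{Ho}(\mathcal C)(X,[Y,Z])$. Then $\phi^d$ is the composite $$\mathrm{Ho}(\mathcal C)(QA\otimes QB,C)\xrightarrow{(1,q)}\mathrm{Ho}(\mathcal C)(QA\otimes QB,RC)\xrightarrow{\phi}\mathrm{Ho}(\mathcal C)(QA,[QB,RC])\xrightarrow{(p,1)^{-1}}\mathrm{Ho}(\mathcal C)(A,[QB,RC]).$$ *)

theory Defs
  imports Main
begin

section \<open>Categories and functors\<close>

record ('o, 'm) cat =
  Obj :: "'o set"
  Arr :: "'m set"
  Dom :: "'m \<Rightarrow> 'o"
  Cod :: "'m \<Rightarrow> 'o"
  Ide :: "'o \<Rightarrow> 'm"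
  Comp :: "'m \<Rightarrow> 'm \<Rightarrow> 'm"  (infixr "\<cdot>\<index>" 70)

text \<open>Order of composition: \<open>g \<cdot>\<^bsub>C\<^esub> f\<close> is \<open>f\<close> followed by \<open>g\<close>.\<close>

definition Hom :: "('o, 'm, 'z) cat_scheme \<Rightarrow> 'o \<Rightarrow> 'o \<Rightarrow> 'm set" where
  "Hom C A B = {f \<in> Arr C. Dom C f = A \<and> Cod C f = B}"

locale category =
  fixes C :: "('o, 'm, 'z) cat_scheme" (structure)
  assumes Dom_in: "f \<in> Arr C \<Longrightarrow> Dom C f \<in> Obj C"
    and Cod_in: "f \<in> Arr C \<Longrightarrow> Cod C f \<in> Obj C"
    and Ide_in: "A \<in> Obj C \<Longrightarrow> Ide C A \<in> Hom C A A"
    and Comp_in: "\<lbrakk>f \<in> Hom C X Y; g \<in> Hom C Y Z\<rbrakk> \<Longrightarrow> g \<cdot> f \<in> Hom C X Z"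
    and Comp_Ide: "f \<in> Hom C X Y \<Longrightarrow> f \<cdot> Ide C X = f"
    and Ide_Comp: "f \<in> Hom C X Y \<Longrightarrow> Ide C Y \<cdot> f = f"
    and Comp_assoc: "\<lbrakk>f \<in> Hom C W X; g \<in> Hom C X Y; h \<in> Hom C Y Z\<rbrakk>
      \<Longrightarrow> (h \<cdot> g) \<cdot> f = h \<cdot> (g \<cdot> f)"

definition op_cat :: "('o, 'm, 'z) cat_scheme \<Rightarrow> ('o, 'm) cat" where
  "op_cat C = \<lparr>Obj = Obj C, Arr = Arr C, Dom = Cod C, Cod = Dom C, Ide = Ide C,
     Comp = (\<lambda>g f. f \<cdot>\<^bsub>C\<^esub> g)\<rparr>"

definition prod_cat ::
  "('o, 'm, 'y) cat_scheme \<Rightarrow> ('p, 'n, 'z) cat_scheme \<Rightarrow> ('o \<times> 'p, 'm \<times> 'n) cat" where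
  "prod_cat C D = \<lparr>Obj = Obj C \<times> Obj D, Arr = Arr C \<times> Arr D,
     Dom = (\<lambda>(f, g). (Dom C f, Dom D g)), Cod = (\<lambda>(f, g). (Cod C f, Cod D g)),
     Ide = (\<lambda>(A, B). (Ide C A, Ide D B)),
     Comp = (\<lambda>(f', g') (f, g). (f' \<cdot>\<^bsub>C\<^esub> f, g' \<cdot>\<^bsub>D\<^esub> g))\<rparr>"

record ('o, 'm, 'p, 'n) ftr =
  fobj :: "'o \<Rightarrow> 'p"
  farr :: "'m \<Rightarrow> 'n"

locale cat_functor = src: category C + tgt: category D
  for C :: "('o, 'm, 'y) cat_scheme" and D :: "('p, 'n, 'z) cat_scheme" +
  fixes F :: "('o, 'm, 'p, 'n) ftr"
  assumes fobj_in: "A \<in> Obj C \<Longrightarrow> fobj F A \<in> Obj D"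
    and farr_in: "f \<in> Hom C A B \<Longrightarrow> farr F f \<in> Hom D (fobj F A) (fobj F B)"
    and farr_Ide: "A \<in> Obj C \<Longrightarrow> farr F (Ide C A) = Ide D (fobj F A)"
    and farr_Comp: "\<lbrakk>f \<in> Hom C X Y; g \<in> Hom C Y Z\<rbrakk>
      \<Longrightarrow> farr F (g \<cdot>\<^bsub>C\<^esub> f) = farr F g \<cdot>\<^bsub>D\<^esub> farr F f"

definition inv_arr :: "('o, 'm, 'z) cat_scheme \<Rightarrow> 'm \<Rightarrow> 'm" where
  "inv_arr C f = (THE g. g \<in> Hom C (Cod C f) (Dom C f) \<and>
     g \<cdot>\<^bsub>C\<^esub> f = Ide C (Dom C f) \<and> f \<cdot>\<^bsub>C\<^esub> g = Ide C (Cod C f))"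

text \<open>For a functor \<open>F\<close> of two variables, \<open>sec1 C2 F B\<close> is \<open>F(-,B)\<close> and
  \<open>sec2 C1 F A\<close> is \<open>F(A,-)\<close>.\<close>

definition sec1 :: "('p, 'n, 'z) cat_scheme \<Rightarrow> ('o \<times> 'p, 'm \<times> 'n, 'q, 'r) ftr \<Rightarrow> 'p
    \<Rightarrow> ('o, 'm, 'q, 'r) ftr" where
  "sec1 C2 F B = \<lparr>fobj = (\<lambda>A. fobj F (A, B)), farr = (\<lambda>f. farr F (f, Ide C2 B))\<rparr>"

definition sec2 :: "('o, 'm, 'z) cat_scheme \<Rightarrow> ('o \<times> 'p, 'm \<times> 'n, 'q, 'r) ftr \<Rightarrow> 'o
    \<Rightarrow> ('p, 'n, 'q, 'r) ftr" where
  "sec2 C1 F A = \<lparr>fobj = (\<lambda>B. fobj F (A, B)), farr = (\<lambda>g. farr F (Ide C1 A, g))\<rparr>"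

definition is_left_adjoint ::
  "('o, 'm, 'y) cat_scheme \<Rightarrow> ('p, 'n, 'z) cat_scheme \<Rightarrow> ('o, 'm, 'p, 'n) ftr \<Rightarrow> bool" where
  "is_left_adjoint C D F \<longleftrightarrow> cat_functor C D F \<and>
     (\<exists>G \<psi>. cat_functor D C G \<and>
        (\<forall>A\<in>Obj C. \<forall>B\<in>Obj D.
           bij_betw (\<psi> A B) (Hom D (fobj F A) B) (Hom C A (fobj G B))) \<and>
        (\<forall>A A' B B' a b f. a \<in> Hom C A' A \<longrightarrow> b \<in> Hom D B B' \<longrightarrow> f \<in> Hom D (fobj F A) B \<longrightarrow>
           \<psi> A' B' (b \<cdot>\<^bsub>D\<^esub> f \<cdot>\<^bsub>D\<^esub> farr F a) = farr G b \<cdot>\<^bsub>C\<^esub> \<psi> A B f \<cdot>\<^bsub>C\<^esub> a))"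


section \<open>Skew monoidal and skew closed structures\<close>

record ('o, 'm) skew_mon =
  tensor :: "('o \<times> 'o, 'm \<times> 'm, 'o, 'm) ftr"
  tunit :: "'o"
  asc :: "'o \<Rightarrow> 'o \<Rightarrow> 'o \<Rightarrow> 'm"
  lun :: "'o \<Rightarrow> 'm"
  run :: "'o \<Rightarrow> 'm"

record ('o, 'm) skew_clo =
  ihom :: "('o \<times> 'o, 'm \<times> 'm, 'o, 'm) ftr"
  cunit :: "'o"
  Lc :: "'o \<Rightarrow> 'o \<Rightarrow> 'o \<Rightarrow> 'm"  \<comment> \<open>\<open>Lc S A B D\<close> is \<open>L\<close> with superscript \<open>A\<close> and subscripts \<open>B, D\<close>\<close>
  ic :: "'o \<Rightarrow> 'm"
  jc :: "'o \<Rightarrow> 'm"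

text \<open>In the locales below \<open>A \<otimes> B\<close> and \<open>\<lbrakk>A, B\<rbrakk>\<close> are the values of the bifunctors on objects,
  \<open>f \<otimes>\<^sub>m g\<close> and \<open>\<lbrakk>f, g\<rbrakk>\<^sub>m\<close> those on morphisms.\<close>

locale mon_notation =
  fixes C :: "('o, 'm, 'z) cat_scheme" (structure)
    and T :: "('o, 'm) skew_mon"
begin

abbreviation tobj (infixr "\<otimes>" 75) where "A \<otimes> B \<equiv> fobj (tensor T) (A, B)"
abbreviation tarr (infixr "\<otimes>\<^sub>m" 75) where "f \<otimes>\<^sub>m g \<equiv> farr (tensor T) (f, g)"
abbreviation (input) \<alpha> where "\<alpha> \<equiv> asc T"
abbreviation (input) l where "l \<equiv> lun T"
abbreviation (input) r where "r \<equiv> run T"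

end

locale clo_notation =
  fixes C :: "('o, 'm, 'z) cat_scheme" (structure)
    and S :: "('o, 'm) skew_clo"
begin

abbreviation hobj ("\<lbrakk>_,/ _\<rbrakk>") where "\<lbrakk>A, B\<rbrakk> \<equiv> fobj (ihom S) (A, B)"
abbreviation harr ("\<lbrakk>_,/ _\<rbrakk>\<^sub>m") where "\<lbrakk>f, g\<rbrakk>\<^sub>m \<equiv> farr (ihom S) (f, g)"
abbreviation (input) L where "L \<equiv> Lc S"
abbreviation (input) i where "i \<equiv> ic S"
abbreviation (input) j where "j \<equiv> jc S"

end

locale skew_monoidal = mon_notation C T + category C
  for C :: "('o, 'm, 'z) cat_scheme" (structure) and T :: "('o, 'm) skew_mon" +
  assumes tensor_functor: "cat_functor (prod_cat C C) C (tensor T)"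
    and tunit_in: "tunit T \<in> Obj C"
    and asc_in: "\<lbrakk>X \<in> Obj C; Y \<in> Obj C; Z \<in> Obj C\<rbrakk>
      \<Longrightarrow> \<alpha> X Y Z \<in> Hom C ((X \<otimes> Y) \<otimes> Z) (X \<otimes> (Y \<otimes> Z))"
    and lun_in: "X \<in> Obj C \<Longrightarrow> l X \<in> Hom C (tunit T \<otimes> X) X"
    and run_in: "X \<in> Obj C \<Longrightarrow> r X \<in> Hom C X (X \<otimes> tunit T)"
    and asc_natural: "\<lbrakk>f \<in> Hom C X X'; g \<in> Hom C Y Y'; h \<in> Hom C Z Z'\<rbrakk>
      \<Longrightarrow> \<alpha> X' Y' Z' \<cdot> ((f \<otimes>\<^sub>m g) \<otimes>\<^sub>m h) = (f \<otimes>\<^sub>m (g \<otimes>\<^sub>m h)) \<cdot> \<alpha> X Y Z"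
    and lun_natural: "f \<in> Hom C X X' \<Longrightarrow> l X' \<cdot> (Ide C (tunit T) \<otimes>\<^sub>m f) = f \<cdot> l X"
    and run_natural: "f \<in> Hom C X X' \<Longrightarrow> r X' \<cdot> f = (f \<otimes>\<^sub>m Ide C (tunit T)) \<cdot> r X"
    and pentagon: "\<lbrakk>W \<in> Obj C; X \<in> Obj C; Y \<in> Obj C; Z \<in> Obj C\<rbrakk>
      \<Longrightarrow> (Ide C W \<otimes>\<^sub>m \<alpha> X Y Z) \<cdot> \<alpha> W (X \<otimes> Y) Z \<cdot> (\<alpha> W X Y \<otimes>\<^sub>m Ide C Z)
          = \<alpha> W X (Y \<otimes> Z) \<cdot> \<alpha> (W \<otimes> X) Y Z"
    and lun_asc: "\<lbrakk>X \<in> Obj C; Y \<in> Obj C\<rbrakk>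
      \<Longrightarrow> l (X \<otimes> Y) \<cdot> \<alpha> (tunit T) X Y = l X \<otimes>\<^sub>m Ide C Y"
    and triangle: "\<lbrakk>X \<in> Obj C; Y \<in> Obj C\<rbrakk>
      \<Longrightarrow> (Ide C X \<otimes>\<^sub>m l Y) \<cdot> \<alpha> X (tunit T) Y \<cdot> (r X \<otimes>\<^sub>m Ide C Y) = Ide C (X \<otimes> Y)"
    and asc_run: "\<lbrakk>X \<in> Obj C; Y \<in> Obj C\<rbrakk>
      \<Longrightarrow> \<alpha> X Y (tunit T) \<cdot> r (X \<otimes> Y) = Ide C X \<otimes>\<^sub>m r Y"
    and lun_run: "l (tunit T) \<cdot> r (tunit T) = Ide C (tunit T)"

locale skew_closed = clo_notation C S + category C
  for C :: "('o, 'm, 'z) cat_scheme" (structure) and S :: "('o, 'm) skew_clo" +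
  assumes ihom_functor: "cat_functor (prod_cat (op_cat C) C) C (ihom S)"
    and cunit_in: "cunit S \<in> Obj C"
    and Lc_in: "\<lbrakk>X \<in> Obj C; Y \<in> Obj C; Z \<in> Obj C\<rbrakk>
      \<Longrightarrow> L X Y Z \<in> Hom C \<lbrakk>Y, Z\<rbrakk> \<lbrakk>\<lbrakk>X, Y\<rbrakk>, \<lbrakk>X, Z\<rbrakk>\<rbrakk>"
    and ic_in: "X \<in> Obj C \<Longrightarrow> i X \<in> Hom C \<lbrakk>cunit S, X\<rbrakk> X"
    and jc_in: "X \<in> Obj C \<Longrightarrow> j X \<in> Hom C (cunit S) \<lbrakk>X, X\<rbrakk>"
    and Lc_natural1: "\<lbrakk>X \<in> Obj C; g \<in> Hom C Y' Y; Z \<in> Obj C\<rbrakk>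
      \<Longrightarrow> \<lbrakk>\<lbrakk>Ide C X, g\<rbrakk>\<^sub>m, Ide C \<lbrakk>X, Z\<rbrakk>\<rbrakk>\<^sub>m \<cdot> L X Y Z = L X Y' Z \<cdot> \<lbrakk>g, Ide C Z\<rbrakk>\<^sub>m"
    and Lc_natural2: "\<lbrakk>X \<in> Obj C; Y \<in> Obj C; h \<in> Hom C Z Z'\<rbrakk>
      \<Longrightarrow> \<lbrakk>Ide C \<lbrakk>X, Y\<rbrakk>, \<lbrakk>Ide C X, h\<rbrakk>\<^sub>m\<rbrakk>\<^sub>m \<cdot> L X Y Z = L X Y Z' \<cdot> \<lbrakk>Ide C Y, h\<rbrakk>\<^sub>m"
    and Lc_extranatural: "\<lbrakk>f \<in> Hom C X X'; Y \<in> Obj C; Z \<in> Obj C\<rbrakk>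
      \<Longrightarrow> \<lbrakk>\<lbrakk>f, Ide C Y\<rbrakk>\<^sub>m, Ide C \<lbrakk>X, Z\<rbrakk>\<rbrakk>\<^sub>m \<cdot> L X Y Z
          = \<lbrakk>Ide C \<lbrakk>X', Y\<rbrakk>, \<lbrakk>f, Ide C Z\<rbrakk>\<^sub>m\<rbrakk>\<^sub>m \<cdot> L X' Y Z"
    and ic_natural: "f \<in> Hom C X X' \<Longrightarrow> i X' \<cdot> \<lbrakk>Ide C (cunit S), f\<rbrakk>\<^sub>m = f \<cdot> i X"
    and jc_extranatural: "f \<in> Hom C X X'
      \<Longrightarrow> \<lbrakk>Ide C X, f\<rbrakk>\<^sub>m \<cdot> j X = \<lbrakk>f, Ide C X'\<rbrakk>\<^sub>m \<cdot> j X'"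
    and C1: "\<lbrakk>W \<in> Obj C; X \<in> Obj C; Y \<in> Obj C; Z \<in> Obj C\<rbrakk>
      \<Longrightarrow> \<lbrakk>L W X Y, Ide C \<lbrakk>\<lbrakk>W, X\<rbrakk>, \<lbrakk>W, Z\<rbrakk>\<rbrakk>\<rbrakk>\<^sub>m \<cdot> L \<lbrakk>W, X\<rbrakk> \<lbrakk>W, Y\<rbrakk> \<lbrakk>W, Z\<rbrakk> \<cdot> L W Y Z
          = \<lbrakk>Ide C \<lbrakk>X, Y\<rbrakk>, L W X Z\<rbrakk>\<^sub>m \<cdot> L X Y Z"
    and C2: "\<lbrakk>X \<in> Obj C; Y \<in> Obj C\<rbrakk>
      \<Longrightarrow> i \<lbrakk>X, Y\<rbrakk> \<cdot> \<lbrakk>j X, Ide C \<lbrakk>X, Y\<rbrakk>\<rbrakk>\<^sub>m \<cdot> L X X Y = Ide C \<lbrakk>X, Y\<rbrakk>"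
    and C3: "\<lbrakk>X \<in> Obj C; Y \<in> Obj C\<rbrakk> \<Longrightarrow> L X Y Y \<cdot> j Y = j \<lbrakk>X, Y\<rbrakk>"
    and C4: "\<lbrakk>X \<in> Obj C; Y \<in> Obj C\<rbrakk>
      \<Longrightarrow> \<lbrakk>Ide C \<lbrakk>cunit S, X\<rbrakk>, i Y\<rbrakk>\<^sub>m \<cdot> L (cunit S) X Y = \<lbrakk>i X, Ide C Y\<rbrakk>\<^sub>m"
    and C5: "i (cunit S) \<cdot> j (cunit S) = Ide C (cunit S)"

locale monoidal_skew_closed = skew_monoidal C T + skew_closed C S
  for C :: "('o, 'm, 'z) cat_scheme" (structure)
    and T :: "('o, 'm) skew_mon" and S :: "('o, 'm) skew_clo" +
  fixes \<phi> :: "'o \<Rightarrow> 'o \<Rightarrow> 'o \<Rightarrow> 'm \<Rightarrow> 'm"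
  assumes unit_eq: "tunit T = cunit S"
    and \<phi>_bij: "\<lbrakk>X \<in> Obj C; Y \<in> Obj C; Z \<in> Obj C\<rbrakk>
      \<Longrightarrow> bij_betw (\<phi> X Y Z) (Hom C (X \<otimes> Y) Z) (Hom C X \<lbrakk>Y, Z\<rbrakk>)"
    and \<phi>_natural: "\<lbrakk>a \<in> Hom C X' X; b \<in> Hom C Y' Y; c \<in> Hom C Z Z'; f \<in> Hom C (X \<otimes> Y) Z\<rbrakk>
      \<Longrightarrow> \<phi> X' Y' Z' (c \<cdot> f \<cdot> (a \<otimes>\<^sub>m b)) = \<lbrakk>b, c\<rbrakk>\<^sub>m \<cdot> \<phi> X Y Z f \<cdot> a"
    and \<phi>_lun: "f \<in> Hom C X Y
      \<Longrightarrow> \<phi> (tunit T) X Y (f \<cdot> l X) = \<lbrakk>Ide C X, f\<rbrakk>\<^sub>m \<cdot> j X"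
    and \<phi>_run: "\<lbrakk>X \<in> Obj C; Y \<in> Obj C; g \<in> Hom C (X \<otimes> tunit T) Y\<rbrakk>
      \<Longrightarrow> g \<cdot> r X = i Y \<cdot> \<phi> X (tunit T) Y g"
    and \<phi>_asc: "\<lbrakk>X \<in> Obj C; Y \<in> Obj C; Z \<in> Obj C; W \<in> Obj C; h \<in> Hom C (X \<otimes> (Y \<otimes> Z)) W\<rbrakk>
      \<Longrightarrow> \<phi> X Y \<lbrakk>Z, W\<rbrakk> (\<phi> (X \<otimes> Y) Z W (h \<cdot> \<alpha> X Y Z))
          = (let u = \<phi> Y Z (Y \<otimes> Z) (Ide C (Y \<otimes> Z));
                 t = \<lbrakk>u, Ide C \<lbrakk>Z, W\<rbrakk>\<rbrakk>\<^sub>m \<cdot> L Z (Y \<otimes> Z) W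
             in t \<cdot> \<phi> X (Y \<otimes> Z) W h)"


section \<open>Model categories\<close>

text \<open>Finite completeness; up to isomorphism a finite category has its objects and arrows
  among the natural numbers.\<close>

definition is_cone :: "('o, 'm, 'y) cat_scheme \<Rightarrow> ('p, 'n, 'z) cat_scheme \<Rightarrow> ('p, 'n, 'o, 'm) ftr
    \<Rightarrow> 'o \<Rightarrow> ('p \<Rightarrow> 'm) \<Rightarrow> bool" where
  "is_cone C J D X \<tau> \<longleftrightarrow> X \<in> Obj C \<and> (\<forall>a\<in>Obj J. \<tau> a \<in> Hom C X (fobj D a)) \<and>
     (\<forall>u\<in>Arr J. farr D u \<cdot>\<^bsub>C\<^esub> \<tau> (Dom J u) = \<tau> (Cod J u))"

definition is_limit :: "('o, 'm, 'y) cat_scheme \<Rightarrow> ('p, 'n, 'z) cat_scheme \<Rightarrow> ('p, 'n, 'o, 'm) ftr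
    \<Rightarrow> 'o \<Rightarrow> ('p \<Rightarrow> 'm) \<Rightarrow> bool" where
  "is_limit C J D X \<tau> \<longleftrightarrow> is_cone C J D X \<tau> \<and>
     (\<forall>Y \<sigma>. is_cone C J D Y \<sigma> \<longrightarrow>
        (\<exists>!h. h \<in> Hom C Y X \<and> (\<forall>a\<in>Obj J. \<tau> a \<cdot>\<^bsub>C\<^esub> h = \<sigma> a)))"

definition has_finite_limits :: "('o, 'm, 'z) cat_scheme \<Rightarrow> bool" where
  "has_finite_limits C \<longleftrightarrow> (\<forall>(J :: (nat, nat) cat) D.
     finite (Arr J) \<and> cat_functor J C D \<longrightarrow> (\<exists>X \<tau>. is_limit C J D X \<tau>))"

definition has_finite_colimits :: "('o, 'm, 'z) cat_scheme \<Rightarrow> bool" where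
  "has_finite_colimits C \<longleftrightarrow> has_finite_limits (op_cat C)"

definition is_square :: "('o, 'm, 'z) cat_scheme \<Rightarrow> 'm \<Rightarrow> 'm \<Rightarrow> 'm \<Rightarrow> 'm \<Rightarrow> bool" where
  "is_square C f g u v \<longleftrightarrow> f \<in> Arr C \<and> g \<in> Arr C \<and>
     u \<in> Hom C (Dom C f) (Dom C g) \<and> v \<in> Hom C (Cod C f) (Cod C g) \<and>
     g \<cdot>\<^bsub>C\<^esub> u = v \<cdot>\<^bsub>C\<^esub> f"

definition is_retract :: "('o, 'm, 'z) cat_scheme \<Rightarrow> 'm \<Rightarrow> 'm \<Rightarrow> bool" where
  "is_retract C f g \<longleftrightarrow> (\<exists>s s' t t'. is_square C f g s s' \<and> is_square C g f t t' \<and>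
     t \<cdot>\<^bsub>C\<^esub> s = Ide C (Dom C f) \<and> t' \<cdot>\<^bsub>C\<^esub> s' = Ide C (Cod C f))"

definition has_lifting :: "('o, 'm, 'z) cat_scheme \<Rightarrow> 'm \<Rightarrow> 'm \<Rightarrow> bool" where
  "has_lifting C f g \<longleftrightarrow> (\<forall>u v. is_square C f g u v \<longrightarrow>
     (\<exists>d \<in> Hom C (Cod C f) (Dom C g). d \<cdot>\<^bsub>C\<^esub> f = u \<and> g \<cdot>\<^bsub>C\<^esub> d = v))"

text \<open>A functorial factorisation sends \<open>f\<close> to \<open>Dom f \<rightarrow> mid f \<rightarrow> Cod f\<close>, and a commutative square
  \<open>(u, v)\<close> from \<open>f\<close> to \<open>g\<close> to a map \<open>midm f g u v\<close> between the middle objects.\<close>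

record ('o, 'm) factorisation =
  mid :: "'m \<Rightarrow> 'o"
  fleft :: "'m \<Rightarrow> 'm"
  fright :: "'m \<Rightarrow> 'm"
  midm :: "'m \<Rightarrow> 'm \<Rightarrow> 'm \<Rightarrow> 'm \<Rightarrow> 'm"

locale functorial_factorisation = category C
  for C :: "('o, 'm, 'z) cat_scheme" (structure) +
  fixes F :: "('o, 'm) factorisation"
  assumes fleft_in: "f \<in> Hom C X Y \<Longrightarrow> fleft F f \<in> Hom C X (mid F f)"
    and fright_in: "f \<in> Hom C X Y \<Longrightarrow> fright F f \<in> Hom C (mid F f) Y"
    and factors: "f \<in> Arr C \<Longrightarrow> fright F f \<cdot> fleft F f = f"
    and midm_in: "is_square C f g u v \<Longrightarrow> midm F f g u v \<in> Hom C (mid F f) (mid F g)"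
    and midm_left: "is_square C f g u v \<Longrightarrow> midm F f g u v \<cdot> fleft F f = fleft F g \<cdot> u"
    and midm_right: "is_square C f g u v \<Longrightarrow> fright F g \<cdot> midm F f g u v = v \<cdot> fright F f"
    and midm_Ide: "f \<in> Hom C X Y \<Longrightarrow> midm F f f (Ide C X) (Ide C Y) = Ide C (mid F f)"
    and midm_Comp: "\<lbrakk>is_square C f g u v; is_square C g h u' v'\<rbrakk>
      \<Longrightarrow> midm F f h (u' \<cdot> u) (v' \<cdot> v) = midm F g h u' v' \<cdot> midm F f g u v"

record ('o, 'm) model = "('o, 'm) cat" +
  Weq :: "'m set"
  Cofs :: "'m set"
  Fibs :: "'m set"
  cfac :: "('o, 'm) factorisation"  \<comment> \<open>cofibration followed by trivial fibration\<close>
  ffac :: "('o, 'm) factorisation"  \<comment> \<open>trivial cofibration followed by fibration\<close>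

definition wide_subcategory :: "('o, 'm, 'z) cat_scheme \<Rightarrow> 'm set \<Rightarrow> bool" where
  "wide_subcategory C K \<longleftrightarrow> K \<subseteq> Arr C \<and> (\<forall>A\<in>Obj C. Ide C A \<in> K) \<and>
     (\<forall>f\<in>K. \<forall>g\<in>K. Cod C f = Dom C g \<longrightarrow> g \<cdot>\<^bsub>C\<^esub> f \<in> K)"

locale model_category = category M
  for M :: "('o, 'm) model" (structure) +
  assumes finite_limits: "has_finite_limits M"
    and finite_colimits: "has_finite_colimits M"
    and Weq_sub: "wide_subcategory M (Weq M)"
    and Cofs_sub: "wide_subcategory M (Cofs M)"
    and Fibs_sub: "wide_subcategory M (Fibs M)"
    and two_of_three1: "\<lbrakk>f \<in> Hom M X Y; g \<in> Hom M Y Z; g \<cdot> f \<in> Weq M; g \<in> Weq M\<rbrakk> \<Longrightarrow> f \<in> Weq M"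
    and two_of_three2: "\<lbrakk>f \<in> Hom M X Y; g \<in> Hom M Y Z; g \<cdot> f \<in> Weq M; f \<in> Weq M\<rbrakk> \<Longrightarrow> g \<in> Weq M"
    and Weq_retract: "\<lbrakk>is_retract M f g; g \<in> Weq M\<rbrakk> \<Longrightarrow> f \<in> Weq M"
    and Cofs_retract: "\<lbrakk>is_retract M f g; g \<in> Cofs M\<rbrakk> \<Longrightarrow> f \<in> Cofs M"
    and Fibs_retract: "\<lbrakk>is_retract M f g; g \<in> Fibs M\<rbrakk> \<Longrightarrow> f \<in> Fibs M"
    and lifting1: "\<lbrakk>f \<in> Cofs M \<inter> Weq M; g \<in> Fibs M\<rbrakk> \<Longrightarrow> has_lifting M f g"
    and lifting2: "\<lbrakk>f \<in> Cofs M; g \<in> Fibs M \<inter> Weq M\<rbrakk> \<Longrightarrow> has_lifting M f g"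
    and cfac: "functorial_factorisation M (cfac M)"
    and cfac_left: "f \<in> Arr M \<Longrightarrow> fleft (cfac M) f \<in> Cofs M"
    and cfac_right: "f \<in> Arr M \<Longrightarrow> fright (cfac M) f \<in> Fibs M \<inter> Weq M"
    and ffac: "functorial_factorisation M (ffac M)"
    and ffac_left: "f \<in> Arr M \<Longrightarrow> fleft (ffac M) f \<in> Cofs M \<inter> Weq M"
    and ffac_right: "f \<in> Arr M \<Longrightarrow> fright (ffac M) f \<in> Fibs M"

definition init_obj :: "('o, 'm, 'z) cat_scheme \<Rightarrow> 'o" where
  "init_obj C = (SOME Z. Z \<in> Obj C \<and> (\<forall>A\<in>Obj C. \<exists>!f. f \<in> Hom C Z A))"

definition term_obj :: "('o, 'm, 'z) cat_scheme \<Rightarrow> 'o" where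
  "term_obj C = init_obj (op_cat C)"

definition from_init :: "('o, 'm, 'z) cat_scheme \<Rightarrow> 'o \<Rightarrow> 'm" where
  "from_init C A = (THE f. f \<in> Hom C (init_obj C) A)"

definition to_term :: "('o, 'm, 'z) cat_scheme \<Rightarrow> 'o \<Rightarrow> 'm" where
  "to_term C A = (THE f. f \<in> Hom C A (term_obj C))"

definition cofibrant :: "('o, 'm) model \<Rightarrow> 'o \<Rightarrow> bool" where
  "cofibrant M A \<longleftrightarrow> A \<in> Obj M \<and> from_init M A \<in> Cofs M"

text \<open>Cofibrant replacement factors \<open>0 \<rightarrow> A\<close>, fibrant replacement factors \<open>A \<rightarrow> 1\<close>.\<close>

definition Qf :: "('o, 'm) model \<Rightarrow> ('o, 'm, 'o, 'm) ftr" where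
  "Qf M = \<lparr>fobj = (\<lambda>A. mid (cfac M) (from_init M A)),
     farr = (\<lambda>f. midm (cfac M) (from_init M (Dom M f)) (from_init M (Cod M f))
                   (Ide M (init_obj M)) f)\<rparr>"

definition Rf :: "('o, 'm) model \<Rightarrow> ('o, 'm, 'o, 'm) ftr" where
  "Rf M = \<lparr>fobj = (\<lambda>A. mid (ffac M) (to_term M A)),
     farr = (\<lambda>f. midm (ffac M) (to_term M (Dom M f)) (to_term M (Cod M f))
                   f (Ide M (term_obj M)))\<rparr>"

definition pm :: "('o, 'm) model \<Rightarrow> 'o \<Rightarrow> 'm" where
  "pm M A = fright (cfac M) (from_init M A)"

definition qm :: "('o, 'm) model \<Rightarrow> 'o \<Rightarrow> 'm" where
  "qm M A = fleft (ffac M) (to_term M A)"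

definition left_quillen :: "('o, 'm) model \<Rightarrow> ('p, 'n) model \<Rightarrow> ('o, 'm, 'p, 'n) ftr \<Rightarrow> bool" where
  "left_quillen M N F \<longleftrightarrow> is_left_adjoint M N F \<and>
     (\<forall>f\<in>Cofs M. farr F f \<in> Cofs N) \<and>
     (\<forall>f\<in>Cofs M \<inter> Weq M. farr F f \<in> Cofs N \<inter> Weq N)"

definition axiom_MC :: "('o, 'm) model \<Rightarrow> ('o, 'm) skew_mon \<Rightarrow> bool" where
  "axiom_MC M T \<longleftrightarrow>
     (\<forall>X. cofibrant M X \<longrightarrow> left_quillen M M (sec1 M (tensor T) X)) \<and>
     (\<forall>Y. cofibrant M Y \<longrightarrow> (\<forall>f\<in>Weq M. cofibrant M (Dom M f) \<longrightarrow> cofibrant M (Cod M f) \<longrightarrow>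
        farr (sec2 M (tensor T) Y) f \<in> Weq M)) \<and>
     cofibrant M (tunit T)"


section \<open>The homotopy category\<close>

text \<open>The localisation at the weak equivalences: the objects are those of \<open>M\<close> and the morphisms
  are zigzags, i.e. strings of arrows of \<open>M\<close> (\<open>Fwd\<close>) and formal reversals of weak equivalences
  (\<open>Bwd\<close>), listed in the order in which they are traversed, modulo the congruence generated by the
  relations of \<open>M\<close> and the requirement that \<open>Bwd w\<close> be inverse to \<open>Fwd w\<close>.\<close>

datatype 'm letter = Fwd 'm | Bwd 'm

primrec zigzag :: "('o, 'm) model \<Rightarrow> 'o \<Rightarrow> 'm letter list \<Rightarrow> 'o \<Rightarrow> bool" where
  "zigzag M A [] B \<longleftrightarrow> A \<in> Obj M \<and> A = B"
| "zigzag M A (x # xs) B \<longleftrightarrow> (case x of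
     Fwd f \<Rightarrow> f \<in> Arr M \<and> Dom M f = A \<and> zigzag M (Cod M f) xs B
   | Bwd w \<Rightarrow> w \<in> Weq M \<and> Cod M w = A \<and> zigzag M (Dom M w) xs B)"

inductive zz_step :: "('o, 'm) model \<Rightarrow> 'm letter list \<Rightarrow> 'm letter list \<Rightarrow> bool"
  for M :: "('o, 'm) model" where
  zz_Ide: "A \<in> Obj M \<Longrightarrow> zz_step M (us @ Fwd (Ide M A) # vs) (us @ vs)"
| zz_Comp: "zz_step M (us @ Fwd f # Fwd g # vs) (us @ Fwd (g \<cdot>\<^bsub>M\<^esub> f) # vs)"
| zz_Fwd_Bwd: "zz_step M (us @ Fwd w # Bwd w # vs) (us @ vs)"
| zz_Bwd_Fwd: "zz_step M (us @ Bwd w # Fwd w # vs) (us @ vs)"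

definition zz_equiv ::
  "('o, 'm) model \<Rightarrow> 'o \<Rightarrow> 'o \<Rightarrow> 'm letter list \<Rightarrow> 'm letter list \<Rightarrow> bool" where
  "zz_equiv M A B = equivclp (\<lambda>us vs. zigzag M A us B \<and> zigzag M A vs B \<and> zz_step M us vs)"

type_synonym ('o, 'm) ho_arr = "'o \<times> 'm letter list set \<times> 'o"

definition ho_class :: "('o, 'm) model \<Rightarrow> 'o \<Rightarrow> 'm letter list \<Rightarrow> 'o \<Rightarrow> ('o, 'm) ho_arr" where
  "ho_class M A us B = (A, {vs. zz_equiv M A B us vs}, B)"

definition Ho :: "('o, 'm) model \<Rightarrow> ('o, ('o, 'm) ho_arr) cat" where
  "Ho M = \<lparr>Obj = Obj M,
     Arr = {ho_class M A us B | A us B. zigzag M A us B},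
     Dom = (\<lambda>(A, X, B). A),
     Cod = (\<lambda>(A, X, B). B),
     Ide = (\<lambda>A. ho_class M A [] A),
     Comp = (\<lambda>(B', Y, D) (A, X, B).
       (A, {ws. \<exists>us\<in>X. \<exists>vs\<in>Y. zz_equiv M A D (us @ vs) ws}, D))\<rparr>"

text \<open>The localisation functor is the identity on objects; on arrows it is \<open>\<gamma>\<close>.\<close>

definition \<gamma> :: "('o, 'm) model \<Rightarrow> 'm \<Rightarrow> ('o, 'm) ho_arr" where
  "\<gamma> M f = ho_class M (Dom M f) [Fwd f] (Cod M f)"

text \<open>The functor \<open>Ho M \<rightarrow> D\<close> induced by a functor \<open>F : M \<rightarrow> D\<close> that inverts weak equivalences.\<close>

primrec zz_eval :: "('o, 'm) model \<Rightarrow> ('p, 'n, 'z) cat_scheme \<Rightarrow> ('o, 'm, 'p, 'n) ftr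
    \<Rightarrow> 'o \<Rightarrow> 'm letter list \<Rightarrow> 'n" where
  "zz_eval M D F A [] = Ide D (fobj F A)"
| "zz_eval M D F A (x # xs) = (case x of
     Fwd f \<Rightarrow> zz_eval M D F (Cod M f) xs \<cdot>\<^bsub>D\<^esub> farr F f
   | Bwd w \<Rightarrow> zz_eval M D F (Dom M w) xs \<cdot>\<^bsub>D\<^esub> inv_arr D (farr F w))"

definition ho_ext :: "('o, 'm) model \<Rightarrow> ('p, 'n, 'z) cat_scheme \<Rightarrow> ('o, 'm, 'p, 'n) ftr
    \<Rightarrow> ('o, ('o, 'm) ho_arr, 'p, 'n) ftr" where
  "ho_ext M D F = \<lparr>fobj = fobj F,
     farr = (\<lambda>(A, X, B). THE d. \<exists>us\<in>X. d = zz_eval M D F A us)\<rparr>"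

text \<open>The functors \<open>Ho M \<times> Ho M \<rightarrow> D\<close> and \<open>(Ho M)\<^sup>o\<^sup>p \<times> Ho M \<rightarrow> D\<close> induced by functors
  \<open>M \<times> M \<rightarrow> D\<close> and \<open>M\<^sup>o\<^sup>p \<times> M \<rightarrow> D\<close> that invert weak equivalences in each variable. They are
  obtained one variable at a time; a contravariant functor to \<open>D\<close> is a functor to
  \<open>op_cat D\<close>.\<close>

definition ho_ext2 :: "('o, 'm) model \<Rightarrow> ('p, 'n, 'z) cat_scheme
    \<Rightarrow> ('o \<times> 'o, 'm \<times> 'm, 'p, 'n) ftr
    \<Rightarrow> ('o \<times> 'o, ('o, 'm) ho_arr \<times> ('o, 'm) ho_arr, 'p, 'n) ftr" where
  "ho_ext2 M D F = \<lparr>fobj = fobj F,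
     farr = (\<lambda>(h, k). farr (ho_ext M D (sec1 M F (Cod (Ho M) k))) h
                      \<cdot>\<^bsub>D\<^esub> farr (ho_ext M D (sec2 M F (Dom (Ho M) h))) k)\<rparr>"

definition ho_ext2_op :: "('o, 'm) model \<Rightarrow> ('p, 'n, 'z) cat_scheme
    \<Rightarrow> ('o \<times> 'o, 'm \<times> 'm, 'p, 'n) ftr
    \<Rightarrow> ('o \<times> 'o, ('o, 'm) ho_arr \<times> ('o, 'm) ho_arr, 'p, 'n) ftr" where
  "ho_ext2_op M D F = \<lparr>fobj = fobj F,
     farr = (\<lambda>(h, k). farr (ho_ext M (op_cat D) (sec1 M F (Cod (Ho M) k))) h
                      \<cdot>\<^bsub>D\<^esub> farr (ho_ext M D (sec2 M F (Cod (Ho M) h))) k)\<rparr>"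


section \<open>Derived structures\<close>

text \<open>An arrow of \<open>M\<close> used in \<open>Ho M\<close> is written with an explicit \<open>\<gamma>\<close>.\<close>

definition left_derived :: "('o, 'm) model \<Rightarrow> ('o, 'm) skew_mon
    \<Rightarrow> ('o, ('o, 'm) ho_arr) skew_mon" where
  "left_derived M T = (let
       H = Ho M; Q = fobj (Qf M); p = pm M; one = Ide M;
       to = (\<lambda>A B. fobj (tensor T) (A, B));
       ta = (\<lambda>f g. farr (tensor T) (f, g))
     in \<lparr>tensor = ho_ext2 M H
           \<lparr>fobj = (\<lambda>(A, B). to (Q A) (Q B)),
            farr = (\<lambda>(f, g). \<gamma> M (ta (farr (Qf M) f) (farr (Qf M) g)))\<rparr>,
         tunit = tunit T,
         asc = (\<lambda>A B C. inv_arr H (\<gamma> M (ta (one (Q A)) (p (to (Q B) (Q C)))))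
                 \<cdot>\<^bsub>H\<^esub> \<gamma> M (asc T (Q A) (Q B) (Q C))
                 \<cdot>\<^bsub>H\<^esub> \<gamma> M (ta (p (to (Q A) (Q B))) (one (Q C)))),
         lun = (\<lambda>A. \<gamma> M (p A) \<cdot>\<^bsub>H\<^esub> \<gamma> M (lun T (Q A)) \<cdot>\<^bsub>H\<^esub> \<gamma> M (ta (p (tunit T)) (one (Q A)))),
         run = (\<lambda>A. inv_arr H (\<gamma> M (ta (one (Q A)) (p (tunit T))))
                 \<cdot>\<^bsub>H\<^esub> \<gamma> M (run T (Q A)) \<cdot>\<^bsub>H\<^esub> inv_arr H (\<gamma> M (p A)))\<rparr>)"

definition is_k_choice :: "('o, 'm) model \<Rightarrow> ('o, 'm) skew_clo \<Rightarrow> ('o \<Rightarrow> 'o \<Rightarrow> 'm) \<Rightarrow> bool" where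
  "is_k_choice M S k \<longleftrightarrow> (\<forall>A B. cofibrant M A \<longrightarrow> B \<in> Obj M \<longrightarrow>
     k A B \<in> Hom M (fobj (Qf M) (fobj (ihom S) (A, B))) (fobj (ihom S) (A, fobj (Qf M) B)) \<and>
     farr (ihom S) (Ide M A, pm M B) \<cdot>\<^bsub>M\<^esub> k A B = pm M (fobj (ihom S) (A, B)))"

definition is_e_choice :: "('o, 'm) model \<Rightarrow> ('o, 'm) skew_clo \<Rightarrow> 'm \<Rightarrow> bool" where
  "is_e_choice M S e \<longleftrightarrow> e \<in> Hom M (cunit S) (fobj (Qf M) (cunit S)) \<and>
     pm M (cunit S) \<cdot>\<^bsub>M\<^esub> e = Ide M (cunit S)"

text \<open>In the field \<open>Lc\<close> the arguments \<open>C A B\<close> are in the order of \<open>L\<^sup>C\<^sub>A\<^sub>,\<^sub>B\<close>.\<close>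

definition right_derived :: "('o, 'm) model \<Rightarrow> ('o, 'm) skew_clo \<Rightarrow> ('o \<Rightarrow> 'o \<Rightarrow> 'm) \<Rightarrow> 'm
    \<Rightarrow> ('o, ('o, 'm) ho_arr) skew_clo" where
  "right_derived M S k e = (let
       H = Ho M; Q = fobj (Qf M); R = fobj (Rf M); p = pm M; q = qm M; one = Ide M;
       ho = (\<lambda>A B. fobj (ihom S) (A, B));
       ha = (\<lambda>f g. farr (ihom S) (f, g))
     in \<lparr>ihom = ho_ext2_op M H
           \<lparr>fobj = (\<lambda>(A, B). ho (Q A) (R B)),
            farr = (\<lambda>(f, g). \<gamma> M (ha (farr (Qf M) f) (farr (Rf M) g)))\<rparr>,
         cunit = cunit S,
         Lc = (\<lambda>C A B. \<gamma> M (ha (one (Q (ho (Q C) (R A)))) (q (ho (Q C) (R B))))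
                \<cdot>\<^bsub>H\<^esub> \<gamma> M (ha (k (Q C) (R A)) (one (ho (Q C) (R B))))
                \<cdot>\<^bsub>H\<^esub> \<gamma> M (Lc S (Q C) (Q (R A)) (R B))
                \<cdot>\<^bsub>H\<^esub> inv_arr H (\<gamma> M (ha (farr (Qf M) (q A)) (one (R B))))),
         ic = (\<lambda>A. inv_arr H (\<gamma> M (q A)) \<cdot>\<^bsub>H\<^esub> \<gamma> M (ic S (R A)) \<cdot>\<^bsub>H\<^esub> \<gamma> M (ha e (one (R A)))),
         jc = (\<lambda>A. \<gamma> M (ha (one (Q A)) (q A)) \<cdot>\<^bsub>H\<^esub> \<gamma> M (ha (p A) (one A)) \<cdot>\<^bsub>H\<^esub> \<gamma> M (jc S A))\<rparr>)"

text \<open>The map \<open>Ho M (X \<otimes> Y, Z) \<rightarrow> Ho M (X, [Y, Z])\<close> induced by \<open>\<phi>\<close>, for \<open>X, Y\<close> cofibrant and \<open>Z\<close>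
  fibrant: the class of \<open>f\<close> goes to the class of \<open>\<phi> f\<close>.\<close>

definition phi_ho :: "('o, 'm) model \<Rightarrow> ('o, 'm) skew_mon \<Rightarrow> ('o \<Rightarrow> 'o \<Rightarrow> 'o \<Rightarrow> 'm \<Rightarrow> 'm)
    \<Rightarrow> 'o \<Rightarrow> 'o \<Rightarrow> 'o \<Rightarrow> ('o, 'm) ho_arr \<Rightarrow> ('o, 'm) ho_arr" where
  "phi_ho M T \<phi> X Y Z g = (THE h. \<exists>f \<in> Hom M (fobj (tensor T) (X, Y)) Z.
     \<gamma> M f = g \<and> h = \<gamma> M (\<phi> X Y Z f))"

definition phi_d :: "('o, 'm) model \<Rightarrow> ('o, 'm) skew_mon \<Rightarrow> ('o \<Rightarrow> 'o \<Rightarrow> 'o \<Rightarrow> 'm \<Rightarrow> 'm)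
    \<Rightarrow> 'o \<Rightarrow> 'o \<Rightarrow> 'o \<Rightarrow> ('o, 'm) ho_arr \<Rightarrow> ('o, 'm) ho_arr" where
  "phi_d M T \<phi> A B C g =
     phi_ho M T \<phi> (fobj (Qf M) A) (fobj (Qf M) B) (fobj (Rf M) C) (\<gamma> M (qm M C) \<cdot>\<^bsub>Ho M\<^esub> g)
     \<cdot>\<^bsub>Ho M\<^esub> inv_arr (Ho M) (\<gamma> M (pm M A))"

end

(* Every coherence question is moved along the natural weak equivalences p : Q A -> A and q : A -> R A
   to the corresponding identity in the model category itself. For the left derived tensor product
   this gives the skew monoidal axioms directly. On the closed side only the naturality of L_r in one
   argument and the three compatibilities with phi^d are checked: the adjunction then determines i, j
   and L as mates of the skew monoidal structure maps, and the skew closed axioms C1-C5 are the mates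
   of the skew monoidal ones.

   No homotopy relation is used. The functors - (x) Y and [Y, -], for Y cofibrant, invert weak
   equivalences between cofibrant, respectively fibrant, objects after localisation; this makes phi on
   homotopy classes well defined and bijective, because every map of the homotopy category from a
   cofibrant to a fibrant object comes from the model category. That [-, Z] inverts weak equivalences
   between cofibrant objects for Z fibrant then follows from Yoneda. *)
theory Submission
  imports Defs
begin

section \<open>Categories, isomorphisms and functors\<close>

text \<open>Three obstacles shape the development. The derived structure maps contain inverses of
  weak equivalences and need not come from the model category; they are therefore used only through
  equations in which the inverses are cleared (\<open>\<alpha>l_eq\<close>,
  \<open>run_TL_eq\<close>, \<open>Lc_SR_eq\<close>, \<open>ic_SR_eq\<close>, and
  \<open>\<phi>d_eq\<close> for the adjunction). Next, some diagrams are only known to commute after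
  composition with a weak equivalence: \<open>Q p\<close> may differ from \<open>p Q\<close>, and
  the liftings \<open>k\<close> need not be natural. By \<open>equal_images\<close>, a functor that
  inverts weak equivalences between cofibrant objects does not see the difference on maps out of a
  cofibrant object. Finally, naturality against arbitrary maps of the homotopy category is obtained
  by induction over zigzags, a formal inverse being handled by reversing a commutative square. On
  the closed side, \<open>\<phi>_asc\<close> describes \<open>L\<close> only where its first lower
  argument is a tensor product. Naturality in that argument, taken along a transposed map such as an
  evaluation, determines \<open>L\<close> everywhere; this is why that one naturality is checked by
  hand.\<close>

lemma in_HomI: "\<lbrakk>f \<in> Arr C; Dom C f = A; Cod C f = B\<rbrakk> \<Longrightarrow> f \<in> Hom C A B"
  by (simp add: Hom_def)

lemma Arr_HomI: "f \<in> Arr C \<Longrightarrow> f \<in> Hom C (Dom C f) (Cod C f)"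
  by (simp add: Hom_def)

lemma in_HomD:
  assumes "f \<in> Hom C A B"
  shows "f \<in> Arr C" "Dom C f = A" "Cod C f = B"
  using assms by (auto simp: Hom_def)

text \<open>\<open>inv_arr\<close> is a definite description and says nothing before an inverse is
  known to exist. This predicate carries the existence, and the simplification rules for
  \<open>inv_arr\<close> are conditional on it.\<close>

definition iso_arr :: "('o, 'm, 'z) cat_scheme \<Rightarrow> 'm \<Rightarrow> bool" where
  "iso_arr C f \<longleftrightarrow> f \<in> Arr C \<and> (\<exists>g \<in> Hom C (Cod C f) (Dom C f).
     g \<cdot>\<^bsub>C\<^esub> f = Ide C (Dom C f) \<and> f \<cdot>\<^bsub>C\<^esub> g = Ide C (Cod C f))"

context category
begin

lemma Dom_Obj [simp]: "f \<in> Arr C \<Longrightarrow> Dom C f \<in> Obj C"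
  by (rule Dom_in)

lemma Cod_Obj [simp]: "f \<in> Arr C \<Longrightarrow> Cod C f \<in> Obj C"
  by (rule Cod_in)

lemma Hom_Obj: "f \<in> Hom C A B \<Longrightarrow> A \<in> Obj C" "f \<in> Hom C A B \<Longrightarrow> B \<in> Obj C"
  by (auto simp: Hom_def)

lemma Ide_arr [simp]:
  assumes "A \<in> Obj C"
  shows "Ide C A \<in> Arr C" "Dom C (Ide C A) = A" "Cod C (Ide C A) = A"
  using Ide_in[OF assms] by (auto simp: Hom_def)

lemma Comp_arr [simp]:
  assumes "f \<in> Arr C" "g \<in> Arr C" "Cod C f = Dom C g"
  shows "g \<cdot> f \<in> Arr C" "Dom C (g \<cdot> f) = Dom C f" "Cod C (g \<cdot> f) = Cod C g"
  using Comp_in[of f "Dom C f" "Cod C f" g "Cod C g"] assms by (auto simp: Hom_def)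

lemma Comp_Ide_right [simp]: "f \<in> Arr C \<Longrightarrow> A = Dom C f \<Longrightarrow> f \<cdot> Ide C A = f"
  using Comp_Ide[of f "Dom C f" "Cod C f"] by (auto simp: Hom_def)

lemma Comp_Ide_left [simp]: "f \<in> Arr C \<Longrightarrow> A = Cod C f \<Longrightarrow> Ide C A \<cdot> f = f"
  using Ide_Comp[of f "Dom C f" "Cod C f"] by (auto simp: Hom_def)

lemma assoc [simp]:
  "\<lbrakk>f \<in> Arr C; g \<in> Arr C; h \<in> Arr C; Cod C f = Dom C g; Cod C g = Dom C h\<rbrakk>
   \<Longrightarrow> (h \<cdot> g) \<cdot> f = h \<cdot> (g \<cdot> f)"
  using Comp_assoc[of f "Dom C f" "Cod C f" g "Cod C g" h "Cod C h"] by (auto simp: Hom_def)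

text \<open>Simplification brackets composites to the right, so \<open>g \<cdot> f\<close> is no
  longer a subterm once something precedes \<open>f\<close>. Equations are therefore applied with
  the tail \<open>x\<close> explicit, here and in \<open>rewr2\<close> for equations between two
  composites.\<close>

lemma rewr:
  assumes "g \<cdot> f = h" "f \<in> Arr C" "g \<in> Arr C" "Cod C f = Dom C g"
    and "x \<in> Arr C" "Cod C x = Dom C f"
  shows "g \<cdot> (f \<cdot> x) = h \<cdot> x"
  using assms assoc[of x f g] by metis

lemma rewr2:
  assumes "g \<cdot> f = g' \<cdot> f'" "f \<in> Arr C" "g \<in> Arr C" "Cod C f = Dom C g"
    "f' \<in> Arr C" "g' \<in> Arr C" "Cod C f' = Dom C g'"
    and "x \<in> Arr C" "Cod C x = Dom C f"
  shows "g \<cdot> (f \<cdot> x) = g' \<cdot> (f' \<cdot> x)"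
proof -
  have d: "Dom C f = Dom C f'"
    using assms(1-7) by (metis Comp_arr(2))
  have "g \<cdot> (f \<cdot> x) = (g \<cdot> f) \<cdot> x" using assms(2-) by simp
  also have "\<dots> = (g' \<cdot> f') \<cdot> x" by (simp only: assms(1))
  also have "\<dots> = g' \<cdot> (f' \<cdot> x)" using assms(2-) d by simp
  finally show ?thesis .
qed

section \<open>Inverses, cancellation and two out of six\<close>

lemma inverse_unique:
  assumes "f \<in> Arr C" "g \<in> Hom C (Cod C f) (Dom C f)" "h \<in> Hom C (Cod C f) (Dom C f)"
    and "g \<cdot> f = Ide C (Dom C f)" "f \<cdot> h = Ide C (Cod C f)"
  shows "g = h"
proof -
  note g = in_HomD[OF assms(2)] and h = in_HomD[OF assms(3)]
  have "g = g \<cdot> (f \<cdot> h)" using assms(1,5) g by simp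
  also have "\<dots> = (g \<cdot> f) \<cdot> h" using assms(1) g h by (simp only: assoc)
  also have "\<dots> = h" using assms(1,4) h by simp
  finally show ?thesis .
qed

lemma inv_arr_eqI:
  assumes "f \<in> Arr C" "g \<in> Hom C (Cod C f) (Dom C f)"
    and "g \<cdot> f = Ide C (Dom C f)" "f \<cdot> g = Ide C (Cod C f)"
  shows "inv_arr C f = g" "iso_arr C f"
proof -
  show "inv_arr C f = g"
    unfolding inv_arr_def
  proof (rule the_equality)
    show "g \<in> Hom C (Cod C f) (Dom C f) \<and> g \<cdot> f = Ide C (Dom C f) \<and> f \<cdot> g = Ide C (Cod C f)"
      using assms by blast
    fix h assume "h \<in> Hom C (Cod C f) (Dom C f) \<and> h \<cdot> f = Ide C (Dom C f) \<and> f \<cdot> h = Ide C (Cod C f)"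
    then show "h = g" using assms inverse_unique by blast
  qed
  show "iso_arr C f" using assms by (auto simp: iso_arr_def)
qed

lemma isoI:
  assumes "f \<in> Arr C" "g \<in> Arr C" "Dom C g = Cod C f" "Cod C g = Dom C f"
    and "g \<cdot> f = Ide C (Dom C f)" "f \<cdot> g = Ide C (Cod C f)"
  shows "inv_arr C f = g" "iso_arr C f"
  using inv_arr_eqI[of f g] assms by (auto simp: Hom_def)

lemma iso_is_Arr: "iso_arr C f \<Longrightarrow> f \<in> Arr C"
  by (simp add: iso_arr_def)

lemma inv_arr [simp]:
  assumes "iso_arr C f"
  shows "inv_arr C f \<in> Arr C" "Dom C (inv_arr C f) = Cod C f" "Cod C (inv_arr C f) = Dom C f"
    "inv_arr C f \<cdot> f = Ide C (Dom C f)" "f \<cdot> inv_arr C f = Ide C (Cod C f)"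
proof -
  obtain g where g: "g \<in> Hom C (Cod C f) (Dom C f)" "g \<cdot> f = Ide C (Dom C f)" "f \<cdot> g = Ide C (Cod C f)"
    and f: "f \<in> Arr C"
    using assms by (auto simp: iso_arr_def)
  then have "inv_arr C f = g" by (intro inv_arr_eqI)
  then show "inv_arr C f \<in> Arr C" "Dom C (inv_arr C f) = Cod C f" "Cod C (inv_arr C f) = Dom C f"
    "inv_arr C f \<cdot> f = Ide C (Dom C f)" "f \<cdot> inv_arr C f = Ide C (Cod C f)"
    using g by (auto simp: Hom_def)
qed

lemma inv_arr_cancel [simp]:
  assumes "iso_arr C f" "x \<in> Arr C"
  shows "Cod C x = Dom C f \<Longrightarrow> inv_arr C f \<cdot> (f \<cdot> x) = x"
    "Cod C x = Cod C f \<Longrightarrow> f \<cdot> (inv_arr C f \<cdot> x) = x"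
  using rewr[OF inv_arr(4)[OF assms(1)], of x] rewr[OF inv_arr(5)[OF assms(1)], of x]
    assms iso_is_Arr[OF assms(1)] by auto

lemma iso_inv [simp]:
  assumes "iso_arr C f"
  shows "iso_arr C (inv_arr C f)" "inv_arr C (inv_arr C f) = f"
  using isoI[of "inv_arr C f" f] assms iso_is_Arr[OF assms] by auto

lemma iso_Ide [simp]: "A \<in> Obj C \<Longrightarrow> iso_arr C (Ide C A)"
  using isoI(2)[of "Ide C A" "Ide C A"] by auto

lemma iso_Comp [simp]:
  assumes "iso_arr C f" "iso_arr C g" "Cod C f = Dom C g"
  shows "iso_arr C (g \<cdot> f)" "inv_arr C (g \<cdot> f) = inv_arr C f \<cdot> inv_arr C g"
  using isoI[of "g \<cdot> f" "inv_arr C f \<cdot> inv_arr C g"] assms iso_is_Arr[OF assms(1)] iso_is_Arr[OF assms(2)]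
  by auto

lemma iso_mono:
  assumes "iso_arr C g" "g \<cdot> f = g \<cdot> f'" "f \<in> Arr C" "f' \<in> Arr C" "Cod C f = Dom C g" "Cod C f' = Dom C g"
  shows "f = f'"
  using inv_arr_cancel(1)[OF assms(1,3,5)] inv_arr_cancel(1)[OF assms(1,4,6)] assms(2) by metis

lemma iso_epi:
  assumes "iso_arr C g" "f \<cdot> g = f' \<cdot> g" "f \<in> Arr C" "f' \<in> Arr C" "Cod C g = Dom C f" "Cod C g = Dom C f'"
  shows "f = f'"
proof -
  note g = iso_is_Arr[OF assms(1)]
  have "f = (f \<cdot> g) \<cdot> inv_arr C g" "f' = (f' \<cdot> g) \<cdot> inv_arr C g"
    using assms(1,3-) g by simp_all
  then show ?thesis
    using assms(2) by metis
qed

lemma iso_move_left: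
  assumes "iso_arr C g" "g \<cdot> f = h" "f \<in> Arr C" "Cod C f = Dom C g"
  shows "f = inv_arr C g \<cdot> h"
  using inv_arr_cancel(1)[OF assms(1,3,4)] assms(2) by simp

lemma iso_move_right:
  assumes "iso_arr C g" "f \<cdot> g = h" "f \<in> Arr C" "Cod C g = Dom C f"
  shows "f = h \<cdot> inv_arr C g"
proof -
  have "f = (f \<cdot> g) \<cdot> inv_arr C g"
    using assms(1,3,4) iso_is_Arr[OF assms(1)] by simp
  then show ?thesis
    using assms(2) by simp
qed

text \<open>Serves formal inverses in naturality proofs: a commutative square survives when both of
  its invertible parallel sides are reversed.\<close>

lemma exchange_inv:
  assumes "iso_arr C a" "iso_arr C b" "x \<in> Arr C" "y \<in> Arr C" "Dom C x = Dom C a" "Dom C y = Cod C a"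
    "Cod C x = Dom C b" "Cod C y = Cod C b" "b \<cdot> x = y \<cdot> a"
  shows "x \<cdot> inv_arr C a = inv_arr C b \<cdot> y"
proof -
  have a: "a \<in> Arr C" "b \<in> Arr C" using assms(1,2) iso_is_Arr by auto
  have "x \<cdot> inv_arr C a = inv_arr C b \<cdot> ((b \<cdot> x) \<cdot> inv_arr C a)"
    using assms(1-8) a by simp
  also have "\<dots> = inv_arr C b \<cdot> ((y \<cdot> a) \<cdot> inv_arr C a)"
    by (simp only: assms(9))
  also have "\<dots> = inv_arr C b \<cdot> y"
    using assms(1-8) a by simp
  finally show ?thesis .
qed

lemma iso_split:
  assumes "f \<in> Arr C" "g \<in> Arr C" "h \<in> Arr C" "Dom C g = Cod C f" "Cod C g = Dom C f"
    "Dom C h = Cod C f" "Cod C h = Dom C f"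
    "g \<cdot> f = Ide C (Dom C f)" "f \<cdot> h = Ide C (Cod C f)"
  shows "iso_arr C f" "inv_arr C f = g"
proof -
  have "g = h" using inverse_unique[of f g h] assms by (auto simp: Hom_def)
  then show "iso_arr C f" "inv_arr C f = g" using isoI[of f g] assms by auto
qed

lemma iso_cancel:
  assumes "g \<in> Arr C" "f \<in> Arr C" "Cod C f = Dom C g" "iso_arr C (g \<cdot> f)"
  shows "iso_arr C f \<Longrightarrow> iso_arr C g" "iso_arr C g \<Longrightarrow> iso_arr C f"
proof -
  assume f: "iso_arr C f"
  have "g = (g \<cdot> f) \<cdot> inv_arr C f" using assms(1-3) f by simp
  moreover have "iso_arr C ((g \<cdot> f) \<cdot> inv_arr C f)"
    by (rule iso_Comp) (use assms f in simp_all)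
  ultimately show "iso_arr C g" by metis
next
  assume g: "iso_arr C g"
  have "f = inv_arr C g \<cdot> (g \<cdot> f)" using assms(1-3) g by simp
  moreover have "iso_arr C (inv_arr C g \<cdot> (g \<cdot> f))"
    by (rule iso_Comp) (use assms g in simp_all)
  ultimately show "iso_arr C f" by metis
qed

text \<open>The map \<open>g\<close> acquires a left inverse from \<open>h \<cdot> g\<close> and a
  right inverse from \<open>g \<cdot> f\<close>; once \<open>g\<close> is invertible, it can be
  cancelled from \<open>h \<cdot> g\<close>.\<close>

lemma iso_two_of_six:
  assumes "f \<in> Arr C" "g \<in> Arr C" "h \<in> Arr C" "Cod C f = Dom C g" "Cod C g = Dom C h"
    and gf: "iso_arr C (g \<cdot> f)" and hg: "iso_arr C (h \<cdot> g)"
  shows "iso_arr C h"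
proof -
  have 1: "(inv_arr C (h \<cdot> g) \<cdot> h) \<cdot> g = Ide C (Dom C g)"
    using inv_arr(4)[OF hg] inv_arr(1-3)[OF hg] assms(1-5) by simp
  have 2: "g \<cdot> (f \<cdot> inv_arr C (g \<cdot> f)) = Ide C (Cod C g)"
    using inv_arr(5)[OF gf] inv_arr(1-3)[OF gf] assms(1-5) by simp
  have "iso_arr C g"
    by (rule iso_split[OF _ _ _ _ _ _ _ 1 2])
      (use assms(1-5) inv_arr(1-3)[OF gf] inv_arr(1-3)[OF hg] in simp_all)
  then show ?thesis using iso_cancel(1)[of h g] assms by simp
qed

end

section \<open>Opposite and product categories, functors and bifunctors\<close>

lemma op_cat_simps [simp]:
  "Obj (op_cat C) = Obj C" "Arr (op_cat C) = Arr C" "Dom (op_cat C) = Cod C"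
  "Cod (op_cat C) = Dom C" "Ide (op_cat C) = Ide C" "g \<cdot>\<^bsub>op_cat C\<^esub> f = f \<cdot>\<^bsub>C\<^esub> g"
  by (simp_all add: op_cat_def)

lemma Hom_op_cat [simp]: "Hom (op_cat C) A B = Hom C B A"
  by (auto simp: Hom_def)

lemma category_op_cat: "category C \<Longrightarrow> category (op_cat C)"
proof -
  assume "category C"
  then interpret category C .
  show ?thesis by unfold_locales (auto simp: Hom_def)
qed

lemma iso_arr_op_cat [simp]: "iso_arr (op_cat C) f = iso_arr C f"
  by (auto simp: iso_arr_def Hom_def)

lemma prod_cat_simps [simp]:
  "Obj (prod_cat C D) = Obj C \<times> Obj D" "Arr (prod_cat C D) = Arr C \<times> Arr D"
  "Dom (prod_cat C D) (f, g) = (Dom C f, Dom D g)"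
  "Cod (prod_cat C D) (f, g) = (Cod C f, Cod D g)"
  "Ide (prod_cat C D) (A, B) = (Ide C A, Ide D B)"
  "(f', g') \<cdot>\<^bsub>prod_cat C D\<^esub> (f, g) = (f' \<cdot>\<^bsub>C\<^esub> f, g' \<cdot>\<^bsub>D\<^esub> g)"
  by (simp_all add: prod_cat_def)

lemma Hom_prod_cat [simp]: "Hom (prod_cat C D) (A, B) (A', B') = Hom C A A' \<times> Hom D B B'"
  by (auto simp: Hom_def)

lemma category_prod_cat:
  assumes "category C" "category D"
  shows "category (prod_cat C D)"
proof -
  interpret C: category C by fact
  interpret D: category D by fact
  show ?thesis
    by unfold_locales (auto simp: Hom_def)
qed

context cat_functor
begin

lemma fobj_Obj [simp]: "A \<in> Obj C \<Longrightarrow> fobj F A \<in> Obj D"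
  by (rule fobj_in)

lemma farr_arr [simp]:
  assumes "f \<in> Arr C"
  shows "farr F f \<in> Arr D" "Dom D (farr F f) = fobj F (Dom C f)" "Cod D (farr F f) = fobj F (Cod C f)"
  using farr_in[OF Arr_HomI[OF assms]] by (auto simp: Hom_def)

lemma farr_Comp' [simp]:
  "\<lbrakk>f \<in> Arr C; g \<in> Arr C; Cod C f = Dom C g\<rbrakk> \<Longrightarrow> farr F (g \<cdot>\<^bsub>C\<^esub> f) = farr F g \<cdot>\<^bsub>D\<^esub> farr F f"
  using farr_Comp[of f "Dom C f" "Cod C f" g "Cod C g"] by (auto simp: Hom_def)

lemma farr_iso [simp]:
  assumes "iso_arr C f"
  shows "iso_arr D (farr F f)" "inv_arr D (farr F f) = farr F (inv_arr C f)"
proof -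
  note f = src.iso_is_Arr[OF assms]
  have "farr F (inv_arr C f) \<cdot>\<^bsub>D\<^esub> farr F f = Ide D (fobj F (Dom C f))"
    "farr F f \<cdot>\<^bsub>D\<^esub> farr F (inv_arr C f) = Ide D (fobj F (Cod C f))"
    using assms f farr_Comp'[of f "inv_arr C f"] farr_Comp'[of "inv_arr C f" f]
    by (auto simp: farr_Ide)
  then show "iso_arr D (farr F f)" "inv_arr D (farr F f) = farr F (inv_arr C f)"
    using tgt.isoI[of "farr F f" "farr F (inv_arr C f)"] assms f by auto
qed

end

lemma cat_functorI:
  assumes "category C" "category D"
    and "\<And>A. A \<in> Obj C \<Longrightarrow> fobj F A \<in> Obj D"
    and "\<And>f. f \<in> Arr C \<Longrightarrow> farr F f \<in> Arr D \<and> Dom D (farr F f) = fobj F (Dom C f)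
           \<and> Cod D (farr F f) = fobj F (Cod C f)"
    and "\<And>A. A \<in> Obj C \<Longrightarrow> farr F (Ide C A) = Ide D (fobj F A)"
    and "\<And>f g. \<lbrakk>f \<in> Arr C; g \<in> Arr C; Cod C f = Dom C g\<rbrakk>
           \<Longrightarrow> farr F (g \<cdot>\<^bsub>C\<^esub> f) = farr F g \<cdot>\<^bsub>D\<^esub> farr F f"
  shows "cat_functor C D F"
  unfolding cat_functor_def cat_functor_axioms_def using assms by (auto simp: Hom_def)

text \<open>Extension along the localisation starts from \<open>Ho M\<close>, so a contravariant
  functor arises with the opposite category as its target; the bifunctor lemma needs the opposite on
  the source.\<close>

lemma cat_functor_op_cat:
  assumes "category C" "cat_functor C (op_cat D) F" "category D"
  shows "cat_functor (op_cat C) D F"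
proof -
  interpret cat_functor C "op_cat D" F by fact
  show ?thesis
    using category_op_cat[OF assms(1)] assms(3) farr_Ide fobj_Obj farr_arr
    by (intro cat_functorI) auto
qed

text \<open>The order \<open>F1\<close> after \<open>F2\<close> is that of \<open>ho_ext2\<close>
  and \<open>ho_ext2_op\<close>, so both are instances. Functoriality rests on \<open>inter\<close>,
  which moves the second-variable part of the later map past the first-variable part of the earlier
  one.\<close>

lemma bifunctor_from_sections:
  assumes C: "category C" and D: "category D" and E: "category E"
    and F1: "\<And>B. B \<in> Obj D \<Longrightarrow> cat_functor C E \<lparr>fobj = (\<lambda>A. ob (A, B)), farr = F1 B\<rparr>"
    and F2: "\<And>A. A \<in> Obj C \<Longrightarrow> cat_functor D E \<lparr>fobj = (\<lambda>B. ob (A, B)), farr = F2 A\<rparr>"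
    and inter: "\<And>f g. \<lbrakk>f \<in> Arr C; g \<in> Arr D\<rbrakk> \<Longrightarrow>
       F1 (Cod D g) f \<cdot>\<^bsub>E\<^esub> F2 (Dom C f) g = F2 (Cod C f) g \<cdot>\<^bsub>E\<^esub> F1 (Dom D g) f"
  shows "cat_functor (prod_cat C D) E
     \<lparr>fobj = ob, farr = (\<lambda>(f, g). F1 (Cod D g) f \<cdot>\<^bsub>E\<^esub> F2 (Dom C f) g)\<rparr>"
proof -
  interpret C: category C by fact
  interpret D: category D by fact
  interpret E: category E by fact
  have F1a [simp]: "F1 B f \<in> Arr E" "Dom E (F1 B f) = ob (Dom C f, B)" "Cod E (F1 B f) = ob (Cod C f, B)"
    if "B \<in> Obj D" "f \<in> Arr C" for B f
    using cat_functor.farr_arr[OF F1[OF that(1)] that(2)] by auto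
  have F2a [simp]: "F2 A f \<in> Arr E" "Dom E (F2 A f) = ob (A, Dom D f)" "Cod E (F2 A f) = ob (A, Cod D f)"
    if "A \<in> Obj C" "f \<in> Arr D" for A f
    using cat_functor.farr_arr[OF F2[OF that(1)] that(2)] by auto
  have F1i: "F1 B (Ide C A) = Ide E (ob (A, B))" "F2 A (Ide D B) = Ide E (ob (A, B))"
    and ob: "ob (A, B) \<in> Obj E"
    if "A \<in> Obj C" "B \<in> Obj D" for A B
    using cat_functor.farr_Ide[OF F1] cat_functor.farr_Ide[OF F2] cat_functor.fobj_Obj[OF F1] that by auto
  have F1c: "F1 B (g \<cdot>\<^bsub>C\<^esub> f) = F1 B g \<cdot>\<^bsub>E\<^esub> F1 B f"
    if "B \<in> Obj D" "f \<in> Arr C" "g \<in> Arr C" "Cod C f = Dom C g" for B f g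
    using cat_functor.farr_Comp'[OF F1] that by simp
  have F2c: "F2 A (g \<cdot>\<^bsub>D\<^esub> f) = F2 A g \<cdot>\<^bsub>E\<^esub> F2 A f"
    if "A \<in> Obj C" "f \<in> Arr D" "g \<in> Arr D" "Cod D f = Dom D g" for A f g
    using cat_functor.farr_Comp'[OF F2] that by simp
  show ?thesis
  proof (rule cat_functorI)
    show "category (prod_cat C D)" by (intro category_prod_cat C D)
    show "category E" by fact
  next
    fix u v assume a: "u \<in> Arr (prod_cat C D)" "v \<in> Arr (prod_cat C D)"
      "Cod (prod_cat C D) u = Dom (prod_cat C D) v"
    obtain f g f' g' where uv: "u = (f, g)" "v = (f', g')" by fastforce
    from a uv have [simp]: "f \<in> Arr C" "f' \<in> Arr C" "g \<in> Arr D" "g' \<in> Arr D" "Cod C f = Dom C f'"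
      "Cod D g = Dom D g'" by auto
    have "F1 (Cod D g') (f' \<cdot>\<^bsub>C\<^esub> f) \<cdot>\<^bsub>E\<^esub> F2 (Dom C f) (g' \<cdot>\<^bsub>D\<^esub> g)
      = F1 (Cod D g') f' \<cdot>\<^bsub>E\<^esub> (F1 (Cod D g') f \<cdot>\<^bsub>E\<^esub> (F2 (Dom C f) g' \<cdot>\<^bsub>E\<^esub> F2 (Dom C f) g))"
      by (simp add: F1c F2c)
    also have "\<dots> = F1 (Cod D g') f' \<cdot>\<^bsub>E\<^esub> (F2 (Dom C f') g' \<cdot>\<^bsub>E\<^esub> (F1 (Dom D g') f \<cdot>\<^bsub>E\<^esub> F2 (Dom C f) g))"
      using E.rewr2[OF inter[of f g'], of "F2 (Dom C f) g"] by simp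
    finally show "farr \<lparr>fobj = ob, farr = (\<lambda>(f, g). F1 (Cod D g) f \<cdot>\<^bsub>E\<^esub> F2 (Dom C f) g)\<rparr> (v \<cdot>\<^bsub>prod_cat C D\<^esub> u)
       = farr \<lparr>fobj = ob, farr = (\<lambda>(f, g). F1 (Cod D g) f \<cdot>\<^bsub>E\<^esub> F2 (Dom C f) g)\<rparr> v \<cdot>\<^bsub>E\<^esub>
         farr \<lparr>fobj = ob, farr = (\<lambda>(f, g). F1 (Cod D g) f \<cdot>\<^bsub>E\<^esub> F2 (Dom C f) g)\<rparr> u"
      by (simp add: uv)
  qed (auto simp: F1i ob)
qed

section \<open>The localisation at the weak equivalences\<close>

locale weq_category = category M
  for M :: "('o, 'm) model" (structure) +
  assumes Weq_wide: "wide_subcategory M (Weq M)"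
begin

abbreviation H where "H \<equiv> Ho M"
abbreviation hcomp (infixr "\<bullet>" 70) where "g \<bullet> f \<equiv> g \<cdot>\<^bsub>Ho M\<^esub> f"

lemma Weq_Arr [simp]: "w \<in> Weq M \<Longrightarrow> w \<in> Arr M"
  using Weq_wide by (auto simp: wide_subcategory_def)

section \<open>Zigzags and the congruence on them\<close>

lemma zigzag_Obj: "zigzag M A us B \<Longrightarrow> A \<in> Obj M \<and> B \<in> Obj M"
  by (induction us arbitrary: A) (auto split: letter.splits)

lemma zigzag_append: "zigzag M A (us @ vs) B \<longleftrightarrow> (\<exists>X. zigzag M A us X \<and> zigzag M X vs B)"
  by (induction us arbitrary: A) (auto split: letter.splits dest: zigzag_Obj)

lemma zz_step_append:
  assumes "zz_step M us us'"
  shows "zz_step M (us @ ws) (us' @ ws)" "zz_step M (ws @ us) (ws @ us')"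
  using assms
proof (atomize (full), cases rule: zz_step.cases)
  case (zz_Ide A xs ys)
  then show "zz_step M (us @ ws) (us' @ ws) \<and> zz_step M (ws @ us) (ws @ us')"
    using zz_step.zz_Ide[of A M xs "ys @ ws"] zz_step.zz_Ide[of A M "ws @ xs" ys] by simp
next
  case (zz_Comp xs f g ys)
  then show "zz_step M (us @ ws) (us' @ ws) \<and> zz_step M (ws @ us) (ws @ us')"
    using zz_step.zz_Comp[of M xs f g "ys @ ws"] zz_step.zz_Comp[of M "ws @ xs" f g ys] by simp
next
  case (zz_Fwd_Bwd xs w ys)
  then show "zz_step M (us @ ws) (us' @ ws) \<and> zz_step M (ws @ us) (ws @ us')"
    using zz_step.zz_Fwd_Bwd[of M xs w "ys @ ws"] zz_step.zz_Fwd_Bwd[of M "ws @ xs" w ys] by simp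
next
  case (zz_Bwd_Fwd xs w ys)
  then show "zz_step M (us @ ws) (us' @ ws) \<and> zz_step M (ws @ us) (ws @ us')"
    using zz_step.zz_Bwd_Fwd[of M xs w "ys @ ws"] zz_step.zz_Bwd_Fwd[of M "ws @ xs" w ys] by simp
qed

lemma zz_equiv_refl: "zz_equiv M A B us us"
  by (simp add: zz_equiv_def)

lemma zz_equiv_sym: "zz_equiv M A B us vs \<Longrightarrow> zz_equiv M A B vs us"
  by (simp add: zz_equiv_def equivclp_sym)

lemma zz_equiv_trans: "zz_equiv M A B us vs \<Longrightarrow> zz_equiv M A B vs ws \<Longrightarrow> zz_equiv M A B us ws"
  unfolding zz_equiv_def by (rule equivclp_trans)

lemma zz_equiv_step:
  "\<lbrakk>zigzag M A us B; zigzag M A vs B; zz_step M us vs\<rbrakk> \<Longrightarrow> zz_equiv M A B us vs"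
  unfolding zz_equiv_def by (rule r_into_equivclp) simp

lemma zz_equiv_induct [consumes 1, case_names refl step]:
  assumes "zz_equiv M A B us vs"
    and "P us"
    and "\<And>xs ys. \<lbrakk>zigzag M A xs B; zigzag M A ys B; zz_step M xs ys \<or> zz_step M ys xs; P xs\<rbrakk> \<Longrightarrow> P ys"
  shows "P vs"
  using assms(1) unfolding zz_equiv_def
  by (induction rule: equivclp_induct) (use assms(2,3) in blast)+

text \<open>\<open>equivclp\<close> relates every list to itself, whether or not it is a zigzag, so
  equivalence alone does not give well-formedness. It transports it, because the generating steps
  are restricted to zigzags from \<open>A\<close> to \<open>B\<close>.\<close>

lemma zz_equiv_zigzag: "zz_equiv M A B us vs \<Longrightarrow> zigzag M A us B \<longleftrightarrow> zigzag M A vs B"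
proof -
  have *: "zz_equiv M A B us vs \<Longrightarrow> zigzag M A us B \<Longrightarrow> zigzag M A vs B" for us vs
    by (induction rule: zz_equiv_induct) auto
  show "zz_equiv M A B us vs \<Longrightarrow> zigzag M A us B \<longleftrightarrow> zigzag M A vs B"
    using * zz_equiv_sym by blast
qed

lemma zz_equiv_append1:
  assumes "zz_equiv M A B us us'" "zigzag M B vs D"
  shows "zz_equiv M A D (us @ vs) (us' @ vs)"
  using assms(1)
proof (induction rule: zz_equiv_induct)
  case refl
  then show ?case by (rule zz_equiv_refl)
next
  case (step xs ys)
  have "zigzag M A (xs @ vs) D" "zigzag M A (ys @ vs) D"
    using step assms(2) zigzag_append by auto
  then have "zz_equiv M A D (xs @ vs) (ys @ vs)"
    using step(3) zz_step_append(1) zz_equiv_step zz_equiv_sym by metis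
  then show ?case using step zz_equiv_trans by metis
qed

lemma zz_equiv_append2:
  assumes "zz_equiv M B D vs vs'" "zigzag M A us B"
  shows "zz_equiv M A D (us @ vs) (us @ vs')"
  using assms(1)
proof (induction rule: zz_equiv_induct)
  case refl
  then show ?case by (rule zz_equiv_refl)
next
  case (step xs ys)
  have "zigzag M A (us @ xs) D" "zigzag M A (us @ ys) D"
    using step assms(2) zigzag_append by auto
  then have "zz_equiv M A D (us @ xs) (us @ ys)"
    using step(3) zz_step_append(2) zz_equiv_step zz_equiv_sym by metis
  then show ?case using step zz_equiv_trans by metis
qed

lemma ho_class_eq: "ho_class M A us B = ho_class M A vs B \<longleftrightarrow> zz_equiv M A B us vs"
proof
  assume "ho_class M A us B = ho_class M A vs B"
  then have "vs \<in> {xs. zz_equiv M A B us xs}"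
    using zz_equiv_refl[of A B vs] by (simp add: ho_class_def)
  then show "zz_equiv M A B us vs" by simp
next
  assume "zz_equiv M A B us vs"
  then have "zz_equiv M A B us xs = zz_equiv M A B vs xs" for xs
    using zz_equiv_trans zz_equiv_sym by metis
  then show "ho_class M A us B = ho_class M A vs B"
    by (simp add: ho_class_def)
qed

lemma ho_class_eqI:
  "\<lbrakk>zigzag M A us B; zigzag M A vs B; zz_step M us vs\<rbrakk> \<Longrightarrow> ho_class M A us B = ho_class M A vs B"
  by (simp add: ho_class_eq zz_equiv_step)

section \<open>The category of zigzag classes and the localisation functor\<close>

lemma Ho_simps [simp]:
  "Obj H = Obj M" "Dom H (ho_class M A us B) = A" "Cod H (ho_class M A us B) = B"
  "Ide H A = ho_class M A [] A"
  by (auto simp: Ho_def ho_class_def)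

lemma Arr_Ho: "f \<in> Arr H \<longleftrightarrow> (\<exists>A us B. f = ho_class M A us B \<and> zigzag M A us B)"
  by (auto simp: Ho_def)

lemma Hom_Ho: "f \<in> Hom H A B \<longleftrightarrow> (\<exists>us. f = ho_class M A us B \<and> zigzag M A us B)"
  by (auto simp: Hom_def Arr_Ho)

lemma ho_class_Arr: "zigzag M A us B \<Longrightarrow> ho_class M A us B \<in> Arr H"
  using Arr_Ho by blast

text \<open>Composition in \<open>Ho M\<close> collects the concatenations of all representatives.
  The congruence is stable under concatenation on either side, so the result is the class of a
  single one.\<close>

lemma Comp_Ho:
  assumes "zigzag M A us B" "zigzag M B vs D"
  shows "ho_class M B vs D \<bullet> ho_class M A us B = ho_class M A (us @ vs) D"
proof -
  have "zz_equiv M A D (us @ vs) ws"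
    if "zz_equiv M A B us us'" "zz_equiv M B D vs vs'" "zz_equiv M A D (us' @ vs') ws" for us' vs' ws
  proof -
    have "zz_equiv M A D (us @ vs) (us' @ vs)"
      using zz_equiv_append1 that assms by blast
    moreover have "zz_equiv M A D (us' @ vs) (us' @ vs')"
      using zz_equiv_append2 that assms zz_equiv_zigzag by blast
    ultimately show ?thesis using that zz_equiv_trans by blast
  qed
  then have "{ws. \<exists>us'\<in>{x. zz_equiv M A B us x}. \<exists>vs'\<in>{x. zz_equiv M B D vs x}. zz_equiv M A D (us' @ vs') ws}
    = {ws. zz_equiv M A D (us @ vs) ws}"
    using zz_equiv_refl by blast
  then show ?thesis
    by (simp add: Ho_def ho_class_def)
qed

lemma category_Ho: "category H"
proof
  show "Ide H A \<in> Hom H A A" if "A \<in> Obj H" for A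
    using that ho_class_Arr[of A "[]" A] by (simp add: Hom_def)
  show "g \<bullet> f \<in> Hom H X Z" if fg: "f \<in> Hom H X Y" "g \<in> Hom H Y Z" for f g X Y Z
  proof -
    obtain us vs where *: "f = ho_class M X us Y" "zigzag M X us Y" "g = ho_class M Y vs Z" "zigzag M Y vs Z"
      using fg unfolding Hom_Ho by blast
    then have "zigzag M X (us @ vs) Z"
      using zigzag_append by blast
    then show ?thesis using * Comp_Ho ho_class_Arr by (auto simp: Hom_def)
  qed
  show "f \<bullet> Ide H X = f" "Ide H Y \<bullet> f = f" if "f \<in> Hom H X Y" for f X Y
    using that Comp_Ho[of X "[]" X] Comp_Ho[of X _ Y "[]" Y] zigzag_Obj by (auto simp: Hom_def Arr_Ho)
  show "(h \<bullet> g) \<bullet> f = h \<bullet> (g \<bullet> f)"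
    if fgh: "f \<in> Hom H W X" "g \<in> Hom H X Y" "h \<in> Hom H Y Z" for f g h W X Y Z
  proof -
    obtain us vs ws where *: "f = ho_class M W us X" "zigzag M W us X" "g = ho_class M X vs Y" "zigzag M X vs Y"
      "h = ho_class M Y ws Z" "zigzag M Y ws Z"
      using fgh unfolding Hom_Ho by blast
    moreover have "zigzag M W (us @ vs) Y" "zigzag M X (vs @ ws) Z"
      using * zigzag_append by blast+
    ultimately show ?thesis by (simp add: Comp_Ho)
  qed
qed (auto simp: Arr_Ho dest: zigzag_Obj)

sublocale H: category H
  by (rule category_Ho)

declare Ho_simps(4) [simp del]

lemma \<gamma>_arr [simp]:
  assumes "f \<in> Arr M"
  shows "\<gamma> M f \<in> Arr H" "Dom H (\<gamma> M f) = Dom M f" "Cod H (\<gamma> M f) = Cod M f"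
  using assms ho_class_Arr[of "Dom M f" "[Fwd f]" "Cod M f"] by (auto simp: \<gamma>_def)

lemma \<gamma>_Ide: "A \<in> Obj M \<Longrightarrow> \<gamma> M (Ide M A) = Ide H A"
  using ho_class_eqI[of A "[Fwd (Ide M A)]" A "[]"] zz_Ide[of A M "[]" "[]"]
  by (simp add: \<gamma>_def Ho_simps)

lemma \<gamma>_Comp:
  assumes "f \<in> Arr M" "g \<in> Arr M" "Cod M f = Dom M g"
  shows "\<gamma> M (g \<cdot> f) = \<gamma> M g \<bullet> \<gamma> M f"
  using assms Comp_Ho[of "Dom M f" "[Fwd f]" "Cod M f" "[Fwd g]" "Cod M g"]
    ho_class_eqI[of "Dom M f" "[Fwd f, Fwd g]" "Cod M g" "[Fwd (g \<cdot> f)]"] zz_Comp[of M "[]" f g "[]"]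
  by (simp add: \<gamma>_def)

text \<open>Oriented towards \<open>M\<close>: composites of images become images of composites,
  where the identities of the model category apply. The rule is switched off where separate factors
  have to survive.\<close>

lemma \<gamma>_Comp_rev [simp]:
  "\<lbrakk>f \<in> Arr M; g \<in> Arr M; Cod M f = Dom M g\<rbrakk> \<Longrightarrow> \<gamma> M g \<bullet> \<gamma> M f = \<gamma> M (g \<cdot> f)"
  by (simp add: \<gamma>_Comp)

lemma \<gamma>_Comp_rev' [simp]:
  "\<lbrakk>f \<in> Arr M; g \<in> Arr M; Cod M f = Dom M g; x \<in> Arr H; Cod H x = Dom M f\<rbrakk>
   \<Longrightarrow> \<gamma> M g \<bullet> (\<gamma> M f \<bullet> x) = \<gamma> M (g \<cdot> f) \<bullet> x"
  by (metis H.assoc \<gamma>_Comp \<gamma>_arr)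

lemma \<gamma>_Weq_inv:
  assumes "w \<in> Weq M"
  shows "iso_arr H (\<gamma> M w)" "inv_arr H (\<gamma> M w) = ho_class M (Cod M w) [Bwd w] (Dom M w)"
proof -
  have w: "w \<in> Arr M" using assms by simp
  have "ho_class M (Cod M w) [Bwd w] (Dom M w) \<bullet> \<gamma> M w = Ide H (Dom M w)"
    using w assms ho_class_eqI[of "Dom M w" "[Fwd w, Bwd w]" "Dom M w" "[]"] zz_Fwd_Bwd[of M "[]" w "[]"]
    by (simp add: \<gamma>_def Comp_Ho Ho_simps)
  moreover have "\<gamma> M w \<bullet> ho_class M (Cod M w) [Bwd w] (Dom M w) = Ide H (Cod M w)"
    using w assms ho_class_eqI[of "Cod M w" "[Bwd w, Fwd w]" "Cod M w" "[]"] zz_Bwd_Fwd[of M "[]" w "[]"]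
    by (simp add: \<gamma>_def Comp_Ho Ho_simps)
  moreover have "ho_class M (Cod M w) [Bwd w] (Dom M w) \<in> Arr H"
    using w assms by (intro ho_class_Arr) simp
  ultimately show "iso_arr H (\<gamma> M w)" "inv_arr H (\<gamma> M w) = ho_class M (Cod M w) [Bwd w] (Dom M w)"
    using H.isoI[of "\<gamma> M w" "ho_class M (Cod M w) [Bwd w] (Dom M w)"] w by auto
qed

lemma \<gamma>_Weq [simp]: "w \<in> Weq M \<Longrightarrow> iso_arr H (\<gamma> M w)"
  by (rule \<gamma>_Weq_inv)

text \<open>A class is taken apart letter by letter along a representing zigzag. Identities need no
  case of their own, being images of identities of \<open>M\<close>.\<close>

lemma ho_induct [consumes 1, case_names arr comp inv]:
  assumes "h \<in> Arr H"
    and arr: "\<And>f. f \<in> Arr M \<Longrightarrow> P (\<gamma> M f)"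
    and comp: "\<And>f g. \<lbrakk>f \<in> Arr H; g \<in> Arr H; Cod H f = Dom H g; P f; P g\<rbrakk> \<Longrightarrow> P (g \<bullet> f)"
    and inv: "\<And>w. w \<in> Weq M \<Longrightarrow> P (inv_arr H (\<gamma> M w))"
  shows "P h"
proof -
  obtain A us B where h: "h = ho_class M A us B" "zigzag M A us B"
    using assms(1) Arr_Ho by blast
  have "zigzag M A us B \<Longrightarrow> P (ho_class M A us B)"
  proof (induction us arbitrary: A)
    case Nil
    then have "A \<in> Obj M" "A = B" by auto
    then show ?case using arr[of "Ide M A"] by (simp add: \<gamma>_Ide Ho_simps)
  next
    case (Cons x xs)
    show ?case
    proof (cases x)
      case (Fwd f)
      then have f: "f \<in> Arr M" "Dom M f = A" "zigzag M (Cod M f) xs B" using Cons by auto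
      have "ho_class M A (x # xs) B = ho_class M (Cod M f) xs B \<bullet> \<gamma> M f"
        using f Comp_Ho[of A "[Fwd f]" "Cod M f" xs B] by (simp add: \<gamma>_def Fwd)
      then show ?thesis using f comp[of "\<gamma> M f" "ho_class M (Cod M f) xs B"] arr Cons.IH ho_class_Arr by simp
    next
      case (Bwd f)
      then have f: "f \<in> Weq M" "f \<in> Arr M" "Cod M f = A" "zigzag M (Dom M f) xs B" using Cons by auto
      have "ho_class M A (x # xs) B = ho_class M (Dom M f) xs B \<bullet> inv_arr H (\<gamma> M f)"
        using f Comp_Ho[of A "[Bwd f]" "Dom M f" xs B] by (simp add: \<gamma>_Weq_inv Bwd)
      then show ?thesis
        using f comp[of "inv_arr H (\<gamma> M f)" "ho_class M (Dom M f) xs B"] inv Cons.IH ho_class_Arr by simp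
    qed
  qed
  then show ?thesis using h by simp
qed

text \<open>Zigzags for \<open>h\<close> and \<open>k\<close> may differ in length and cannot be
  traversed together. The pair is split into \<open>h\<close> with an identity, followed by an
  identity with \<open>k\<close>; an identity is both an image and the image of a weak equivalence,
  so each half is a one-variable induction.\<close>

lemma ho_induct2 [consumes 2, case_names arr comp inv]:
  assumes "h \<in> Arr H" "k \<in> Arr H"
    and arr: "\<And>f g. \<lbrakk>f \<in> Arr M; g \<in> Arr M\<rbrakk> \<Longrightarrow> P (\<gamma> M f) (\<gamma> M g)"
    and comp: "\<And>f g f' g'. \<lbrakk>f \<in> Arr H; g \<in> Arr H; f' \<in> Arr H; g' \<in> Arr H; Cod H f = Dom H f';
      Cod H g = Dom H g'; P f g; P f' g'\<rbrakk> \<Longrightarrow> P (f' \<bullet> f) (g' \<bullet> g)"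
    and inv: "\<And>f g. \<lbrakk>f \<in> Weq M; g \<in> Weq M; P (\<gamma> M f) (\<gamma> M g)\<rbrakk>
      \<Longrightarrow> P (inv_arr H (\<gamma> M f)) (inv_arr H (\<gamma> M g))"
  shows "P h k"
proof -
  have Ide_Weq: "Ide M A \<in> Weq M" if "A \<in> Obj M" for A
    using that Weq_wide by (auto simp: wide_subcategory_def)
  have Ide_inv: "inv_arr H (Ide H A) = Ide H A" if "A \<in> Obj M" for A
    using that H.isoI[of "Ide H A" "Ide H A"] by simp
  have 1: "P f (Ide H A)" if "f \<in> Arr H" "A \<in> Obj M" for f A
    using that(1)
  proof (induction rule: ho_induct)
    case (arr f)
    then show ?case using assms(3)[of f "Ide M A"] that by (simp add: \<gamma>_Ide)
  next
    case (comp f g)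
    then show ?case using assms(4)[of f "Ide H A" g "Ide H A"] that by simp
  next
    case (inv w)
    then show ?case
      using assms(5)[of w "Ide M A"] assms(3)[of w "Ide M A"] that Ide_Weq[of A] by (simp add: \<gamma>_Ide Ide_inv)
  qed
  have 2: "P (Ide H A) f" if "f \<in> Arr H" "A \<in> Obj M" for f A
    using that(1)
  proof (induction rule: ho_induct)
    case (arr f)
    then show ?case using assms(3)[of "Ide M A" f] that by (simp add: \<gamma>_Ide)
  next
    case (comp f g)
    then show ?case using assms(4)[of "Ide H A" f "Ide H A" g] that by simp
  next
    case (inv w)
    then show ?case
      using assms(5)[of "Ide M A" w] assms(3)[of "Ide M A" w] that Ide_Weq[of A] by (simp add: \<gamma>_Ide Ide_inv)
  qed
  have o: "Dom H k \<in> Obj M" "Cod H h \<in> Obj M"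
    using H.Dom_Obj[OF assms(2)] H.Cod_Obj[OF assms(1)] by auto
  have "P (Ide H (Cod H h) \<bullet> h) (k \<bullet> Ide H (Dom H k))"
    using comp[OF _ _ _ _ _ _ 1[OF assms(1) o(1)] 2[OF assms(2) o(2)]] o assms(1,2) by simp
  then show ?thesis using assms(1,2) by simp
qed

text \<open>The same splitting: \<open>ho_induct2\<close> with an identity in the third place, then
  the third variable with two identities.\<close>

lemma ho_induct3 [consumes 3, case_names arr comp inv]:
  assumes "h \<in> Arr H" "k \<in> Arr H" "m \<in> Arr H"
    and arr: "\<And>e f g. \<lbrakk>e \<in> Arr M; f \<in> Arr M; g \<in> Arr M\<rbrakk> \<Longrightarrow> P (\<gamma> M e) (\<gamma> M f) (\<gamma> M g)"
    and comp: "\<And>e f g e' f' g'. \<lbrakk>e \<in> Arr H; f \<in> Arr H; g \<in> Arr H; e' \<in> Arr H; f' \<in> Arr H; g' \<in> Arr H;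
      Cod H e = Dom H e'; Cod H f = Dom H f'; Cod H g = Dom H g'; P e f g; P e' f' g'\<rbrakk>
      \<Longrightarrow> P (e' \<bullet> e) (f' \<bullet> f) (g' \<bullet> g)"
    and inv: "\<And>e f g. \<lbrakk>e \<in> Weq M; f \<in> Weq M; g \<in> Weq M; P (\<gamma> M e) (\<gamma> M f) (\<gamma> M g)\<rbrakk>
      \<Longrightarrow> P (inv_arr H (\<gamma> M e)) (inv_arr H (\<gamma> M f)) (inv_arr H (\<gamma> M g))"
  shows "P h k m"
proof -
  have Ide_Weq: "Ide M A \<in> Weq M" if "A \<in> Obj M" for A
    using that Weq_wide by (auto simp: wide_subcategory_def)
  have Ide_inv: "inv_arr H (Ide H A) = Ide H A" if "A \<in> Obj M" for A
    using that H.isoI[of "Ide H A" "Ide H A"] by simp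
  have 1: "P f g (Ide H A)" if "f \<in> Arr H" "g \<in> Arr H" "A \<in> Obj M" for f g A
    using that(1,2)
  proof (induction rule: ho_induct2)
    case (arr f g)
    then show ?case using assms(4)[of f g "Ide M A"] that by (simp add: \<gamma>_Ide)
  next
    case (comp f g f' g')
    then show ?case using assms(5)[of f g "Ide H A" f' g' "Ide H A"] that by simp
  next
    case (inv f g)
    then show ?case
      using assms(6)[of f g "Ide M A"] assms(4)[of f g "Ide M A"] that Ide_Weq[of A] by (simp add: \<gamma>_Ide Ide_inv)
  qed
  have 2: "P (Ide H A) (Ide H B) f" if "f \<in> Arr H" "A \<in> Obj M" "B \<in> Obj M" for f A B
    using that(1)
  proof (induction rule: ho_induct)
    case (arr f)
    then show ?case using assms(4)[of "Ide M A" "Ide M B" f] that by (simp add: \<gamma>_Ide)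
  next
    case (comp f g)
    then show ?case using assms(5)[of "Ide H A" "Ide H B" f "Ide H A" "Ide H B" g] that by simp
  next
    case (inv w)
    then show ?case
      using assms(6)[of "Ide M A" "Ide M B" w] assms(4)[of "Ide M A" "Ide M B" w] that
        Ide_Weq[of A] Ide_Weq[of B] by (simp add: \<gamma>_Ide Ide_inv)
  qed
  have o: "Dom H m \<in> Obj M" "Cod H h \<in> Obj M" "Cod H k \<in> Obj M"
    using H.Dom_Obj[OF assms(3)] H.Cod_Obj[OF assms(1)] H.Cod_Obj[OF assms(2)] by auto
  have "P (Ide H (Cod H h) \<bullet> h) (Ide H (Cod H k) \<bullet> k) (m \<bullet> Ide H (Dom H m))"
    using comp[OF _ _ _ _ _ _ _ _ _ 1[OF assms(1,2) o(1)] 2[OF assms(3) o(2,3)]] o assms(1-3) by simp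
  then show ?thesis using assms(1-3) by simp
qed

text \<open>The maps for which the square commutes include the images of \<open>M\<close> and are
  closed under composition by pasting and under inverses of weak equivalences by
  \<open>exchange_inv\<close>.\<close>

lemma ho_natural:
  assumes F: "cat_functor H D F" and G: "cat_functor H D G"
    and arr: "\<And>A. A \<in> Obj M \<Longrightarrow> \<tau> A \<in> Arr D" "\<And>A. A \<in> Obj M \<Longrightarrow> Dom D (\<tau> A) = fobj F A"
      "\<And>A. A \<in> Obj M \<Longrightarrow> Cod D (\<tau> A) = fobj G A"
    and nat: "\<And>f. f \<in> Arr M \<Longrightarrow> \<tau> (Cod M f) \<cdot>\<^bsub>D\<^esub> farr F (\<gamma> M f) = farr G (\<gamma> M f) \<cdot>\<^bsub>D\<^esub> \<tau> (Dom M f)"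
    and f: "f \<in> Arr H"
  shows "\<tau> (Cod H f) \<cdot>\<^bsub>D\<^esub> farr F f = farr G f \<cdot>\<^bsub>D\<^esub> \<tau> (Dom H f)"
proof -
  interpret F: cat_functor H D F by fact
  interpret G: cat_functor H D G by fact
  have [simp]: "f \<in> Arr H \<Longrightarrow> Dom H f \<in> Obj M" "f \<in> Arr H \<Longrightarrow> Cod H f \<in> Obj M" for f
    using H.Dom_Obj H.Cod_Obj by auto
  show ?thesis using f
  proof (induction rule: ho_induct)
    case (arr f)
    then show ?case using nat by simp
  next
    case (comp f g)
    note [simp] = comp(1-3) assms(3-5)
    have "\<tau> (Cod H g) \<cdot>\<^bsub>D\<^esub> farr F (g \<bullet> f) = (\<tau> (Cod H g) \<cdot>\<^bsub>D\<^esub> farr F g) \<cdot>\<^bsub>D\<^esub> farr F f" by simp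
    also have "\<dots> = farr G g \<cdot>\<^bsub>D\<^esub> (\<tau> (Cod H f) \<cdot>\<^bsub>D\<^esub> farr F f)" unfolding comp(5) by simp
    finally show ?case unfolding comp(4) by simp
  next
    case (inv w)
    have "\<tau> (Dom M w) \<cdot>\<^bsub>D\<^esub> inv_arr D (farr F (\<gamma> M w)) = inv_arr D (farr G (\<gamma> M w)) \<cdot>\<^bsub>D\<^esub> \<tau> (Cod M w)"
      by (rule F.tgt.exchange_inv) (use inv assms(3-6) in simp_all)
    then show ?case using inv by simp
  qed
qed

end

subsection \<open>Functors that invert the weak equivalences\<close>

locale weq_inverting = weq_category M + cat_functor M D F
  for M :: "('o, 'm) model" (structure) and D :: "('p, 'n, 'z) cat_scheme"
    and F :: "('o, 'm, 'p, 'n) ftr" +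
  assumes F_iso: "w \<in> Weq M \<Longrightarrow> iso_arr D (farr F w)"
begin

lemma zz_eval_arr:
  assumes "zigzag M A us B"
  shows "zz_eval M D F A us \<in> Arr D \<and> Dom D (zz_eval M D F A us) = fobj F A \<and>
    Cod D (zz_eval M D F A us) = fobj F B"
  using assms by (induction us arbitrary: A) (auto simp: F_iso split: letter.splits)

lemma zz_eval_append:
  assumes "zigzag M A us X" "zigzag M X vs B"
  shows "zz_eval M D F A (us @ vs) = zz_eval M D F X vs \<cdot>\<^bsub>D\<^esub> zz_eval M D F A us"
  using assms by (induction us arbitrary: A) (auto simp: F_iso zz_eval_arr split: letter.splits)

lemma zz_eval_equiv:
  assumes "zz_equiv M A B us vs"
  shows "zz_eval M D F A us = zz_eval M D F A vs"
proof -
  \<comment> \<open>Each rewriting step replaces a short segment. This is the claim for the segment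
    alone; \<open>red\<close> puts it into a context by means of
    \<open>zz_eval_append\<close>.\<close>
  have base: "zz_eval M D F X xs = zz_eval M D F X ys \<and> zigzag M X xs Y = zigzag M X ys Y"
    if "zigzag M X xs Y" "zigzag M X ys Y"
      "(\<exists>Z. Z \<in> Obj M \<and> xs = [Fwd (Ide M Z)] \<and> ys = []) \<or> (\<exists>f g. xs = [Fwd f, Fwd g] \<and> ys = [Fwd (g \<cdot> f)])
        \<or> (\<exists>w. xs = [Fwd w, Bwd w] \<and> ys = []) \<or> (\<exists>w. xs = [Bwd w, Fwd w] \<and> ys = [])" for xs ys X Y
    using that by (auto simp: F_iso farr_Ide)
  have red: "zz_eval M D F A (us @ xs @ vs) = zz_eval M D F A (us @ ys @ vs)"
    if z: "zigzag M A (us @ xs @ vs) B" "zigzag M A (us @ ys @ vs) B"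
      and s: "(\<exists>Z. Z \<in> Obj M \<and> xs = [Fwd (Ide M Z)] \<and> ys = []) \<or> (\<exists>f g. xs = [Fwd f, Fwd g] \<and> ys = [Fwd (g \<cdot> f)])
        \<or> (\<exists>w. xs = [Fwd w, Bwd w] \<and> ys = []) \<or> (\<exists>w. xs = [Bwd w, Fwd w] \<and> ys = [])" for us xs ys vs
  proof -
    obtain X Y where 1: "zigzag M A us X" "zigzag M X xs Y" "zigzag M Y vs B"
      using z(1) by (auto simp: zigzag_append)
    have 2: "zigzag M X ys Y"
      using s 1(2) by auto
    have *: "zz_eval M D F A (us @ zs @ vs) =
      (zz_eval M D F Y vs \<cdot>\<^bsub>D\<^esub> zz_eval M D F X zs) \<cdot>\<^bsub>D\<^esub> zz_eval M D F A us" if "zigzag M X zs Y" for zs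
      using zz_eval_append[OF 1(1), of "zs @ vs" B] zz_eval_append[OF that 1(3)] zigzag_append that 1(3) by auto
    show ?thesis
      using base[OF 1(2) 2 s] *[OF 1(2)] *[OF 2] by metis
  qed
  have zz_eval_step: "zz_eval M D F A xs = zz_eval M D F A ys"
    if "zigzag M A xs B" "zigzag M A ys B" "zz_step M xs ys" for xs ys
    using that(3)
  proof (cases rule: zz_step.cases)
    case (zz_Ide Z us vs)
    then show ?thesis using red[of us "[Fwd (Ide M Z)]" vs "[]"] that by auto
  next
    case (zz_Comp us f g vs)
    then show ?thesis using red[of us "[Fwd f, Fwd g]" vs "[Fwd (g \<cdot> f)]"] that by auto
  next
    case (zz_Fwd_Bwd us w vs)
    then show ?thesis using red[of us "[Fwd w, Bwd w]" vs "[]"] that by auto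
  next
    case (zz_Bwd_Fwd us w vs)
    then show ?thesis using red[of us "[Bwd w, Fwd w]" vs "[]"] that by auto
  qed
  show ?thesis
    using assms
  proof (induction rule: zz_equiv_induct)
    case (step xs ys)
    then show ?case using zz_eval_step by metis
  qed simp
qed

lemma ho_ext_class:
  assumes "zigzag M A us B"
  shows "farr (ho_ext M D F) (ho_class M A us B) = zz_eval M D F A us"
  unfolding ho_ext_def ho_class_def
  using zz_eval_equiv zz_equiv_refl by (simp, intro the_equality) (blast, metis)

lemma ho_ext_functor: "cat_functor H D (ho_ext M D F)"
proof (rule cat_functorI)
  show "category H" "category D" by (fact category_Ho, fact tgt.category_axioms)
  show "fobj (ho_ext M D F) A \<in> Obj D" if "A \<in> Obj H" for A
    using that by (simp add: ho_ext_def)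
  show "farr (ho_ext M D F) f \<in> Arr D \<and> Dom D (farr (ho_ext M D F) f) = fobj (ho_ext M D F) (Dom H f)
    \<and> Cod D (farr (ho_ext M D F) f) = fobj (ho_ext M D F) (Cod H f)" if "f \<in> Arr H" for f
    using that by (auto simp: Arr_Ho ho_ext_class zz_eval_arr) (auto simp: ho_ext_def)
  show "farr (ho_ext M D F) (Ide H A) = Ide D (fobj (ho_ext M D F) A)" if "A \<in> Obj H" for A
    using that ho_ext_class[of A "[]" A] by (simp add: Ho_simps(4)) (simp add: ho_ext_def)
  show "farr (ho_ext M D F) (g \<bullet> f) = farr (ho_ext M D F) g \<cdot>\<^bsub>D\<^esub> farr (ho_ext M D F) f"
    if "f \<in> Arr H" "g \<in> Arr H" "Cod H f = Dom H g" for f g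
  proof -
    obtain A us B vs X where "f = ho_class M A us B" "zigzag M A us B" "g = ho_class M B vs X" "zigzag M B vs X"
      using \<open>f \<in> Arr H\<close> \<open>g \<in> Arr H\<close> \<open>Cod H f = Dom H g\<close> by (auto simp: Arr_Ho)
    moreover from this have "zigzag M A (us @ vs) X" using zigzag_append by blast
    ultimately show ?thesis by (simp add: Comp_Ho ho_ext_class zz_eval_append)
  qed
qed

lemma ho_ext_\<gamma>: "f \<in> Arr M \<Longrightarrow> farr (ho_ext M D F) (\<gamma> M f) = farr F f"
  unfolding \<gamma>_def using ho_ext_class[of "Dom M f" "[Fwd f]" "Cod M f"] by simp

end

subsection \<open>Derived functors of two variables\<close>

context weq_category
begin

lemma weq_invertingI:
  assumes "category D"
    and "\<And>A. A \<in> Obj M \<Longrightarrow> fobj F A \<in> Obj D"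
    and "\<And>f. f \<in> Arr M \<Longrightarrow> farr F f \<in> Arr D \<and> Dom D (farr F f) = fobj F (Dom M f)
           \<and> Cod D (farr F f) = fobj F (Cod M f)"
    and "\<And>A. A \<in> Obj M \<Longrightarrow> farr F (Ide M A) = Ide D (fobj F A)"
    and "\<And>f g. \<lbrakk>f \<in> Arr M; g \<in> Arr M; Cod M f = Dom M g\<rbrakk>
           \<Longrightarrow> farr F (g \<cdot> f) = farr F g \<cdot>\<^bsub>D\<^esub> farr F f"
    and "\<And>w. w \<in> Weq M \<Longrightarrow> iso_arr D (farr F w)"
  shows "weq_inverting M D F"
  using cat_functorI[OF category_axioms assms(1), of F] assms(2-6) weq_category_axioms
  by (simp add: weq_inverting_def weq_inverting_axioms_def)

text \<open>Interchange is given only for maps of \<open>M\<close>. With \<open>f\<close> in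
  \<open>M\<close> fixed, the maps \<open>F1 B (\<gamma> M f)\<close> are natural in
  \<open>B\<close> on \<open>M\<close>, hence on \<open>Ho M\<close>; then, with \<open>g\<close> in
  \<open>Ho M\<close> fixed, the same argument in the other variable frees \<open>f\<close>.\<close>

lemma ho_ext2_sections:
  assumes D: "category D"
    and S1: "\<And>B. B \<in> Obj M \<Longrightarrow> weq_inverting M D (sec1 M F B)"
    and S2: "\<And>A. A \<in> Obj M \<Longrightarrow> weq_inverting M D (sec2 M F A)"
    and inter: "\<And>f g. \<lbrakk>f \<in> Arr M; g \<in> Arr M\<rbrakk> \<Longrightarrow>
       farr F (f, Ide M (Cod M g)) \<cdot>\<^bsub>D\<^esub> farr F (Ide M (Dom M f), g) =
       farr F (Ide M (Cod M f), g) \<cdot>\<^bsub>D\<^esub> farr F (f, Ide M (Dom M g))"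
  shows "cat_functor (prod_cat H H) D (ho_ext2 M D F)"
    and "\<And>f g. \<lbrakk>f \<in> Arr M; g \<in> Arr M\<rbrakk> \<Longrightarrow> farr (ho_ext2 M D F) (\<gamma> M f, \<gamma> M g) =
       farr F (f, Ide M (Cod M g)) \<cdot>\<^bsub>D\<^esub> farr F (Ide M (Dom M f), g)"
proof -
  define F1 where "F1 B = farr (ho_ext M D (sec1 M F B))" for B
  define F2 where "F2 A = farr (ho_ext M D (sec2 M F A))" for A
  have f1: "cat_functor H D \<lparr>fobj = (\<lambda>A. fobj F (A, B)), farr = F1 B\<rparr>" if "B \<in> Obj M" for B
    using weq_inverting.ho_ext_functor[OF S1[OF that]]
    by (simp add: F1_def ho_ext_def sec1_def)
  have f2: "cat_functor H D \<lparr>fobj = (\<lambda>B. fobj F (A, B)), farr = F2 A\<rparr>" if "A \<in> Obj M" for A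
    using weq_inverting.ho_ext_functor[OF S2[OF that]]
    by (simp add: F2_def ho_ext_def sec2_def)
  have g1: "F1 B (\<gamma> M f) = farr F (f, Ide M B)" if "f \<in> Arr M" "B \<in> Obj M" for f B
    using weq_inverting.ho_ext_\<gamma>[OF S1[OF that(2)] that(1)] by (simp add: F1_def sec1_def)
  have g2: "F2 A (\<gamma> M f) = farr F (Ide M A, f)" if "f \<in> Arr M" "A \<in> Obj M" for f A
    using weq_inverting.ho_ext_\<gamma>[OF S2[OF that(2)] that(1)] by (simp add: F2_def sec2_def)
  have F1a: "F1 B f \<in> Arr D" "Dom D (F1 B f) = fobj F (Dom H f, B)" "Cod D (F1 B f) = fobj F (Cod H f, B)"
    if "B \<in> Obj M" "f \<in> Arr H" for B f
    using cat_functor.farr_arr[OF f1[OF that(1)] that(2)] by auto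
  have F2a: "F2 A f \<in> Arr D" "Dom D (F2 A f) = fobj F (A, Dom H f)" "Cod D (F2 A f) = fobj F (A, Cod H f)"
    if "A \<in> Obj M" "f \<in> Arr H" for A f
    using cat_functor.farr_arr[OF f2[OF that(1)] that(2)] by auto
  have [simp]: "f \<in> Arr H \<Longrightarrow> Dom H f \<in> Obj M" "f \<in> Arr H \<Longrightarrow> Cod H f \<in> Obj M" for f
    using H.Dom_Obj H.Cod_Obj by auto
  have 0: "F1 (Cod M g) (\<gamma> M f) \<cdot>\<^bsub>D\<^esub> F2 (Dom M f) (\<gamma> M g) = F2 (Cod M f) (\<gamma> M g) \<cdot>\<^bsub>D\<^esub> F1 (Dom M g) (\<gamma> M f)"
    if "f \<in> Arr M" "g \<in> Arr M" for f g
    using inter[OF that] that by (simp add: g1 g2)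
  have 1: "F1 (Cod H g) (\<gamma> M f) \<cdot>\<^bsub>D\<^esub> F2 (Dom M f) g = F2 (Cod M f) g \<cdot>\<^bsub>D\<^esub> F1 (Dom H g) (\<gamma> M f)"
    if "f \<in> Arr M" "g \<in> Arr H" for f g
    using ho_natural[OF f2[of "Dom M f"] f2[of "Cod M f"], of "\<lambda>B. F1 B (\<gamma> M f)" g] that F1a 0 by simp
  have 2: "F1 (Cod H g) f \<cdot>\<^bsub>D\<^esub> F2 (Dom H f) g = F2 (Cod H f) g \<cdot>\<^bsub>D\<^esub> F1 (Dom H g) f"
    if "f \<in> Arr H" "g \<in> Arr H" for f g
    using ho_natural[OF f1[of "Dom H g"] f1[of "Cod H g"], of "\<lambda>A. F2 A g" f] that F2a 1 by simp
  show "cat_functor (prod_cat H H) D (ho_ext2 M D F)"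
    using bifunctor_from_sections[OF category_Ho category_Ho D, of "fobj F" F1 F2] f1 f2 2
    by (simp add: ho_ext2_def F1_def F2_def)
  show "farr (ho_ext2 M D F) (\<gamma> M f, \<gamma> M g) =
       farr F (f, Ide M (Cod M g)) \<cdot>\<^bsub>D\<^esub> farr F (Ide M (Dom M f), g)" if "f \<in> Arr M" "g \<in> Arr M" for f g
    using that g1[of f "Cod M g"] g2[of g "Dom M f"] by (simp add: ho_ext2_def F1_def F2_def)
qed

text \<open>Contravariance puts \<open>F1\<close> into \<open>op_cat D\<close> and swaps domain and
  codomain of \<open>f\<close> in the interchange law. The two-stage extension is that of
  \<open>ho_ext2_sections\<close>.\<close>

lemma ho_ext2_op_sections:
  assumes D: "category D"
    and S1: "\<And>B. B \<in> Obj M \<Longrightarrow> weq_inverting M (op_cat D) (sec1 M F B)"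
    and S2: "\<And>A. A \<in> Obj M \<Longrightarrow> weq_inverting M D (sec2 M F A)"
    and inter: "\<And>f g. \<lbrakk>f \<in> Arr M; g \<in> Arr M\<rbrakk> \<Longrightarrow>
       farr F (f, Ide M (Cod M g)) \<cdot>\<^bsub>D\<^esub> farr F (Ide M (Cod M f), g) =
       farr F (Ide M (Dom M f), g) \<cdot>\<^bsub>D\<^esub> farr F (f, Ide M (Dom M g))"
  shows "cat_functor (prod_cat (op_cat H) H) D (ho_ext2_op M D F)"
    and "\<And>f g. \<lbrakk>f \<in> Arr M; g \<in> Arr M\<rbrakk> \<Longrightarrow> farr (ho_ext2_op M D F) (\<gamma> M f, \<gamma> M g) =
       farr F (f, Ide M (Cod M g)) \<cdot>\<^bsub>D\<^esub> farr F (Ide M (Cod M f), g)"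
proof -
  define F1 where "F1 B = farr (ho_ext M (op_cat D) (sec1 M F B))" for B
  define F2 where "F2 A = farr (ho_ext M D (sec2 M F A))" for A
  have f1: "cat_functor H (op_cat D) \<lparr>fobj = (\<lambda>A. fobj F (A, B)), farr = F1 B\<rparr>" if "B \<in> Obj M" for B
    using weq_inverting.ho_ext_functor[OF S1[OF that]]
    by (simp add: F1_def ho_ext_def sec1_def)
  have f2: "cat_functor H D \<lparr>fobj = (\<lambda>B. fobj F (A, B)), farr = F2 A\<rparr>" if "A \<in> Obj M" for A
    using weq_inverting.ho_ext_functor[OF S2[OF that]]
    by (simp add: F2_def ho_ext_def sec2_def)
  have g1: "F1 B (\<gamma> M f) = farr F (f, Ide M B)" if "f \<in> Arr M" "B \<in> Obj M" for f B
    using weq_inverting.ho_ext_\<gamma>[OF S1[OF that(2)] that(1)] by (simp add: F1_def sec1_def)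
  have g2: "F2 A (\<gamma> M f) = farr F (Ide M A, f)" if "f \<in> Arr M" "A \<in> Obj M" for f A
    using weq_inverting.ho_ext_\<gamma>[OF S2[OF that(2)] that(1)] by (simp add: F2_def sec2_def)
  have F1a: "F1 B f \<in> Arr D" "Dom D (F1 B f) = fobj F (Cod H f, B)" "Cod D (F1 B f) = fobj F (Dom H f, B)"
    if "B \<in> Obj M" "f \<in> Arr H" for B f
    using cat_functor.farr_arr[OF f1[OF that(1)] that(2)] by auto
  have F2a: "F2 A f \<in> Arr D" "Dom D (F2 A f) = fobj F (A, Dom H f)" "Cod D (F2 A f) = fobj F (A, Cod H f)"
    if "A \<in> Obj M" "f \<in> Arr H" for A f
    using cat_functor.farr_arr[OF f2[OF that(1)] that(2)] by auto
  have [simp]: "f \<in> Arr H \<Longrightarrow> Dom H f \<in> Obj M" "f \<in> Arr H \<Longrightarrow> Cod H f \<in> Obj M" for f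
    using H.Dom_Obj H.Cod_Obj by auto
  have 0: "F1 (Cod M g) (\<gamma> M f) \<cdot>\<^bsub>D\<^esub> F2 (Cod M f) (\<gamma> M g) = F2 (Dom M f) (\<gamma> M g) \<cdot>\<^bsub>D\<^esub> F1 (Dom M g) (\<gamma> M f)"
    if "f \<in> Arr M" "g \<in> Arr M" for f g
    using inter[OF that] that by (simp add: g1 g2)
  have 1: "F1 (Cod H g) (\<gamma> M f) \<cdot>\<^bsub>D\<^esub> F2 (Cod M f) g = F2 (Dom M f) g \<cdot>\<^bsub>D\<^esub> F1 (Dom H g) (\<gamma> M f)"
    if "f \<in> Arr M" "g \<in> Arr H" for f g
    using ho_natural[OF f2[of "Cod M f"] f2[of "Dom M f"], of "\<lambda>B. F1 B (\<gamma> M f)" g] that F1a 0 by simp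
  have 2: "F1 (Cod H g) f \<cdot>\<^bsub>D\<^esub> F2 (Cod H f) g = F2 (Dom H f) g \<cdot>\<^bsub>D\<^esub> F1 (Dom H g) f"
    if "f \<in> Arr H" "g \<in> Arr H" for f g
    using ho_natural[OF f1[of "Cod H g"] f1[of "Dom H g"], of "\<lambda>A. F2 A g" f] that F2a 1 by simp
  show "cat_functor (prod_cat (op_cat H) H) D (ho_ext2_op M D F)"
    using bifunctor_from_sections[OF category_op_cat[OF category_Ho] category_Ho D, of "fobj F" F1 F2]
      cat_functor_op_cat[OF category_Ho f1 D] f2 2
    by (simp add: ho_ext2_op_def F1_def F2_def)
  show "farr (ho_ext2_op M D F) (\<gamma> M f, \<gamma> M g) =
       farr F (f, Ide M (Cod M g)) \<cdot>\<^bsub>D\<^esub> farr F (Ide M (Cod M f), g)" if "f \<in> Arr M" "g \<in> Arr M" for f g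
    using that g1[of f "Cod M g"] g2[of g "Cod M f"] by (simp add: ho_ext2_op_def F1_def F2_def)
qed

end

section \<open>Skew closed structures from skew monoidal ones\<close>

context skew_monoidal
begin

sublocale tensor: cat_functor "prod_cat C C" C "tensor T"
  by (rule tensor_functor)

lemma tobj_Obj [simp]: "\<lbrakk>X \<in> Obj C; Y \<in> Obj C\<rbrakk> \<Longrightarrow> X \<otimes> Y \<in> Obj C"
  using tensor.fobj_Obj[of "(X, Y)"] by simp

lemma tarr_arr [simp]:
  assumes "f \<in> Arr C" "g \<in> Arr C"
  shows "f \<otimes>\<^sub>m g \<in> Arr C" "Dom C (f \<otimes>\<^sub>m g) = Dom C f \<otimes> Dom C g" "Cod C (f \<otimes>\<^sub>m g) = Cod C f \<otimes> Cod C g"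
  using tensor.farr_arr[of "(f, g)"] assms by auto

lemma tarr_Ide [simp]: "\<lbrakk>X \<in> Obj C; Y \<in> Obj C\<rbrakk> \<Longrightarrow> Ide C X \<otimes>\<^sub>m Ide C Y = Ide C (X \<otimes> Y)"
  using tensor.farr_Ide[of "(X, Y)"] by simp

lemma tarr_Comp [simp]:
  "\<lbrakk>f \<in> Arr C; g \<in> Arr C; f' \<in> Arr C; g' \<in> Arr C; Cod C f = Dom C f'; Cod C g = Dom C g'\<rbrakk>
   \<Longrightarrow> (f' \<otimes>\<^sub>m g') \<cdot> (f \<otimes>\<^sub>m g) = (f' \<cdot> f) \<otimes>\<^sub>m (g' \<cdot> g)"
  using tensor.farr_Comp'[of "(f, g)" "(f', g')"] by simp

lemma tarr_Comp' [simp]: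
  "\<lbrakk>f \<in> Arr C; g \<in> Arr C; f' \<in> Arr C; g' \<in> Arr C; Cod C f = Dom C f'; Cod C g = Dom C g';
    x \<in> Arr C; Cod C x = Dom C f \<otimes> Dom C g\<rbrakk>
   \<Longrightarrow> (f' \<otimes>\<^sub>m g') \<cdot> ((f \<otimes>\<^sub>m g) \<cdot> x) = ((f' \<cdot> f) \<otimes>\<^sub>m (g' \<cdot> g)) \<cdot> x"
  using rewr[OF tarr_Comp[of f g f' g'], of x] by simp

lemma tunit_Obj [simp]: "tunit T \<in> Obj C"
  by (rule tunit_in)

lemma asc_arr [simp]:
  assumes "X \<in> Obj C" "Y \<in> Obj C" "Z \<in> Obj C"
  shows "\<alpha> X Y Z \<in> Arr C" "Dom C (\<alpha> X Y Z) = (X \<otimes> Y) \<otimes> Z" "Cod C (\<alpha> X Y Z) = X \<otimes> (Y \<otimes> Z)"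
  using in_HomD[OF asc_in[OF assms]] by auto

lemma lun_arr [simp]:
  assumes "X \<in> Obj C"
  shows "l X \<in> Arr C" "Dom C (l X) = tunit T \<otimes> X" "Cod C (l X) = X"
  using in_HomD[OF lun_in[OF assms]] by auto

lemma run_arr [simp]:
  assumes "X \<in> Obj C"
  shows "r X \<in> Arr C" "Dom C (r X) = X" "Cod C (r X) = X \<otimes> tunit T"
  using in_HomD[OF run_in[OF assms]] by auto

lemma asc_nat:
  "\<lbrakk>f \<in> Arr C; g \<in> Arr C; h \<in> Arr C; X = Cod C f; Y = Cod C g; Z = Cod C h\<rbrakk>
   \<Longrightarrow> \<alpha> X Y Z \<cdot> ((f \<otimes>\<^sub>m g) \<otimes>\<^sub>m h) = (f \<otimes>\<^sub>m (g \<otimes>\<^sub>m h)) \<cdot> \<alpha> (Dom C f) (Dom C g) (Dom C h)"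
  using asc_natural[OF Arr_HomI Arr_HomI Arr_HomI, of f g h] by simp

lemma lun_nat: "\<lbrakk>f \<in> Arr C; X = Cod C f\<rbrakk> \<Longrightarrow> l X \<cdot> (Ide C (tunit T) \<otimes>\<^sub>m f) = f \<cdot> l (Dom C f)"
  using lun_natural[OF Arr_HomI, of f] by simp

lemma run_nat: "\<lbrakk>f \<in> Arr C; X = Cod C f\<rbrakk> \<Longrightarrow> r X \<cdot> f = (f \<otimes>\<^sub>m Ide C (tunit T)) \<cdot> r (Dom C f)"
  using run_natural[OF Arr_HomI, of f] by simp

end

text \<open>Split off from \<open>skew_closed\<close> so that the calculus of the internal hom is
  available for the derived structure before \<open>C1\<close> to \<open>C5\<close> are
  known.\<close>

locale hom_functor = clo_notation C S + category C
  for C :: "('o, 'm, 'z) cat_scheme" (structure) and S :: "('o, 'm) skew_clo" +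
  assumes hom_functor: "cat_functor (prod_cat (op_cat C) C) C (ihom S)"
begin

sublocale ihom: cat_functor "prod_cat (op_cat C) C" C "ihom S"
  by (rule hom_functor)

lemma hobj_Obj [simp]: "\<lbrakk>X \<in> Obj C; Y \<in> Obj C\<rbrakk> \<Longrightarrow> \<lbrakk>X, Y\<rbrakk> \<in> Obj C"
  using ihom.fobj_Obj[of "(X, Y)"] by simp

lemma harr_arr [simp]:
  assumes "f \<in> Arr C" "g \<in> Arr C"
  shows "\<lbrakk>f, g\<rbrakk>\<^sub>m \<in> Arr C" "Dom C \<lbrakk>f, g\<rbrakk>\<^sub>m = \<lbrakk>Cod C f, Dom C g\<rbrakk>" "Cod C \<lbrakk>f, g\<rbrakk>\<^sub>m = \<lbrakk>Dom C f, Cod C g\<rbrakk>"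
  using ihom.farr_arr[of "(f, g)"] assms by auto

lemma harr_Ide [simp]: "\<lbrakk>X \<in> Obj C; Y \<in> Obj C\<rbrakk> \<Longrightarrow> \<lbrakk>Ide C X, Ide C Y\<rbrakk>\<^sub>m = Ide C \<lbrakk>X, Y\<rbrakk>"
  using ihom.farr_Ide[of "(X, Y)"] by simp

lemma harr_Comp [simp]:
  "\<lbrakk>f \<in> Arr C; g \<in> Arr C; f' \<in> Arr C; g' \<in> Arr C; Cod C f' = Dom C f; Cod C g = Dom C g'\<rbrakk>
   \<Longrightarrow> \<lbrakk>f', g'\<rbrakk>\<^sub>m \<cdot> \<lbrakk>f, g\<rbrakk>\<^sub>m = \<lbrakk>f \<cdot> f', g' \<cdot> g\<rbrakk>\<^sub>m"
  using ihom.farr_Comp'[of "(f, g)" "(f', g')"] by simp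

lemma harr_Comp' [simp]:
  "\<lbrakk>f \<in> Arr C; g \<in> Arr C; f' \<in> Arr C; g' \<in> Arr C; Cod C f' = Dom C f; Cod C g = Dom C g';
    x \<in> Arr C; Cod C x = \<lbrakk>Cod C f, Dom C g\<rbrakk>\<rbrakk>
   \<Longrightarrow> \<lbrakk>f', g'\<rbrakk>\<^sub>m \<cdot> (\<lbrakk>f, g\<rbrakk>\<^sub>m \<cdot> x) = \<lbrakk>f \<cdot> f', g' \<cdot> g\<rbrakk>\<^sub>m \<cdot> x"
  using rewr[OF harr_Comp[of f g f' g'], of x] by simp

end

text \<open>Everything in a monoidal skew closed category except the axioms of the skew closed structure
  other than the naturality of \<open>L\<close> in its first lower argument.\<close>

locale tensor_hom_adjunction = skew_monoidal C T + hom_functor C S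
  for C :: "('o, 'm, 'z) cat_scheme" (structure)
    and T :: "('o, 'm) skew_mon" and S :: "('o, 'm) skew_clo" +
  fixes \<phi> :: "'o \<Rightarrow> 'o \<Rightarrow> 'o \<Rightarrow> 'm \<Rightarrow> 'm"
  assumes unit_eq: "tunit T = cunit S"
    and Lc_in: "\<lbrakk>X \<in> Obj C; Y \<in> Obj C; Z \<in> Obj C\<rbrakk>
      \<Longrightarrow> L X Y Z \<in> Hom C \<lbrakk>Y, Z\<rbrakk> \<lbrakk>\<lbrakk>X, Y\<rbrakk>, \<lbrakk>X, Z\<rbrakk>\<rbrakk>"
    and ic_in: "X \<in> Obj C \<Longrightarrow> i X \<in> Hom C \<lbrakk>cunit S, X\<rbrakk> X"
    and jc_in: "X \<in> Obj C \<Longrightarrow> j X \<in> Hom C (cunit S) \<lbrakk>X, X\<rbrakk>"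
    and Lc_natural1: "\<lbrakk>X \<in> Obj C; g \<in> Hom C Y' Y; Z \<in> Obj C\<rbrakk>
      \<Longrightarrow> \<lbrakk>\<lbrakk>Ide C X, g\<rbrakk>\<^sub>m, Ide C \<lbrakk>X, Z\<rbrakk>\<rbrakk>\<^sub>m \<cdot> L X Y Z = L X Y' Z \<cdot> \<lbrakk>g, Ide C Z\<rbrakk>\<^sub>m"
    and \<phi>_bij: "\<lbrakk>X \<in> Obj C; Y \<in> Obj C; Z \<in> Obj C\<rbrakk>
      \<Longrightarrow> bij_betw (\<phi> X Y Z) (Hom C (X \<otimes> Y) Z) (Hom C X \<lbrakk>Y, Z\<rbrakk>)"
    and \<phi>_natural: "\<lbrakk>a \<in> Hom C X' X; b \<in> Hom C Y' Y; c \<in> Hom C Z Z'; f \<in> Hom C (X \<otimes> Y) Z\<rbrakk>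
      \<Longrightarrow> \<phi> X' Y' Z' (c \<cdot> f \<cdot> (a \<otimes>\<^sub>m b)) = \<lbrakk>b, c\<rbrakk>\<^sub>m \<cdot> \<phi> X Y Z f \<cdot> a"
    and \<phi>_lun: "f \<in> Hom C X Y
      \<Longrightarrow> \<phi> (tunit T) X Y (f \<cdot> l X) = \<lbrakk>Ide C X, f\<rbrakk>\<^sub>m \<cdot> j X"
    and \<phi>_run: "\<lbrakk>X \<in> Obj C; Y \<in> Obj C; g \<in> Hom C (X \<otimes> tunit T) Y\<rbrakk>
      \<Longrightarrow> g \<cdot> r X = i Y \<cdot> \<phi> X (tunit T) Y g"
    and \<phi>_asc: "\<lbrakk>X \<in> Obj C; Y \<in> Obj C; Z \<in> Obj C; W \<in> Obj C; h \<in> Hom C (X \<otimes> (Y \<otimes> Z)) W\<rbrakk>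
      \<Longrightarrow> \<phi> X Y \<lbrakk>Z, W\<rbrakk> (\<phi> (X \<otimes> Y) Z W (h \<cdot> \<alpha> X Y Z))
          = \<lbrakk>\<phi> Y Z (Y \<otimes> Z) (Ide C (Y \<otimes> Z)), Ide C \<lbrakk>Z, W\<rbrakk>\<rbrakk>\<^sub>m \<cdot> L Z (Y \<otimes> Z) W \<cdot> \<phi> X (Y \<otimes> Z) W h"
begin

section \<open>Transposition and evaluation\<close>

lemma \<phi>_arr [simp]:
  assumes "X \<in> Obj C" "Y \<in> Obj C" "f \<in> Arr C" "Dom C f = X \<otimes> Y" "Z = Cod C f"
  shows "\<phi> X Y Z f \<in> Arr C" "Dom C (\<phi> X Y Z f) = X" "Cod C (\<phi> X Y Z f) = \<lbrakk>Y, Z\<rbrakk>"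
proof -
  have "f \<in> Hom C (X \<otimes> Y) Z" using assms by (simp add: Hom_def)
  then have "\<phi> X Y Z f \<in> Hom C X \<lbrakk>Y, Z\<rbrakk>"
    using \<phi>_bij[of X Y Z] assms by (auto simp: bij_betw_def)
  then show "\<phi> X Y Z f \<in> Arr C" "Dom C (\<phi> X Y Z f) = X" "Cod C (\<phi> X Y Z f) = \<lbrakk>Y, Z\<rbrakk>"
    by (auto simp: Hom_def)
qed

lemma \<phi>_pre1:
  "\<lbrakk>X \<in> Obj C; Y \<in> Obj C; f \<in> Arr C; Dom C f = X \<otimes> Y; Z = Cod C f; a \<in> Arr C; Cod C a = X; X' = Dom C a\<rbrakk>
   \<Longrightarrow> \<phi> X' Y Z (f \<cdot> (a \<otimes>\<^sub>m Ide C Y)) = \<phi> X Y Z f \<cdot> a"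
  using \<phi>_natural[of a X' X "Ide C Y" Y Y "Ide C Z" Z Z f] by (simp add: Hom_def)

lemma \<phi>_pre2:
  "\<lbrakk>X \<in> Obj C; Y \<in> Obj C; f \<in> Arr C; Dom C f = X \<otimes> Y; Z = Cod C f; b \<in> Arr C; Cod C b = Y; Y' = Dom C b\<rbrakk>
   \<Longrightarrow> \<phi> X Y' Z (f \<cdot> (Ide C X \<otimes>\<^sub>m b)) = \<lbrakk>b, Ide C Z\<rbrakk>\<^sub>m \<cdot> \<phi> X Y Z f"
  using \<phi>_natural[of "Ide C X" X X b Y' Y "Ide C Z" Z Z f] by (simp add: Hom_def)

lemma \<phi>_post:
  "\<lbrakk>X \<in> Obj C; Y \<in> Obj C; f \<in> Arr C; Dom C f = X \<otimes> Y; Z = Cod C f; c \<in> Arr C; Dom C c = Z; Z' = Cod C c\<rbrakk>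
   \<Longrightarrow> \<phi> X Y Z' (c \<cdot> f) = \<lbrakk>Ide C Y, c\<rbrakk>\<^sub>m \<cdot> \<phi> X Y Z f"
  using \<phi>_natural[of "Ide C X" X X "Ide C Y" Y Y c Z Z' f] by (simp add: Hom_def)

text \<open>The counit of the adjunction, as the preimage of an identity under
  \<open>\<phi>\<close>.\<close>

definition ev where "ev Y Z = inv_into (Hom C (\<lbrakk>Y, Z\<rbrakk> \<otimes> Y) Z) (\<phi> \<lbrakk>Y, Z\<rbrakk> Y Z) (Ide C \<lbrakk>Y, Z\<rbrakk>)"

lemma ev [simp]:
  assumes "Y \<in> Obj C" "Z \<in> Obj C"
  shows "ev Y Z \<in> Arr C" "Dom C (ev Y Z) = \<lbrakk>Y, Z\<rbrakk> \<otimes> Y" "Cod C (ev Y Z) = Z"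
    "\<phi> \<lbrakk>Y, Z\<rbrakk> Y Z (ev Y Z) = Ide C \<lbrakk>Y, Z\<rbrakk>"
proof -
  have 1: "Ide C \<lbrakk>Y, Z\<rbrakk> \<in> \<phi> \<lbrakk>Y, Z\<rbrakk> Y Z ` Hom C (\<lbrakk>Y, Z\<rbrakk> \<otimes> Y) Z"
    using \<phi>_bij[of "\<lbrakk>Y, Z\<rbrakk>" Y Z] assms Ide_in[of "\<lbrakk>Y, Z\<rbrakk>"] by (simp add: bij_betw_def)
  show "ev Y Z \<in> Arr C" "Dom C (ev Y Z) = \<lbrakk>Y, Z\<rbrakk> \<otimes> Y" "Cod C (ev Y Z) = Z"
    using inv_into_into[OF 1] unfolding ev_def Hom_def by auto
  show "\<phi> \<lbrakk>Y, Z\<rbrakk> Y Z (ev Y Z) = Ide C \<lbrakk>Y, Z\<rbrakk>"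
    using f_inv_into_f[OF 1] unfolding ev_def .
qed

text \<open>The inverse of \<open>\<phi>\<close>. Written through \<open>ev\<close> rather than as
  an inverse on sets, its naturality in \<open>g\<close> is bifunctoriality of the tensor
  product.\<close>

definition un where "un Y Z g = ev Y Z \<cdot> (g \<otimes>\<^sub>m Ide C Y)"

lemma un [simp]:
  assumes "Y \<in> Obj C" "Z \<in> Obj C" "g \<in> Arr C" "Cod C g = \<lbrakk>Y, Z\<rbrakk>"
  shows "un Y Z g \<in> Arr C" "Dom C (un Y Z g) = Dom C g \<otimes> Y" "Cod C (un Y Z g) = Z"
    "X = Dom C g \<Longrightarrow> \<phi> X Y Z (un Y Z g) = g"
  using assms \<phi>_pre1[of "\<lbrakk>Y, Z\<rbrakk>" Y "ev Y Z" Z g] by (simp_all add: un_def)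

lemma un_\<phi> [simp]:
  assumes "X \<in> Obj C" "Y \<in> Obj C" "f \<in> Arr C" "Dom C f = X \<otimes> Y" "Z = Cod C f"
  shows "un Y Z (\<phi> X Y Z f) = f"
proof -
  have "inj_on (\<phi> X Y Z) (Hom C (X \<otimes> Y) Z)"
    using \<phi>_bij[of X Y Z] assms by (simp add: bij_betw_def)
  moreover have "f \<in> Hom C (X \<otimes> Y) Z" "un Y Z (\<phi> X Y Z f) \<in> Hom C (X \<otimes> Y) Z"
    using assms by (simp_all add: Hom_def)
  moreover have "\<phi> X Y Z (un Y Z (\<phi> X Y Z f)) = \<phi> X Y Z f"
    using assms by simp
  ultimately show ?thesis by (meson inj_onD)
qed

lemma un_Ide: "\<lbrakk>Y \<in> Obj C; Z \<in> Obj C\<rbrakk> \<Longrightarrow> un Y Z (Ide C \<lbrakk>Y, Z\<rbrakk>) = ev Y Z"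
  by (simp add: un_def)

lemma un_harr:
  assumes "Y \<in> Obj C" "h \<in> Arr C"
  shows "un Y (Cod C h) \<lbrakk>Ide C Y, h\<rbrakk>\<^sub>m = h \<cdot> ev Y (Dom C h)"
    "Z \<in> Obj C \<Longrightarrow> un (Dom C h) Z \<lbrakk>h, Ide C Z\<rbrakk>\<^sub>m = ev (Cod C h) Z \<cdot> (Ide C \<lbrakk>Cod C h, Z\<rbrakk> \<otimes>\<^sub>m h)"
proof -
  have "\<phi> \<lbrakk>Y, Dom C h\<rbrakk> Y (Cod C h) (h \<cdot> ev Y (Dom C h)) = \<lbrakk>Ide C Y, h\<rbrakk>\<^sub>m"
    using assms \<phi>_post[of "\<lbrakk>Y, Dom C h\<rbrakk>" Y "ev Y (Dom C h)" "Dom C h" h "Cod C h"] by simp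
  then show "un Y (Cod C h) \<lbrakk>Ide C Y, h\<rbrakk>\<^sub>m = h \<cdot> ev Y (Dom C h)"
    using assms un_\<phi>[of "\<lbrakk>Y, Dom C h\<rbrakk>" Y "h \<cdot> ev Y (Dom C h)" "Cod C h"] by simp
  assume Z: "Z \<in> Obj C"
  have "\<phi> \<lbrakk>Cod C h, Z\<rbrakk> (Dom C h) Z (ev (Cod C h) Z \<cdot> (Ide C \<lbrakk>Cod C h, Z\<rbrakk> \<otimes>\<^sub>m h)) = \<lbrakk>h, Ide C Z\<rbrakk>\<^sub>m"
    using assms Z \<phi>_pre2[of "\<lbrakk>Cod C h, Z\<rbrakk>" "Cod C h" "ev (Cod C h) Z" Z h "Dom C h"] by simp
  then show "un (Dom C h) Z \<lbrakk>h, Ide C Z\<rbrakk>\<^sub>m = ev (Cod C h) Z \<cdot> (Ide C \<lbrakk>Cod C h, Z\<rbrakk> \<otimes>\<^sub>m h)"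
    using assms Z un_\<phi>[of "\<lbrakk>Cod C h, Z\<rbrakk>" "Dom C h" "ev (Cod C h) Z \<cdot> (Ide C \<lbrakk>Cod C h, Z\<rbrakk> \<otimes>\<^sub>m h)" Z] by simp
qed

section \<open>The closed structure maps as mates of the monoidal ones\<close>

lemma cunit_Obj [simp]: "cunit S \<in> Obj C"
  using unit_eq tunit_Obj by simp

lemma Lc_arr [simp]:
  assumes "X \<in> Obj C" "Y \<in> Obj C" "Z \<in> Obj C"
  shows "L X Y Z \<in> Arr C" "Dom C (L X Y Z) = \<lbrakk>Y, Z\<rbrakk>" "Cod C (L X Y Z) = \<lbrakk>\<lbrakk>X, Y\<rbrakk>, \<lbrakk>X, Z\<rbrakk>\<rbrakk>"
  using in_HomD[OF Lc_in[OF assms]] by auto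

lemma ic_arr [simp]:
  assumes "X \<in> Obj C"
  shows "i X \<in> Arr C" "Dom C (i X) = \<lbrakk>cunit S, X\<rbrakk>" "Cod C (i X) = X"
  using in_HomD[OF ic_in[OF assms]] by auto

lemma jc_arr [simp]:
  assumes "X \<in> Obj C"
  shows "j X \<in> Arr C" "Dom C (j X) = cunit S" "Cod C (j X) = \<lbrakk>X, X\<rbrakk>"
  using in_HomD[OF jc_in[OF assms]] by auto

text \<open>In terms of elements, \<open>L x y z = x (y z)\<close>.\<close>

lemma L_eq:
  assumes x: "x \<in> Arr C" "Cod C x = \<lbrakk>Y, W\<rbrakk>" and y: "y \<in> Arr C" "Cod C y = \<lbrakk>Z, Y\<rbrakk>"
    and o: "Y \<in> Obj C" "W \<in> Obj C" "Z \<in> Obj C" and X: "X = Dom C x" "V = Dom C y"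
  shows "\<lbrakk>y, Ide C \<lbrakk>Z, W\<rbrakk>\<rbrakk>\<^sub>m \<cdot> L Z Y W \<cdot> x =
    \<phi> X V \<lbrakk>Z, W\<rbrakk> (\<phi> (X \<otimes> V) Z W (un Y W x \<cdot> (Ide C X \<otimes>\<^sub>m un Z Y y) \<cdot> \<alpha> X V Z))"
proof -
  have XV [simp]: "X \<in> Obj C" "V \<in> Obj C" using x y X by auto
  note t [simp] = x y o X[symmetric]
  let ?h = "un Y W x \<cdot> (Ide C X \<otimes>\<^sub>m un Z Y y)" and ?u = "\<phi> V Z (V \<otimes> Z) (Ide C (V \<otimes> Z))"
  \<comment> \<open>Here \<open>\<phi>_asc\<close> produces \<open>L\<close> at the lower argument
    \<open>V \<otimes> Z\<close>, restricted along the unit \<open>?u\<close>.\<close>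
  have "\<phi> X V \<lbrakk>Z, W\<rbrakk> (\<phi> (X \<otimes> V) Z W (un Y W x \<cdot> (Ide C X \<otimes>\<^sub>m un Z Y y) \<cdot> \<alpha> X V Z)) =
    \<lbrakk>?u, Ide C \<lbrakk>Z, W\<rbrakk>\<rbrakk>\<^sub>m \<cdot> L Z (V \<otimes> Z) W \<cdot> \<phi> X (V \<otimes> Z) W ?h"
    using \<phi>_asc[of X V Z W ?h] by (simp add: Hom_def)
  also have "\<phi> X (V \<otimes> Z) W ?h = \<lbrakk>un Z Y y, Ide C W\<rbrakk>\<^sub>m \<cdot> x"
    using \<phi>_pre2[of X Y "un Y W x" W "un Z Y y" "V \<otimes> Z"] by simp
  \<comment> \<open>Naturality of \<open>L\<close> along \<open>un Z Y y\<close>, a map from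
    \<open>V \<otimes> Z\<close> to \<open>Y\<close>, moves the lower argument to \<open>Y\<close>.
    Its image under the hom then meets \<open>?u\<close>, and the two compose to
    \<open>y\<close>.\<close>
  also have "L Z (V \<otimes> Z) W \<cdot> \<lbrakk>un Z Y y, Ide C W\<rbrakk>\<^sub>m \<cdot> x = \<lbrakk>\<lbrakk>Ide C Z, un Z Y y\<rbrakk>\<^sub>m, Ide C \<lbrakk>Z, W\<rbrakk>\<rbrakk>\<^sub>m \<cdot> L Z Y W \<cdot> x"
    using rewr2[OF Lc_natural1[of Z "un Z Y y" "V \<otimes> Z" Y W], of x] by (simp add: Hom_def)
  also have "\<lbrakk>?u, Ide C \<lbrakk>Z, W\<rbrakk>\<rbrakk>\<^sub>m \<cdot> \<dots> = \<lbrakk>\<lbrakk>Ide C Z, un Z Y y\<rbrakk>\<^sub>m \<cdot> ?u, Ide C \<lbrakk>Z, W\<rbrakk>\<rbrakk>\<^sub>m \<cdot> L Z Y W \<cdot> x"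
    by simp
  also have "\<lbrakk>Ide C Z, un Z Y y\<rbrakk>\<^sub>m \<cdot> ?u = y"
    using \<phi>_post[of V Z "Ide C (V \<otimes> Z)" "V \<otimes> Z" "un Z Y y" Y] by simp
  finally show ?thesis by simp
qed

text \<open>Evaluates two composable internal maps in succession. Its transpose is internal
  composition; the second transpose is \<open>L\<close>.\<close>

abbreviation pair_ev where
  "pair_ev Z Y W \<equiv> ev Y W \<cdot> (Ide C \<lbrakk>Y, W\<rbrakk> \<otimes>\<^sub>m ev Z Y) \<cdot> \<alpha> \<lbrakk>Y, W\<rbrakk> \<lbrakk>Z, Y\<rbrakk> Z"

lemma L_ev:
  assumes [simp]: "Y \<in> Obj C" "W \<in> Obj C" "Z \<in> Obj C"
  shows "L Z Y W = \<phi> \<lbrakk>Y, W\<rbrakk> \<lbrakk>Z, Y\<rbrakk> \<lbrakk>Z, W\<rbrakk> (\<phi> (\<lbrakk>Y, W\<rbrakk> \<otimes> \<lbrakk>Z, Y\<rbrakk>) Z W (pair_ev Z Y W))"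
  using L_eq[of "Ide C \<lbrakk>Y, W\<rbrakk>" Y W "Ide C \<lbrakk>Z, Y\<rbrakk>" Z] by (simp add: un_Ide)

lemma un_L:
  assumes "Y \<in> Obj C" "W \<in> Obj C" "Z \<in> Obj C"
  shows "un \<lbrakk>Z, Y\<rbrakk> \<lbrakk>Z, W\<rbrakk> (L Z Y W) = \<phi> (\<lbrakk>Y, W\<rbrakk> \<otimes> \<lbrakk>Z, Y\<rbrakk>) Z W (pair_ev Z Y W)"
  using assms by (simp add: L_ev)

lemma i_\<phi>: "\<lbrakk>X \<in> Obj C; g \<in> Arr C; Dom C g = X \<otimes> tunit T; Y = Cod C g\<rbrakk>
  \<Longrightarrow> i Y \<cdot> \<phi> X (tunit T) Y g = g \<cdot> r X"
  using \<phi>_run[of X Y g] by (simp add: Hom_def)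

lemma i_ev: "X \<in> Obj C \<Longrightarrow> i X = ev (tunit T) X \<cdot> r \<lbrakk>tunit T, X\<rbrakk>"
  using i_\<phi>[of "\<lbrakk>tunit T, X\<rbrakk>" "ev (tunit T) X" X] by (simp add: unit_eq)

lemma j_eq: "X \<in> Obj C \<Longrightarrow> j X = \<phi> (tunit T) X X (l X)"
  using \<phi>_lun[of "Ide C X" X X] by (simp add: Hom_def unit_eq)

lemma un_j: "X \<in> Obj C \<Longrightarrow> un X X (j X) = l X"
  by (simp add: j_eq)

text \<open>Transposed three times, each side becomes the threefold evaluation \<open>?e\<close>
  preceded by one side of the pentagon: the left-hand side runs along \<open>?a\<close>, the
  right-hand side along \<open>?b\<close>.\<close>

lemma skew_C1:
  assumes [simp]: "W \<in> Obj C" "X \<in> Obj C" "Y \<in> Obj C" "Z \<in> Obj C"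
  shows "\<lbrakk>L W X Y, Ide C \<lbrakk>\<lbrakk>W, X\<rbrakk>, \<lbrakk>W, Z\<rbrakk>\<rbrakk>\<rbrakk>\<^sub>m \<cdot> L \<lbrakk>W, X\<rbrakk> \<lbrakk>W, Y\<rbrakk> \<lbrakk>W, Z\<rbrakk> \<cdot> L W Y Z
          = \<lbrakk>Ide C \<lbrakk>X, Y\<rbrakk>, L W X Z\<rbrakk>\<^sub>m \<cdot> L X Y Z"
proof -
  let ?YZ = "\<lbrakk>Y, Z\<rbrakk>" and ?XY = "\<lbrakk>X, Y\<rbrakk>" and ?WX = "\<lbrakk>W, X\<rbrakk>"
  \<comment> \<open>\<open>?y\<close> is internal composition of
    \<open>\<lbrakk>X, Y\<rbrakk>\<close> with \<open>\<lbrakk>W, X\<rbrakk>\<close>, and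
    \<open>?n\<close> that of \<open>\<lbrakk>Y, Z\<rbrakk>\<close> with
    \<open>\<lbrakk>X, Y\<rbrakk>\<close>.\<close>
  let ?y = "\<phi> (?XY \<otimes> ?WX) W Y (pair_ev W X Y)"
  let ?n = "\<phi> (?YZ \<otimes> ?XY) X Z (pair_ev X Y Z)"
  let ?a = "\<alpha> ?YZ (?XY \<otimes> ?WX) W \<cdot> (\<alpha> ?YZ ?XY ?WX \<otimes>\<^sub>m Ide C W)"
  let ?b = "\<alpha> ?YZ ?XY (?WX \<otimes> W) \<cdot> \<alpha> (?YZ \<otimes> ?XY) ?WX W"
  let ?e = "ev Y Z \<cdot> (Ide C ?YZ \<otimes>\<^sub>m (ev X Y \<cdot> (Ide C ?XY \<otimes>\<^sub>m ev W X)))"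
  have pent: "(Ide C ?YZ \<otimes>\<^sub>m \<alpha> ?XY ?WX W) \<cdot> ?a = ?b"
    using pentagon[of ?YZ ?XY ?WX W] by simp
  have y: "ev W Y \<cdot> (?y \<otimes>\<^sub>m Ide C W) = pair_ev W X Y"
    using un_\<phi>[of "?XY \<otimes> ?WX" W "pair_ev W X Y" Y] by (simp add: un_def)
  have n: "ev X Z \<cdot> (?n \<otimes>\<^sub>m Ide C X) = pair_ev X Y Z"
    using un_\<phi>[of "?YZ \<otimes> ?XY" X "pair_ev X Y Z" Z] by (simp add: un_def)
  have "\<phi> (?YZ \<otimes> \<lbrakk>W, Y\<rbrakk>) W Z (pair_ev W Y Z) \<cdot> (Ide C ?YZ \<otimes>\<^sub>m ?y) \<cdot> \<alpha> ?YZ ?XY ?WX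
      = \<phi> ((?YZ \<otimes> ?XY) \<otimes> ?WX) W Z (pair_ev W Y Z \<cdot> (((Ide C ?YZ \<otimes>\<^sub>m ?y) \<cdot> \<alpha> ?YZ ?XY ?WX) \<otimes>\<^sub>m Ide C W))"
    using \<phi>_pre1[of "?YZ \<otimes> \<lbrakk>W, Y\<rbrakk>" W "pair_ev W Y Z" Z "(Ide C ?YZ \<otimes>\<^sub>m ?y) \<cdot> \<alpha> ?YZ ?XY ?WX"] by simp
  also have "pair_ev W Y Z \<cdot> (((Ide C ?YZ \<otimes>\<^sub>m ?y) \<cdot> \<alpha> ?YZ ?XY ?WX) \<otimes>\<^sub>m Ide C W)
      = ev Y Z \<cdot> (Ide C ?YZ \<otimes>\<^sub>m ev W Y) \<cdot> (\<alpha> ?YZ \<lbrakk>W, Y\<rbrakk> W \<cdot> ((Ide C ?YZ \<otimes>\<^sub>m ?y) \<otimes>\<^sub>m Ide C W)) \<cdot> (\<alpha> ?YZ ?XY ?WX \<otimes>\<^sub>m Ide C W)"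
    by simp
  also have "\<alpha> ?YZ \<lbrakk>W, Y\<rbrakk> W \<cdot> ((Ide C ?YZ \<otimes>\<^sub>m ?y) \<otimes>\<^sub>m Ide C W) = (Ide C ?YZ \<otimes>\<^sub>m (?y \<otimes>\<^sub>m Ide C W)) \<cdot> \<alpha> ?YZ (?XY \<otimes> ?WX) W"
    by (subst asc_nat) simp_all
  also have "ev Y Z \<cdot> (Ide C ?YZ \<otimes>\<^sub>m ev W Y) \<cdot> ((Ide C ?YZ \<otimes>\<^sub>m (?y \<otimes>\<^sub>m Ide C W)) \<cdot> \<alpha> ?YZ (?XY \<otimes> ?WX) W) \<cdot> (\<alpha> ?YZ ?XY ?WX \<otimes>\<^sub>m Ide C W)
      = ev Y Z \<cdot> (Ide C ?YZ \<otimes>\<^sub>m (ev W Y \<cdot> (?y \<otimes>\<^sub>m Ide C W))) \<cdot> ?a"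
    by simp
  also have "\<dots> = ?e \<cdot> ((Ide C ?YZ \<otimes>\<^sub>m \<alpha> ?XY ?WX W) \<cdot> ?a)"
    unfolding y by simp
  finally have lhs: "\<phi> (?YZ \<otimes> \<lbrakk>W, Y\<rbrakk>) W Z (pair_ev W Y Z) \<cdot> (Ide C ?YZ \<otimes>\<^sub>m ?y) \<cdot> \<alpha> ?YZ ?XY ?WX
      = \<phi> ((?YZ \<otimes> ?XY) \<otimes> ?WX) W Z (?e \<cdot> ?b)"
    unfolding pent .
  have "\<phi> (\<lbrakk>X, Z\<rbrakk> \<otimes> ?WX) W Z (pair_ev W X Z) \<cdot> (?n \<otimes>\<^sub>m Ide C ?WX)
      = \<phi> ((?YZ \<otimes> ?XY) \<otimes> ?WX) W Z (pair_ev W X Z \<cdot> ((?n \<otimes>\<^sub>m Ide C ?WX) \<otimes>\<^sub>m Ide C W))"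
    using \<phi>_pre1[of "\<lbrakk>X, Z\<rbrakk> \<otimes> ?WX" W "pair_ev W X Z" Z "?n \<otimes>\<^sub>m Ide C ?WX"] by simp
  also have "pair_ev W X Z \<cdot> ((?n \<otimes>\<^sub>m Ide C ?WX) \<otimes>\<^sub>m Ide C W)
      = ev X Z \<cdot> (Ide C \<lbrakk>X, Z\<rbrakk> \<otimes>\<^sub>m ev W X) \<cdot> (\<alpha> \<lbrakk>X, Z\<rbrakk> ?WX W \<cdot> ((?n \<otimes>\<^sub>m Ide C ?WX) \<otimes>\<^sub>m Ide C W))"
    by simp
  also have "\<alpha> \<lbrakk>X, Z\<rbrakk> ?WX W \<cdot> ((?n \<otimes>\<^sub>m Ide C ?WX) \<otimes>\<^sub>m Ide C W) = (?n \<otimes>\<^sub>m (Ide C ?WX \<otimes>\<^sub>m Ide C W)) \<cdot> \<alpha> (?YZ \<otimes> ?XY) ?WX W"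
    by (subst asc_nat) simp_all
  also have "ev X Z \<cdot> (Ide C \<lbrakk>X, Z\<rbrakk> \<otimes>\<^sub>m ev W X) \<cdot> \<dots>
      = ev X Z \<cdot> (?n \<otimes>\<^sub>m ev W X) \<cdot> \<alpha> (?YZ \<otimes> ?XY) ?WX W"
    by simp
  also have "?n \<otimes>\<^sub>m ev W X = (?n \<otimes>\<^sub>m Ide C X) \<cdot> (Ide C (?YZ \<otimes> ?XY) \<otimes>\<^sub>m ev W X)"
    by simp
  also have "ev X Z \<cdot> \<dots> \<cdot> \<alpha> (?YZ \<otimes> ?XY) ?WX W
      = (ev X Z \<cdot> (?n \<otimes>\<^sub>m Ide C X)) \<cdot> (Ide C (?YZ \<otimes> ?XY) \<otimes>\<^sub>m ev W X) \<cdot> \<alpha> (?YZ \<otimes> ?XY) ?WX W"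
    by simp
  also have "\<dots> = ev Y Z \<cdot> (Ide C ?YZ \<otimes>\<^sub>m ev X Y) \<cdot> (\<alpha> ?YZ ?XY X \<cdot> ((Ide C ?YZ \<otimes>\<^sub>m Ide C ?XY) \<otimes>\<^sub>m ev W X)) \<cdot> \<alpha> (?YZ \<otimes> ?XY) ?WX W"
    unfolding n by simp
  also have "\<alpha> ?YZ ?XY X \<cdot> ((Ide C ?YZ \<otimes>\<^sub>m Ide C ?XY) \<otimes>\<^sub>m ev W X) = (Ide C ?YZ \<otimes>\<^sub>m (Ide C ?XY \<otimes>\<^sub>m ev W X)) \<cdot> \<alpha> ?YZ ?XY (?WX \<otimes> W)"
    by (subst asc_nat) simp_all
  also have "ev Y Z \<cdot> (Ide C ?YZ \<otimes>\<^sub>m ev X Y) \<cdot> \<dots> \<cdot> \<alpha> (?YZ \<otimes> ?XY) ?WX W = ?e \<cdot> ?b"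
    by simp
  finally have rhs: "\<phi> (\<lbrakk>X, Z\<rbrakk> \<otimes> ?WX) W Z (pair_ev W X Z) \<cdot> (?n \<otimes>\<^sub>m Ide C ?WX) = \<phi> ((?YZ \<otimes> ?XY) \<otimes> ?WX) W Z (?e \<cdot> ?b)" .
  have "\<lbrakk>Ide C ?XY, L W X Z\<rbrakk>\<^sub>m \<cdot> L X Y Z = \<phi> ?YZ ?XY \<lbrakk>?WX, \<lbrakk>W, Z\<rbrakk>\<rbrakk> (L W X Z \<cdot> ?n)"
    using \<phi>_post[of ?YZ ?XY ?n "\<lbrakk>X, Z\<rbrakk>" "L W X Z" "\<lbrakk>?WX, \<lbrakk>W, Z\<rbrakk>\<rbrakk>"] by (simp add: L_ev[of Y Z X])
  also have "L W X Z \<cdot> ?n = \<phi> (?YZ \<otimes> ?XY) ?WX \<lbrakk>W, Z\<rbrakk> (\<phi> (\<lbrakk>X, Z\<rbrakk> \<otimes> ?WX) W Z (pair_ev W X Z) \<cdot> (?n \<otimes>\<^sub>m Ide C ?WX))"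
    using \<phi>_pre1[of "\<lbrakk>X, Z\<rbrakk>" ?WX "\<phi> (\<lbrakk>X, Z\<rbrakk> \<otimes> ?WX) W Z (pair_ev W X Z)" "\<lbrakk>W, Z\<rbrakk>" ?n] by (simp add: L_ev[of X Z W])
  finally have R: "\<lbrakk>Ide C ?XY, L W X Z\<rbrakk>\<^sub>m \<cdot> L X Y Z =
    \<phi> ?YZ ?XY \<lbrakk>?WX, \<lbrakk>W, Z\<rbrakk>\<rbrakk> (\<phi> (?YZ \<otimes> ?XY) ?WX \<lbrakk>W, Z\<rbrakk> (\<phi> ((?YZ \<otimes> ?XY) \<otimes> ?WX) W Z (?e \<cdot> ?b)))"
    unfolding rhs .
  show ?thesis
    unfolding R lhs[symmetric]
    using L_eq[of "L W Y Z" "\<lbrakk>W, Y\<rbrakk>" "\<lbrakk>W, Z\<rbrakk>" "L W X Y" "\<lbrakk>W, X\<rbrakk>" ?YZ ?XY] by (simp add: un_L)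
qed

text \<open>The transposes match as follows: \<open>C2\<close> comes from \<open>triangle\<close>,
  \<open>C3\<close> from \<open>lun_asc\<close> and naturality of \<open>l\<close>,
  \<open>C4\<close> from \<open>asc_run\<close>, \<open>C5\<close> from \<open>lun_run\<close>.
  Extranaturality of \<open>L\<close> is naturality of \<open>\<alpha>\<close> in its third
  variable, and that of \<open>j\<close> is naturality of \<open>l\<close>.\<close>

theorem monoidal_skew_closed: "monoidal_skew_closed C T S \<phi>"
proof unfold_locales
  show "cunit S \<in> Obj C" by simp
next
  fix X Y Z Z' h assume [simp]: "X \<in> Obj C" "Y \<in> Obj C" and "h \<in> Hom C Z Z'"
  then have h [simp]: "h \<in> Arr C" "Dom C h = Z" "Cod C h = Z'" "Z \<in> Obj C" "Z' \<in> Obj C"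
    using in_HomD Hom_Obj by metis+
  have "\<lbrakk>Ide C \<lbrakk>X, Y\<rbrakk>, \<lbrakk>Ide C X, h\<rbrakk>\<^sub>m\<rbrakk>\<^sub>m \<cdot> L X Y Z
    = \<phi> \<lbrakk>Y, Z\<rbrakk> \<lbrakk>X, Y\<rbrakk> \<lbrakk>X, Z'\<rbrakk> (\<phi> (\<lbrakk>Y, Z\<rbrakk> \<otimes> \<lbrakk>X, Y\<rbrakk>) X Z' (h \<cdot> pair_ev X Y Z))"
    using \<phi>_post[of "\<lbrakk>Y, Z\<rbrakk>" "\<lbrakk>X, Y\<rbrakk>" "\<phi> (\<lbrakk>Y, Z\<rbrakk> \<otimes> \<lbrakk>X, Y\<rbrakk>) X Z (pair_ev X Y Z)" "\<lbrakk>X, Z\<rbrakk>" "\<lbrakk>Ide C X, h\<rbrakk>\<^sub>m" "\<lbrakk>X, Z'\<rbrakk>"]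
      \<phi>_post[of "\<lbrakk>Y, Z\<rbrakk> \<otimes> \<lbrakk>X, Y\<rbrakk>" X "pair_ev X Y Z" Z h Z']
    by (simp add: L_ev)
  also have "\<dots> = L X Y Z' \<cdot> \<lbrakk>Ide C Y, h\<rbrakk>\<^sub>m"
    using L_eq[of "\<lbrakk>Ide C Y, h\<rbrakk>\<^sub>m" Y Z' "Ide C \<lbrakk>X, Y\<rbrakk>" X "\<lbrakk>Y, Z\<rbrakk>" "\<lbrakk>X, Y\<rbrakk>"] un_harr(1)[of Y h] by (simp add: un_Ide)
  finally show "\<lbrakk>Ide C \<lbrakk>X, Y\<rbrakk>, \<lbrakk>Ide C X, h\<rbrakk>\<^sub>m\<rbrakk>\<^sub>m \<cdot> L X Y Z = L X Y Z' \<cdot> \<lbrakk>Ide C Y, h\<rbrakk>\<^sub>m" .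
next
  fix X X' Y Z f assume "f \<in> Hom C X X'" and [simp]: "Y \<in> Obj C" "Z \<in> Obj C"
  then have f [simp]: "f \<in> Arr C" "Dom C f = X" "Cod C f = X'" "X \<in> Obj C" "X' \<in> Obj C"
    using in_HomD Hom_Obj by metis+
  have "\<lbrakk>\<lbrakk>f, Ide C Y\<rbrakk>\<^sub>m, Ide C \<lbrakk>X, Z\<rbrakk>\<rbrakk>\<^sub>m \<cdot> L X Y Z
    = \<phi> \<lbrakk>Y, Z\<rbrakk> \<lbrakk>X', Y\<rbrakk> \<lbrakk>X, Z\<rbrakk> (\<phi> (\<lbrakk>Y, Z\<rbrakk> \<otimes> \<lbrakk>X', Y\<rbrakk>) X Z
        (ev Y Z \<cdot> (Ide C \<lbrakk>Y, Z\<rbrakk> \<otimes>\<^sub>m ev X' Y) \<cdot> (Ide C \<lbrakk>Y, Z\<rbrakk> \<otimes>\<^sub>m (Ide C \<lbrakk>X', Y\<rbrakk> \<otimes>\<^sub>m f)) \<cdot> \<alpha> \<lbrakk>Y, Z\<rbrakk> \<lbrakk>X', Y\<rbrakk> X))"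
    using L_eq[of "Ide C \<lbrakk>Y, Z\<rbrakk>" Y Z "\<lbrakk>f, Ide C Y\<rbrakk>\<^sub>m" X "\<lbrakk>Y, Z\<rbrakk>" "\<lbrakk>X', Y\<rbrakk>"] un_harr(2)[of Y f Y] by (simp add: un_Ide)
  also have "(Ide C \<lbrakk>Y, Z\<rbrakk> \<otimes>\<^sub>m (Ide C \<lbrakk>X', Y\<rbrakk> \<otimes>\<^sub>m f)) \<cdot> \<alpha> \<lbrakk>Y, Z\<rbrakk> \<lbrakk>X', Y\<rbrakk> X
    = \<alpha> \<lbrakk>Y, Z\<rbrakk> \<lbrakk>X', Y\<rbrakk> X' \<cdot> ((Ide C \<lbrakk>Y, Z\<rbrakk> \<otimes>\<^sub>m Ide C \<lbrakk>X', Y\<rbrakk>) \<otimes>\<^sub>m f)"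
    by (subst asc_nat) simp_all
  also have "ev Y Z \<cdot> (Ide C \<lbrakk>Y, Z\<rbrakk> \<otimes>\<^sub>m ev X' Y) \<cdot> \<dots> = pair_ev X' Y Z \<cdot> (Ide C (\<lbrakk>Y, Z\<rbrakk> \<otimes> \<lbrakk>X', Y\<rbrakk>) \<otimes>\<^sub>m f)"
    by simp
  also have "\<phi> (\<lbrakk>Y, Z\<rbrakk> \<otimes> \<lbrakk>X', Y\<rbrakk>) X Z \<dots> = \<lbrakk>f, Ide C Z\<rbrakk>\<^sub>m \<cdot> \<phi> (\<lbrakk>Y, Z\<rbrakk> \<otimes> \<lbrakk>X', Y\<rbrakk>) X' Z (pair_ev X' Y Z)"
    by (rule \<phi>_pre2) simp_all
  also have "\<phi> \<lbrakk>Y, Z\<rbrakk> \<lbrakk>X', Y\<rbrakk> \<lbrakk>X, Z\<rbrakk> \<dots> = \<lbrakk>Ide C \<lbrakk>X', Y\<rbrakk>, \<lbrakk>f, Ide C Z\<rbrakk>\<^sub>m\<rbrakk>\<^sub>m \<cdot> L X' Y Z"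
    unfolding L_ev[OF \<open>Y \<in> Obj C\<close> \<open>Z \<in> Obj C\<close> \<open>X' \<in> Obj C\<close>] by (rule \<phi>_post) simp_all
  finally show "\<lbrakk>\<lbrakk>f, Ide C Y\<rbrakk>\<^sub>m, Ide C \<lbrakk>X, Z\<rbrakk>\<rbrakk>\<^sub>m \<cdot> L X Y Z = \<lbrakk>Ide C \<lbrakk>X', Y\<rbrakk>, \<lbrakk>f, Ide C Z\<rbrakk>\<^sub>m\<rbrakk>\<^sub>m \<cdot> L X' Y Z" .
next
  fix X X' f assume "f \<in> Hom C X X'"
  then have f [simp]: "f \<in> Arr C" "Dom C f = X" "Cod C f = X'" "X \<in> Obj C" "X' \<in> Obj C"
    using in_HomD Hom_Obj by metis+
  have "i X' \<cdot> \<lbrakk>Ide C (tunit T), f\<rbrakk>\<^sub>m = i X' \<cdot> \<phi> \<lbrakk>tunit T, X\<rbrakk> (tunit T) X' (f \<cdot> ev (tunit T) X)"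
    using \<phi>_post[of "\<lbrakk>tunit T, X\<rbrakk>" "tunit T" "ev (tunit T) X" X f X'] by simp
  also have "\<dots> = f \<cdot> i X"
    using i_\<phi>[of "\<lbrakk>tunit T, X\<rbrakk>" "f \<cdot> ev (tunit T) X" X'] by (simp add: i_ev)
  finally show "i X' \<cdot> \<lbrakk>Ide C (cunit S), f\<rbrakk>\<^sub>m = f \<cdot> i X" by (simp add: unit_eq)
  have "\<lbrakk>f, Ide C X'\<rbrakk>\<^sub>m \<cdot> j X' = \<phi> (tunit T) X X' (l X' \<cdot> (Ide C (tunit T) \<otimes>\<^sub>m f))"
    using \<phi>_pre2[of "tunit T" X' "l X'" X' f X] by (simp add: j_eq)
  also have "\<dots> = \<lbrakk>Ide C X, f\<rbrakk>\<^sub>m \<cdot> j X"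
    using \<phi>_post[of "tunit T" X "l X" X f X'] by (simp add: lun_nat j_eq)
  finally show "\<lbrakk>Ide C X, f\<rbrakk>\<^sub>m \<cdot> j X = \<lbrakk>f, Ide C X'\<rbrakk>\<^sub>m \<cdot> j X'" by simp
next
  fix X Y assume [simp]: "X \<in> Obj C" "Y \<in> Obj C"
  let ?h = "ev X Y \<cdot> (Ide C \<lbrakk>X, Y\<rbrakk> \<otimes>\<^sub>m l X) \<cdot> \<alpha> \<lbrakk>X, Y\<rbrakk> (tunit T) X"
  have "i \<lbrakk>X, Y\<rbrakk> \<cdot> \<lbrakk>j X, Ide C \<lbrakk>X, Y\<rbrakk>\<rbrakk>\<^sub>m \<cdot> L X X Y
    = i \<lbrakk>X, Y\<rbrakk> \<cdot> \<phi> \<lbrakk>X, Y\<rbrakk> (tunit T) \<lbrakk>X, Y\<rbrakk> (\<phi> (\<lbrakk>X, Y\<rbrakk> \<otimes> tunit T) X Y ?h)"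
    using L_eq[of "Ide C \<lbrakk>X, Y\<rbrakk>" X Y "j X" X "\<lbrakk>X, Y\<rbrakk>" "tunit T"] by (simp add: un_Ide un_j unit_eq)
  also have "\<dots> = \<phi> (\<lbrakk>X, Y\<rbrakk> \<otimes> tunit T) X Y ?h \<cdot> r \<lbrakk>X, Y\<rbrakk>"
    by (rule i_\<phi>) simp_all
  also have "\<dots> = \<phi> \<lbrakk>X, Y\<rbrakk> X Y (?h \<cdot> (r \<lbrakk>X, Y\<rbrakk> \<otimes>\<^sub>m Ide C X))"
    by (rule \<phi>_pre1[symmetric]) simp_all
  also have "?h \<cdot> (r \<lbrakk>X, Y\<rbrakk> \<otimes>\<^sub>m Ide C X) = ev X Y"
    using triangle[of "\<lbrakk>X, Y\<rbrakk>" X] by simp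
  finally show "i \<lbrakk>X, Y\<rbrakk> \<cdot> \<lbrakk>j X, Ide C \<lbrakk>X, Y\<rbrakk>\<rbrakk>\<^sub>m \<cdot> L X X Y = Ide C \<lbrakk>X, Y\<rbrakk>" by simp
  have "L X Y Y \<cdot> j Y = \<phi> (tunit T) \<lbrakk>X, Y\<rbrakk> \<lbrakk>X, Y\<rbrakk> (\<phi> (tunit T \<otimes> \<lbrakk>X, Y\<rbrakk>) X Y
      (l Y \<cdot> (Ide C (tunit T) \<otimes>\<^sub>m ev X Y) \<cdot> \<alpha> (tunit T) \<lbrakk>X, Y\<rbrakk> X))"
    using L_eq[of "j Y" Y Y "Ide C \<lbrakk>X, Y\<rbrakk>" X "tunit T" "\<lbrakk>X, Y\<rbrakk>"] by (simp add: un_Ide un_j unit_eq)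
  also have "l Y \<cdot> (Ide C (tunit T) \<otimes>\<^sub>m ev X Y) \<cdot> \<alpha> (tunit T) \<lbrakk>X, Y\<rbrakk> X = ev X Y \<cdot> (l \<lbrakk>X, Y\<rbrakk> \<otimes>\<^sub>m Ide C X)"
    using rewr2[OF lun_nat[of "ev X Y" Y], of "\<alpha> (tunit T) \<lbrakk>X, Y\<rbrakk> X"] lun_asc[of "\<lbrakk>X, Y\<rbrakk>" X] by simp
  also have "\<phi> (tunit T \<otimes> \<lbrakk>X, Y\<rbrakk>) X Y \<dots> = l \<lbrakk>X, Y\<rbrakk>"
    using \<phi>_pre1[of "\<lbrakk>X, Y\<rbrakk>" X "ev X Y" Y "l \<lbrakk>X, Y\<rbrakk>" "tunit T \<otimes> \<lbrakk>X, Y\<rbrakk>"] by simp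
  finally show "L X Y Y \<cdot> j Y = j \<lbrakk>X, Y\<rbrakk>" by (simp add: j_eq)
  have "\<lbrakk>Ide C \<lbrakk>tunit T, X\<rbrakk>, i Y\<rbrakk>\<^sub>m \<cdot> L (tunit T) X Y
    = \<phi> \<lbrakk>X, Y\<rbrakk> \<lbrakk>tunit T, X\<rbrakk> Y (i Y \<cdot> \<phi> (\<lbrakk>X, Y\<rbrakk> \<otimes> \<lbrakk>tunit T, X\<rbrakk>) (tunit T) Y (pair_ev (tunit T) X Y))"
    unfolding L_ev[OF \<open>X \<in> Obj C\<close> \<open>Y \<in> Obj C\<close> tunit_Obj] by (rule \<phi>_post[symmetric]) (simp_all add: unit_eq)
  also have "i Y \<cdot> \<phi> (\<lbrakk>X, Y\<rbrakk> \<otimes> \<lbrakk>tunit T, X\<rbrakk>) (tunit T) Y (pair_ev (tunit T) X Y)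
    = pair_ev (tunit T) X Y \<cdot> r (\<lbrakk>X, Y\<rbrakk> \<otimes> \<lbrakk>tunit T, X\<rbrakk>)"
    by (rule i_\<phi>) simp_all
  also have "\<dots> = ev X Y \<cdot> (Ide C \<lbrakk>X, Y\<rbrakk> \<otimes>\<^sub>m i X)"
    using asc_run[of "\<lbrakk>X, Y\<rbrakk>" "\<lbrakk>tunit T, X\<rbrakk>"] by (simp add: i_ev)
  also have "\<phi> \<lbrakk>X, Y\<rbrakk> \<lbrakk>tunit T, X\<rbrakk> Y \<dots> = \<lbrakk>i X, Ide C Y\<rbrakk>\<^sub>m"
    using \<phi>_pre2[of "\<lbrakk>X, Y\<rbrakk>" X "ev X Y" Y "i X" "\<lbrakk>tunit T, X\<rbrakk>"] by (simp add: unit_eq)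
  finally show "\<lbrakk>Ide C \<lbrakk>cunit S, X\<rbrakk>, i Y\<rbrakk>\<^sub>m \<cdot> L (cunit S) X Y = \<lbrakk>i X, Ide C Y\<rbrakk>\<^sub>m"
    by (simp add: unit_eq)
next
  have "i (tunit T) \<cdot> j (tunit T) = l (tunit T) \<cdot> r (tunit T)"
    unfolding j_eq[OF tunit_Obj] by (rule i_\<phi>) simp_all
  then show "i (cunit S) \<cdot> j (cunit S) = Ide C (cunit S)"
    using lun_run by (simp add: unit_eq)
next
  fix X Y Z W h assume "X \<in> Obj C" "Y \<in> Obj C" "Z \<in> Obj C" "W \<in> Obj C" "h \<in> Hom C (X \<otimes> (Y \<otimes> Z)) W"
  then show "\<phi> X Y \<lbrakk>Z, W\<rbrakk> (\<phi> (X \<otimes> Y) Z W (h \<cdot> \<alpha> X Y Z))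
          = (let u = \<phi> Y Z (Y \<otimes> Z) (Ide C (Y \<otimes> Z));
                 t = \<lbrakk>u, Ide C \<lbrakk>Z, W\<rbrakk>\<rbrakk>\<^sub>m \<cdot> L Z (Y \<otimes> Z) W
             in t \<cdot> \<phi> X (Y \<otimes> Z) W h)"
    unfolding Let_def using \<phi>_asc[of X Y Z W h] by (simp add: Hom_def)
qed (use Lc_in ic_in jc_in Lc_natural1 unit_eq \<phi>_bij \<phi>_natural \<phi>_lun \<phi>_run skew_C1 in simp_all)

end

section \<open>Model categories\<close>

text \<open>A terminal object is the limit of the empty diagram, whose cones are just objects.
  Applied to the opposite category, the lemma also provides the initial object.\<close>

lemma terminal_if_finite_limits:
  fixes C :: "('o, 'm, 'z) cat_scheme"
  assumes "category C" "has_finite_limits C"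
  shows "\<exists>Z\<in>Obj C. \<forall>A\<in>Obj C. \<exists>!f. f \<in> Hom C A Z"
proof -
  interpret category C by fact
  define J :: "(nat, nat) cat" where
    "J = \<lparr>Obj = {}, Arr = {}, Dom = id, Cod = id, Ide = id, Comp = (\<lambda>g f. f)\<rparr>"
  define D :: "(nat, nat, 'o, 'm) ftr" where "D = \<lparr>fobj = (\<lambda>_ :: nat. undefined), farr = (\<lambda>_ :: nat. undefined)\<rparr>"
  have J [simp]: "Obj J = {}" "Arr J = {}" by (auto simp: J_def)
  have "cat_functor J C D"
    unfolding cat_functor_def cat_functor_axioms_def category_def using category_axioms[unfolded category_def]
    by (simp add: Hom_def)
  then obtain X \<tau> where "is_limit C J D X \<tau>"
    using assms(2)[unfolded has_finite_limits_def, rule_format, of J D] by auto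
  then show ?thesis
    by (intro bexI[of _ X]) (auto simp: is_limit_def is_cone_def)
qed

definition fibrant :: "('o, 'm) model \<Rightarrow> 'o \<Rightarrow> bool" where
  "fibrant M A \<longleftrightarrow> A \<in> Obj M \<and> to_term M A \<in> Fibs M"

context model_category
begin

sublocale weq_category M
  by unfold_locales (rule Weq_sub)

sublocale cfac: functorial_factorisation M "cfac M"
  by (rule cfac)

sublocale ffac: functorial_factorisation M "ffac M"
  by (rule ffac)

lemma init_obj: "init_obj M \<in> Obj M" "A \<in> Obj M \<Longrightarrow> \<exists>!f. f \<in> Hom M (init_obj M) A"
proof -
  have "\<exists>Z. Z \<in> Obj M \<and> (\<forall>A\<in>Obj M. \<exists>!f. f \<in> Hom M Z A)"
    using terminal_if_finite_limits[OF category_op_cat[OF category_axioms]] finite_colimits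
    by (auto simp: has_finite_colimits_def)
  from someI_ex[OF this] show "init_obj M \<in> Obj M" "A \<in> Obj M \<Longrightarrow> \<exists>!f. f \<in> Hom M (init_obj M) A"
    unfolding init_obj_def[symmetric] by blast+
qed

lemma term_obj: "term_obj M \<in> Obj M" "A \<in> Obj M \<Longrightarrow> \<exists>!f. f \<in> Hom M A (term_obj M)"
proof -
  have "\<exists>Z. Z \<in> Obj M \<and> (\<forall>A\<in>Obj M. \<exists>!f. f \<in> Hom M A Z)"
    using terminal_if_finite_limits[OF category_axioms finite_limits] by blast
  from someI_ex[OF this] show "term_obj M \<in> Obj M" "A \<in> Obj M \<Longrightarrow> \<exists>!f. f \<in> Hom M A (term_obj M)"
    unfolding term_obj_def init_obj_def[of "op_cat M"] by simp_all
qed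

lemma from_init [simp]:
  assumes "A \<in> Obj M"
  shows "from_init M A \<in> Arr M" "Dom M (from_init M A) = init_obj M" "Cod M (from_init M A) = A"
  using theI'[OF init_obj(2)[OF assms]] in_HomD unfolding from_init_def by metis+

lemma to_term [simp]:
  assumes "A \<in> Obj M"
  shows "to_term M A \<in> Arr M" "Dom M (to_term M A) = A" "Cod M (to_term M A) = term_obj M"
  using theI'[OF term_obj(2)[OF assms]] in_HomD unfolding to_term_def by metis+

lemma from_init_unique: "\<lbrakk>f \<in> Arr M; Dom M f = init_obj M; A = Cod M f\<rbrakk> \<Longrightarrow> from_init M A = f"
  using init_obj(2)[of A] from_init[of A] by (metis Cod_Obj in_HomI)

lemma to_term_unique: "\<lbrakk>f \<in> Arr M; Cod M f = term_obj M; A = Dom M f\<rbrakk> \<Longrightarrow> to_term M A = f"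
  using term_obj(2)[of A] to_term[of A] by (metis Dom_Obj in_HomI)

lemma Ide_classes [simp]:
  assumes "A \<in> Obj M"
  shows "Ide M A \<in> Weq M" "Ide M A \<in> Cofs M" "Ide M A \<in> Fibs M"
  using assms Weq_sub Cofs_sub Fibs_sub by (auto simp: wide_subcategory_def)

lemma classes_Arr [simp]: "f \<in> Cofs M \<Longrightarrow> f \<in> Arr M" "f \<in> Fibs M \<Longrightarrow> f \<in> Arr M"
  using Cofs_sub Fibs_sub by (auto simp: wide_subcategory_def)

lemma classes_Comp:
  assumes "Cod M f = Dom M g"
  shows "\<lbrakk>f \<in> Weq M; g \<in> Weq M\<rbrakk> \<Longrightarrow> g \<cdot> f \<in> Weq M" "\<lbrakk>f \<in> Cofs M; g \<in> Cofs M\<rbrakk> \<Longrightarrow> g \<cdot> f \<in> Cofs M"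
    "\<lbrakk>f \<in> Fibs M; g \<in> Fibs M\<rbrakk> \<Longrightarrow> g \<cdot> f \<in> Fibs M"
  using assms Weq_sub Cofs_sub Fibs_sub by (auto simp: wide_subcategory_def)

lemma Weq_cancel:
  assumes "f \<in> Arr M" "g \<in> Arr M" "Cod M f = Dom M g" "g \<cdot> f \<in> Weq M"
  shows "g \<in> Weq M \<Longrightarrow> f \<in> Weq M" "f \<in> Weq M \<Longrightarrow> g \<in> Weq M"
  using two_of_three1[of f "Dom M f" "Cod M f" g "Cod M g"] two_of_three2[of f "Dom M f" "Cod M f" g "Cod M g"] assms
  by (auto simp: Hom_def)

text \<open>An isomorphism is a retract of the identity of its domain, and each of the three classes
  contains identities and is closed under retracts.\<close>

lemma iso_classes:
  assumes "iso_arr M f"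
  shows "f \<in> Weq M" "f \<in> Cofs M" "f \<in> Fibs M"
proof -
  have f: "f \<in> Arr M" using assms by (rule iso_is_Arr)
  have r: "is_retract M f (Ide M (Dom M f))"
    unfolding is_retract_def
    by (rule exI[of _ "Ide M (Dom M f)"], rule exI[of _ "inv_arr M f"], rule exI[of _ "Ide M (Dom M f)"],
        rule exI[of _ f]) (use f assms in \<open>simp add: is_square_def Hom_def\<close>)
  show "f \<in> Weq M" "f \<in> Cofs M" "f \<in> Fibs M"
    using Weq_retract[OF r] Cofs_retract[OF r] Fibs_retract[OF r] f by simp_all
qed

section \<open>Lifting against cofibrant and fibrant objects, and the retract argument\<close>

lemma lift:
  assumes "f \<in> Cofs M" "g \<in> Fibs M" "f \<in> Weq M \<or> g \<in> Weq M"
    and "u \<in> Arr M" "v \<in> Arr M" "Dom M u = Dom M f" "Cod M u = Dom M g" "Dom M v = Cod M f" "Cod M v = Cod M g"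
    and "g \<cdot> u = v \<cdot> f"
  obtains d where "d \<in> Arr M" "Dom M d = Cod M f" "Cod M d = Dom M g" "d \<cdot> f = u" "g \<cdot> d = v"
proof -
  have "has_lifting M f g" using assms lifting1 lifting2 by blast
  moreover have "is_square M f g u v" using assms by (simp add: is_square_def Hom_def)
  ultimately show thesis using that by (auto simp: has_lifting_def Hom_def)
qed

lemma cofibrant_Obj: "cofibrant M A \<Longrightarrow> A \<in> Obj M"
  by (simp add: cofibrant_def)

lemma fibrant_Obj: "fibrant M A \<Longrightarrow> A \<in> Obj M"
  by (simp add: fibrant_def)

lemma lift_cofibrant:
  assumes "cofibrant M A" "t \<in> Fibs M" "t \<in> Weq M" "f \<in> Arr M" "Dom M f = A" "Cod M f = Cod M t"
  obtains g where "g \<in> Arr M" "Dom M g = A" "Cod M g = Dom M t" "t \<cdot> g = f"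
proof -
  have A: "A \<in> Obj M" "from_init M A \<in> Cofs M" using assms(1) by (auto simp: cofibrant_def)
  have "t \<cdot> from_init M (Dom M t) = f \<cdot> from_init M A"
    using from_init_unique[of "t \<cdot> from_init M (Dom M t)" "Cod M t"] from_init_unique[of "f \<cdot> from_init M A" "Cod M t"] A assms
    by simp
  then show thesis
    using lift[of "from_init M A" t "from_init M (Dom M t)" f] A assms that by auto
qed

lemma extend_fibrant:
  assumes "fibrant M Z" "c \<in> Cofs M" "c \<in> Weq M" "f \<in> Arr M" "Cod M f = Z" "Dom M f = Dom M c"
  obtains g where "g \<in> Arr M" "Dom M g = Cod M c" "Cod M g = Z" "g \<cdot> c = f"
proof -
  have Z: "Z \<in> Obj M" "to_term M Z \<in> Fibs M" using assms(1) by (auto simp: fibrant_def)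
  have "to_term M Z \<cdot> f = to_term M (Cod M c) \<cdot> c"
    using to_term_unique[of "to_term M (Cod M c) \<cdot> c" "Dom M c"] to_term_unique[of "to_term M Z \<cdot> f" "Dom M c"] Z assms
    by simp
  then show thesis
    using lift[of c "to_term M Z" f "to_term M (Cod M c)"] Z assms that by auto
qed

lemma cofibrant_Cofs:
  assumes "cofibrant M (Dom M c)" "c \<in> Cofs M"
  shows "cofibrant M (Cod M c)"
  using assms classes_Comp(2)[of "from_init M (Dom M c)" c] from_init_unique[of "c \<cdot> from_init M (Dom M c)" "Cod M c"]
  by (simp add: cofibrant_def)

lemma fibrant_Fibs:
  assumes "fibrant M (Cod M t)" "t \<in> Fibs M"
  shows "fibrant M (Dom M t)"
  using assms classes_Comp(3)[of t "to_term M (Cod M t)"] to_term_unique[of "to_term M (Cod M t) \<cdot> t" "Dom M t"]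
  by (simp add: fibrant_def)

lemma triv_cof_fib_factorisation:
  assumes "f \<in> Arr M"
  obtains c g where "c \<in> Cofs M" "c \<in> Weq M" "g \<in> Fibs M" "Dom M c = Dom M f" "Cod M c = Dom M g"
    "Cod M g = Cod M f" "g \<cdot> c = f"
  using ffac_left[OF assms] ffac_right[OF assms]
    in_HomD[OF ffac.fleft_in[OF Arr_HomI[OF assms]]] in_HomD[OF ffac.fright_in[OF Arr_HomI[OF assms]]]
    ffac.factors[OF assms]
  by (intro that[of "fleft (ffac M) f" "fright (ffac M) f"]) simp_all

lemma cof_triv_fib_factorisation:
  assumes "f \<in> Arr M"
  obtains c g where "c \<in> Cofs M" "g \<in> Weq M" "g \<in> Fibs M" "Dom M c = Dom M f" "Cod M c = Dom M g"
    "Cod M g = Cod M f" "g \<cdot> c = f"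
  using cfac_left[OF assms] cfac_right[OF assms]
    in_HomD[OF cfac.fleft_in[OF Arr_HomI[OF assms]]] in_HomD[OF cfac.fright_in[OF Arr_HomI[OF assms]]]
    cfac.factors[OF assms]
  by (intro that[of "fleft (cfac M) f" "fright (cfac M) f"]) simp_all

text \<open>A lift in the square from \<open>c\<close> to \<open>g \<cdot> c\<close> with an
  identity on top and \<open>g\<close> below exhibits the composite as a retract of its second
  factor.\<close>

lemma retract_of_factor:
  assumes "c \<in> Arr M" "g \<in> Arr M" "Cod M c = Dom M g" "has_lifting M c (g \<cdot> c)"
  shows "is_retract M (g \<cdot> c) g"
proof -
  have "is_square M c (g \<cdot> c) (Ide M (Dom M c)) g"
    using assms by (simp add: is_square_def Hom_def)
  then obtain d where d: "d \<in> Arr M" "Dom M d = Cod M c" "Cod M d = Dom M c" "d \<cdot> c = Ide M (Dom M c)" "g \<cdot> c \<cdot> d = g"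
    using assms by (auto simp: has_lifting_def Hom_def)
  show ?thesis
    unfolding is_retract_def
    by (rule exI[of _ c], rule exI[of _ "Ide M (Cod M g)"], rule exI[of _ d], rule exI[of _ "Ide M (Cod M g)"])
      (use d assms(1-3) in \<open>simp add: is_square_def Hom_def\<close>)
qed

text \<open>Factor \<open>f\<close> as a cofibration followed by a trivial fibration; the retract
  argument makes \<open>f\<close> a retract of the latter. Recognising fibrations by lifting, here
  and in \<open>fib_if_lifting\<close>, is what carries left Quillen properties of the tensor
  product over to the internal hom.\<close>

lemma triv_fib_if_lifting:
  assumes "f \<in> Arr M" "\<And>c. c \<in> Cofs M \<Longrightarrow> has_lifting M c f"
  shows "f \<in> Fibs M" "f \<in> Weq M"
proof -
  obtain c g where "c \<in> Cofs M" "g \<in> Weq M" "g \<in> Fibs M" "Dom M c = Dom M f" "Cod M c = Dom M g"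
    "Cod M g = Cod M f" "g \<cdot> c = f"
    using cof_triv_fib_factorisation[OF assms(1)] by metis
  then show "f \<in> Fibs M" "f \<in> Weq M"
    using retract_of_factor[of c g] assms(2)[of c] Fibs_retract[of f g] Weq_retract[of f g] by auto
qed

lemma fib_if_lifting:
  assumes "f \<in> Arr M" "\<And>c. \<lbrakk>c \<in> Cofs M; c \<in> Weq M\<rbrakk> \<Longrightarrow> has_lifting M c f"
  shows "f \<in> Fibs M"
proof -
  obtain c g where "c \<in> Cofs M" "c \<in> Weq M" "g \<in> Fibs M" "Dom M c = Dom M f" "Cod M c = Dom M g"
    "Cod M g = Cod M f" "g \<cdot> c = f"
    using triv_cof_fib_factorisation[OF assms(1)] by metis
  then show "f \<in> Fibs M"
    using retract_of_factor[of c g] assms(2)[of c] Fibs_retract[of f g] by auto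
qed

subsection \<open>Cofibrant and fibrant replacement\<close>

abbreviation Q where "Q \<equiv> fobj (Qf M)"
abbreviation Qm where "Qm \<equiv> farr (Qf M)"
abbreviation R where "R \<equiv> fobj (Rf M)"
abbreviation Rm where "Rm \<equiv> farr (Rf M)"
abbreviation p where "p \<equiv> pm M"
abbreviation q where "q \<equiv> qm M"

lemma pm [simp]:
  assumes "A \<in> Obj M"
  shows "p A \<in> Arr M" "Dom M (p A) = Q A" "Cod M (p A) = A" "p A \<in> Fibs M" "p A \<in> Weq M"
proof -
  have f: "from_init M A \<in> Hom M (init_obj M) A" using assms by (simp add: Hom_def)
  show "p A \<in> Arr M" "Dom M (p A) = Q A" "Cod M (p A) = A"
    using in_HomD[OF cfac.fright_in[OF f]] by (auto simp: pm_def Qf_def)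
  show "p A \<in> Fibs M" "p A \<in> Weq M"
    using cfac_right[of "from_init M A"] assms by (auto simp: pm_def)
qed

lemma qm [simp]:
  assumes "A \<in> Obj M"
  shows "q A \<in> Arr M" "Dom M (q A) = A" "Cod M (q A) = R A" "q A \<in> Cofs M" "q A \<in> Weq M"
proof -
  have f: "to_term M A \<in> Hom M A (term_obj M)" using assms by (simp add: Hom_def)
  show "q A \<in> Arr M" "Dom M (q A) = A" "Cod M (q A) = R A"
    using in_HomD[OF ffac.fleft_in[OF f]] by (auto simp: qm_def Rf_def)
  show "q A \<in> Cofs M" "q A \<in> Weq M"
    using ffac_left[of "to_term M A"] assms by (auto simp: qm_def)
qed

lemma Q_Obj [simp]: "A \<in> Obj M \<Longrightarrow> Q A \<in> Obj M"
  using pm(1,2)[of A] Dom_Obj by metis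

lemma R_Obj [simp]: "A \<in> Obj M \<Longrightarrow> R A \<in> Obj M"
  using qm(1,3)[of A] Cod_Obj by metis

lemma cofibrant_Q [simp]: "A \<in> Obj M \<Longrightarrow> cofibrant M (Q A)"
proof -
  assume A: "A \<in> Obj M"
  then have f: "from_init M A \<in> Hom M (init_obj M) A" by (simp add: Hom_def)
  have "from_init M (Q A) = fleft (cfac M) (from_init M A)"
    using in_HomD[OF cfac.fleft_in[OF f]] by (intro from_init_unique) (auto simp: Qf_def)
  then show ?thesis
    using cfac_left[of "from_init M A"] A by (simp add: cofibrant_def)
qed

lemma fibrant_R [simp]: "A \<in> Obj M \<Longrightarrow> fibrant M (R A)"
proof -
  assume A: "A \<in> Obj M"
  then have f: "to_term M A \<in> Hom M A (term_obj M)" by (simp add: Hom_def)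
  have "to_term M (R A) = fright (ffac M) (to_term M A)"
    using in_HomD[OF ffac.fright_in[OF f]] by (intro to_term_unique) (auto simp: Rf_def)
  then show ?thesis
    using ffac_right[of "to_term M A"] A by (simp add: fibrant_def)
qed

lemma Q_square:
  assumes "f \<in> Arr M"
  shows "is_square M (from_init M (Dom M f)) (from_init M (Cod M f)) (Ide M (init_obj M)) f"
  using assms init_obj(1) from_init_unique[of "f \<cdot> from_init M (Dom M f)" "Cod M f"] by (simp add: is_square_def Hom_def)

lemma R_square:
  assumes "f \<in> Arr M"
  shows "is_square M (to_term M (Dom M f)) (to_term M (Cod M f)) f (Ide M (term_obj M))"
  using assms term_obj(1) to_term_unique[of "to_term M (Cod M f) \<cdot> f" "Dom M f"] by (simp add: is_square_def Hom_def)

lemma Qm_arr [simp]: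
  assumes "f \<in> Arr M"
  shows "Qm f \<in> Arr M" "Dom M (Qm f) = Q (Dom M f)" "Cod M (Qm f) = Q (Cod M f)"
  using in_HomD[OF cfac.midm_in[OF Q_square[OF assms]]] by (auto simp: Qf_def)

lemma Rm_arr [simp]:
  assumes "f \<in> Arr M"
  shows "Rm f \<in> Arr M" "Dom M (Rm f) = R (Dom M f)" "Cod M (Rm f) = R (Cod M f)"
  using in_HomD[OF ffac.midm_in[OF R_square[OF assms]]] by (auto simp: Rf_def)

lemma pm_natural: "\<lbrakk>f \<in> Arr M; B = Cod M f\<rbrakk> \<Longrightarrow> p B \<cdot> Qm f = f \<cdot> p (Dom M f)"
  using cfac.midm_right[OF Q_square[of f]] by (simp add: pm_def Qf_def)

lemma qm_natural: "\<lbrakk>f \<in> Arr M; A = Dom M f\<rbrakk> \<Longrightarrow> Rm f \<cdot> q A = q (Cod M f) \<cdot> f"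
  using ffac.midm_left[OF R_square[of f]] by (simp add: qm_def Rf_def)

lemma Qm_Ide [simp]: "A \<in> Obj M \<Longrightarrow> Qm (Ide M A) = Ide M (Q A)"
  using cfac.midm_Ide[of "from_init M A" "init_obj M" A] by (simp add: Qf_def Hom_def)

lemma Rm_Ide [simp]: "A \<in> Obj M \<Longrightarrow> Rm (Ide M A) = Ide M (R A)"
  using ffac.midm_Ide[of "to_term M A" A "term_obj M"] by (simp add: Rf_def Hom_def)

lemma Qm_Comp: "\<lbrakk>f \<in> Arr M; g \<in> Arr M; Cod M f = Dom M g\<rbrakk> \<Longrightarrow> Qm (g \<cdot> f) = Qm g \<cdot> Qm f"
  using cfac.midm_Comp[of "from_init M (Dom M f)" "from_init M (Cod M f)" "Ide M (init_obj M)" f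
      "from_init M (Cod M g)" "Ide M (init_obj M)" g] Q_square[of f] Q_square[of g] init_obj(1)
  by (simp add: Qf_def)

lemma Rm_Comp: "\<lbrakk>f \<in> Arr M; g \<in> Arr M; Cod M f = Dom M g\<rbrakk> \<Longrightarrow> Rm (g \<cdot> f) = Rm g \<cdot> Rm f"
  using ffac.midm_Comp[of "to_term M (Dom M f)" "to_term M (Cod M f)" f "Ide M (term_obj M)"
      "to_term M (Cod M g)" g "Ide M (term_obj M)"] R_square[of f] R_square[of g] term_obj(1)
  by (simp add: Rf_def)

lemma Qm_Weq [simp]: "w \<in> Weq M \<Longrightarrow> Qm w \<in> Weq M"
  using Weq_cancel(1)[of "Qm w" "p (Cod M w)"] classes_Comp(1)[of "p (Dom M w)" w] pm_natural[of w "Cod M w"] by simp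

lemma Rm_Weq [simp]: "w \<in> Weq M \<Longrightarrow> Rm w \<in> Weq M"
  using Weq_cancel(2)[of "q (Dom M w)" "Rm w"] classes_Comp(1)[of w "q (Cod M w)"] qm_natural[of w "Dom M w"] by simp

subsection \<open>Ken Brown's lemma\<close>

text \<open>Only the images in the target category have to be shown invertible, so the coproducts of the
  usual proof can be avoided: two out of six, applied to a chain of trivial fibrations each of which
  has a section up to an isomorphism.\<close>

lemma ken_brown:
  assumes F: "cat_functor M D F"
    and triv: "\<And>c. \<lbrakk>c \<in> Cofs M; c \<in> Weq M; cofibrant M (Dom M c)\<rbrakk> \<Longrightarrow> iso_arr D (farr F c)"
    and w: "w \<in> Weq M" "cofibrant M (Dom M w)" "cofibrant M (Cod M w)"
  shows "iso_arr D (farr F w)"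
proof -
  interpret F: cat_functor M D F by fact
  \<comment> \<open>A section \<open>s\<close> of \<open>t\<close> is factored as a trivial
    cofibration \<open>c\<close> followed by a fibration \<open>g\<close>. Then \<open>g\<close> is
    again a trivial fibration between cofibrant objects, and \<open>F (t \<cdot> g)\<close> after
    \<open>F c\<close> is an identity with \<open>F c\<close> invertible.\<close>
  have 1: "\<exists>t'. t' \<in> Fibs M \<and> t' \<in> Weq M \<and> Cod M t' = Dom M t \<and> cofibrant M (Dom M t') \<and>
    iso_arr D (farr F t \<cdot>\<^bsub>D\<^esub> farr F t')"
    if t: "t \<in> Fibs M" "t \<in> Weq M" "cofibrant M (Dom M t)" "cofibrant M (Cod M t)" for t
  proof -
    have B: "Cod M t \<in> Obj M" using t by simp
    obtain s where s: "s \<in> Arr M" "Dom M s = Cod M t" "Cod M s = Dom M t" "t \<cdot> s = Ide M (Cod M t)"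
      using lift_cofibrant[of "Cod M t" t "Ide M (Cod M t)"] t B by auto
    then have sw: "s \<in> Weq M"
      using Weq_cancel(1)[of s t] t B by simp
    obtain c g where cg: "c \<in> Cofs M" "c \<in> Weq M" "g \<in> Fibs M" "Dom M c = Dom M s" "Cod M c = Dom M g"
        "Cod M g = Cod M s" "g \<cdot> c = s"
      using triv_cof_fib_factorisation[OF s(1)] by metis
    have g: "g \<in> Weq M" using Weq_cancel(2)[of c g] cg sw by simp
    have "(farr F t \<cdot>\<^bsub>D\<^esub> farr F g) \<cdot>\<^bsub>D\<^esub> farr F c = farr F (t \<cdot> g \<cdot> c)"
      using t cg(1-6) s(1-3) by simp
    also have "\<dots> = Ide D (fobj F (Cod M t))" by (simp only: cg(7) s(4) F.farr_Ide[OF B])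
    finally have "(farr F t \<cdot>\<^bsub>D\<^esub> farr F g) \<cdot>\<^bsub>D\<^esub> farr F c = Ide D (fobj F (Cod M t))" .
    then have "iso_arr D ((farr F t \<cdot>\<^bsub>D\<^esub> farr F g) \<cdot>\<^bsub>D\<^esub> farr F c)"
      using B by (simp only: F.tgt.iso_Ide F.fobj_Obj)
    then have "iso_arr D (farr F t \<cdot>\<^bsub>D\<^esub> farr F g)"
      using F.tgt.iso_cancel(1)[of "farr F t \<cdot>\<^bsub>D\<^esub> farr F g" "farr F c"] triv[of c] t cg s by simp
    moreover have "cofibrant M (Dom M g)"
      using cofibrant_Cofs[of c] cg s t by simp
    ultimately show ?thesis using cg(3,6) g s(3) by (intro exI[of _ g]) simp
  qed
  have 2: "iso_arr D (farr F t)"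
    if t: "t \<in> Fibs M" "t \<in> Weq M" "cofibrant M (Dom M t)" "cofibrant M (Cod M t)" for t
  proof -
    obtain t1 where t1: "t1 \<in> Fibs M" "t1 \<in> Weq M" "Cod M t1 = Dom M t" "cofibrant M (Dom M t1)"
      "iso_arr D (farr F t \<cdot>\<^bsub>D\<^esub> farr F t1)"
      using 1[OF t] by blast
    obtain t2 where t2: "t2 \<in> Fibs M" "t2 \<in> Weq M" "Cod M t2 = Dom M t1" "cofibrant M (Dom M t2)"
      "iso_arr D (farr F t1 \<cdot>\<^bsub>D\<^esub> farr F t2)"
      using 1[of t1] t1 t by metis
    show ?thesis
      using F.tgt.iso_two_of_six[of "farr F t2" "farr F t1" "farr F t"] t t1 t2 by simp
  qed
  obtain c g where cg: "c \<in> Cofs M" "c \<in> Weq M" "g \<in> Fibs M" "Dom M c = Dom M w" "Cod M c = Dom M g"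
      "Cod M g = Cod M w" "g \<cdot> c = w"
    using triv_cof_fib_factorisation[of w] w by (metis Weq_Arr)
  have g: "g \<in> Weq M" using Weq_cancel(2)[of c g] cg w by simp
  have "iso_arr D (farr F g)" "iso_arr D (farr F c)"
    using 2[of g] triv[of c] cofibrant_Cofs[of c] cg g w by simp_all
  then have "iso_arr D (farr F g \<cdot>\<^bsub>D\<^esub> farr F c)" using cg by simp
  then show ?thesis using F.farr_Comp'[of c g] cg by simp
qed

text \<open>The argument of \<open>ken_brown\<close> with arrows reversed, with retractions of
  trivial cofibrations in place of sections. It serves the right adjoint
  \<open>\<lbrakk>Y, -\<rbrakk>\<close>, which is controlled between fibrant objects.\<close>

lemma ken_brown_dual:
  assumes F: "cat_functor M D F"
    and triv: "\<And>t. \<lbrakk>t \<in> Fibs M; t \<in> Weq M; fibrant M (Cod M t)\<rbrakk> \<Longrightarrow> iso_arr D (farr F t)"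
    and w: "w \<in> Weq M" "fibrant M (Dom M w)" "fibrant M (Cod M w)"
  shows "iso_arr D (farr F w)"
proof -
  interpret F: cat_functor M D F by fact
  have 1: "\<exists>c'. c' \<in> Cofs M \<and> c' \<in> Weq M \<and> Dom M c' = Cod M c \<and> fibrant M (Cod M c') \<and>
    iso_arr D (farr F c' \<cdot>\<^bsub>D\<^esub> farr F c)"
    if t: "c \<in> Cofs M" "c \<in> Weq M" "fibrant M (Dom M c)" "fibrant M (Cod M c)" for c
  proof -
    have B: "Dom M c \<in> Obj M" using t by simp
    obtain s where s: "s \<in> Arr M" "Dom M s = Cod M c" "Cod M s = Dom M c" "s \<cdot> c = Ide M (Dom M c)"
      using extend_fibrant[of "Dom M c" c "Ide M (Dom M c)"] t B by auto
    then have sw: "s \<in> Weq M"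
      using Weq_cancel(2)[of c s] t B by simp
    obtain d g where cg: "d \<in> Cofs M" "g \<in> Weq M" "g \<in> Fibs M" "Dom M d = Dom M s" "Cod M d = Dom M g"
        "Cod M g = Cod M s" "g \<cdot> d = s"
      using cof_triv_fib_factorisation[OF s(1)] by metis
    have d: "d \<in> Weq M" using Weq_cancel(1)[of d g] cg sw by simp
    have "farr F g \<cdot>\<^bsub>D\<^esub> (farr F d \<cdot>\<^bsub>D\<^esub> farr F c) = farr F ((g \<cdot> d) \<cdot> c)"
      using t cg(1-6) s(1-3) by simp
    also have "\<dots> = Ide D (fobj F (Dom M c))" by (simp only: cg(7) s(4) F.farr_Ide[OF B])
    finally have "farr F g \<cdot>\<^bsub>D\<^esub> (farr F d \<cdot>\<^bsub>D\<^esub> farr F c) = Ide D (fobj F (Dom M c))" .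
    then have "iso_arr D (farr F g \<cdot>\<^bsub>D\<^esub> (farr F d \<cdot>\<^bsub>D\<^esub> farr F c))"
      using B by (simp only: F.tgt.iso_Ide F.fobj_Obj)
    then have "iso_arr D (farr F d \<cdot>\<^bsub>D\<^esub> farr F c)"
      using F.tgt.iso_cancel(2)[of "farr F g" "farr F d \<cdot>\<^bsub>D\<^esub> farr F c"] triv[of g] t cg s by simp
    moreover have "fibrant M (Cod M d)"
      using fibrant_Fibs[of g] cg s t by simp
    ultimately show ?thesis using cg(1,4) d s(2) by (intro exI[of _ d]) simp
  qed
  have 2: "iso_arr D (farr F t)"
    if t: "t \<in> Cofs M" "t \<in> Weq M" "fibrant M (Dom M t)" "fibrant M (Cod M t)" for t
  proof -
    obtain t1 where t1: "t1 \<in> Cofs M" "t1 \<in> Weq M" "Dom M t1 = Cod M t" "fibrant M (Cod M t1)"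
      "iso_arr D (farr F t1 \<cdot>\<^bsub>D\<^esub> farr F t)"
      using 1[OF t] by blast
    obtain t2 where t2: "t2 \<in> Cofs M" "t2 \<in> Weq M" "Dom M t2 = Cod M t1" "fibrant M (Cod M t2)"
      "iso_arr D (farr F t2 \<cdot>\<^bsub>D\<^esub> farr F t1)"
      using 1[of t1] t1 t by metis
    \<comment> \<open>Two out of six yields the last map of the chain, which is now
      \<open>t2\<close>; cancellation carries invertibility back to \<open>t1\<close> and then to
      \<open>t\<close>.\<close>
    have "iso_arr D (farr F t2)"
      using F.tgt.iso_two_of_six[of "farr F t" "farr F t1" "farr F t2"] t t1 t2 by simp
    then have "iso_arr D (farr F t1)"
      using F.tgt.iso_cancel(2)[of "farr F t2" "farr F t1"] t1 t2 by simp
    then show ?thesis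
      using F.tgt.iso_cancel(2)[of "farr F t1" "farr F t"] t t1 by simp
  qed
  obtain c g where cg: "c \<in> Cofs M" "c \<in> Weq M" "g \<in> Fibs M" "Dom M c = Dom M w" "Cod M c = Dom M g"
      "Cod M g = Cod M w" "g \<cdot> c = w"
    using triv_cof_fib_factorisation[of w] w by (metis Weq_Arr)
  have g: "g \<in> Weq M" using Weq_cancel(2)[of c g] cg w by simp
  have "iso_arr D (farr F g)" "iso_arr D (farr F c)"
    using 2[of c] triv[of g] fibrant_Fibs[of g] cg g w by simp_all
  then have "iso_arr D (farr F g \<cdot>\<^bsub>D\<^esub> farr F c)" using cg by simp
  then show ?thesis using F.farr_Comp'[of c g] cg by simp
qed

text \<open>Replaces the homotopy invariance of such functors: maps out of a cofibrant object that agree after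
  composition with a weak equivalence are identified.\<close>

lemma equal_images:
  assumes F: "cat_functor M D F"
    and inv: "\<And>w. \<lbrakk>w \<in> Weq M; cofibrant M (Dom M w); cofibrant M (Cod M w)\<rbrakk> \<Longrightarrow> iso_arr D (farr F w)"
    and fg: "f \<in> Arr M" "g \<in> Arr M" "Dom M f = Dom M g" "Cod M f = Cod M g" "cofibrant M (Dom M g)"
    and t: "t \<in> Weq M" "Dom M t = Cod M g" "t \<cdot> f = t \<cdot> g"
  shows "farr F f = farr F g"
proof -
  interpret F: cat_functor M D F by fact
  \<comment> \<open>The cofibrant case. The codomain of \<open>t\<close> is arbitrary, so
    \<open>t\<close> is replaced by \<open>Qm t\<close>, which \<open>F\<close> inverts. This
    identifies the images of \<open>Qm f\<close> and \<open>Qm g\<close>, and naturality of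
    \<open>p\<close> brings the conclusion back to \<open>f\<close> and \<open>g\<close>.\<close>
  have cof: "farr F f = farr F g"
    if "f \<in> Arr M" "g \<in> Arr M" "Dom M f = Dom M g" "Cod M f = Cod M g" "cofibrant M (Dom M g)" "cofibrant M (Cod M g)"
      "t \<in> Weq M" "Dom M t = Cod M g" "t \<cdot> f = t \<cdot> g" for f g t
  proof -
    have "farr F (Qm t) \<cdot>\<^bsub>D\<^esub> farr F (Qm f) = farr F (Qm (t \<cdot> f))"
      "farr F (Qm t) \<cdot>\<^bsub>D\<^esub> farr F (Qm g) = farr F (Qm (t \<cdot> g))"
      using that(1-8) by (simp_all add: Qm_Comp)
    then have "farr F (Qm t) \<cdot>\<^bsub>D\<^esub> farr F (Qm f) = farr F (Qm t) \<cdot>\<^bsub>D\<^esub> farr F (Qm g)"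
      by (simp only: that(9))
    moreover have "iso_arr D (farr F (Qm t))" using inv[of "Qm t"] that by simp
    ultimately have Qfg: "farr F (Qm f) = farr F (Qm g)"
      using F.tgt.iso_mono[of "farr F (Qm t)" "farr F (Qm f)" "farr F (Qm g)"] that by simp
    have nat: "farr F h \<cdot>\<^bsub>D\<^esub> farr F (p (Dom M h)) = farr F (p (Cod M h)) \<cdot>\<^bsub>D\<^esub> farr F (Qm h)" if "h \<in> Arr M" for h
      using that F.farr_Comp'[of "Qm h" "p (Cod M h)"] F.farr_Comp'[of "p (Dom M h)" h] by (simp add: pm_natural)
    have "farr F f \<cdot>\<^bsub>D\<^esub> farr F (p (Dom M g)) = farr F g \<cdot>\<^bsub>D\<^esub> farr F (p (Dom M g))"
      using nat[of f] nat[of g] Qfg that by metis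
    moreover have "iso_arr D (farr F (p (Dom M g)))"
      using inv[of "p (Dom M g)"] that by simp
    ultimately show ?thesis
      using F.tgt.iso_epi[of "farr F (p (Dom M g))" "farr F f" "farr F g"] that by simp
  qed
  let ?B = "Cod M g"
  have B: "?B \<in> Obj M" using fg by simp
  \<comment> \<open>An arbitrary codomain is reached by lifting both maps through \<open>p\<close>,
    with \<open>t \<cdot> p ?B\<close> in the role of \<open>t\<close>.\<close>
  obtain f1 where f1: "f1 \<in> Arr M" "Dom M f1 = Dom M g" "Cod M f1 = Q ?B" "p ?B \<cdot> f1 = f"
    using lift_cofibrant[of "Dom M g" "p ?B" f] fg B by auto
  obtain g1 where g1: "g1 \<in> Arr M" "Dom M g1 = Dom M g" "Cod M g1 = Q ?B" "p ?B \<cdot> g1 = g"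
    using lift_cofibrant[of "Dom M g" "p ?B" g] fg B by auto
  have "(t \<cdot> p ?B) \<cdot> f1 = t \<cdot> f" "(t \<cdot> p ?B) \<cdot> g1 = t \<cdot> g"
    using f1 g1 t(1,2) B by simp_all
  then have "(t \<cdot> p ?B) \<cdot> f1 = (t \<cdot> p ?B) \<cdot> g1"
    using t(3) by simp
  then have "farr F f1 = farr F g1"
    using cof[of f1 g1 "t \<cdot> p ?B"] f1 g1 t(1,2) B fg classes_Comp(1)[of "p ?B" t] by simp
  then show ?thesis
    using F.farr_Comp'[of f1 "p ?B"] F.farr_Comp'[of g1 "p ?B"] f1 g1 B by simp
qed

subsection \<open>Fullness of the localisation functor\<close>

lemma \<gamma>_full:
  assumes "h \<in> Arr H" "cofibrant M (Dom H h)"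
  obtains f where "f \<in> Arr M" "Dom M f = Dom H h" "Cod M f = R (Cod H h)" "\<gamma> M (q (Cod H h)) \<bullet> h = \<gamma> M f"
proof -
  have Ho_Obj: "Dom H x \<in> Obj M" "Cod H x \<in> Obj M" if "x \<in> Arr H" for x
    using H.Dom_Obj[OF that] H.Cod_Obj[OF that] by simp_all
  \<comment> \<open>The claim is strengthened by an arbitrary \<open>f\<close> from a cofibrant
    object into the fibrant replacement of the source. The resulting \<open>g\<close> has the same
    shape, so it can be fed into the next factor of a composite.\<close>
  have "\<forall>f \<in> Arr M. cofibrant M (Dom M f) \<and> Cod M f = R (Dom H h) \<longrightarrow>
    (\<exists>g \<in> Arr M. Dom M g = Dom M f \<and> Cod M g = R (Cod H h) \<and>
      \<gamma> M (q (Cod H h)) \<bullet> h \<bullet> inv_arr H (\<gamma> M (q (Dom H h))) \<bullet> \<gamma> M f = \<gamma> M g)"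
    using assms(1)
  proof (induction rule: ho_induct)
    case (arr h)
    show ?case
    proof (intro ballI impI)
      fix f assume f: "f \<in> Arr M" "cofibrant M (Dom M f) \<and> Cod M f = R (Dom H (\<gamma> M h))"
      have "\<gamma> M (q (Cod M h)) \<bullet> \<gamma> M h \<bullet> inv_arr H (\<gamma> M (q (Dom M h))) \<bullet> \<gamma> M f
        = \<gamma> M (Rm h) \<bullet> \<gamma> M (q (Dom M h)) \<bullet> inv_arr H (\<gamma> M (q (Dom M h))) \<bullet> \<gamma> M f"
        using arr f H.rewr2[of "\<gamma> M (q (Cod M h))" "\<gamma> M h" "\<gamma> M (Rm h)" "\<gamma> M (q (Dom M h))"
            "inv_arr H (\<gamma> M (q (Dom M h))) \<bullet> \<gamma> M f"]
        by (simp add: qm_natural del: \<gamma>_Comp_rev')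
      also have "\<dots> = \<gamma> M (Rm h \<cdot> f)" using arr f by simp
      finally show "\<exists>g\<in>Arr M. Dom M g = Dom M f \<and> Cod M g = R (Cod H (\<gamma> M h)) \<and>
        \<gamma> M (q (Cod H (\<gamma> M h))) \<bullet> \<gamma> M h \<bullet> inv_arr H (\<gamma> M (q (Dom H (\<gamma> M h)))) \<bullet> \<gamma> M f = \<gamma> M g"
        using arr f by (intro bexI[of _ "Rm h \<cdot> f"]) simp_all
    qed
  next
    case (comp h k)
    show ?case
    proof (intro ballI impI)
      fix f assume f: "f \<in> Arr M" "cofibrant M (Dom M f) \<and> Cod M f = R (Dom H (k \<bullet> h))"
      note o = Ho_Obj[OF comp(1)] Ho_Obj[OF comp(2)]
      obtain g where g: "g \<in> Arr M" "Dom M g = Dom M f" "Cod M g = R (Cod H h)"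
        "\<gamma> M (q (Cod H h)) \<bullet> h \<bullet> inv_arr H (\<gamma> M (q (Dom H h))) \<bullet> \<gamma> M f = \<gamma> M g"
        using comp f by auto
      have k: "h \<bullet> inv_arr H (\<gamma> M (q (Dom H h))) \<bullet> \<gamma> M f = inv_arr H (\<gamma> M (q (Cod H h))) \<bullet> \<gamma> M g"
        using g(1-3) f comp(1-3) o
        by (intro H.iso_move_left[OF _ g(4)]) simp_all
      obtain g' where g': "g' \<in> Arr M" "Dom M g' = Dom M g" "Cod M g' = R (Cod H k)"
        "\<gamma> M (q (Cod H k)) \<bullet> k \<bullet> inv_arr H (\<gamma> M (q (Dom H k))) \<bullet> \<gamma> M g = \<gamma> M g'"
        using comp(5) comp(3) g(1-3) f by auto
      have "\<gamma> M (q (Cod H (k \<bullet> h))) \<bullet> (k \<bullet> h) \<bullet> inv_arr H (\<gamma> M (q (Dom H (k \<bullet> h)))) \<bullet> \<gamma> M f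
        = \<gamma> M (q (Cod H k)) \<bullet> k \<bullet> (h \<bullet> inv_arr H (\<gamma> M (q (Dom H h))) \<bullet> \<gamma> M f)"
        using comp(1-3) o f by simp
      then show "\<exists>g\<in>Arr M. Dom M g = Dom M f \<and> Cod M g = R (Cod H (k \<bullet> h)) \<and>
        \<gamma> M (q (Cod H (k \<bullet> h))) \<bullet> (k \<bullet> h) \<bullet> inv_arr H (\<gamma> M (q (Dom H (k \<bullet> h)))) \<bullet> \<gamma> M f = \<gamma> M g"
        unfolding k using g' g(1-3) comp(1-3) f by (intro bexI[of _ g']) simp_all
    qed
  next
    case (inv w)
    show ?case
    proof (intro ballI impI)
      fix f assume f: "f \<in> Arr M" "cofibrant M (Dom M f) \<and> Cod M f = R (Dom H (inv_arr H (\<gamma> M w)))"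
      have w: "w \<in> Arr M" using inv by simp
      \<comment> \<open>To apply the formal inverse of \<open>w\<close> to \<open>f\<close>, factor
        \<open>Rm w\<close> as a trivial cofibration \<open>c\<close> and a trivial fibration
        \<open>t\<close>, lift \<open>f\<close> through \<open>t\<close> because its domain is
        cofibrant, and retract along \<open>s\<close> because \<open>R (Dom M w)\<close> is
        fibrant.\<close>
      obtain c t where ct: "c \<in> Cofs M" "c \<in> Weq M" "t \<in> Fibs M" "Dom M c = R (Dom M w)" "Cod M c = Dom M t"
          "Cod M t = R (Cod M w)" "t \<cdot> c = Rm w"
        using triv_cof_fib_factorisation[of "Rm w"] w by auto
      have t: "t \<in> Weq M" using Weq_cancel(2)[of c t] ct inv by simp
      obtain f1 where f1: "f1 \<in> Arr M" "Dom M f1 = Dom M f" "Cod M f1 = Dom M t" "t \<cdot> f1 = f"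
        using lift_cofibrant[of "Dom M f" t f] ct t f w inv by auto
      obtain s where s: "s \<in> Arr M" "Dom M s = Cod M c" "Cod M s = R (Dom M w)" "s \<cdot> c = Ide M (R (Dom M w))"
        using extend_fibrant[of "R (Dom M w)" c "Ide M (R (Dom M w))"] ct w by auto
      have sw: "s \<in> Weq M" using Weq_cancel(2)[of c s] s ct w by simp
      have cs: "\<gamma> M c \<bullet> \<gamma> M s = Ide H (Cod M c)"
      proof -
        have "\<gamma> M s = inv_arr H (\<gamma> M c)"
          using H.iso_move_right[of "\<gamma> M c" "\<gamma> M s" "Ide H (R (Dom M w))"] s ct w by (simp add: \<gamma>_Ide)
        then show ?thesis using ct by (simp del: \<gamma>_Comp_rev)
      qed
      have "\<gamma> M (Rm w) \<bullet> \<gamma> M (s \<cdot> f1) = (\<gamma> M t \<bullet> \<gamma> M c) \<bullet> (\<gamma> M s \<bullet> \<gamma> M f1)"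
        using s f1 ct by simp
      also have "\<dots> = \<gamma> M t \<bullet> (\<gamma> M c \<bullet> \<gamma> M s) \<bullet> \<gamma> M f1"
        using s f1 ct by (simp del: \<gamma>_Comp_rev \<gamma>_Comp_rev')
      also have "\<dots> = \<gamma> M f" unfolding cs using s f1 ct by simp
      finally have 1: "\<gamma> M (Rm w) \<bullet> \<gamma> M (s \<cdot> f1) = \<gamma> M f" .
      have 2: "\<gamma> M (q (Dom M w)) \<bullet> inv_arr H (\<gamma> M w) = inv_arr H (\<gamma> M (Rm w)) \<bullet> \<gamma> M (q (Cod M w))"
        by (rule H.exchange_inv) (use w inv in \<open>simp_all add: qm_natural\<close>)
      have "\<gamma> M (q (Dom M w)) \<bullet> inv_arr H (\<gamma> M w) \<bullet> inv_arr H (\<gamma> M (q (Cod M w))) \<bullet> \<gamma> M f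
        = (\<gamma> M (q (Dom M w)) \<bullet> inv_arr H (\<gamma> M w)) \<bullet> inv_arr H (\<gamma> M (q (Cod M w))) \<bullet> \<gamma> M f"
        using w inv f by simp
      also have "\<dots> = inv_arr H (\<gamma> M (Rm w)) \<bullet> \<gamma> M f"
        unfolding 2 using w inv f by simp
      also have "\<dots> = \<gamma> M (s \<cdot> f1)"
        unfolding 1[symmetric] using w inv s f1 ct by (simp del: \<gamma>_Comp_rev)
      finally show "\<exists>g\<in>Arr M. Dom M g = Dom M f \<and> Cod M g = R (Cod H (inv_arr H (\<gamma> M w))) \<and>
        \<gamma> M (q (Cod H (inv_arr H (\<gamma> M w)))) \<bullet> inv_arr H (\<gamma> M w) \<bullet> inv_arr H (\<gamma> M (q (Dom H (inv_arr H (\<gamma> M w))))) \<bullet> \<gamma> M f = \<gamma> M g"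
        using w inv s f1(1-3) f ct(5) by (intro bexI[of _ "s \<cdot> f1"]) simp_all
    qed
  qed
  moreover have "Dom H h \<in> Obj M" "Cod H h \<in> Obj M" using Ho_Obj assms by auto
  \<comment> \<open>With \<open>f\<close> chosen as \<open>q (Dom H h)\<close>, the inverse of
    \<open>q\<close> in the strengthened claim cancels.\<close>
  ultimately show thesis
    using that assms by (auto dest!: bspec[of _ _ "q (Dom H h)"])
qed

text \<open>A fibrant \<open>B\<close> is a retract of \<open>R B\<close>; the retraction of
  \<open>q B\<close> turns the representative with codomain \<open>R B\<close> into one with
  codomain \<open>B\<close>.\<close>

lemma \<gamma>_surj:
  assumes "h \<in> Arr H" "Dom H h = A" "Cod H h = B" "cofibrant M A" "fibrant M B"
  obtains f where "f \<in> Arr M" "Dom M f = A" "Cod M f = B" "\<gamma> M f = h"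
proof -
  have B: "B \<in> Obj M" using fibrant_Obj assms by blast
  obtain f where f: "f \<in> Arr M" "Dom M f = A" "Cod M f = R B" "\<gamma> M (q B) \<bullet> h = \<gamma> M f"
    using \<gamma>_full[OF assms(1)] assms by metis
  obtain s where s: "s \<in> Arr M" "Dom M s = R B" "Cod M s = B" "s \<cdot> q B = Ide M B"
    using extend_fibrant[of B "q B" "Ide M B"] assms B by auto
  have "\<gamma> M (s \<cdot> f) = \<gamma> M s \<bullet> \<gamma> M (q B) \<bullet> h"
    unfolding f(4) using s f by simp
  also have "\<dots> = h"
    using s B assms by (simp add: \<gamma>_Ide)
  finally show thesis using that[of "s \<cdot> f"] s f by simp
qed

end

section \<open>Monoidal skew closed model categories\<close>

locale monoidal_model_category = model_category M + tensor_hom_adjunction M T S \<phi>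
  for M :: "('o, 'm) model" (structure)
    and T :: "('o, 'm) skew_mon" and S :: "('o, 'm) skew_clo"
    and \<phi> :: "'o \<Rightarrow> 'o \<Rightarrow> 'o \<Rightarrow> 'm \<Rightarrow> 'm" +
  assumes MC: "axiom_MC M T"
begin

declare cofibrant_Obj [simp] fibrant_Obj [simp]

section \<open>Tensor product and internal hom under Axiom MC\<close>

lemma cofibrant_unit [simp]: "cofibrant M (tunit T)"
  using MC by (simp add: axiom_MC_def)

lemma tensor_Cofs:
  assumes "cofibrant M X" "f \<in> Cofs M"
  shows "f \<otimes>\<^sub>m Ide M X \<in> Cofs M" "f \<in> Weq M \<Longrightarrow> f \<otimes>\<^sub>m Ide M X \<in> Weq M"
  using MC assms by (auto simp: axiom_MC_def left_quillen_def sec1_def)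

lemma tensor_Weq2:
  assumes "cofibrant M Y" "w \<in> Weq M" "cofibrant M (Dom M w)" "cofibrant M (Cod M w)"
  shows "Ide M Y \<otimes>\<^sub>m w \<in> Weq M"
  using MC assms by (auto simp: axiom_MC_def sec2_def)

text \<open>Tensoring with \<open>Y\<close>, a left adjoint, preserves the initial object: the
  transpose of the map from the initial object to \<open>\<lbrakk>Y, init_obj M\<rbrakk>\<close>
  inverts the map to \<open>?Z\<close>. The cofibration from \<open>?Z\<close> to
  \<open>X \<otimes> Y\<close> then makes its codomain cofibrant.\<close>

lemma cofibrant_tensor [simp]:
  assumes "cofibrant M X" "cofibrant M Y"
  shows "cofibrant M (X \<otimes> Y)"
proof -
  have o [simp]: "X \<in> Obj M" "Y \<in> Obj M" "init_obj M \<in> Obj M" using assms init_obj by auto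
  let ?Z = "init_obj M \<otimes> Y" and ?u = "un Y (init_obj M) (from_init M \<lbrakk>Y, init_obj M\<rbrakk>)"
  have 1: "?u \<cdot> from_init M ?Z = Ide M (init_obj M)"
    using from_init_unique[of "?u \<cdot> from_init M ?Z" "init_obj M"] from_init_unique[of "Ide M (init_obj M)" "init_obj M"]
    by simp
  have "\<phi> (init_obj M) Y ?Z (from_init M ?Z \<cdot> ?u) = \<phi> (init_obj M) Y ?Z (Ide M ?Z)"
    using from_init_unique[of "\<phi> (init_obj M) Y ?Z (from_init M ?Z \<cdot> ?u)" "\<lbrakk>Y, ?Z\<rbrakk>"]
      from_init_unique[of "\<phi> (init_obj M) Y ?Z (Ide M ?Z)" "\<lbrakk>Y, ?Z\<rbrakk>"] by simp
  then have "un Y ?Z (\<phi> (init_obj M) Y ?Z (from_init M ?Z \<cdot> ?u)) = un Y ?Z (\<phi> (init_obj M) Y ?Z (Ide M ?Z))"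
    by simp
  then have 2: "from_init M ?Z \<cdot> ?u = Ide M ?Z"
    by simp
  have "iso_arr M (from_init M ?Z)"
    using isoI(2)[of "from_init M ?Z" ?u] 1 2 by simp
  then have "from_init M ?Z \<in> Cofs M" by (rule iso_classes)
  then have "cofibrant M ?Z" by (simp add: cofibrant_def)
  moreover have "from_init M X \<otimes>\<^sub>m Ide M Y \<in> Cofs M"
    using tensor_Cofs assms by (simp add: cofibrant_def)
  ultimately show ?thesis
    using cofibrant_Cofs[of "from_init M X \<otimes>\<^sub>m Ide M Y"] by simp
qed

text \<open>In the first variable Axiom MC speaks of cofibrations and trivial cofibrations, so Ken
  Brown's lemma is needed, and in the form above it yields invertibility after localisation. In the
  second variable the axiom gives weak equivalences directly.\<close>

lemma tensor_iso1 [simp]: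
  assumes "cofibrant M Y" "w \<in> Weq M" "cofibrant M (Dom M w)" "cofibrant M (Cod M w)"
  shows "iso_arr H (\<gamma> M (w \<otimes>\<^sub>m Ide M Y))"
proof -
  let ?F = "\<lparr>fobj = (\<lambda>A. A \<otimes> Y), farr = (\<lambda>f. \<gamma> M (f \<otimes>\<^sub>m Ide M Y))\<rparr>"
  have "iso_arr H (farr ?F w)"
  proof (rule ken_brown)
    show "cat_functor M H ?F"
      by (rule cat_functorI) (use assms in \<open>simp_all add: \<gamma>_Ide category_axioms category_Ho\<close>)
  qed (use assms tensor_Cofs in auto)
  then show ?thesis by simp
qed

lemma tensor_iso2 [simp]:
  "\<lbrakk>cofibrant M Y; w \<in> Weq M; cofibrant M (Dom M w); cofibrant M (Cod M w)\<rbrakk>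
   \<Longrightarrow> iso_arr H (\<gamma> M (Ide M Y \<otimes>\<^sub>m w))"
  using tensor_Weq2 by simp

text \<open>The lifting problem transposes to one for \<open>c \<otimes>\<^sub>m Ide M Y\<close>
  against \<open>t\<close>: \<open>un\<close> carries the square over, and \<open>\<phi>\<close>
  carries the diagonal back.\<close>

lemma hom_lifting:
  assumes "Y \<in> Obj M" "t \<in> Arr M" "c \<in> Arr M" "has_lifting M (c \<otimes>\<^sub>m Ide M Y) t"
  shows "has_lifting M c \<lbrakk>Ide M Y, t\<rbrakk>\<^sub>m"
  unfolding has_lifting_def
proof (intro allI impI)
  fix u v assume sq: "is_square M c \<lbrakk>Ide M Y, t\<rbrakk>\<^sub>m u v"
  let ?E = "Dom M t" and ?D = "Cod M t"
  from sq assms have uv [simp]: "u \<in> Arr M" "Dom M u = Dom M c" "Cod M u = \<lbrakk>Y, ?E\<rbrakk>"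
      "v \<in> Arr M" "Dom M v = Cod M c" "Cod M v = \<lbrakk>Y, ?D\<rbrakk>" and e: "\<lbrakk>Ide M Y, t\<rbrakk>\<^sub>m \<cdot> u = v \<cdot> c"
    by (auto simp: is_square_def Hom_def)
  note [simp] = assms(1-3)
  have "t \<cdot> un Y ?E u = un Y ?D (\<phi> (Dom M c) Y ?D (t \<cdot> un Y ?E u))" by simp
  also have "\<phi> (Dom M c) Y ?D (t \<cdot> un Y ?E u) = v \<cdot> c"
    using \<phi>_post[of "Dom M c" Y "un Y ?E u" ?E t ?D] e by simp
  also have "v \<cdot> c = \<phi> (Dom M c) Y ?D (un Y ?D v \<cdot> (c \<otimes>\<^sub>m Ide M Y))"
    using \<phi>_pre1[of "Cod M c" Y "un Y ?D v" ?D c "Dom M c"] by simp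
  also have "un Y ?D \<dots> = un Y ?D v \<cdot> (c \<otimes>\<^sub>m Ide M Y)" by simp
  finally have "is_square M (c \<otimes>\<^sub>m Ide M Y) t (un Y ?E u) (un Y ?D v)"
    by (simp add: is_square_def Hom_def)
  then obtain d where d [simp]: "d \<in> Arr M" "Dom M d = Cod M c \<otimes> Y" "Cod M d = ?E" and
      e1: "d \<cdot> (c \<otimes>\<^sub>m Ide M Y) = un Y ?E u" and e2: "t \<cdot> d = un Y ?D v"
    using assms(4) by (auto simp: has_lifting_def Hom_def)
  have "\<phi> (Cod M c) Y ?E d \<cdot> c = u"
    using \<phi>_pre1[of "Cod M c" Y d ?E c "Dom M c"] by (simp add: e1)
  moreover have "\<lbrakk>Ide M Y, t\<rbrakk>\<^sub>m \<cdot> \<phi> (Cod M c) Y ?E d = v"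
    using \<phi>_post[of "Cod M c" Y d ?E t ?D] by (simp add: e2)
  ultimately show "\<exists>d\<in>Hom M (Cod M c) (Dom M \<lbrakk>Ide M Y, t\<rbrakk>\<^sub>m). d \<cdot> c = u \<and> \<lbrakk>Ide M Y, t\<rbrakk>\<^sub>m \<cdot> d = v"
    by (intro bexI[of _ "\<phi> (Cod M c) Y ?E d"]) (simp_all add: Hom_def)
qed

lemma hom_triv_fib [simp]:
  assumes "cofibrant M Y" "t \<in> Fibs M" "t \<in> Weq M"
  shows "\<lbrakk>Ide M Y, t\<rbrakk>\<^sub>m \<in> Fibs M" "\<lbrakk>Ide M Y, t\<rbrakk>\<^sub>m \<in> Weq M"
proof -
  have "has_lifting M c \<lbrakk>Ide M Y, t\<rbrakk>\<^sub>m" if "c \<in> Cofs M" for c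
    using hom_lifting[of Y t c] lifting2[of "c \<otimes>\<^sub>m Ide M Y" t] tensor_Cofs[of Y c] assms that by simp
  then show "\<lbrakk>Ide M Y, t\<rbrakk>\<^sub>m \<in> Fibs M" "\<lbrakk>Ide M Y, t\<rbrakk>\<^sub>m \<in> Weq M"
    using triv_fib_if_lifting[of "\<lbrakk>Ide M Y, t\<rbrakk>\<^sub>m"] assms by simp_all
qed

lemma hom_fib:
  assumes "cofibrant M Y" "t \<in> Fibs M"
  shows "\<lbrakk>Ide M Y, t\<rbrakk>\<^sub>m \<in> Fibs M"
proof -
  have "has_lifting M c \<lbrakk>Ide M Y, t\<rbrakk>\<^sub>m" if "c \<in> Cofs M" "c \<in> Weq M" for c
    using hom_lifting[of Y t c] lifting1[of "c \<otimes>\<^sub>m Ide M Y" t] tensor_Cofs[of Y c] assms that by simp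
  then show ?thesis
    using fib_if_lifting[of "\<lbrakk>Ide M Y, t\<rbrakk>\<^sub>m"] assms by simp
qed

text \<open>Dual to \<open>cofibrant_tensor\<close>: the right adjoint preserves the terminal
  object, and \<open>\<lbrakk>Y, Z\<rbrakk>\<close> has a fibration onto a terminal, hence fibrant,
  object.\<close>

lemma fibrant_hom [simp]:
  assumes "cofibrant M Y" "fibrant M Z"
  shows "fibrant M \<lbrakk>Y, Z\<rbrakk>"
proof -
  have o [simp]: "Y \<in> Obj M" "Z \<in> Obj M" "term_obj M \<in> Obj M" using assms term_obj by auto
  let ?D = "\<lbrakk>Y, term_obj M\<rbrakk>" and ?u = "\<phi> (term_obj M) Y (term_obj M) (to_term M (term_obj M \<otimes> Y))"
  have 1: "to_term M ?D \<cdot> ?u = Ide M (term_obj M)"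
    using to_term_unique[of "to_term M ?D \<cdot> ?u" "term_obj M"] to_term_unique[of "Ide M (term_obj M)" "term_obj M"]
    by simp
  have "un Y (term_obj M) (?u \<cdot> to_term M ?D) = un Y (term_obj M) (Ide M ?D)"
    using to_term_unique[of "un Y (term_obj M) (?u \<cdot> to_term M ?D)" "?D \<otimes> Y"]
      to_term_unique[of "un Y (term_obj M) (Ide M ?D)" "?D \<otimes> Y"] by simp
  then have "\<phi> ?D Y (term_obj M) (un Y (term_obj M) (?u \<cdot> to_term M ?D)) = \<phi> ?D Y (term_obj M) (un Y (term_obj M) (Ide M ?D))"
    by simp
  then have 2: "?u \<cdot> to_term M ?D = Ide M ?D"
    by simp
  have "iso_arr M (to_term M ?D)"
    using isoI(2)[of "to_term M ?D" ?u] 1 2 by simp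
  then have "to_term M ?D \<in> Fibs M" by (rule iso_classes)
  then have "fibrant M ?D" by (simp add: fibrant_def)
  moreover have "\<lbrakk>Ide M Y, to_term M Z\<rbrakk>\<^sub>m \<in> Fibs M"
    using hom_fib assms by (simp add: fibrant_def)
  ultimately show ?thesis
    using fibrant_Fibs[of "\<lbrakk>Ide M Y, to_term M Z\<rbrakk>\<^sub>m"] by simp
qed

lemma hom_iso2 [simp]:
  assumes "cofibrant M Y" "w \<in> Weq M" "fibrant M (Dom M w)" "fibrant M (Cod M w)"
  shows "iso_arr H (\<gamma> M \<lbrakk>Ide M Y, w\<rbrakk>\<^sub>m)"
proof -
  let ?F = "\<lparr>fobj = (\<lambda>A. \<lbrakk>Y, A\<rbrakk>), farr = (\<lambda>f. \<gamma> M \<lbrakk>Ide M Y, f\<rbrakk>\<^sub>m)\<rparr>"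
  have "iso_arr H (farr ?F w)"
  proof (rule ken_brown_dual)
    show "cat_functor M H ?F"
      by (rule cat_functorI) (use assms in \<open>simp_all add: \<gamma>_Ide category_axioms category_Ho\<close>)
  qed (use assms in simp_all)
  then show ?thesis by simp
qed

section \<open>The adjunction on homotopy classes\<close>

lemma \<gamma>_\<phi>_cong:
  assumes "X \<in> Obj M" "cofibrant M Y" "fibrant M Z"
    and f: "f \<in> Arr M" "Dom M f = X \<otimes> Y" "Cod M f = Z" and f': "f' \<in> Arr M" "Dom M f' = X \<otimes> Y" "Cod M f' = Z"
    and e: "\<gamma> M f = \<gamma> M f'"
  shows "\<gamma> M (\<phi> X Y Z f) = \<gamma> M (\<phi> X Y Z f')"
proof -
  note [simp] = assms(1-3)
  \<comment> \<open>By naturality, \<open>\<phi> h\<close> is \<open>\<lbrakk>1, h\<rbrakk>\<close>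
    after the unit, but \<open>\<lbrakk>Y, -\<rbrakk>\<close> is controlled only between fibrant
    objects and \<open>X \<otimes> Y\<close> need not be fibrant. Inserting \<open>R\<close> gives a
    functor that inverts all weak equivalences; \<open>\<lbrakk>1, q\<rbrakk>\<close> can be
    cancelled because \<open>Z\<close> is fibrant.\<close>
  let ?F = "\<lparr>fobj = (\<lambda>A. \<lbrakk>Y, R A\<rbrakk>), farr = (\<lambda>f. \<gamma> M \<lbrakk>Ide M Y, Rm f\<rbrakk>\<^sub>m)\<rparr>"
  interpret F: weq_inverting M H ?F
    by (rule weq_invertingI) (simp_all add: \<gamma>_Ide category_Ho Rm_Comp)
  let ?v = "\<gamma> M (\<phi> X Y (R (X \<otimes> Y)) (q (X \<otimes> Y)))"
  have *: "\<gamma> M \<lbrakk>Ide M Y, q Z\<rbrakk>\<^sub>m \<bullet> \<gamma> M (\<phi> X Y Z h) = farr (ho_ext M H ?F) (\<gamma> M h) \<bullet> ?v"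
    if h: "h \<in> Arr M" "Dom M h = X \<otimes> Y" "Cod M h = Z" for h
  proof -
    have "\<lbrakk>Ide M Y, q Z\<rbrakk>\<^sub>m \<cdot> \<phi> X Y Z h = \<phi> X Y (R Z) (q Z \<cdot> h)"
      using \<phi>_post[of X Y h Z "q Z" "R Z"] h by simp
    also have "q Z \<cdot> h = Rm h \<cdot> q (X \<otimes> Y)" using h by (simp add: qm_natural)
    also have "\<phi> X Y (R Z) \<dots> = \<lbrakk>Ide M Y, Rm h\<rbrakk>\<^sub>m \<cdot> \<phi> X Y (R (X \<otimes> Y)) (q (X \<otimes> Y))"
      using \<phi>_post[of X Y "q (X \<otimes> Y)" "R (X \<otimes> Y)" "Rm h" "R Z"] h by simp
    finally show ?thesis using h by (simp add: F.ho_ext_\<gamma>)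
  qed
  have "\<gamma> M \<lbrakk>Ide M Y, q Z\<rbrakk>\<^sub>m \<bullet> \<gamma> M (\<phi> X Y Z f) = \<gamma> M \<lbrakk>Ide M Y, q Z\<rbrakk>\<^sub>m \<bullet> \<gamma> M (\<phi> X Y Z f')"
    unfolding *[OF f] *[OF f'] e ..
  from H.iso_mono[OF _ this] show ?thesis
    using f f' by simp
qed

lemma \<gamma>_un_cong:
  assumes "cofibrant M X" "cofibrant M Y" "Z \<in> Obj M"
    and f: "f \<in> Arr M" "Dom M f = X" "Cod M f = \<lbrakk>Y, Z\<rbrakk>" and f': "f' \<in> Arr M" "Dom M f' = X" "Cod M f' = \<lbrakk>Y, Z\<rbrakk>"
    and e: "\<gamma> M f = \<gamma> M f'"
  shows "\<gamma> M (un Y Z f) = \<gamma> M (un Y Z f')"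
proof -
  note [simp] = assms(1-3)
  \<comment> \<open>The mirror image: \<open>Q\<close> is inserted before tensoring, and
    \<open>p X \<otimes>\<^sub>m Ide M Y\<close> can be cancelled after localisation because
    \<open>X\<close> is cofibrant.\<close>
  let ?F = "\<lparr>fobj = (\<lambda>A. Q A \<otimes> Y), farr = (\<lambda>f. \<gamma> M (Qm f \<otimes>\<^sub>m Ide M Y))\<rparr>"
  interpret F: weq_inverting M H ?F
    by (rule weq_invertingI) (simp_all add: \<gamma>_Ide category_Ho Qm_Comp)
  let ?v = "\<gamma> M (un Y Z (p \<lbrakk>Y, Z\<rbrakk>))"
  have *: "\<gamma> M (un Y Z h) \<bullet> \<gamma> M (p X \<otimes>\<^sub>m Ide M Y) = ?v \<bullet> farr (ho_ext M H ?F) (\<gamma> M h)"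
    if h: "h \<in> Arr M" "Dom M h = X" "Cod M h = \<lbrakk>Y, Z\<rbrakk>" for h
    using h pm_natural[of h "\<lbrakk>Y, Z\<rbrakk>"] by (simp add: un_def F.ho_ext_\<gamma>)
  have "\<gamma> M (un Y Z f) \<bullet> \<gamma> M (p X \<otimes>\<^sub>m Ide M Y) = \<gamma> M (un Y Z f') \<bullet> \<gamma> M (p X \<otimes>\<^sub>m Ide M Y)"
    unfolding *[OF f] *[OF f'] e ..
  from H.iso_epi[OF _ this] show ?thesis
    using f f' by simp
qed

lemma phi_ho_\<gamma>:
  assumes "X \<in> Obj M" "cofibrant M Y" "fibrant M Z" "f \<in> Arr M" "Dom M f = X \<otimes> Y" "Cod M f = Z"
  shows "phi_ho M T \<phi> X Y Z (\<gamma> M f) = \<gamma> M (\<phi> X Y Z f)"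
  unfolding phi_ho_def
proof (rule the_equality)
  show "\<exists>fa\<in>Hom M (X \<otimes> Y) Z. \<gamma> M fa = \<gamma> M f \<and> \<gamma> M (\<phi> X Y Z f) = \<gamma> M (\<phi> X Y Z fa)"
    using assms by (intro bexI[of _ f]) (auto simp: Hom_def)
  fix h assume "\<exists>fa\<in>Hom M (X \<otimes> Y) Z. \<gamma> M fa = \<gamma> M f \<and> h = \<gamma> M (\<phi> X Y Z fa)"
  then obtain g where g: "g \<in> Hom M (X \<otimes> Y) Z" "\<gamma> M g = \<gamma> M f" "h = \<gamma> M (\<phi> X Y Z g)"
    by blast
  show "h = \<gamma> M (\<phi> X Y Z f)"
    unfolding g(3) by (rule \<gamma>_\<phi>_cong[OF assms(1-3) in_HomD[OF g(1)] assms(4-6) g(2)])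
qed

text \<open>All maps concerned have representatives in \<open>M\<close>, as \<open>X\<close> and
  \<open>X \<otimes> Y\<close> are cofibrant and \<open>Z\<close> and
  \<open>\<lbrakk>Y, Z\<rbrakk>\<close> fibrant. On representatives \<open>\<phi>\<close> and
  \<open>un\<close> are mutually inverse, and both respect equality of images.\<close>

lemma phi_ho_bij:
  assumes [simp]: "cofibrant M X" "cofibrant M Y" "fibrant M Z"
  shows "bij_betw (phi_ho M T \<phi> X Y Z) (Hom H (X \<otimes> Y) Z) (Hom H X \<lbrakk>Y, Z\<rbrakk>)"
proof (rule bij_betw_imageI)
  show "inj_on (phi_ho M T \<phi> X Y Z) (Hom H (X \<otimes> Y) Z)"
  proof (rule inj_onI)
    fix g h assume gh: "g \<in> Hom H (X \<otimes> Y) Z" "h \<in> Hom H (X \<otimes> Y) Z" "phi_ho M T \<phi> X Y Z g = phi_ho M T \<phi> X Y Z h"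
    obtain g' where g': "g' \<in> Arr M" "Dom M g' = X \<otimes> Y" "Cod M g' = Z" "\<gamma> M g' = g"
      using \<gamma>_surj[of g "X \<otimes> Y" Z] gh by (auto simp: Hom_def)
    obtain h' where h': "h' \<in> Arr M" "Dom M h' = X \<otimes> Y" "Cod M h' = Z" "\<gamma> M h' = h"
      using \<gamma>_surj[of h "X \<otimes> Y" Z] gh by (auto simp: Hom_def)
    have "\<gamma> M (\<phi> X Y Z g') = phi_ho M T \<phi> X Y Z g" "\<gamma> M (\<phi> X Y Z h') = phi_ho M T \<phi> X Y Z h"
      using g' h' phi_ho_\<gamma>[of X Y Z g'] phi_ho_\<gamma>[of X Y Z h'] by simp_all
    then have "\<gamma> M (\<phi> X Y Z g') = \<gamma> M (\<phi> X Y Z h')"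
      using gh(3) by metis
    then have "\<gamma> M (un Y Z (\<phi> X Y Z g')) = \<gamma> M (un Y Z (\<phi> X Y Z h'))"
      using g' h' by (intro \<gamma>_un_cong[of X]) simp_all
    then show "g = h" using g' h' by simp
  qed
  show "phi_ho M T \<phi> X Y Z ` Hom H (X \<otimes> Y) Z = Hom H X \<lbrakk>Y, Z\<rbrakk>"
  proof (intro set_eqI iffI)
    fix h assume "h \<in> phi_ho M T \<phi> X Y Z ` Hom H (X \<otimes> Y) Z"
    then obtain g where g: "g \<in> Hom H (X \<otimes> Y) Z" "h = phi_ho M T \<phi> X Y Z g" by blast
    obtain g' where g': "g' \<in> Arr M" "Dom M g' = X \<otimes> Y" "Cod M g' = Z" "\<gamma> M g' = g"
      using \<gamma>_surj[of g "X \<otimes> Y" Z] g by (auto simp: Hom_def)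
    then show "h \<in> Hom H X \<lbrakk>Y, Z\<rbrakk>"
      using g phi_ho_\<gamma>[of X Y Z g'] by (auto simp: Hom_def)
  next
    fix h assume h: "h \<in> Hom H X \<lbrakk>Y, Z\<rbrakk>"
    obtain h' where h': "h' \<in> Arr M" "Dom M h' = X" "Cod M h' = \<lbrakk>Y, Z\<rbrakk>" "\<gamma> M h' = h"
      using \<gamma>_surj[of h X "\<lbrakk>Y, Z\<rbrakk>"] h by (auto simp: Hom_def)
    have "phi_ho M T \<phi> X Y Z (\<gamma> M (un Y Z h')) = h"
      using h' phi_ho_\<gamma>[of X Y Z "un Y Z h'"] by simp
    then show "h \<in> phi_ho M T \<phi> X Y Z ` Hom H (X \<otimes> Y) Z"
      using h' by (intro image_eqI[of _ _ "\<gamma> M (un Y Z h')"]) (simp_all add: Hom_def)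
  qed
qed

text \<open>By Yoneda: maps in the homotopy category from a cofibrant \<open>X\<close> into \<open>\<lbrakk>A, Z\<rbrakk>\<close> are maps out of \<open>X \<otimes> A\<close>.\<close>

lemma hom_iso1 [simp]:
  assumes [simp]: "fibrant M Z" and w: "w \<in> Weq M" and cof: "cofibrant M (Dom M w)" "cofibrant M (Cod M w)"
  shows "iso_arr H (\<gamma> M \<lbrakk>w, Ide M Z\<rbrakk>\<^sub>m)"
proof -
  define A B g where "A = Dom M w" and "B = Cod M w" and "g = \<gamma> M \<lbrakk>w, Ide M Z\<rbrakk>\<^sub>m"
  have A [simp]: "w \<in> Arr M" "Dom M w = A" "Cod M w = B" "cofibrant M A" "cofibrant M B" "w \<in> Weq M"
    using w cof by (auto simp: A_def B_def)
  have g [simp]: "g \<in> Arr H" "Dom H g = \<lbrakk>B, Z\<rbrakk>" "Cod H g = \<lbrakk>A, Z\<rbrakk>" by (auto simp: g_def)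
  have wz: "\<lbrakk>w, Ide M Z\<rbrakk>\<^sub>m \<cdot> \<phi> X B Z m = \<phi> X A Z (m \<cdot> (Ide M X \<otimes>\<^sub>m w))"
    if "X \<in> Obj M" "m \<in> Arr M" "Dom M m = X \<otimes> B" "Cod M m = Z" for X m
    using \<phi>_pre2[of X B m Z w A] that by simp
  \<comment> \<open>Surjectivity of composition with \<open>g\<close> on maps out of a cofibrant
    \<open>X\<close>: transpose, divide by the invertible image of
    \<open>Ide M X \<otimes>\<^sub>m w\<close>, and transpose back.\<close>
  have ex: "\<exists>k. k \<in> Arr H \<and> Dom H k = X \<and> Cod H k = \<lbrakk>B, Z\<rbrakk> \<and> g \<bullet> k = h"
    if X [simp]: "cofibrant M X" and h: "h \<in> Arr H" "Dom H h = X" "Cod H h = \<lbrakk>A, Z\<rbrakk>" for X h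
  proof -
    obtain h' where h' [simp]: "h' \<in> Arr M" "Dom M h' = X" "Cod M h' = \<lbrakk>A, Z\<rbrakk>" and e: "\<gamma> M h' = h"
      using \<gamma>_surj[OF h] by auto
    let ?m = "\<gamma> M (un A Z h') \<bullet> inv_arr H (\<gamma> M (Ide M X \<otimes>\<^sub>m w))"
    obtain m where m [simp]: "m \<in> Arr M" "Dom M m = X \<otimes> B" "Cod M m = Z" and me: "\<gamma> M m = ?m"
      using \<gamma>_surj[of ?m "X \<otimes> B" Z] by auto
    have "\<gamma> M (m \<cdot> (Ide M X \<otimes>\<^sub>m w)) = \<gamma> M m \<bullet> \<gamma> M (Ide M X \<otimes>\<^sub>m w)" by simp
    also have "\<dots> = \<gamma> M (un A Z h')" unfolding me by simp
    finally have "\<gamma> M (\<phi> X A Z (m \<cdot> (Ide M X \<otimes>\<^sub>m w))) = \<gamma> M (\<phi> X A Z (un A Z h'))"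
      by (intro \<gamma>_\<phi>_cong) simp_all
    then have "g \<bullet> \<gamma> M (\<phi> X B Z m) = h"
      using e wz[of X m] by (simp add: g_def)
    then show ?thesis by (intro exI[of _ "\<gamma> M (\<phi> X B Z m)"]) simp
  qed
  \<comment> \<open>Injectivity, by the same passage through the tensor product.\<close>
  have un: "h = k"
    if X [simp]: "cofibrant M X" and h: "h \<in> Arr H" "Dom H h = X" "Cod H h = \<lbrakk>B, Z\<rbrakk>"
      and k: "k \<in> Arr H" "Dom H k = X" "Cod H k = \<lbrakk>B, Z\<rbrakk>" and e: "g \<bullet> h = g \<bullet> k" for X h k
  proof -
    obtain h' where h' [simp]: "h' \<in> Arr M" "Dom M h' = X" "Cod M h' = \<lbrakk>B, Z\<rbrakk>" and he: "\<gamma> M h' = h"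
      using \<gamma>_surj[OF h] by auto
    obtain k' where k' [simp]: "k' \<in> Arr M" "Dom M k' = X" "Cod M k' = \<lbrakk>B, Z\<rbrakk>" and ke: "\<gamma> M k' = k"
      using \<gamma>_surj[OF k] by auto
    have "\<gamma> M (\<lbrakk>w, Ide M Z\<rbrakk>\<^sub>m \<cdot> h') = \<gamma> M (\<lbrakk>w, Ide M Z\<rbrakk>\<^sub>m \<cdot> k')"
      using e by (simp add: g_def he[symmetric] ke[symmetric])
    then have "\<gamma> M (un A Z (\<lbrakk>w, Ide M Z\<rbrakk>\<^sub>m \<cdot> h')) = \<gamma> M (un A Z (\<lbrakk>w, Ide M Z\<rbrakk>\<^sub>m \<cdot> k'))"
      by (intro \<gamma>_un_cong[of X]) simp_all
    moreover have "un A Z (\<lbrakk>w, Ide M Z\<rbrakk>\<^sub>m \<cdot> x) = un B Z x \<cdot> (Ide M X \<otimes>\<^sub>m w)"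
      if "x \<in> Arr M" "Dom M x = X" "Cod M x = \<lbrakk>B, Z\<rbrakk>" for x
      using wz[of X "un B Z x"] un_\<phi>[of X A "un B Z x \<cdot> (Ide M X \<otimes>\<^sub>m w)" Z] that by simp
    ultimately have "\<gamma> M (un B Z h') \<bullet> \<gamma> M (Ide M X \<otimes>\<^sub>m w) = \<gamma> M (un B Z k') \<bullet> \<gamma> M (Ide M X \<otimes>\<^sub>m w)"
      by simp
    from H.iso_epi[OF _ this] have "\<gamma> M (un B Z h') = \<gamma> M (un B Z k')"
      by simp
    then have "\<gamma> M (\<phi> X B Z (un B Z h')) = \<gamma> M (\<phi> X B Z (un B Z k'))"
      by (intro \<gamma>_\<phi>_cong) simp_all
    then show ?thesis using he ke by simp
  qed
  \<comment> \<open>The object \<open>\<lbrakk>A, Z\<rbrakk>\<close> need not be cofibrant, so its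
    replacement serves as test object and the inverse of \<open>p\<close> is composed
    afterwards.\<close>
  obtain s0 where s0: "s0 \<in> Arr H" "Dom H s0 = Q \<lbrakk>A, Z\<rbrakk>" "Cod H s0 = \<lbrakk>B, Z\<rbrakk>" "g \<bullet> s0 = \<gamma> M (p \<lbrakk>A, Z\<rbrakk>)"
    using ex[of "Q \<lbrakk>A, Z\<rbrakk>" "\<gamma> M (p \<lbrakk>A, Z\<rbrakk>)"] by auto
  define s where "s = s0 \<bullet> inv_arr H (\<gamma> M (p \<lbrakk>A, Z\<rbrakk>))"
  have s [simp]: "s \<in> Arr H" "Dom H s = \<lbrakk>A, Z\<rbrakk>" "Cod H s = \<lbrakk>B, Z\<rbrakk>" using s0 by (auto simp: s_def)
  have gs: "g \<bullet> s = Ide H \<lbrakk>A, Z\<rbrakk>"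
    unfolding s_def using H.rewr[OF s0(4), of "inv_arr H (\<gamma> M (p \<lbrakk>A, Z\<rbrakk>))"] s0(1-3) by simp
  \<comment> \<open>The right inverse \<open>s\<close> is also a left inverse, by injectivity tested
    on \<open>Q \<lbrakk>B, Z\<rbrakk>\<close>.\<close>
  have "g \<bullet> (s \<bullet> g \<bullet> \<gamma> M (p \<lbrakk>B, Z\<rbrakk>)) = g \<bullet> \<gamma> M (p \<lbrakk>B, Z\<rbrakk>)"
    using H.rewr[OF gs, of "g \<bullet> \<gamma> M (p \<lbrakk>B, Z\<rbrakk>)"] by simp
  then have "s \<bullet> g \<bullet> \<gamma> M (p \<lbrakk>B, Z\<rbrakk>) = \<gamma> M (p \<lbrakk>B, Z\<rbrakk>)"
    by (rule un[rotated -1]) simp_all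
  then have "(s \<bullet> g) \<bullet> \<gamma> M (p \<lbrakk>B, Z\<rbrakk>) = Ide H \<lbrakk>B, Z\<rbrakk> \<bullet> \<gamma> M (p \<lbrakk>B, Z\<rbrakk>)" by simp
  from H.iso_epi[OF _ this] have "s \<bullet> g = Ide H \<lbrakk>B, Z\<rbrakk>"
    by simp
  then have "iso_arr H g" using gs H.isoI(2)[of g s] by simp
  then show ?thesis by (simp add: g_def)
qed

text \<open>With the next two lemmas, the instances of \<open>equal_images\<close> for tensoring on
  either side and, with values in the opposite category, for the internal hom into a fibrant
  object.\<close>

lemma \<gamma>_tensor_cong1:
  assumes "cofibrant M Y" "f \<in> Arr M" "g \<in> Arr M" "Dom M f = Dom M g" "Cod M f = Cod M g" "cofibrant M (Dom M g)"
    and "t \<in> Weq M" "Dom M t = Cod M g" "t \<cdot> f = t \<cdot> g"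
  shows "\<gamma> M (f \<otimes>\<^sub>m Ide M Y) = \<gamma> M (g \<otimes>\<^sub>m Ide M Y)"
proof -
  let ?F = "\<lparr>fobj = (\<lambda>A. A \<otimes> Y), farr = (\<lambda>f. \<gamma> M (f \<otimes>\<^sub>m Ide M Y))\<rparr>"
  have "cat_functor M H ?F"
    by (rule cat_functorI) (use assms in \<open>simp_all add: \<gamma>_Ide category_axioms category_Ho\<close>)
  then have "farr ?F f = farr ?F g"
    by (rule equal_images[OF _ _ assms(2-9)]) (use assms(1) in simp_all)
  then show ?thesis by simp
qed

lemma \<gamma>_tensor_cong2:
  assumes "cofibrant M Y" "f \<in> Arr M" "g \<in> Arr M" "Dom M f = Dom M g" "Cod M f = Cod M g" "cofibrant M (Dom M g)"
    and "t \<in> Weq M" "Dom M t = Cod M g" "t \<cdot> f = t \<cdot> g"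
  shows "\<gamma> M (Ide M Y \<otimes>\<^sub>m f) = \<gamma> M (Ide M Y \<otimes>\<^sub>m g)"
proof -
  let ?F = "\<lparr>fobj = (\<lambda>A. Y \<otimes> A), farr = (\<lambda>f. \<gamma> M (Ide M Y \<otimes>\<^sub>m f))\<rparr>"
  have "cat_functor M H ?F"
    by (rule cat_functorI) (use assms in \<open>simp_all add: \<gamma>_Ide category_axioms category_Ho\<close>)
  then have "farr ?F f = farr ?F g"
    by (rule equal_images[OF _ _ assms(2-9)]) (use assms(1) in simp_all)
  then show ?thesis by simp
qed

lemma \<gamma>_hom_cong:
  assumes "fibrant M Z" "f \<in> Arr M" "g \<in> Arr M" "Dom M f = Dom M g" "Cod M f = Cod M g" "cofibrant M (Dom M g)"
    and "t \<in> Weq M" "Dom M t = Cod M g" "t \<cdot> f = t \<cdot> g"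
  shows "\<gamma> M \<lbrakk>f, Ide M Z\<rbrakk>\<^sub>m = \<gamma> M \<lbrakk>g, Ide M Z\<rbrakk>\<^sub>m"
proof -
  let ?F = "\<lparr>fobj = (\<lambda>A. \<lbrakk>A, Z\<rbrakk>), farr = (\<lambda>f. \<gamma> M \<lbrakk>f, Ide M Z\<rbrakk>\<^sub>m)\<rparr>"
  have "cat_functor M (op_cat H) ?F"
    by (rule cat_functorI) (use assms in \<open>simp_all add: \<gamma>_Ide category_axioms category_Ho category_op_cat\<close>)
  then have "farr ?F f = farr ?F g"
    by (rule equal_images[OF _ _ assms(2-9)]) (use assms(1) in simp_all)
  then show ?thesis by simp
qed

text \<open>The maps \<open>Qm (p A)\<close> and \<open>p (Q A)\<close> may differ, but by
  naturality of \<open>p\<close> they agree after composition with the weak equivalence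
  \<open>p A\<close>.\<close>

lemma \<gamma>_Qp:
  assumes [simp]: "A \<in> Obj M"
  shows "cofibrant M Y \<Longrightarrow> \<gamma> M (Qm (p A) \<otimes>\<^sub>m Ide M Y) = \<gamma> M (p (Q A) \<otimes>\<^sub>m Ide M Y)"
    "cofibrant M Y \<Longrightarrow> \<gamma> M (Ide M Y \<otimes>\<^sub>m Qm (p A)) = \<gamma> M (Ide M Y \<otimes>\<^sub>m p (Q A))"
    "fibrant M Z \<Longrightarrow> \<gamma> M \<lbrakk>Qm (p A), Ide M Z\<rbrakk>\<^sub>m = \<gamma> M \<lbrakk>p (Q A), Ide M Z\<rbrakk>\<^sub>m"
  using \<gamma>_tensor_cong1[of Y "Qm (p A)" "p (Q A)" "p A"] \<gamma>_tensor_cong2[of Y "Qm (p A)" "p (Q A)" "p A"]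
    \<gamma>_hom_cong[of Z "Qm (p A)" "p (Q A)" "p A"] pm_natural[of "p A" A] by simp_all

end

section \<open>The left derived skew monoidal structure\<close>

context monoidal_model_category
begin

section \<open>The derived tensor product and its structure maps\<close>

lemma Ho_Obj [simp]: "f \<in> Arr H \<Longrightarrow> Dom H f \<in> Obj M" "f \<in> Arr H \<Longrightarrow> Cod H f \<in> Obj M"
  using H.Dom_Obj H.Cod_Obj by auto

abbreviation TL where "TL \<equiv> left_derived M T"
abbreviation tl where "tl f g \<equiv> farr (tensor TL) (f, g)"
abbreviation \<alpha>l where "\<alpha>l \<equiv> asc TL"

text \<open>Weak equivalences are inverted in each variable by \<open>tensor_iso1\<close> and
  \<open>tensor_iso2\<close>, since \<open>Qm w\<close> is a weak equivalence between cofibrant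
  objects.\<close>

lemma TL_functor: "cat_functor (prod_cat H H) H (tensor TL)"
  and tl_\<gamma> [simp]: "\<lbrakk>f \<in> Arr M; g \<in> Arr M\<rbrakk> \<Longrightarrow> tl (\<gamma> M f) (\<gamma> M g) = \<gamma> M (Qm f \<otimes>\<^sub>m Qm g)"
proof -
  let ?F = "\<lparr>fobj = (\<lambda>(A, B). Q A \<otimes> Q B), farr = (\<lambda>(f, g). \<gamma> M (Qm f \<otimes>\<^sub>m Qm g))\<rparr>"
  have T: "tensor TL = ho_ext2 M H ?F" by (simp add: left_derived_def Let_def)
  have 1: "weq_inverting M H (sec1 M ?F B)" if "B \<in> Obj M" for B
    by (rule weq_invertingI) (use that in \<open>simp_all add: sec1_def category_Ho \<gamma>_Ide Qm_Comp\<close>)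
  have 2: "weq_inverting M H (sec2 M ?F A)" if "A \<in> Obj M" for A
    by (rule weq_invertingI) (use that in \<open>simp_all add: sec2_def category_Ho \<gamma>_Ide Qm_Comp\<close>)
  show "cat_functor (prod_cat H H) H (tensor TL)"
    unfolding T by (rule ho_ext2_sections(1)[OF category_Ho 1 2]) simp_all
  show "tl (\<gamma> M f) (\<gamma> M g) = \<gamma> M (Qm f \<otimes>\<^sub>m Qm g)" if "f \<in> Arr M" "g \<in> Arr M"
    unfolding T using ho_ext2_sections(2)[OF category_Ho 1 2 _ that] that by simp
qed

lemma TL_Obj [simp]: "fobj (tensor TL) (A, B) = Q A \<otimes> Q B"
  by (simp add: left_derived_def Let_def ho_ext2_def)

lemma tunit_TL [simp]: "tunit TL = tunit T"
  by (simp add: left_derived_def Let_def)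

lemma tl_arr [simp]:
  assumes "f \<in> Arr H" "g \<in> Arr H"
  shows "tl f g \<in> Arr H" "Dom H (tl f g) = Q (Dom H f) \<otimes> Q (Dom H g)"
    "Cod H (tl f g) = Q (Cod H f) \<otimes> Q (Cod H g)"
  using cat_functor.farr_arr[OF TL_functor, of "(f, g)"] assms by auto

lemma tl_Comp:
  "\<lbrakk>f \<in> Arr H; g \<in> Arr H; f' \<in> Arr H; g' \<in> Arr H; Cod H f = Dom H f'; Cod H g = Dom H g'\<rbrakk>
   \<Longrightarrow> tl (f' \<bullet> f) (g' \<bullet> g) = tl f' g' \<bullet> tl f g"
  using cat_functor.farr_Comp'[OF TL_functor, of "(f, g)" "(f', g')"] by simp

lemma tl_Ide [simp]: "\<lbrakk>A \<in> Obj M; B \<in> Obj M\<rbrakk> \<Longrightarrow> tl (Ide H A) (Ide H B) = Ide H (Q A \<otimes> Q B)"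
  using cat_functor.farr_Ide[OF TL_functor, of "(A, B)"] by simp

lemma tl_\<gamma>_Ide [simp]:
  "\<lbrakk>f \<in> Arr M; B \<in> Obj M\<rbrakk> \<Longrightarrow> tl (\<gamma> M f) (Ide H B) = \<gamma> M (Qm f \<otimes>\<^sub>m Ide M (Q B))"
  "\<lbrakk>f \<in> Arr M; B \<in> Obj M\<rbrakk> \<Longrightarrow> tl (Ide H B) (\<gamma> M f) = \<gamma> M (Ide M (Q B) \<otimes>\<^sub>m Qm f)"
  using tl_\<gamma>[of f "Ide M B"] tl_\<gamma>[of "Ide M B" f] by (simp_all add: \<gamma>_Ide)

lemma tl_iso [simp]:
  assumes "iso_arr H f" "iso_arr H g"
  shows "iso_arr H (tl f g)" "inv_arr H (tl f g) = tl (inv_arr H f) (inv_arr H g)"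
  using H.isoI[of "tl f g" "tl (inv_arr H f) (inv_arr H g)"] assms
    H.iso_is_Arr[OF assms(1)] H.iso_is_Arr[OF assms(2)] by (simp_all flip: tl_Comp)

text \<open>The comparison \<open>\<gamma> (p \<otimes> 1)\<close> carries the functor \<open>- \<otimes>\<^sub>l D\<close> to \<open>- \<otimes> Q D\<close>.\<close>

lemma tl_square1:
  assumes h: "h \<in> Arr H" "Dom H h = A" "Cod H h = B" and b: "b \<in> Arr M" "Dom M b = B" and a: "a \<in> Arr M" "Dom M a = A"
    and e: "\<gamma> M b \<bullet> h = \<gamma> M a" and D: "D \<in> Obj M"
  shows "\<gamma> M ((b \<cdot> p B) \<otimes>\<^sub>m Ide M (Q D)) \<bullet> tl h (Ide H D) = \<gamma> M ((a \<cdot> p A) \<otimes>\<^sub>m Ide M (Q D))"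
proof -
  have c: "Cod M b = Cod M a"
    using arg_cong[OF e, of "Cod H"] a b h by simp
  have [simp]: "A \<in> Obj M" "B \<in> Obj M" using a b by auto
  have "\<gamma> M ((b \<cdot> p B) \<otimes>\<^sub>m Ide M (Q D)) \<bullet> tl h (Ide H D)
    = \<gamma> M ((p (Cod M b) \<cdot> Qm b) \<otimes>\<^sub>m Ide M (Q D)) \<bullet> tl h (Ide H D)"
    using b by (simp add: pm_natural)
  also have "\<dots> = \<gamma> M (p (Cod M b) \<otimes>\<^sub>m Ide M (Q D)) \<bullet> (tl (\<gamma> M b) (Ide H D) \<bullet> tl h (Ide H D))"
    using b h D by simp
  also have "tl (\<gamma> M b) (Ide H D) \<bullet> tl h (Ide H D) = tl (\<gamma> M a) (Ide H D)"
    using tl_Comp[of h "Ide H D" "\<gamma> M b" "Ide H D"] b h D e by simp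
  also have "\<gamma> M (p (Cod M b) \<otimes>\<^sub>m Ide M (Q D)) \<bullet> \<dots> = \<gamma> M ((p (Cod M a) \<cdot> Qm a) \<otimes>\<^sub>m Ide M (Q D))"
    using a c D by simp
  finally show ?thesis using a by (simp add: pm_natural)
qed

text \<open>The other variable of \<open>tl_square1\<close>. The map \<open>h\<close> need not come
  from \<open>M\<close>; it is described only by \<open>b\<close> and \<open>a\<close>, as the
  derived associator and right unit are.\<close>

lemma tl_square2:
  assumes h: "h \<in> Arr H" "Dom H h = A" "Cod H h = B" and b: "b \<in> Arr M" "Dom M b = B" and a: "a \<in> Arr M" "Dom M a = A"
    and e: "\<gamma> M b \<bullet> h = \<gamma> M a" and D: "D \<in> Obj M"
  shows "\<gamma> M (Ide M (Q D) \<otimes>\<^sub>m (b \<cdot> p B)) \<bullet> tl (Ide H D) h = \<gamma> M (Ide M (Q D) \<otimes>\<^sub>m (a \<cdot> p A))"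
proof -
  have c: "Cod M b = Cod M a"
    using arg_cong[OF e, of "Cod H"] a b h by simp
  have [simp]: "A \<in> Obj M" "B \<in> Obj M" using a b by auto
  have "\<gamma> M (Ide M (Q D) \<otimes>\<^sub>m (b \<cdot> p B)) \<bullet> tl (Ide H D) h
    = \<gamma> M (Ide M (Q D) \<otimes>\<^sub>m (p (Cod M b) \<cdot> Qm b)) \<bullet> tl (Ide H D) h"
    using b by (simp add: pm_natural)
  also have "\<dots> = \<gamma> M (Ide M (Q D) \<otimes>\<^sub>m p (Cod M b)) \<bullet> (tl (Ide H D) (\<gamma> M b) \<bullet> tl (Ide H D) h)"
    using b h D by simp
  also have "tl (Ide H D) (\<gamma> M b) \<bullet> tl (Ide H D) h = tl (Ide H D) (\<gamma> M a)"
    using tl_Comp[of "Ide H D" h "Ide H D" "\<gamma> M b"] b h D e by simp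
  also have "\<gamma> M (Ide M (Q D) \<otimes>\<^sub>m p (Cod M b)) \<bullet> \<dots> = \<gamma> M (Ide M (Q D) \<otimes>\<^sub>m (p (Cod M a) \<cdot> Qm a))"
    using a c D by simp
  finally show ?thesis using a by (simp add: pm_natural)
qed

text \<open>The associator is pinned down by composing with the map that its definition inverts;
  \<open>run_TL_eq\<close> does the same with two inverses. Proofs of the axioms compare both sides
  after such compositions and then cancel.\<close>

lemma \<alpha>l:
  assumes [simp]: "A \<in> Obj M" "B \<in> Obj M" "D \<in> Obj M"
  shows \<alpha>l_arr [simp]: "\<alpha>l A B D \<in> Arr H" "Dom H (\<alpha>l A B D) = Q (Q A \<otimes> Q B) \<otimes> Q D"
      "Cod H (\<alpha>l A B D) = Q A \<otimes> Q (Q B \<otimes> Q D)"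
    and \<alpha>l_eq: "\<gamma> M (Ide M (Q A) \<otimes>\<^sub>m p (Q B \<otimes> Q D)) \<bullet> \<alpha>l A B D
      = \<gamma> M (\<alpha> (Q A) (Q B) (Q D) \<cdot> (p (Q A \<otimes> Q B) \<otimes>\<^sub>m Ide M (Q D)))"
  by (simp_all add: left_derived_def Let_def)

lemma lun_TL:
  "A \<in> Obj M \<Longrightarrow> lun TL A = \<gamma> M (p A \<cdot> l (Q A) \<cdot> (p (tunit T) \<otimes>\<^sub>m Ide M (Q A)))"
  by (simp add: left_derived_def Let_def)

lemma run_TL:
  assumes [simp]: "A \<in> Obj M"
  shows run_TL_arr [simp]: "run TL A \<in> Arr H" "Dom H (run TL A) = A" "Cod H (run TL A) = Q A \<otimes> Q (tunit T)"
    and run_TL_eq: "\<gamma> M (Ide M (Q A) \<otimes>\<^sub>m p (tunit T)) \<bullet> run TL A \<bullet> \<gamma> M (p A) = \<gamma> M (r (Q A))"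
  by (simp_all add: left_derived_def Let_def)

text \<open>On maps of \<open>M\<close>, composing with the invertible \<open>?b\<close> splits the
  square into naturality of \<open>\<alpha>\<close> and of \<open>p\<close>. Induction in the three
  variables at once does the rest, with the square reversed for formal inverses.\<close>

lemma \<alpha>l_natural:
  assumes "f \<in> Arr H" "g \<in> Arr H" "h \<in> Arr H"
  shows "\<alpha>l (Cod H f) (Cod H g) (Cod H h) \<bullet> tl (tl f g) h = tl f (tl g h) \<bullet> \<alpha>l (Dom H f) (Dom H g) (Dom H h)"
  using assms
proof (induction rule: ho_induct3)
  case (arr f g h)
  note [simp] = arr
  let ?A = "Dom M f" and ?B = "Dom M g" and ?D = "Dom M h" and ?A' = "Cod M f" and ?B' = "Cod M g" and ?D' = "Cod M h"
  let ?b = "\<gamma> M (Ide M (Q ?A') \<otimes>\<^sub>m p (Q ?B' \<otimes> Q ?D'))"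
  have "?b \<bullet> (\<alpha>l ?A' ?B' ?D' \<bullet> \<gamma> M (Qm (Qm f \<otimes>\<^sub>m Qm g) \<otimes>\<^sub>m Qm h))
    = (?b \<bullet> \<alpha>l ?A' ?B' ?D') \<bullet> \<gamma> M (Qm (Qm f \<otimes>\<^sub>m Qm g) \<otimes>\<^sub>m Qm h)" by simp
  also have "\<dots> = \<gamma> M ((\<alpha> (Q ?A') (Q ?B') (Q ?D') \<cdot> ((Qm f \<otimes>\<^sub>m Qm g) \<otimes>\<^sub>m Qm h)) \<cdot> (p (Q ?A \<otimes> Q ?B) \<otimes>\<^sub>m Ide M (Q ?D)))"
    unfolding \<alpha>l_eq[OF Cod_Obj Cod_Obj Cod_Obj, OF arr] by (simp add: pm_natural)
  also have "\<dots> = \<gamma> M (Qm f \<otimes>\<^sub>m (Qm g \<otimes>\<^sub>m Qm h)) \<bullet> \<gamma> M (\<alpha> (Q ?A) (Q ?B) (Q ?D) \<cdot> (p (Q ?A \<otimes> Q ?B) \<otimes>\<^sub>m Ide M (Q ?D)))"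
    by (simp add: asc_nat)
  also have "\<dots> = \<gamma> M (Qm f \<otimes>\<^sub>m (Qm g \<otimes>\<^sub>m Qm h)) \<bullet> \<gamma> M (Ide M (Q ?A) \<otimes>\<^sub>m p (Q ?B \<otimes> Q ?D)) \<bullet> \<alpha>l ?A ?B ?D"
    unfolding \<alpha>l_eq[OF Dom_Obj Dom_Obj Dom_Obj, OF arr] ..
  also have "\<dots> = ?b \<bullet> (\<gamma> M (Qm f \<otimes>\<^sub>m Qm (Qm g \<otimes>\<^sub>m Qm h)) \<bullet> \<alpha>l ?A ?B ?D)"
    by (simp add: pm_natural)
  finally have "?b \<bullet> (\<alpha>l ?A' ?B' ?D' \<bullet> \<gamma> M (Qm (Qm f \<otimes>\<^sub>m Qm g) \<otimes>\<^sub>m Qm h))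
    = ?b \<bullet> (\<gamma> M (Qm f \<otimes>\<^sub>m Qm (Qm g \<otimes>\<^sub>m Qm h)) \<bullet> \<alpha>l ?A ?B ?D)" .
  from H.iso_mono[OF _ this] show ?case by simp
next
  case (comp e f g e' f' g')
  note [simp] = comp(1-9)
  have "\<alpha>l (Cod H e') (Cod H f') (Cod H g') \<bullet> tl (tl (e' \<bullet> e) (f' \<bullet> f)) (g' \<bullet> g)
    = (\<alpha>l (Cod H e') (Cod H f') (Cod H g') \<bullet> tl (tl e' f') g') \<bullet> tl (tl e f) g"
    by (simp add: tl_Comp)
  also have "\<dots> = tl e' (tl f' g') \<bullet> (\<alpha>l (Dom H e') (Dom H f') (Dom H g') \<bullet> tl (tl e f) g)"
    unfolding comp(11) by simp
  also have "\<alpha>l (Dom H e') (Dom H f') (Dom H g') \<bullet> tl (tl e f) g = tl e (tl f g) \<bullet> \<alpha>l (Dom H e) (Dom H f) (Dom H g)"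
    using comp(10) by simp
  also have "tl e' (tl f' g') \<bullet> \<dots> = tl (e' \<bullet> e) (tl (f' \<bullet> f) (g' \<bullet> g)) \<bullet> \<alpha>l (Dom H e) (Dom H f) (Dom H g)"
    by (simp add: tl_Comp)
  finally show ?case by simp
next
  case (inv e f g)
  have "\<alpha>l (Dom M e) (Dom M f) (Dom M g) \<bullet> inv_arr H (tl (tl (\<gamma> M e) (\<gamma> M f)) (\<gamma> M g))
    = inv_arr H (tl (\<gamma> M e) (tl (\<gamma> M f) (\<gamma> M g))) \<bullet> \<alpha>l (Cod M e) (Cod M f) (Cod M g)"
    by (rule H.exchange_inv) (use inv in \<open>simp_all del: tl_\<gamma>\<close>)
  then show ?case using inv(1-3) by (simp del: tl_\<gamma>)
qed

lemma lun_TL_arr [simp]: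
  assumes "A \<in> Obj M"
  shows "lun TL A \<in> Arr H" "Dom H (lun TL A) = Q (tunit T) \<otimes> Q A" "Cod H (lun TL A) = A"
  using assms by (simp_all add: lun_TL)

lemma lun_TL_natural:
  assumes "f \<in> Arr H"
  shows "lun TL (Cod H f) \<bullet> tl (Ide H (tunit T)) f = f \<bullet> lun TL (Dom H f)"
proof -
  let ?F = "\<lparr>fobj = (\<lambda>A. Q (tunit T) \<otimes> Q A), farr = tl (Ide H (tunit T))\<rparr>" and ?G = "\<lparr>fobj = (\<lambda>A :: 'o. A), farr = (\<lambda>f. f)\<rparr>"
  have "lun TL (Cod H f) \<bullet> farr ?F f = farr ?G f \<bullet> lun TL (Dom H f)"
  proof (rule ho_natural[where \<tau> = "lun TL", OF _ _ _ _ _ _ assms])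
    show "cat_functor H H ?F"
    proof (rule cat_functorI)
      show "farr ?F (g \<bullet> f) = farr ?F g \<bullet> farr ?F f" if "f \<in> Arr H" "g \<in> Arr H" "Cod H f = Dom H g" for f g
        using tl_Comp[of "Ide H (tunit T)" f "Ide H (tunit T)" g] that by simp
    qed (simp_all add: category_Ho)
    show "cat_functor H H ?G" by (rule cat_functorI) (simp_all add: category_Ho)
    fix f assume [simp]: "f \<in> Arr M"
    let ?I = "tunit T" and ?A = "Dom M f" and ?B = "Cod M f"
    have "p ?B \<cdot> l (Q ?B) \<cdot> (p ?I \<otimes>\<^sub>m Ide M (Q ?B)) \<cdot> (Ide M (Q ?I) \<otimes>\<^sub>m Qm f)
      = p ?B \<cdot> (l (Q ?B) \<cdot> (Ide M ?I \<otimes>\<^sub>m Qm f)) \<cdot> (p ?I \<otimes>\<^sub>m Ide M (Q ?A))"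
      by simp
    also have "\<dots> = (p ?B \<cdot> Qm f) \<cdot> l (Q ?A) \<cdot> (p ?I \<otimes>\<^sub>m Ide M (Q ?A))"
      by (simp add: lun_nat)
    also have "\<dots> = f \<cdot> p ?A \<cdot> l (Q ?A) \<cdot> (p ?I \<otimes>\<^sub>m Ide M (Q ?A))"
      by (simp add: pm_natural)
    finally show "lun TL (Cod M f) \<bullet> farr ?F (\<gamma> M f) = farr ?G (\<gamma> M f) \<bullet> lun TL (Dom M f)"
      by (simp add: lun_TL)
  qed simp_all
  then show ?thesis by simp
qed

lemma run_TL_natural:
  assumes "f \<in> Arr H"
  shows "run TL (Cod H f) \<bullet> f = tl f (Ide H (tunit T)) \<bullet> run TL (Dom H f)"
proof -
  let ?G = "\<lparr>fobj = (\<lambda>A. Q A \<otimes> Q (tunit T)), farr = (\<lambda>f. tl f (Ide H (tunit T)))\<rparr>" and ?F = "\<lparr>fobj = (\<lambda>A :: 'o. A), farr = (\<lambda>f. f)\<rparr>"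
  have "run TL (Cod H f) \<bullet> farr ?F f = farr ?G f \<bullet> run TL (Dom H f)"
  proof (rule ho_natural[where \<tau> = "run TL", OF _ _ _ _ _ _ assms])
    show "cat_functor H H ?G"
    proof (rule cat_functorI)
      show "farr ?G (g \<bullet> f) = farr ?G g \<bullet> farr ?G f" if "f \<in> Arr H" "g \<in> Arr H" "Cod H f = Dom H g" for f g
        using tl_Comp[of f "Ide H (tunit T)" g "Ide H (tunit T)"] that by simp
    qed (simp_all add: category_Ho)
    show "cat_functor H H ?F" by (rule cat_functorI) (simp_all add: category_Ho)
    fix f assume [simp]: "f \<in> Arr M"
    let ?I = "tunit T" and ?A = "Dom M f" and ?B = "Cod M f"
    let ?b = "\<gamma> M (Ide M (Q ?B) \<otimes>\<^sub>m p ?I)"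
    have "(?b \<bullet> run TL ?B \<bullet> \<gamma> M f) \<bullet> \<gamma> M (p ?A) = (?b \<bullet> run TL ?B \<bullet> \<gamma> M (p ?B)) \<bullet> \<gamma> M (Qm f)"
      by (simp add: pm_natural)
    also have "\<dots> = \<gamma> M (Qm f \<otimes>\<^sub>m Ide M ?I) \<bullet> \<gamma> M (r (Q ?A))"
      unfolding run_TL_eq[OF Cod_Obj[OF \<open>f \<in> Arr M\<close>]] by (simp add: run_nat)
    also have "\<dots> = (?b \<bullet> \<gamma> M (Qm f \<otimes>\<^sub>m Ide M (Q ?I)) \<bullet> run TL ?A) \<bullet> \<gamma> M (p ?A)"
      unfolding run_TL_eq[OF Dom_Obj[OF \<open>f \<in> Arr M\<close>], symmetric] by simp
    finally have "(?b \<bullet> run TL ?B \<bullet> \<gamma> M f) \<bullet> \<gamma> M (p ?A) = (?b \<bullet> \<gamma> M (Qm f \<otimes>\<^sub>m Ide M (Q ?I)) \<bullet> run TL ?A) \<bullet> \<gamma> M (p ?A)" .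
    from H.iso_epi[OF _ this] have "?b \<bullet> (run TL ?B \<bullet> \<gamma> M f) = ?b \<bullet> (\<gamma> M (Qm f \<otimes>\<^sub>m Ide M (Q ?I)) \<bullet> run TL ?A)"
      by simp
    from H.iso_mono[OF _ this] show "run TL ?B \<bullet> farr ?F (\<gamma> M f) = farr ?G (\<gamma> M f) \<bullet> run TL ?A"
      by simp
  qed simp_all
  then show ?thesis by simp
qed

section \<open>Coherence axioms of the left derived structure\<close>

lemma TL_pentagon:
  assumes [simp]: "W \<in> Obj M" "X \<in> Obj M" "Y \<in> Obj M" "Z \<in> Obj M"
  shows "tl (Ide H W) (\<alpha>l X Y Z) \<bullet> \<alpha>l W (Q X \<otimes> Q Y) Z \<bullet> tl (\<alpha>l W X Y) (Ide H Z)
    = \<alpha>l W X (Q Y \<otimes> Q Z) \<bullet> \<alpha>l (Q W \<otimes> Q X) Y Z"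
proof -
  let ?WX = "Q W \<otimes> Q X" and ?XY = "Q X \<otimes> Q Y" and ?YZ = "Q Y \<otimes> Q Z"
  \<comment> \<open>After composition with \<open>\<gamma> M ?v\<close>, each side becomes a side of
    the pentagon at \<open>Q W\<close>, \<open>Q X\<close>, \<open>Q Y\<close>, \<open>Q Z\<close>
    preceded by the same comparison \<open>?s\<close>. The squares \<open>tl_square2\<close> and
    \<open>tl_square1\<close> remove the associators inside a derived tensor product, and each
    \<open>p\<close> in the way passes through \<open>\<alpha>\<close> by naturality.\<close>
  let ?v = "Ide M (Q W) \<otimes>\<^sub>m ((Ide M (Q X) \<otimes>\<^sub>m p ?YZ) \<cdot> p (Q X \<otimes> Q ?YZ))"
  let ?s = "((p ?WX \<otimes>\<^sub>m Ide M (Q Y)) \<cdot> p (Q ?WX \<otimes> Q Y)) \<otimes>\<^sub>m Ide M (Q Z)"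
  have "\<gamma> M ?v \<bullet> (tl (Ide H W) (\<alpha>l X Y Z) \<bullet> \<alpha>l W ?XY Z \<bullet> tl (\<alpha>l W X Y) (Ide H Z))
    = (\<gamma> M ?v \<bullet> tl (Ide H W) (\<alpha>l X Y Z)) \<bullet> \<alpha>l W ?XY Z \<bullet> tl (\<alpha>l W X Y) (Ide H Z)"
    by simp
  also have "\<gamma> M ?v \<bullet> tl (Ide H W) (\<alpha>l X Y Z)
    = \<gamma> M (Ide M (Q W) \<otimes>\<^sub>m ((\<alpha> (Q X) (Q Y) (Q Z) \<cdot> (p ?XY \<otimes>\<^sub>m Ide M (Q Z))) \<cdot> p (Q ?XY \<otimes> Q Z)))"
    by (rule tl_square2) (simp_all add: \<alpha>l_eq)
  also have "\<dots> \<bullet> \<alpha>l W ?XY Z \<bullet> tl (\<alpha>l W X Y) (Ide H Z)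
    = \<gamma> M (Ide M (Q W) \<otimes>\<^sub>m (\<alpha> (Q X) (Q Y) (Q Z) \<cdot> (p ?XY \<otimes>\<^sub>m Ide M (Q Z)))) \<bullet>
      (\<gamma> M (Ide M (Q W) \<otimes>\<^sub>m p (Q ?XY \<otimes> Q Z)) \<bullet> \<alpha>l W ?XY Z) \<bullet> tl (\<alpha>l W X Y) (Ide H Z)"
    by simp
  also have "\<gamma> M (Ide M (Q W) \<otimes>\<^sub>m p (Q ?XY \<otimes> Q Z)) \<bullet> \<alpha>l W ?XY Z
    = \<gamma> M (\<alpha> (Q W) (Q ?XY) (Q Z) \<cdot> (p (Q W \<otimes> Q ?XY) \<otimes>\<^sub>m Ide M (Q Z)))"
    by (simp add: \<alpha>l_eq)
  also have "\<gamma> M (Ide M (Q W) \<otimes>\<^sub>m (\<alpha> (Q X) (Q Y) (Q Z) \<cdot> (p ?XY \<otimes>\<^sub>m Ide M (Q Z)))) \<bullet>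
      \<dots> \<bullet> tl (\<alpha>l W X Y) (Ide H Z)
    = \<gamma> M ((Ide M (Q W) \<otimes>\<^sub>m \<alpha> (Q X) (Q Y) (Q Z)) \<cdot>
        ((Ide M (Q W) \<otimes>\<^sub>m (p ?XY \<otimes>\<^sub>m Ide M (Q Z))) \<cdot> \<alpha> (Q W) (Q ?XY) (Q Z)) \<cdot> (p (Q W \<otimes> Q ?XY) \<otimes>\<^sub>m Ide M (Q Z)))
      \<bullet> tl (\<alpha>l W X Y) (Ide H Z)"
    by simp
  also have "(Ide M (Q W) \<otimes>\<^sub>m (p ?XY \<otimes>\<^sub>m Ide M (Q Z))) \<cdot> \<alpha> (Q W) (Q ?XY) (Q Z)
    = \<alpha> (Q W) ?XY (Q Z) \<cdot> ((Ide M (Q W) \<otimes>\<^sub>m p ?XY) \<otimes>\<^sub>m Ide M (Q Z))"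
    by (subst asc_nat) simp_all
  also have "\<gamma> M ((Ide M (Q W) \<otimes>\<^sub>m \<alpha> (Q X) (Q Y) (Q Z)) \<cdot> \<dots> \<cdot> (p (Q W \<otimes> Q ?XY) \<otimes>\<^sub>m Ide M (Q Z)))
      \<bullet> tl (\<alpha>l W X Y) (Ide H Z)
    = \<gamma> M ((Ide M (Q W) \<otimes>\<^sub>m \<alpha> (Q X) (Q Y) (Q Z)) \<cdot> \<alpha> (Q W) ?XY (Q Z)) \<bullet>
      (\<gamma> M (((Ide M (Q W) \<otimes>\<^sub>m p ?XY) \<cdot> p (Q W \<otimes> Q ?XY)) \<otimes>\<^sub>m Ide M (Q Z)) \<bullet> tl (\<alpha>l W X Y) (Ide H Z))"
    by simp
  also have "\<gamma> M (((Ide M (Q W) \<otimes>\<^sub>m p ?XY) \<cdot> p (Q W \<otimes> Q ?XY)) \<otimes>\<^sub>m Ide M (Q Z)) \<bullet> tl (\<alpha>l W X Y) (Ide H Z)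
    = \<gamma> M (((\<alpha> (Q W) (Q X) (Q Y) \<cdot> (p ?WX \<otimes>\<^sub>m Ide M (Q Y))) \<cdot> p (Q ?WX \<otimes> Q Y)) \<otimes>\<^sub>m Ide M (Q Z))"
    by (rule tl_square1) (simp_all add: \<alpha>l_eq)
  also have "\<gamma> M ((Ide M (Q W) \<otimes>\<^sub>m \<alpha> (Q X) (Q Y) (Q Z)) \<cdot> \<alpha> (Q W) ?XY (Q Z)) \<bullet> \<dots>
    = \<gamma> M (((Ide M (Q W) \<otimes>\<^sub>m \<alpha> (Q X) (Q Y) (Q Z)) \<cdot> \<alpha> (Q W) ?XY (Q Z) \<cdot> (\<alpha> (Q W) (Q X) (Q Y) \<otimes>\<^sub>m Ide M (Q Z))) \<cdot> ?s)"
    by simp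
  also have "\<dots> = \<gamma> M ((\<alpha> (Q W) (Q X) ?YZ \<cdot> \<alpha> ?WX (Q Y) (Q Z)) \<cdot> ?s)"
    by (simp only: pentagon Q_Obj assms)
  finally have L: "\<gamma> M ?v \<bullet> (tl (Ide H W) (\<alpha>l X Y Z) \<bullet> \<alpha>l W ?XY Z \<bullet> tl (\<alpha>l W X Y) (Ide H Z))
    = \<gamma> M ((\<alpha> (Q W) (Q X) ?YZ \<cdot> \<alpha> ?WX (Q Y) (Q Z)) \<cdot> ?s)" .
  have "\<gamma> M ?v \<bullet> (\<alpha>l W X ?YZ \<bullet> \<alpha>l ?WX Y Z)
    = \<gamma> M (Ide M (Q W) \<otimes>\<^sub>m (Ide M (Q X) \<otimes>\<^sub>m p ?YZ)) \<bullet> (\<gamma> M (Ide M (Q W) \<otimes>\<^sub>m p (Q X \<otimes> Q ?YZ)) \<bullet> \<alpha>l W X ?YZ) \<bullet> \<alpha>l ?WX Y Z"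
    by simp
  also have "\<gamma> M (Ide M (Q W) \<otimes>\<^sub>m p (Q X \<otimes> Q ?YZ)) \<bullet> \<alpha>l W X ?YZ
    = \<gamma> M (\<alpha> (Q W) (Q X) (Q ?YZ) \<cdot> (p ?WX \<otimes>\<^sub>m Ide M (Q ?YZ)))"
    by (simp add: \<alpha>l_eq)
  also have "\<gamma> M (Ide M (Q W) \<otimes>\<^sub>m (Ide M (Q X) \<otimes>\<^sub>m p ?YZ)) \<bullet> \<dots> \<bullet> \<alpha>l ?WX Y Z
    = \<gamma> M (((Ide M (Q W) \<otimes>\<^sub>m (Ide M (Q X) \<otimes>\<^sub>m p ?YZ)) \<cdot> \<alpha> (Q W) (Q X) (Q ?YZ)) \<cdot> (p ?WX \<otimes>\<^sub>m Ide M (Q ?YZ))) \<bullet> \<alpha>l ?WX Y Z"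
    by simp
  also have "(Ide M (Q W) \<otimes>\<^sub>m (Ide M (Q X) \<otimes>\<^sub>m p ?YZ)) \<cdot> \<alpha> (Q W) (Q X) (Q ?YZ)
    = \<alpha> (Q W) (Q X) ?YZ \<cdot> ((Ide M (Q W) \<otimes>\<^sub>m Ide M (Q X)) \<otimes>\<^sub>m p ?YZ)"
    by (subst asc_nat) simp_all
  also have "\<gamma> M (\<dots> \<cdot> (p ?WX \<otimes>\<^sub>m Ide M (Q ?YZ))) \<bullet> \<alpha>l ?WX Y Z
    = \<gamma> M (\<alpha> (Q W) (Q X) ?YZ \<cdot> (p ?WX \<otimes>\<^sub>m Ide M ?YZ)) \<bullet> (\<gamma> M (Ide M (Q ?WX) \<otimes>\<^sub>m p ?YZ) \<bullet> \<alpha>l ?WX Y Z)"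
    by simp
  also have "\<gamma> M (Ide M (Q ?WX) \<otimes>\<^sub>m p ?YZ) \<bullet> \<alpha>l ?WX Y Z
    = \<gamma> M (\<alpha> (Q ?WX) (Q Y) (Q Z) \<cdot> (p (Q ?WX \<otimes> Q Y) \<otimes>\<^sub>m Ide M (Q Z)))"
    by (simp add: \<alpha>l_eq)
  also have "\<gamma> M (\<alpha> (Q W) (Q X) ?YZ \<cdot> (p ?WX \<otimes>\<^sub>m Ide M ?YZ)) \<bullet> \<dots>
    = \<gamma> M (\<alpha> (Q W) (Q X) ?YZ \<cdot> ((p ?WX \<otimes>\<^sub>m (Ide M (Q Y) \<otimes>\<^sub>m Ide M (Q Z))) \<cdot> \<alpha> (Q ?WX) (Q Y) (Q Z))
        \<cdot> (p (Q ?WX \<otimes> Q Y) \<otimes>\<^sub>m Ide M (Q Z)))"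
    by simp
  also have "(p ?WX \<otimes>\<^sub>m (Ide M (Q Y) \<otimes>\<^sub>m Ide M (Q Z))) \<cdot> \<alpha> (Q ?WX) (Q Y) (Q Z)
    = \<alpha> ?WX (Q Y) (Q Z) \<cdot> ((p ?WX \<otimes>\<^sub>m Ide M (Q Y)) \<otimes>\<^sub>m Ide M (Q Z))"
    by (subst asc_nat) simp_all
  also have "\<gamma> M (\<alpha> (Q W) (Q X) ?YZ \<cdot> \<dots> \<cdot> (p (Q ?WX \<otimes> Q Y) \<otimes>\<^sub>m Ide M (Q Z)))
    = \<gamma> M ((\<alpha> (Q W) (Q X) ?YZ \<cdot> \<alpha> ?WX (Q Y) (Q Z)) \<cdot> ?s)"
    by simp
  finally have "\<gamma> M ?v \<bullet> (tl (Ide H W) (\<alpha>l X Y Z) \<bullet> \<alpha>l W ?XY Z \<bullet> tl (\<alpha>l W X Y) (Ide H Z))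
    = \<gamma> M ?v \<bullet> (\<alpha>l W X ?YZ \<bullet> \<alpha>l ?WX Y Z)"
    unfolding L by (rule sym)
  moreover have "iso_arr H (\<gamma> M ?v)"
    by (intro tensor_iso2 classes_Comp) (simp_all add: tensor_Weq2)
  ultimately show ?thesis
    using H.iso_mono[of "\<gamma> M ?v" "tl (Ide H W) (\<alpha>l X Y Z) \<bullet> \<alpha>l W ?XY Z \<bullet> tl (\<alpha>l W X Y) (Ide H Z)" "\<alpha>l W X ?YZ \<bullet> \<alpha>l ?WX Y Z"]
    by (simp del: \<gamma>_Comp_rev \<gamma>_Comp_rev')
qed

text \<open>The derived left unit is \<open>p X\<close> after \<open>g\<close>, and the derived
  tensor product applies \<open>Qm\<close> to both. Replacing \<open>Qm (p X)\<close> by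
  \<open>p (Q X)\<close>, which has the same image here, lets naturality of \<open>p\<close> turn
  \<open>Qm g\<close> into \<open>g\<close>.\<close>

lemma tl_lun:
  assumes [simp]: "X \<in> Obj M" "Y \<in> Obj M"
  defines "g \<equiv> l (Q X) \<cdot> (p (tunit T) \<otimes>\<^sub>m Ide M (Q X))"
  shows "tl (lun TL X) (Ide H Y) = \<gamma> M (g \<otimes>\<^sub>m Ide M (Q Y)) \<bullet> \<gamma> M (p (Q (tunit T) \<otimes> Q X) \<otimes>\<^sub>m Ide M (Q Y))"
    "tl (Ide H Y) (lun TL X) = \<gamma> M (Ide M (Q Y) \<otimes>\<^sub>m g) \<bullet> \<gamma> M (Ide M (Q Y) \<otimes>\<^sub>m p (Q (tunit T) \<otimes> Q X))"
proof -
  have g [simp]: "g \<in> Arr M" "Dom M g = Q (tunit T) \<otimes> Q X" "Cod M g = Q X" by (simp_all add: g_def)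
  have n: "p (Q X) \<cdot> Qm g = g \<cdot> p (Q (tunit T) \<otimes> Q X)" by (simp add: pm_natural)
  have "tl (lun TL X) (Ide H Y) = \<gamma> M (Qm (p X) \<otimes>\<^sub>m Ide M (Q Y)) \<bullet> \<gamma> M (Qm g \<otimes>\<^sub>m Ide M (Q Y))"
    by (simp add: lun_TL Qm_Comp flip: g_def)
  also have "\<dots> = \<gamma> M ((p (Q X) \<cdot> Qm g) \<otimes>\<^sub>m Ide M (Q Y))" by (simp add: \<gamma>_Qp del: n)
  finally show "tl (lun TL X) (Ide H Y) = \<gamma> M (g \<otimes>\<^sub>m Ide M (Q Y)) \<bullet> \<gamma> M (p (Q (tunit T) \<otimes> Q X) \<otimes>\<^sub>m Ide M (Q Y))"
    unfolding n by simp
  have "tl (Ide H Y) (lun TL X) = \<gamma> M (Ide M (Q Y) \<otimes>\<^sub>m Qm (p X)) \<bullet> \<gamma> M (Ide M (Q Y) \<otimes>\<^sub>m Qm g)"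
    by (simp add: lun_TL Qm_Comp flip: g_def)
  also have "\<dots> = \<gamma> M (Ide M (Q Y) \<otimes>\<^sub>m (p (Q X) \<cdot> Qm g))" by (simp add: \<gamma>_Qp del: n)
  finally show "tl (Ide H Y) (lun TL X) = \<gamma> M (Ide M (Q Y) \<otimes>\<^sub>m g) \<bullet> \<gamma> M (Ide M (Q Y) \<otimes>\<^sub>m p (Q (tunit T) \<otimes> Q X))"
    unfolding n by simp
qed

lemma TL_lun_asc:
  assumes [simp]: "X \<in> Obj M" "Y \<in> Obj M"
  shows "lun TL (Q X \<otimes> Q Y) \<bullet> \<alpha>l (tunit T) X Y = tl (lun TL X) (Ide H Y)"
proof -
  let ?P = "Q X \<otimes> Q Y" and ?I = "tunit T"
  let ?c = "p (Q ?I \<otimes> Q X) \<otimes>\<^sub>m Ide M (Q Y)"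
  \<comment> \<open>The leftmost \<open>p\<close> is moved to the right of \<open>l\<close>, where
    it becomes the factor that clears the inverse in the associator.\<close>
  have "p ?P \<cdot> l (Q ?P) \<cdot> (p ?I \<otimes>\<^sub>m Ide M (Q ?P)) = (l ?P \<cdot> (Ide M ?I \<otimes>\<^sub>m p ?P)) \<cdot> (p ?I \<otimes>\<^sub>m Ide M (Q ?P))"
    by (simp add: lun_nat)
  also have "\<dots> = l ?P \<cdot> (p ?I \<otimes>\<^sub>m Ide M ?P) \<cdot> (Ide M (Q ?I) \<otimes>\<^sub>m p ?P)"
    by simp
  finally have "lun TL ?P \<bullet> \<alpha>l ?I X Y
    = \<gamma> M (l ?P \<cdot> (p ?I \<otimes>\<^sub>m Ide M ?P)) \<bullet> (\<gamma> M (Ide M (Q ?I) \<otimes>\<^sub>m p ?P) \<bullet> \<alpha>l ?I X Y)"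
    by (simp add: lun_TL)
  also have "\<dots> = \<gamma> M (l ?P \<cdot> ((p ?I \<otimes>\<^sub>m (Ide M (Q X) \<otimes>\<^sub>m Ide M (Q Y))) \<cdot> \<alpha> (Q ?I) (Q X) (Q Y)) \<cdot> ?c)"
    unfolding \<alpha>l_eq[OF tunit_Obj assms] by simp
  also have "(p ?I \<otimes>\<^sub>m (Ide M (Q X) \<otimes>\<^sub>m Ide M (Q Y))) \<cdot> \<alpha> (Q ?I) (Q X) (Q Y)
    = \<alpha> ?I (Q X) (Q Y) \<cdot> ((p ?I \<otimes>\<^sub>m Ide M (Q X)) \<otimes>\<^sub>m Ide M (Q Y))"
    by (subst asc_nat) simp_all
  also have "l ?P \<cdot> \<dots> \<cdot> ?c = (l ?P \<cdot> \<alpha> ?I (Q X) (Q Y)) \<cdot> ((p ?I \<otimes>\<^sub>m Ide M (Q X)) \<otimes>\<^sub>m Ide M (Q Y)) \<cdot> ?c"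
    by simp
  also have "l ?P \<cdot> \<alpha> ?I (Q X) (Q Y) = l (Q X) \<otimes>\<^sub>m Ide M (Q Y)"
    by (rule lun_asc) simp_all
  finally show ?thesis
    by (simp add: tl_lun)
qed

lemma TL_triangle:
  assumes [simp]: "X \<in> Obj M" "Y \<in> Obj M"
  shows "tl (Ide H X) (lun TL Y) \<bullet> \<alpha>l X (tunit T) Y \<bullet> tl (run TL X) (Ide H Y) = Ide H (Q X \<otimes> Q Y)"
proof -
  let ?I = "tunit T" and ?D = "Ide M (Q Y)"
  \<comment> \<open>\<open>run TL X\<close> begins with the inverse of \<open>p X\<close>, so it
    enters the square together with \<open>\<gamma> M (p X)\<close>. Under the derived tensor
    product that factor becomes \<open>p (Q X)\<close> tensored with \<open>?D\<close>, by
    \<open>\<gamma>_Qp\<close>, and is cancelled afterwards.\<close>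
  have "\<gamma> M (((Ide M (Q X) \<otimes>\<^sub>m p ?I) \<cdot> p (Q X \<otimes> Q ?I)) \<otimes>\<^sub>m ?D) \<bullet> tl (run TL X \<bullet> \<gamma> M (p X)) (Ide H Y)
    = \<gamma> M ((r (Q X) \<cdot> p (Q X)) \<otimes>\<^sub>m ?D)"
    by (rule tl_square1) (simp_all add: run_TL_eq)
  also have "tl (run TL X \<bullet> \<gamma> M (p X)) (Ide H Y) = tl (run TL X) (Ide H Y) \<bullet> \<gamma> M (p (Q X) \<otimes>\<^sub>m ?D)"
    using tl_Comp[of "\<gamma> M (p X)" "Ide H Y" "run TL X" "Ide H Y"] by (simp add: \<gamma>_Qp)
  finally have "(\<gamma> M (((Ide M (Q X) \<otimes>\<^sub>m p ?I) \<cdot> p (Q X \<otimes> Q ?I)) \<otimes>\<^sub>m ?D) \<bullet> tl (run TL X) (Ide H Y)) \<bullet> \<gamma> M (p (Q X) \<otimes>\<^sub>m ?D)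
    = \<gamma> M (r (Q X) \<otimes>\<^sub>m ?D) \<bullet> \<gamma> M (p (Q X) \<otimes>\<^sub>m ?D)"
    by simp
  from H.iso_epi[OF _ this] have R: "\<gamma> M (((Ide M (Q X) \<otimes>\<^sub>m p ?I) \<cdot> p (Q X \<otimes> Q ?I)) \<otimes>\<^sub>m ?D) \<bullet> tl (run TL X) (Ide H Y)
    = \<gamma> M (r (Q X) \<otimes>\<^sub>m ?D)"
    by simp
  have "tl (Ide H X) (lun TL Y) \<bullet> \<alpha>l X ?I Y \<bullet> tl (run TL X) (Ide H Y)
    = \<gamma> M (Ide M (Q X) \<otimes>\<^sub>m (l (Q Y) \<cdot> (p ?I \<otimes>\<^sub>m ?D))) \<bullet> (\<gamma> M (Ide M (Q X) \<otimes>\<^sub>m p (Q ?I \<otimes> Q Y)) \<bullet> \<alpha>l X ?I Y) \<bullet> tl (run TL X) (Ide H Y)"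
    by (simp add: tl_lun)
  also have "\<dots> = \<gamma> M ((Ide M (Q X) \<otimes>\<^sub>m l (Q Y)) \<cdot> ((Ide M (Q X) \<otimes>\<^sub>m (p ?I \<otimes>\<^sub>m ?D)) \<cdot> \<alpha> (Q X) (Q ?I) (Q Y)) \<cdot> (p (Q X \<otimes> Q ?I) \<otimes>\<^sub>m ?D))
      \<bullet> tl (run TL X) (Ide H Y)"
    unfolding \<alpha>l_eq[OF assms(1) tunit_Obj assms(2)] by simp
  also have "(Ide M (Q X) \<otimes>\<^sub>m (p ?I \<otimes>\<^sub>m ?D)) \<cdot> \<alpha> (Q X) (Q ?I) (Q Y) = \<alpha> (Q X) ?I (Q Y) \<cdot> ((Ide M (Q X) \<otimes>\<^sub>m p ?I) \<otimes>\<^sub>m ?D)"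
    by (subst asc_nat) simp_all
  also have "\<gamma> M ((Ide M (Q X) \<otimes>\<^sub>m l (Q Y)) \<cdot> \<dots> \<cdot> (p (Q X \<otimes> Q ?I) \<otimes>\<^sub>m ?D)) \<bullet> tl (run TL X) (Ide H Y)
    = \<gamma> M ((Ide M (Q X) \<otimes>\<^sub>m l (Q Y)) \<cdot> \<alpha> (Q X) ?I (Q Y)) \<bullet>
      (\<gamma> M (((Ide M (Q X) \<otimes>\<^sub>m p ?I) \<cdot> p (Q X \<otimes> Q ?I)) \<otimes>\<^sub>m ?D) \<bullet> tl (run TL X) (Ide H Y))"
    by simp
  also have "\<dots> = \<gamma> M ((Ide M (Q X) \<otimes>\<^sub>m l (Q Y)) \<cdot> \<alpha> (Q X) ?I (Q Y) \<cdot> (r (Q X) \<otimes>\<^sub>m ?D))"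
    unfolding R by simp
  also have "\<dots> = Ide H (Q X \<otimes> Q Y)"
    using triangle[of "Q X" "Q Y"] by (simp add: \<gamma>_Ide)
  finally show ?thesis .
qed

text \<open>For cofibrant \<open>A\<close>, naturality of \<open>r\<close> along \<open>p A\<close>
  relates the derived unit to \<open>r A\<close> itself instead of \<open>r (Q A)\<close>. This is
  applied at \<open>Q X \<otimes> Q Y\<close> and at the unit object.\<close>

lemma run_TL_cofibrant:
  assumes "cofibrant M A"
  shows "\<gamma> M (p A \<otimes>\<^sub>m p (tunit T)) \<bullet> run TL A = \<gamma> M (r A)"
proof -
  note [simp] = assms
  have "(\<gamma> M (p A \<otimes>\<^sub>m p (tunit T)) \<bullet> run TL A) \<bullet> \<gamma> M (p A)
    = \<gamma> M (p A \<otimes>\<^sub>m Ide M (tunit T)) \<bullet> (\<gamma> M (Ide M (Q A) \<otimes>\<^sub>m p (tunit T)) \<bullet> run TL A \<bullet> \<gamma> M (p A))"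
    by simp
  also have "\<dots> = \<gamma> M (r A) \<bullet> \<gamma> M (p A)"
    unfolding run_TL_eq[OF cofibrant_Obj[OF assms]] by (simp add: run_nat)
  finally have "(\<gamma> M (p A \<otimes>\<^sub>m p (tunit T)) \<bullet> run TL A) \<bullet> \<gamma> M (p A) = \<gamma> M (r A) \<bullet> \<gamma> M (p A)" .
  from H.iso_epi[OF _ this] show ?thesis by simp
qed

lemma TL_asc_run:
  assumes [simp]: "X \<in> Obj M" "Y \<in> Obj M"
  shows "\<alpha>l X Y (tunit T) \<bullet> run TL (Q X \<otimes> Q Y) = tl (Ide H X) (run TL Y)"
proof -
  let ?I = "tunit T" and ?P = "Q X \<otimes> Q Y" and ?E = "Ide M (Q X)"
  let ?v = "?E \<otimes>\<^sub>m ((Ide M (Q Y) \<otimes>\<^sub>m p ?I) \<cdot> p (Q Y \<otimes> Q ?I))"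
  have "\<gamma> M ?v \<bullet> tl (Ide H X) (run TL Y \<bullet> \<gamma> M (p Y))
    = \<gamma> M (?E \<otimes>\<^sub>m (r (Q Y) \<cdot> p (Q Y)))"
    by (rule tl_square2) (simp_all add: run_TL_eq)
  also have "tl (Ide H X) (run TL Y \<bullet> \<gamma> M (p Y)) = tl (Ide H X) (run TL Y) \<bullet> \<gamma> M (?E \<otimes>\<^sub>m p (Q Y))"
    using tl_Comp[of "Ide H X" "\<gamma> M (p Y)" "Ide H X" "run TL Y"] by (simp add: \<gamma>_Qp)
  finally have "(\<gamma> M ?v \<bullet> tl (Ide H X) (run TL Y)) \<bullet> \<gamma> M (?E \<otimes>\<^sub>m p (Q Y)) = \<gamma> M (?E \<otimes>\<^sub>m r (Q Y)) \<bullet> \<gamma> M (?E \<otimes>\<^sub>m p (Q Y))"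
    by simp
  from H.iso_epi[OF _ this] have R: "\<gamma> M ?v \<bullet> tl (Ide H X) (run TL Y) = \<gamma> M (?E \<otimes>\<^sub>m r (Q Y))"
    by simp
  have "\<gamma> M ?v \<bullet> (\<alpha>l X Y ?I \<bullet> run TL ?P)
    = \<gamma> M (?E \<otimes>\<^sub>m (Ide M (Q Y) \<otimes>\<^sub>m p ?I)) \<bullet> (\<gamma> M (?E \<otimes>\<^sub>m p (Q Y \<otimes> Q ?I)) \<bullet> \<alpha>l X Y ?I) \<bullet> run TL ?P"
    by simp
  also have "\<dots> = \<gamma> M (((?E \<otimes>\<^sub>m (Ide M (Q Y) \<otimes>\<^sub>m p ?I)) \<cdot> \<alpha> (Q X) (Q Y) (Q ?I)) \<cdot> (p ?P \<otimes>\<^sub>m Ide M (Q ?I))) \<bullet> run TL ?P"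
    unfolding \<alpha>l_eq[OF assms tunit_Obj] by simp
  also have "(?E \<otimes>\<^sub>m (Ide M (Q Y) \<otimes>\<^sub>m p ?I)) \<cdot> \<alpha> (Q X) (Q Y) (Q ?I) = \<alpha> (Q X) (Q Y) ?I \<cdot> ((?E \<otimes>\<^sub>m Ide M (Q Y)) \<otimes>\<^sub>m p ?I)"
    by (subst asc_nat) simp_all
  also have "\<gamma> M (\<dots> \<cdot> (p ?P \<otimes>\<^sub>m Ide M (Q ?I))) \<bullet> run TL ?P
    = \<gamma> M (\<alpha> (Q X) (Q Y) ?I) \<bullet> (\<gamma> M (p ?P \<otimes>\<^sub>m p ?I) \<bullet> run TL ?P)"
    by simp
  also have "\<dots> = \<gamma> M (\<alpha> (Q X) (Q Y) ?I \<cdot> r ?P)"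
    by (simp add: run_TL_cofibrant)
  also have "\<alpha> (Q X) (Q Y) ?I \<cdot> r ?P = ?E \<otimes>\<^sub>m r (Q Y)"
    by (rule asc_run) simp_all
  finally have "\<gamma> M ?v \<bullet> (\<alpha>l X Y ?I \<bullet> run TL ?P) = \<gamma> M ?v \<bullet> tl (Ide H X) (run TL Y)"
    unfolding R .
  moreover have "iso_arr H (\<gamma> M ?v)"
    by (intro tensor_iso2 classes_Comp) (simp_all add: tensor_Weq2)
  ultimately show ?thesis
    using H.iso_mono[of "\<gamma> M ?v" "\<alpha>l X Y ?I \<bullet> run TL ?P" "tl (Ide H X) (run TL Y)"]
    by (simp del: \<gamma>_Comp_rev \<gamma>_Comp_rev')
qed

lemma TL_lun_run: "lun TL (tunit T) \<bullet> run TL (tunit T) = Ide H (tunit T)"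
proof -
  let ?I = "tunit T"
  have "p ?I \<cdot> l (Q ?I) \<cdot> (p ?I \<otimes>\<^sub>m Ide M (Q ?I)) = (l ?I \<cdot> (Ide M ?I \<otimes>\<^sub>m p ?I)) \<cdot> (p ?I \<otimes>\<^sub>m Ide M (Q ?I))"
    by (simp add: lun_nat)
  then have "lun TL ?I \<bullet> run TL ?I = \<gamma> M (l ?I) \<bullet> (\<gamma> M (p ?I \<otimes>\<^sub>m p ?I) \<bullet> run TL ?I)"
    by (simp add: lun_TL)
  also have "\<dots> = Ide H ?I"
    by (simp add: run_TL_cofibrant lun_run \<gamma>_Ide)
  finally show ?thesis .
qed

theorem skew_monoidal_left_derived: "skew_monoidal H TL"
proof (intro skew_monoidal.intro skew_monoidal_axioms.intro)
  show "category H" by (rule category_Ho)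
  show "cat_functor (prod_cat H H) H (tensor TL)" by (rule TL_functor)
  show "\<alpha>l X Y Z \<in> Hom H (fobj (tensor TL) (fobj (tensor TL) (X, Y), Z)) (fobj (tensor TL) (X, fobj (tensor TL) (Y, Z)))"
    if "X \<in> Obj H" "Y \<in> Obj H" "Z \<in> Obj H" for X Y Z
    using that by (simp add: Hom_def)
  show "lun TL X \<in> Hom H (fobj (tensor TL) (tunit TL, X)) X" "run TL X \<in> Hom H X (fobj (tensor TL) (X, tunit TL))"
    if "X \<in> Obj H" for X
    using that by (simp_all add: Hom_def)
  show "\<alpha>l X' Y' Z' \<bullet> tl (tl f g) h = tl f (tl g h) \<bullet> \<alpha>l X Y Z"
    if "f \<in> Hom H X X'" "g \<in> Hom H Y Y'" "h \<in> Hom H Z Z'" for f g h X X' Y Y' Z Z'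
    using \<alpha>l_natural[of f g h] that by (simp add: Hom_def)
  show "lun TL X' \<bullet> tl (Ide H (tunit TL)) f = f \<bullet> lun TL X" "run TL X' \<bullet> f = tl f (Ide H (tunit TL)) \<bullet> run TL X"
    if "f \<in> Hom H X X'" for f X X'
    using lun_TL_natural[of f] run_TL_natural[of f] that by (simp_all add: Hom_def)
qed (simp_all add: TL_pentagon TL_lun_asc TL_triangle TL_asc_run TL_lun_run)

end

section \<open>The right derived skew closed structure\<close>

locale derived_structures = monoidal_model_category M T S \<phi>
  for M :: "('o, 'm) model" (structure)
    and T :: "('o, 'm) skew_mon" and S :: "('o, 'm) skew_clo"
    and \<phi> :: "'o \<Rightarrow> 'o \<Rightarrow> 'o \<Rightarrow> 'm \<Rightarrow> 'm" +
  fixes k :: "'o \<Rightarrow> 'o \<Rightarrow> 'm" and e :: 'm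
  assumes k_choice: "is_k_choice M S k" and e_choice: "is_e_choice M S e"
begin

abbreviation SR where "SR \<equiv> right_derived M S k e"
abbreviation hr where "hr f g \<equiv> farr (ihom SR) (f, g)"
abbreviation \<phi>d where "\<phi>d \<equiv> phi_d M T \<phi>"

section \<open>The derived internal hom and its structure maps\<close>

lemma k [simp]:
  assumes "cofibrant M A" "B \<in> Obj M"
  shows "k A B \<in> Arr M" "Dom M (k A B) = Q \<lbrakk>A, B\<rbrakk>" "Cod M (k A B) = \<lbrakk>A, Q B\<rbrakk>"
    "\<lbrakk>Ide M A, p B\<rbrakk>\<^sub>m \<cdot> k A B = p \<lbrakk>A, B\<rbrakk>"
  using k_choice assms by (auto simp: is_k_choice_def Hom_def)

lemma e [simp]: "e \<in> Arr M" "Dom M e = tunit T" "Cod M e = Q (tunit T)" "p (tunit T) \<cdot> e = Ide M (tunit T)"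
  using e_choice by (auto simp: is_e_choice_def Hom_def unit_eq)

lemma SR_functor: "cat_functor (prod_cat (op_cat H) H) H (ihom SR)"
  and hr_\<gamma> [simp]: "\<lbrakk>f \<in> Arr M; g \<in> Arr M\<rbrakk> \<Longrightarrow> hr (\<gamma> M f) (\<gamma> M g) = \<gamma> M \<lbrakk>Qm f, Rm g\<rbrakk>\<^sub>m"
proof -
  let ?F = "\<lparr>fobj = (\<lambda>(A, B). \<lbrakk>Q A, R B\<rbrakk>), farr = (\<lambda>(f, g). \<gamma> M \<lbrakk>Qm f, Rm g\<rbrakk>\<^sub>m)\<rparr>"
  have S: "ihom SR = ho_ext2_op M H ?F" by (simp add: right_derived_def Let_def)
  have 1: "weq_inverting M (op_cat H) (sec1 M ?F B)" if "B \<in> Obj M" for B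
    by (rule weq_invertingI) (use that in \<open>simp_all add: sec1_def category_Ho category_op_cat \<gamma>_Ide Qm_Comp\<close>)
  have 2: "weq_inverting M H (sec2 M ?F A)" if "A \<in> Obj M" for A
    by (rule weq_invertingI) (use that in \<open>simp_all add: sec2_def category_Ho \<gamma>_Ide Rm_Comp\<close>)
  show "cat_functor (prod_cat (op_cat H) H) H (ihom SR)"
    unfolding S by (rule ho_ext2_op_sections(1)[OF category_Ho 1 2]) simp_all
  show "hr (\<gamma> M f) (\<gamma> M g) = \<gamma> M \<lbrakk>Qm f, Rm g\<rbrakk>\<^sub>m" if "f \<in> Arr M" "g \<in> Arr M"
    unfolding S using ho_ext2_op_sections(2)[OF category_Ho 1 2 _ that] that by simp
qed

lemma SR_Obj [simp]: "fobj (ihom SR) (A, B) = \<lbrakk>Q A, R B\<rbrakk>"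
  by (simp add: right_derived_def Let_def ho_ext2_op_def)

lemma cunit_SR [simp]: "cunit SR = tunit T"
  by (simp add: right_derived_def Let_def unit_eq)

lemma hr_arr [simp]:
  assumes "f \<in> Arr H" "g \<in> Arr H"
  shows "hr f g \<in> Arr H" "Dom H (hr f g) = \<lbrakk>Q (Cod H f), R (Dom H g)\<rbrakk>"
    "Cod H (hr f g) = \<lbrakk>Q (Dom H f), R (Cod H g)\<rbrakk>"
  using cat_functor.farr_arr[OF SR_functor, of "(f, g)"] assms by auto

lemma hr_Comp:
  "\<lbrakk>f \<in> Arr H; g \<in> Arr H; f' \<in> Arr H; g' \<in> Arr H; Cod H f' = Dom H f; Cod H g = Dom H g'\<rbrakk>
   \<Longrightarrow> hr (f \<bullet> f') (g' \<bullet> g) = hr f' g' \<bullet> hr f g"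
  using cat_functor.farr_Comp'[OF SR_functor, of "(f, g)" "(f', g')"] by simp

lemma hr_Ide [simp]: "\<lbrakk>A \<in> Obj M; B \<in> Obj M\<rbrakk> \<Longrightarrow> hr (Ide H A) (Ide H B) = Ide H \<lbrakk>Q A, R B\<rbrakk>"
  using cat_functor.farr_Ide[OF SR_functor, of "(A, B)"] by simp

lemma hr_\<gamma>_Ide [simp]:
  "\<lbrakk>f \<in> Arr M; B \<in> Obj M\<rbrakk> \<Longrightarrow> hr (\<gamma> M f) (Ide H B) = \<gamma> M \<lbrakk>Qm f, Ide M (R B)\<rbrakk>\<^sub>m"
  "\<lbrakk>f \<in> Arr M; B \<in> Obj M\<rbrakk> \<Longrightarrow> hr (Ide H B) (\<gamma> M f) = \<gamma> M \<lbrakk>Ide M (Q B), Rm f\<rbrakk>\<^sub>m"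
  using hr_\<gamma>[of f "Ide M B"] hr_\<gamma>[of "Ide M B" f] by (simp_all add: \<gamma>_Ide)

lemma hr_iso [simp]:
  assumes "iso_arr H f" "iso_arr H g"
  shows "iso_arr H (hr f g)" "inv_arr H (hr f g) = hr (inv_arr H f) (inv_arr H g)"
  using H.isoI[of "hr f g" "hr (inv_arr H f) (inv_arr H g)"] assms
    H.iso_is_Arr[OF assms(1)] H.iso_is_Arr[OF assms(2)] by (simp_all flip: hr_Comp)

text \<open>As for the associator, the inverse is cleared, here by precomposition, since the
  inverted map is applied first in the definition of \<open>L\<close>.\<close>

lemma Lc_SR:
  assumes [simp]: "X \<in> Obj M" "Y \<in> Obj M" "Z \<in> Obj M"
  shows Lc_SR_arr [simp]: "Lc SR X Y Z \<in> Arr H" "Dom H (Lc SR X Y Z) = \<lbrakk>Q Y, R Z\<rbrakk>"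
      "Cod H (Lc SR X Y Z) = \<lbrakk>Q \<lbrakk>Q X, R Y\<rbrakk>, R \<lbrakk>Q X, R Z\<rbrakk>\<rbrakk>"
    and Lc_SR_eq: "Lc SR X Y Z \<bullet> \<gamma> M \<lbrakk>Qm (q Y), Ide M (R Z)\<rbrakk>\<^sub>m
      = \<gamma> M (\<lbrakk>k (Q X) (R Y), q \<lbrakk>Q X, R Z\<rbrakk>\<rbrakk>\<^sub>m \<cdot> L (Q X) (Q (R Y)) (R Z))"
  by (simp_all add: right_derived_def Let_def)

lemma ic_SR:
  assumes [simp]: "X \<in> Obj M"
  shows ic_SR_arr [simp]: "ic SR X \<in> Arr H" "Dom H (ic SR X) = \<lbrakk>Q (tunit T), R X\<rbrakk>" "Cod H (ic SR X) = X"
    and ic_SR_eq: "\<gamma> M (q X) \<bullet> ic SR X = \<gamma> M (i (R X) \<cdot> \<lbrakk>e, Ide M (R X)\<rbrakk>\<^sub>m)"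
  by (simp_all add: right_derived_def Let_def flip: unit_eq)

lemma jc_SR: "X \<in> Obj M \<Longrightarrow> jc SR X = \<gamma> M (\<lbrakk>p X, q X\<rbrakk>\<^sub>m \<cdot> j X)"
  by (simp add: right_derived_def Let_def)

lemma Lc_SR_natural1:
  assumes "g \<in> Arr H" and [simp]: "X \<in> Obj M" "Z \<in> Obj M"
  shows "hr (hr (Ide H X) g) (Ide H \<lbrakk>Q X, R Z\<rbrakk>) \<bullet> Lc SR X (Cod H g) Z = Lc SR X (Dom H g) Z \<bullet> hr g (Ide H Z)"
proof -
  let ?V = "\<lbrakk>Q X, R Z\<rbrakk>"
  let ?F = "\<lparr>fobj = (\<lambda>A. \<lbrakk>Q \<lbrakk>Q X, R A\<rbrakk>, R ?V\<rbrakk>), farr = (\<lambda>g. hr (hr (Ide H X) g) (Ide H ?V))\<rparr>"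
  let ?G = "\<lparr>fobj = (\<lambda>A. \<lbrakk>Q A, R Z\<rbrakk>), farr = (\<lambda>g. hr g (Ide H Z))\<rparr>"
  \<comment> \<open>Both functors are contravariant in \<open>g\<close>; in the opposite category
    \<open>ho_natural\<close> applies, with composition reversed.\<close>
  have "Lc SR X (Cod H g) Z \<cdot>\<^bsub>op_cat H\<^esub> farr ?F g = farr ?G g \<cdot>\<^bsub>op_cat H\<^esub> Lc SR X (Dom H g) Z"
  proof (rule ho_natural[where \<tau> = "\<lambda>A. Lc SR X A Z", OF _ _ _ _ _ _ assms(1)])
    show "cat_functor H (op_cat H) ?F"
    proof (rule cat_functorI)
      fix f g assume [simp]: "f \<in> Arr H" "g \<in> Arr H" "Cod H f = Dom H g"
      show "farr ?F (g \<bullet> f) = farr ?F g \<cdot>\<^bsub>op_cat H\<^esub> farr ?F f"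
        using hr_Comp[of "Ide H X" f "Ide H X" g] hr_Comp[of "hr (Ide H X) g" "Ide H ?V" "hr (Ide H X) f" "Ide H ?V"]
        by simp
    qed (simp_all add: category_Ho category_op_cat)
    show "cat_functor H (op_cat H) ?G"
    proof (rule cat_functorI)
      fix f g assume [simp]: "f \<in> Arr H" "g \<in> Arr H" "Cod H f = Dom H g"
      show "farr ?G (g \<bullet> f) = farr ?G g \<cdot>\<^bsub>op_cat H\<^esub> farr ?G f"
        using hr_Comp[of g "Ide H Z" f "Ide H Z"] by simp
    qed (simp_all add: category_Ho category_op_cat)
    fix f assume f [simp]: "f \<in> Arr M"
    let ?Y = "Cod M f" and ?Y' = "Dom M f"
    \<comment> \<open>Naturality of \<open>k\<close> would make \<open>?a\<close> and
      \<open>?b\<close> equal. They agree after the weak equivalence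
      \<open>\<lbrakk>Ide M (Q X), p (R ?Y)\<rbrakk>\<^sub>m\<close>, and by
      \<open>\<gamma>_hom_cong\<close> this suffices once the hom into the fibrant \<open>?V\<close>
      is applied.\<close>
    let ?a = "k (Q X) (R ?Y) \<cdot> Qm \<lbrakk>Ide M (Q X), Rm f\<rbrakk>\<^sub>m" and ?b = "\<lbrakk>Ide M (Q X), Qm (Rm f)\<rbrakk>\<^sub>m \<cdot> k (Q X) (R ?Y')"
    have "\<lbrakk>Ide M (Q X), p (R ?Y)\<rbrakk>\<^sub>m \<cdot> ?a = (\<lbrakk>Ide M (Q X), p (R ?Y)\<rbrakk>\<^sub>m \<cdot> k (Q X) (R ?Y)) \<cdot> Qm \<lbrakk>Ide M (Q X), Rm f\<rbrakk>\<^sub>m"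
      by (simp del: k(4))
    also have "\<dots> = \<lbrakk>Ide M (Q X), Rm f\<rbrakk>\<^sub>m \<cdot> p \<lbrakk>Q X, R ?Y'\<rbrakk>"
      by (simp add: pm_natural)
    also have "\<dots> = \<lbrakk>Ide M (Q X), Rm f\<rbrakk>\<^sub>m \<cdot> \<lbrakk>Ide M (Q X), p (R ?Y')\<rbrakk>\<^sub>m \<cdot> k (Q X) (R ?Y')"
      by (simp only: k(4) cofibrant_Q R_Obj assms Dom_Obj f)
    also have "\<dots> = \<lbrakk>Ide M (Q X), p (R ?Y)\<rbrakk>\<^sub>m \<cdot> ?b"
      by (simp add: pm_natural del: k(4))
    finally have ab: "\<gamma> M \<lbrakk>?a, Ide M ?V\<rbrakk>\<^sub>m = \<gamma> M \<lbrakk>?b, Ide M ?V\<rbrakk>\<^sub>m"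
      by (intro \<gamma>_hom_cong[where t = "\<lbrakk>Ide M (Q X), p (R ?Y)\<rbrakk>\<^sub>m"]) simp_all
    have "(\<gamma> M \<lbrakk>Qm \<lbrakk>Ide M (Q X), Rm f\<rbrakk>\<^sub>m, Ide M (R ?V)\<rbrakk>\<^sub>m \<bullet> Lc SR X ?Y Z) \<bullet> \<gamma> M \<lbrakk>Qm (q ?Y), Ide M (R Z)\<rbrakk>\<^sub>m
      = \<gamma> M \<lbrakk>Qm \<lbrakk>Ide M (Q X), Rm f\<rbrakk>\<^sub>m, Ide M (R ?V)\<rbrakk>\<^sub>m \<bullet> (Lc SR X ?Y Z \<bullet> \<gamma> M \<lbrakk>Qm (q ?Y), Ide M (R Z)\<rbrakk>\<^sub>m)"
      by simp
    also have "\<dots> = \<gamma> M \<lbrakk>Ide M (Q \<lbrakk>Q X, R ?Y'\<rbrakk>), q ?V\<rbrakk>\<^sub>m \<bullet> \<gamma> M \<lbrakk>?a, Ide M ?V\<rbrakk>\<^sub>m \<bullet> \<gamma> M (L (Q X) (Q (R ?Y)) (R Z))"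
      by (simp add: Lc_SR_eq)
    also have "\<dots> = \<gamma> M \<lbrakk>k (Q X) (R ?Y'), q ?V\<rbrakk>\<^sub>m \<bullet>
        \<gamma> M (\<lbrakk>\<lbrakk>Ide M (Q X), Qm (Rm f)\<rbrakk>\<^sub>m, Ide M ?V\<rbrakk>\<^sub>m \<cdot> L (Q X) (Q (R ?Y)) (R Z))"
      unfolding ab by simp
    also have "\<lbrakk>\<lbrakk>Ide M (Q X), Qm (Rm f)\<rbrakk>\<^sub>m, Ide M ?V\<rbrakk>\<^sub>m \<cdot> L (Q X) (Q (R ?Y)) (R Z)
      = L (Q X) (Q (R ?Y')) (R Z) \<cdot> \<lbrakk>Qm (Rm f), Ide M (R Z)\<rbrakk>\<^sub>m"
      by (rule Lc_natural1) (simp_all add: Hom_def)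
    also have "\<gamma> M \<lbrakk>k (Q X) (R ?Y'), q ?V\<rbrakk>\<^sub>m \<bullet> \<gamma> M \<dots>
      = (Lc SR X ?Y' Z \<bullet> \<gamma> M \<lbrakk>Qm (q ?Y'), Ide M (R Z)\<rbrakk>\<^sub>m) \<bullet> \<gamma> M \<lbrakk>Qm (Rm f), Ide M (R Z)\<rbrakk>\<^sub>m"
      unfolding Lc_SR_eq[OF assms(2) Dom_Obj[OF f] assms(3)] by simp
    also have "\<dots> = Lc SR X ?Y' Z \<bullet> \<gamma> M \<lbrakk>Qm (Rm f \<cdot> q ?Y'), Ide M (R Z)\<rbrakk>\<^sub>m"
      by (simp add: Qm_Comp)
    also have "\<dots> = (Lc SR X ?Y' Z \<bullet> \<gamma> M \<lbrakk>Qm f, Ide M (R Z)\<rbrakk>\<^sub>m) \<bullet> \<gamma> M \<lbrakk>Qm (q ?Y), Ide M (R Z)\<rbrakk>\<^sub>m"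
      by (simp add: qm_natural Qm_Comp)
    finally have "(\<gamma> M \<lbrakk>Qm \<lbrakk>Ide M (Q X), Rm f\<rbrakk>\<^sub>m, Ide M (R ?V)\<rbrakk>\<^sub>m \<bullet> Lc SR X ?Y Z) \<bullet> \<gamma> M \<lbrakk>Qm (q ?Y), Ide M (R Z)\<rbrakk>\<^sub>m
      = (Lc SR X ?Y' Z \<bullet> \<gamma> M \<lbrakk>Qm f, Ide M (R Z)\<rbrakk>\<^sub>m) \<bullet> \<gamma> M \<lbrakk>Qm (q ?Y), Ide M (R Z)\<rbrakk>\<^sub>m" .
    from H.iso_epi[OF _ this]
    show "Lc SR X ?Y Z \<cdot>\<^bsub>op_cat H\<^esub> farr ?F (\<gamma> M f) = farr ?G (\<gamma> M f) \<cdot>\<^bsub>op_cat H\<^esub> Lc SR X ?Y' Z"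
      by simp
  qed simp_all
  then show ?thesis by simp
qed

section \<open>The derived adjunction\<close>

lemma \<phi>d_lift:
  assumes "A \<in> Obj M" "B \<in> Obj M" "g \<in> Arr H" "Dom H g = Q A \<otimes> Q B" "Cod H g = D"
  obtains g' where "g' \<in> Arr M" "Dom M g' = Q A \<otimes> Q B" "Cod M g' = R D" "\<gamma> M (q D) \<bullet> g = \<gamma> M g'"
  using \<gamma>_full[OF assms(3)] assms by auto

text \<open>The working form of the definition: followed by \<open>q D\<close>, the map
  \<open>g\<close> has a representative \<open>g'\<close> by fullness, and composing with
  \<open>p A\<close> clears the remaining inverse.\<close>

lemma \<phi>d_eq:
  assumes [simp]: "A \<in> Obj M" "B \<in> Obj M" "D \<in> Obj M"
    and g [simp]: "g' \<in> Arr M" "Dom M g' = Q A \<otimes> Q B" "Cod M g' = R D" and e: "\<gamma> M (q D) \<bullet> g = \<gamma> M g'"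
  shows "\<phi>d A B D g \<bullet> \<gamma> M (p A) = \<gamma> M (\<phi> (Q A) (Q B) (R D) g')"
    "\<phi>d A B D g \<in> Arr H" "Dom H (\<phi>d A B D g) = A" "Cod H (\<phi>d A B D g) = \<lbrakk>Q B, R D\<rbrakk>"
proof -
  have 1: "\<phi>d A B D g = \<gamma> M (\<phi> (Q A) (Q B) (R D) g') \<bullet> inv_arr H (\<gamma> M (p A))"
    unfolding phi_d_def e by (simp add: phi_ho_\<gamma>)
  show "\<phi>d A B D g \<bullet> \<gamma> M (p A) = \<gamma> M (\<phi> (Q A) (Q B) (R D) g')"
    "\<phi>d A B D g \<in> Arr H" "Dom H (\<phi>d A B D g) = A" "Cod H (\<phi>d A B D g) = \<lbrakk>Q B, R D\<rbrakk>"
    unfolding 1 by simp_all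
qed

lemma \<phi>d_arr [simp]:
  assumes "A \<in> Obj M" "B \<in> Obj M" "g \<in> Arr H" "Dom H g = Q A \<otimes> Q B" "Cod H g = D"
  shows "\<phi>d A B D g \<in> Arr H" "Dom H (\<phi>d A B D g) = A" "Cod H (\<phi>d A B D g) = \<lbrakk>Q B, R D\<rbrakk>"
proof -
  have D: "D \<in> Obj M" using assms by auto
  obtain g' where g': "g' \<in> Arr M" "Dom M g' = Q A \<otimes> Q B" "Cod M g' = R D" "\<gamma> M (q D) \<bullet> g = \<gamma> M g'"
    using \<phi>d_lift[OF assms] by metis
  show "\<phi>d A B D g \<in> Arr H" "Dom H (\<phi>d A B D g) = A" "Cod H (\<phi>d A B D g) = \<lbrakk>Q B, R D\<rbrakk>"
    using \<phi>d_eq(2-4)[OF assms(1,2) D g'] .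
qed

lemma \<phi>d_bij:
  assumes [simp]: "A \<in> Obj M" "B \<in> Obj M" "D \<in> Obj M"
  shows "bij_betw (\<phi>d A B D) (Hom H (Q A \<otimes> Q B) D) (Hom H A \<lbrakk>Q B, R D\<rbrakk>)"
proof -
  let ?f = "\<lambda>g. \<gamma> M (q D) \<bullet> g" and ?g = "phi_ho M T \<phi> (Q A) (Q B) (R D)" and ?h = "\<lambda>g. g \<bullet> inv_arr H (\<gamma> M (p A))"
  have 1: "bij_betw ?f (Hom H (Q A \<otimes> Q B) D) (Hom H (Q A \<otimes> Q B) (R D))"
    by (rule bij_betw_byWitness[where f' = "\<lambda>g. inv_arr H (\<gamma> M (q D)) \<bullet> g"]) (auto simp: Hom_def)
  have 2: "bij_betw ?g (Hom H (Q A \<otimes> Q B) (R D)) (Hom H (Q A) \<lbrakk>Q B, R D\<rbrakk>)"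
    by (rule phi_ho_bij) simp_all
  have 3: "bij_betw ?h (Hom H (Q A) \<lbrakk>Q B, R D\<rbrakk>) (Hom H A \<lbrakk>Q B, R D\<rbrakk>)"
    by (rule bij_betw_byWitness[where f' = "\<lambda>g. g \<bullet> \<gamma> M (p A)"]) (auto simp: Hom_def)
  have "bij_betw (?h \<circ> (?g \<circ> ?f)) (Hom H (Q A \<otimes> Q B) D) (Hom H A \<lbrakk>Q B, R D\<rbrakk>)"
    by (intro bij_betw_trans[OF _ 3] bij_betw_trans[OF 1 2])
  moreover have "?h \<circ> (?g \<circ> ?f) = \<phi>d A B D"
    by (simp add: fun_eq_iff phi_d_def)
  ultimately show ?thesis by simp
qed

text \<open>Induction on the pair of \<open>a\<close> and \<open>b\<close>. The map \<open>f\<close>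
  stays quantified, because a composite is handled by applying the hypothesis for the first factors
  to \<open>f \<bullet> tl a' b'\<close>.\<close>

lemma \<phi>d_pre:
  assumes "a \<in> Arr H" "b \<in> Arr H" "f \<in> Arr H" "Dom H f = Q (Cod H a) \<otimes> Q (Cod H b)" "Cod H f = D"
  shows "\<phi>d (Dom H a) (Dom H b) D (f \<bullet> tl a b) = hr b (Ide H D) \<bullet> \<phi>d (Cod H a) (Cod H b) D f \<bullet> a"
proof -
  have D [simp]: "D \<in> Obj M" using assms(3,5) by auto
  have "\<forall>f. f \<in> Arr H \<longrightarrow> Dom H f = Q (Cod H a) \<otimes> Q (Cod H b) \<longrightarrow> Cod H f = D \<longrightarrow>
    \<phi>d (Dom H a) (Dom H b) D (f \<bullet> tl a b) = hr b (Ide H D) \<bullet> \<phi>d (Cod H a) (Cod H b) D f \<bullet> a"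
    using assms(1,2)
  proof (induction rule: ho_induct2)
    case (arr a b)
    note [simp] = arr
    show ?case
    proof (intro allI impI)
      fix f assume f [simp]: "f \<in> Arr H" "Dom H f = Q (Cod H (\<gamma> M a)) \<otimes> Q (Cod H (\<gamma> M b))" "Cod H f = D"
      obtain f' where f' [simp]: "f' \<in> Arr M" "Dom M f' = Q (Cod M a) \<otimes> Q (Cod M b)" "Cod M f' = R D"
          and e: "\<gamma> M (q D) \<bullet> f = \<gamma> M f'"
        using \<phi>d_lift[of "Cod M a" "Cod M b" f D] by auto
      have "\<gamma> M (q D) \<bullet> (f \<bullet> tl (\<gamma> M a) (\<gamma> M b)) = (\<gamma> M (q D) \<bullet> f) \<bullet> tl (\<gamma> M a) (\<gamma> M b)" by simp
      also have "\<dots> = \<gamma> M (f' \<cdot> (Qm a \<otimes>\<^sub>m Qm b))" unfolding e by simp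
      finally have "\<phi>d (Dom M a) (Dom M b) D (f \<bullet> tl (\<gamma> M a) (\<gamma> M b)) \<bullet> \<gamma> M (p (Dom M a))
        = \<gamma> M (\<phi> (Q (Dom M a)) (Q (Dom M b)) (R D) (f' \<cdot> (Qm a \<otimes>\<^sub>m Qm b)))"
        by (intro \<phi>d_eq(1)) simp_all
      also have "\<phi> (Q (Dom M a)) (Q (Dom M b)) (R D) (f' \<cdot> (Qm a \<otimes>\<^sub>m Qm b))
        = \<lbrakk>Qm b, Ide M (R D)\<rbrakk>\<^sub>m \<cdot> \<phi> (Q (Cod M a)) (Q (Cod M b)) (R D) f' \<cdot> Qm a"
        using \<phi>_natural[of "Qm a" "Q (Dom M a)" "Q (Cod M a)" "Qm b" "Q (Dom M b)" "Q (Cod M b)" "Ide M (R D)" "R D" "R D" f']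
        by (simp add: Hom_def)
      also have "\<gamma> M \<dots> = \<gamma> M \<lbrakk>Qm b, Ide M (R D)\<rbrakk>\<^sub>m \<bullet> (\<gamma> M (\<phi> (Q (Cod M a)) (Q (Cod M b)) (R D) f')) \<bullet> \<gamma> M (Qm a)"
        by simp
      also have "\<gamma> M (\<phi> (Q (Cod M a)) (Q (Cod M b)) (R D) f') = \<phi>d (Cod M a) (Cod M b) D f \<bullet> \<gamma> M (p (Cod M a))"
        using e by (intro \<phi>d_eq(1)[symmetric]) simp_all
      also have "\<gamma> M \<lbrakk>Qm b, Ide M (R D)\<rbrakk>\<^sub>m \<bullet> \<dots> \<bullet> \<gamma> M (Qm a)
        = (\<gamma> M \<lbrakk>Qm b, Ide M (R D)\<rbrakk>\<^sub>m \<bullet> \<phi>d (Cod M a) (Cod M b) D f \<bullet> \<gamma> M a) \<bullet> \<gamma> M (p (Dom M a))"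
        by (simp add: pm_natural)
      finally have "\<phi>d (Dom M a) (Dom M b) D (f \<bullet> tl (\<gamma> M a) (\<gamma> M b)) \<bullet> \<gamma> M (p (Dom M a))
        = (\<gamma> M \<lbrakk>Qm b, Ide M (R D)\<rbrakk>\<^sub>m \<bullet> \<phi>d (Cod M a) (Cod M b) D f \<bullet> \<gamma> M a) \<bullet> \<gamma> M (p (Dom M a))" .
      from H.iso_epi[OF _ this]
      show "\<phi>d (Dom H (\<gamma> M a)) (Dom H (\<gamma> M b)) D (f \<bullet> tl (\<gamma> M a) (\<gamma> M b))
        = hr (\<gamma> M b) (Ide H D) \<bullet> \<phi>d (Cod H (\<gamma> M a)) (Cod H (\<gamma> M b)) D f \<bullet> \<gamma> M a"
        by simp
    qed
  next
    case (comp a b a' b')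
    note [simp] = comp(1-6)
    show ?case
    proof (intro allI impI)
      fix f assume f [simp]: "f \<in> Arr H" "Dom H f = Q (Cod H (a' \<bullet> a)) \<otimes> Q (Cod H (b' \<bullet> b))" "Cod H f = D"
      have "\<phi>d (Dom H a) (Dom H b) D ((f \<bullet> tl a' b') \<bullet> tl a b)
        = hr b (Ide H D) \<bullet> \<phi>d (Cod H a) (Cod H b) D (f \<bullet> tl a' b') \<bullet> a"
        by (rule comp(7)[rule_format]) simp_all
      also have "\<phi>d (Cod H a) (Cod H b) D (f \<bullet> tl a' b') = hr b' (Ide H D) \<bullet> \<phi>d (Cod H a') (Cod H b') D f \<bullet> a'"
        using comp(8)[rule_format, of f] by simp
      also have "hr b (Ide H D) \<bullet> \<dots> \<bullet> a = (hr b (Ide H D) \<bullet> hr b' (Ide H D)) \<bullet> \<phi>d (Cod H a') (Cod H b') D f \<bullet> a' \<bullet> a"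
        by simp
      also have "hr b (Ide H D) \<bullet> hr b' (Ide H D) = hr (b' \<bullet> b) (Ide H D)"
        using hr_Comp[of b' "Ide H D" b "Ide H D"] by simp
      finally show "\<phi>d (Dom H (a' \<bullet> a)) (Dom H (b' \<bullet> b)) D (f \<bullet> tl (a' \<bullet> a) (b' \<bullet> b))
        = hr (b' \<bullet> b) (Ide H D) \<bullet> \<phi>d (Cod H (a' \<bullet> a)) (Cod H (b' \<bullet> b)) D f \<bullet> a' \<bullet> a"
        by (simp add: tl_Comp)
    qed
  next
    case (inv v w)
    define a b where "a = \<gamma> M v" and "b = \<gamma> M w"
    have ab [simp]: "iso_arr H a" "iso_arr H b" "a \<in> Arr H" "b \<in> Arr H" using inv(1,2) by (auto simp: a_def b_def)
    have i: "inv_arr H (Ide H D) = Ide H D" using H.isoI[of "Ide H D" "Ide H D"] by simp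
    have "\<forall>f. f \<in> Arr H \<longrightarrow> Dom H f = Q (Dom H a) \<otimes> Q (Dom H b) \<longrightarrow> Cod H f = D \<longrightarrow>
       \<phi>d (Cod H a) (Cod H b) D (f \<bullet> tl (inv_arr H a) (inv_arr H b))
       = hr (inv_arr H b) (Ide H D) \<bullet> \<phi>d (Dom H a) (Dom H b) D f \<bullet> inv_arr H a"
    proof (intro allI impI)
      fix f assume f [simp]: "f \<in> Arr H" "Dom H f = Q (Dom H a) \<otimes> Q (Dom H b)" "Cod H f = D"
      let ?y = "\<phi>d (Cod H a) (Cod H b) D (f \<bullet> tl (inv_arr H a) (inv_arr H b))"
      \<comment> \<open>The hypothesis for the weak equivalences is applied to \<open>f\<close>
        composed with their inverses; these cancel, and the equation is solved for
        \<open>?y\<close>.\<close>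
      have "\<phi>d (Dom H a) (Dom H b) D ((f \<bullet> tl (inv_arr H a) (inv_arr H b)) \<bullet> tl a b) = hr b (Ide H D) \<bullet> ?y \<bullet> a"
        using inv(3)[folded a_def b_def, rule_format, of "f \<bullet> tl (inv_arr H a) (inv_arr H b)"] by simp
      moreover have "(f \<bullet> tl (inv_arr H a) (inv_arr H b)) \<bullet> tl a b = f"
        using tl_Comp[of a b "inv_arr H a" "inv_arr H b", symmetric] by simp
      ultimately have "hr b (Ide H D) \<bullet> ?y \<bullet> a = \<phi>d (Dom H a) (Dom H b) D f" by simp
      from H.iso_move_left[OF _ this] have "?y \<bullet> a = hr (inv_arr H b) (Ide H D) \<bullet> \<phi>d (Dom H a) (Dom H b) D f"
        by (simp add: i)
      from H.iso_move_right[OF _ this]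
      show "?y = hr (inv_arr H b) (Ide H D) \<bullet> \<phi>d (Dom H a) (Dom H b) D f \<bullet> inv_arr H a"
        by simp
    qed
    then show ?case by (simp add: a_def[symmetric] b_def[symmetric])
  qed
  then show ?thesis using assms by blast
qed

lemma \<phi>d_post_\<gamma>:
  assumes [simp]: "A \<in> Obj M" "B \<in> Obj M" "c \<in> Arr M"
    and f [simp]: "f \<in> Arr H" "Dom H f = Q A \<otimes> Q B" "Cod H f = Dom M c"
  shows "\<phi>d A B (Cod M c) (\<gamma> M c \<bullet> f) = hr (Ide H B) (\<gamma> M c) \<bullet> \<phi>d A B (Dom M c) f"
proof -
  let ?D = "Dom M c" and ?E = "Cod M c"
  obtain f' where f' [simp]: "f' \<in> Arr M" "Dom M f' = Q A \<otimes> Q B" "Cod M f' = R ?D"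
      and e: "\<gamma> M (q ?D) \<bullet> f = \<gamma> M f'"
    using \<phi>d_lift[of A B f ?D] by auto
  have "\<gamma> M (q ?E) \<bullet> (\<gamma> M c \<bullet> f) = \<gamma> M (Rm c) \<bullet> (\<gamma> M (q ?D) \<bullet> f)"
    by (simp add: qm_natural)
  also have "\<dots> = \<gamma> M (Rm c \<cdot> f')" unfolding e by simp
  finally have "\<phi>d A B ?E (\<gamma> M c \<bullet> f) \<bullet> \<gamma> M (p A) = \<gamma> M (\<phi> (Q A) (Q B) (R ?E) (Rm c \<cdot> f'))"
    by (intro \<phi>d_eq(1)) simp_all
  also have "\<phi> (Q A) (Q B) (R ?E) (Rm c \<cdot> f') = \<lbrakk>Ide M (Q B), Rm c\<rbrakk>\<^sub>m \<cdot> \<phi> (Q A) (Q B) (R ?D) f'"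
    by (rule \<phi>_post) simp_all
  also have "\<gamma> M \<dots> = \<gamma> M \<lbrakk>Ide M (Q B), Rm c\<rbrakk>\<^sub>m \<bullet> \<gamma> M (\<phi> (Q A) (Q B) (R ?D) f')" by simp
  also have "\<gamma> M (\<phi> (Q A) (Q B) (R ?D) f') = \<phi>d A B ?D f \<bullet> \<gamma> M (p A)"
    using e by (intro \<phi>d_eq(1)[symmetric]) simp_all
  finally have "\<phi>d A B ?E (\<gamma> M c \<bullet> f) \<bullet> \<gamma> M (p A) = (\<gamma> M \<lbrakk>Ide M (Q B), Rm c\<rbrakk>\<^sub>m \<bullet> \<phi>d A B ?D f) \<bullet> \<gamma> M (p A)"
    by simp
  from H.iso_epi[OF _ this] show ?thesis by simp
qed

text \<open>Induction on \<open>c\<close>, again with \<open>f\<close> quantified. A formal inverse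
  is reduced to \<open>\<phi>d_post_\<gamma>\<close> by cancelling the invertible hom of the weak
  equivalence.\<close>

lemma \<phi>d_post:
  assumes [simp]: "A \<in> Obj M" "B \<in> Obj M" and "c \<in> Arr H"
    and "f \<in> Arr H" "Dom H f = Q A \<otimes> Q B" "Cod H f = Dom H c"
  shows "\<phi>d A B (Cod H c) (c \<bullet> f) = hr (Ide H B) c \<bullet> \<phi>d A B (Dom H c) f"
proof -
  have "\<forall>f. f \<in> Arr H \<longrightarrow> Dom H f = Q A \<otimes> Q B \<longrightarrow> Cod H f = Dom H c \<longrightarrow>
    \<phi>d A B (Cod H c) (c \<bullet> f) = hr (Ide H B) c \<bullet> \<phi>d A B (Dom H c) f"
    using assms(3)
  proof (induction rule: ho_induct)
    case (arr c)
    then show ?case using \<phi>d_post_\<gamma>[OF assms(1,2), of c] by (simp del: hr_\<gamma>_Ide)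
  next
    case (comp c d)
    note [simp] = comp(1-3)
    show ?case
    proof (intro allI impI)
      fix f assume f [simp]: "f \<in> Arr H" "Dom H f = Q A \<otimes> Q B" "Cod H f = Dom H (d \<bullet> c)"
      have "\<phi>d A B (Cod H d) (d \<bullet> (c \<bullet> f)) = hr (Ide H B) d \<bullet> \<phi>d A B (Dom H d) (c \<bullet> f)"
        by (rule comp(5)[rule_format]) simp_all
      also have "\<phi>d A B (Dom H d) (c \<bullet> f) = hr (Ide H B) c \<bullet> \<phi>d A B (Dom H c) f"
        using comp(4)[rule_format, of f] by simp
      finally show "\<phi>d A B (Cod H (d \<bullet> c)) ((d \<bullet> c) \<bullet> f) = hr (Ide H B) (d \<bullet> c) \<bullet> \<phi>d A B (Dom H (d \<bullet> c)) f"
        using hr_Comp[of "Ide H B" c "Ide H B" d] by simp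
    qed
  next
    case (inv w)
    have i: "inv_arr H (Ide H B) = Ide H B" using H.isoI[of "Ide H B" "Ide H B"] by simp
    show ?case
    proof (intro allI impI)
      fix f assume f [simp]: "f \<in> Arr H" "Dom H f = Q A \<otimes> Q B" "Cod H f = Dom H (inv_arr H (\<gamma> M w))"
      have w: "w \<in> Arr M" using inv by simp
      have "hr (Ide H B) (\<gamma> M w) \<bullet> \<phi>d A B (Dom M w) (inv_arr H (\<gamma> M w) \<bullet> f) = \<phi>d A B (Cod M w) f"
        using \<phi>d_post_\<gamma>[OF assms(1,2) w, of "inv_arr H (\<gamma> M w) \<bullet> f"] inv w f(3) by (simp del: hr_\<gamma>_Ide)
      from H.iso_move_left[OF _ this]
      show "\<phi>d A B (Cod H (inv_arr H (\<gamma> M w))) (inv_arr H (\<gamma> M w) \<bullet> f)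
        = hr (Ide H B) (inv_arr H (\<gamma> M w)) \<bullet> \<phi>d A B (Dom H (inv_arr H (\<gamma> M w))) f"
        using inv w f(3) by (simp add: i del: hr_\<gamma>_Ide)
    qed
  qed
  then show ?thesis using assms by blast
qed

lemma \<phi>d_natural:
  assumes "a \<in> Hom H X' X" "b \<in> Hom H Y' Y" "c \<in> Hom H Z Z'" "f \<in> Hom H (Q X \<otimes> Q Y) Z"
  shows "\<phi>d X' Y' Z' (c \<bullet> f \<bullet> tl a b) = hr b c \<bullet> \<phi>d X Y Z f \<bullet> a"
proof -
  note [simp] = in_HomD[OF assms(1)] in_HomD[OF assms(2)] in_HomD[OF assms(3)] in_HomD[OF assms(4)]
  have o [simp]: "X \<in> Obj M" "Y \<in> Obj M" "X' \<in> Obj M" "Y' \<in> Obj M" "Z \<in> Obj M" "Z' \<in> Obj M"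
    using Ho_Obj[of a] Ho_Obj[of b] Ho_Obj[of c] by auto
  have "\<phi>d X' Y' Z' (c \<bullet> f \<bullet> tl a b) = hr (Ide H Y') c \<bullet> \<phi>d X' Y' Z (f \<bullet> tl a b)"
    using \<phi>d_post[of X' Y' c "f \<bullet> tl a b"] by simp
  also have "\<phi>d X' Y' Z (f \<bullet> tl a b) = hr b (Ide H Z) \<bullet> \<phi>d X Y Z f \<bullet> a"
    using \<phi>d_pre[of a b f Z] by simp
  also have "hr (Ide H Y') c \<bullet> \<dots> = (hr (Ide H Y') c \<bullet> hr b (Ide H Z)) \<bullet> \<phi>d X Y Z f \<bullet> a"
    by simp
  also have "hr (Ide H Y') c \<bullet> hr b (Ide H Z) = hr b c"
    using hr_Comp[of b "Ide H Z" "Ide H Y'" c] by simp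
  finally show ?thesis .
qed

section \<open>Compatibility of the derived adjunction with units and associativity\<close>

lemma \<phi>d_lun:
  assumes "X \<in> Obj M" "f \<in> Arr H" "Dom H f = X" "Cod H f = Y"
  shows "\<phi>d (tunit T) X Y (f \<bullet> lun TL X) = hr (Ide H X) f \<bullet> jc SR X"
proof -
  note [simp] = assms
  let ?I = "tunit T" and ?g = "q X \<cdot> p X \<cdot> l (Q X)"
  \<comment> \<open>The case of an identity is enough, the general \<open>f\<close> following by
    \<open>\<phi>d_post\<close>. The map \<open>?g\<close> with \<open>p ?I\<close> tensored in
    front represents \<open>lun TL X\<close> followed by \<open>q X\<close>.\<close>
  have "\<phi>d ?I X X (lun TL X) \<bullet> \<gamma> M (p ?I) = \<gamma> M (\<phi> (Q ?I) (Q X) (R X) (?g \<cdot> (p ?I \<otimes>\<^sub>m Ide M (Q X))))"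
    by (rule \<phi>d_eq(1)) (simp_all add: lun_TL)
  also have "\<phi> (Q ?I) (Q X) (R X) (?g \<cdot> (p ?I \<otimes>\<^sub>m Ide M (Q X))) = \<phi> ?I (Q X) (R X) ?g \<cdot> p ?I"
    by (rule \<phi>_pre1) simp_all
  also have "p X \<cdot> l (Q X) = l X \<cdot> (Ide M ?I \<otimes>\<^sub>m p X)"
    using lun_nat[of "p X" X] by simp
  also have "\<phi> ?I (Q X) (R X) (q X \<cdot> l X \<cdot> (Ide M ?I \<otimes>\<^sub>m p X)) = \<lbrakk>p X, q X\<rbrakk>\<^sub>m \<cdot> j X"
    using \<phi>_natural[of "Ide M ?I" ?I ?I "p X" "Q X" X "q X" X "R X" "l X"] by (simp add: Hom_def j_eq)
  finally have "\<phi>d ?I X X (lun TL X) \<bullet> \<gamma> M (p ?I) = jc SR X \<bullet> \<gamma> M (p ?I)"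
    by (simp add: jc_SR flip: unit_eq)
  from H.iso_epi[OF _ this] have "\<phi>d ?I X X (lun TL X) = jc SR X"
    by (simp add: jc_SR flip: unit_eq)
  then show ?thesis
    using \<phi>d_post[of ?I X f "lun TL X"] by simp
qed

lemma \<phi>d_run:
  assumes [simp]: "X \<in> Obj M" "Y \<in> Obj M"
    and g [simp]: "g \<in> Arr H" "Dom H g = Q X \<otimes> Q (tunit T)" "Cod H g = Y"
  shows "g \<bullet> run TL X = ic SR Y \<bullet> \<phi>d X (tunit T) Y g"
proof -
  let ?I = "tunit T" and ?E = "Ide M (Q X)"
  obtain g' where g' [simp]: "g' \<in> Arr M" "Dom M g' = Q X \<otimes> Q ?I" "Cod M g' = R Y"
      and eg: "\<gamma> M (q Y) \<bullet> g = \<gamma> M g'"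
    using \<phi>d_lift[of X ?I g Y] by auto
  \<comment> \<open>The inverse of \<open>?E \<otimes>\<^sub>m p ?I\<close> is represented by the
    section \<open>e\<close>, the same map along which \<open>ic SR\<close> restricts. Hence both
    sides of the claim reduce to \<open>i_\<phi>\<close> for
    \<open>g' \<cdot> (?E \<otimes>\<^sub>m e)\<close>.\<close>
  have "\<gamma> M (?E \<otimes>\<^sub>m p ?I) \<bullet> (run TL X \<bullet> \<gamma> M (p X)) = \<gamma> M (?E \<otimes>\<^sub>m p ?I) \<bullet> \<gamma> M ((?E \<otimes>\<^sub>m e) \<cdot> r (Q X))"
    by (simp add: run_TL_eq)
  from H.iso_mono[OF _ this] have r: "run TL X \<bullet> \<gamma> M (p X) = \<gamma> M ((?E \<otimes>\<^sub>m e) \<cdot> r (Q X))"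
    by simp
  have "(\<gamma> M (q Y) \<bullet> ic SR Y \<bullet> \<phi>d X ?I Y g) \<bullet> \<gamma> M (p X)
    = (\<gamma> M (q Y) \<bullet> ic SR Y) \<bullet> (\<phi>d X ?I Y g \<bullet> \<gamma> M (p X))"
    by simp
  also have "\<dots> = \<gamma> M (i (R Y)) \<bullet> \<gamma> M (\<lbrakk>e, Ide M (R Y)\<rbrakk>\<^sub>m \<cdot> \<phi> (Q X) (Q ?I) (R Y) g')"
    unfolding ic_SR_eq[OF assms(2)] \<phi>d_eq(1)[OF assms(1) tunit_Obj assms(2) g' eg] by (simp flip: unit_eq)
  also have "\<lbrakk>e, Ide M (R Y)\<rbrakk>\<^sub>m \<cdot> \<phi> (Q X) (Q ?I) (R Y) g' = \<phi> (Q X) ?I (R Y) (g' \<cdot> (?E \<otimes>\<^sub>m e))"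
    by (rule \<phi>_pre2[symmetric]) simp_all
  also have "\<gamma> M (i (R Y)) \<bullet> \<gamma> M \<dots> = \<gamma> M (g' \<cdot> (?E \<otimes>\<^sub>m e) \<cdot> r (Q X))"
    using i_\<phi>[of "Q X" "g' \<cdot> (?E \<otimes>\<^sub>m e)" "R Y"] by (simp flip: unit_eq)
  also have "\<dots> = (\<gamma> M (q Y) \<bullet> g) \<bullet> (run TL X \<bullet> \<gamma> M (p X))"
    unfolding eg r by simp
  also have "\<dots> = (\<gamma> M (q Y) \<bullet> g \<bullet> run TL X) \<bullet> \<gamma> M (p X)"
    by simp
  finally have "(\<gamma> M (q Y) \<bullet> ic SR Y \<bullet> \<phi>d X ?I Y g) \<bullet> \<gamma> M (p X) = (\<gamma> M (q Y) \<bullet> g \<bullet> run TL X) \<bullet> \<gamma> M (p X)" .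
  from H.iso_epi[OF _ this] have "\<gamma> M (q Y) \<bullet> (ic SR Y \<bullet> \<phi>d X ?I Y g) = \<gamma> M (q Y) \<bullet> (g \<bullet> run TL X)"
    by simp
  from H.iso_mono[OF _ this] show ?thesis by simp
qed

text \<open>The map \<open>t\<close> of the derived structure: on the cofibrant object \<open>P = Q Y \<otimes> Q Z\<close> a section \<open>s\<close> of
  \<open>p\<close> takes the place of the liftings \<open>k\<close>.\<close>

lemma t_SR:
  assumes [simp]: "Y \<in> Obj M" "Z \<in> Obj M" "W \<in> Obj M" and P: "P = Q Y \<otimes> Q Z"
    and s: "s \<in> Arr M" "Dom M s = P" "Cod M s = Q P" "p P \<cdot> s = Ide M P"
  shows "hr (\<phi>d Y Z P (Ide H P)) (Ide H \<lbrakk>Q Z, R W\<rbrakk>) \<bullet> Lc SR Z P W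
    = \<gamma> M (\<lbrakk>Ide M (Q Y), q \<lbrakk>Q Z, R W\<rbrakk>\<rbrakk>\<^sub>m \<cdot>
        \<lbrakk>\<phi> (Q Y) (Q Z) P (Ide M P), Ide M \<lbrakk>Q Z, R W\<rbrakk>\<rbrakk>\<^sub>m \<cdot> L (Q Z) P (R W) \<cdot> \<lbrakk>s, Ide M (R W)\<rbrakk>\<^sub>m)"
proof -
  let ?V = "\<lbrakk>Q Z, R W\<rbrakk>" and ?u = "\<phi> (Q Y) (Q Z) P (Ide M P)" and ?ud = "\<phi>d Y Z P (Ide H P)"
  let ?uq = "\<phi> (Q Y) (Q Z) (R P) (q P)"
  have PO [simp]: "P \<in> Obj M" unfolding P by simp
  have u [simp]: "?u \<in> Arr M" "Dom M ?u = Q Y" "Cod M ?u = \<lbrakk>Q Z, P\<rbrakk>" using P by simp_all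
  have uq: "?uq = \<lbrakk>Ide M (Q Z), q P\<rbrakk>\<^sub>m \<cdot> ?u"
    using \<phi>_post[of "Q Y" "Q Z" "Ide M P" P "q P" "R P"] P by simp
  have uq_arr [simp]: "?uq \<in> Arr M" "Dom M ?uq = Q Y" "Cod M ?uq = \<lbrakk>Q Z, R P\<rbrakk>" using P by simp_all
  have ud: "?ud \<bullet> \<gamma> M (p Y) = \<gamma> M ?uq" and [simp]: "?ud \<in> Arr H" "Dom H ?ud = Y" "Cod H ?ud = \<lbrakk>Q Z, R P\<rbrakk>"
    using \<phi>d_eq[of Y Z P "q P" "Ide H P"] P by simp_all
  note [simp] = s(1-3)
  have hud: "\<gamma> M \<lbrakk>Qm (p Y), Ide M (R ?V)\<rbrakk>\<^sub>m \<bullet> hr ?ud (Ide H ?V) = \<gamma> M \<lbrakk>Qm ?uq, Ide M (R ?V)\<rbrakk>\<^sub>m"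
    using hr_Comp[of ?ud "Ide H ?V" "\<gamma> M (p Y)" "Ide H ?V"] by (simp add: ud)
  \<comment> \<open>Both maps lift \<open>?uq \<cdot> p (Q Y)\<close> along
    \<open>\<lbrakk>Ide M (Q Z), p (R P)\<rbrakk>\<^sub>m\<close>: \<open>?a\<close> by the chosen
    \<open>k\<close>, \<open>?b\<close> by the section \<open>s\<close>, because
    \<open>q P \<cdot> p P \<cdot> s\<close> is \<open>q P\<close>.\<close>
  let ?a = "k (Q Z) (R P) \<cdot> Qm ?uq" and ?v = "\<lbrakk>Ide M (Q Z), s\<rbrakk>\<^sub>m \<cdot> ?u"
  let ?b = "\<lbrakk>Ide M (Q Z), Qm (q P)\<rbrakk>\<^sub>m \<cdot> ?v \<cdot> p (Q Y)"
  have "\<lbrakk>Ide M (Q Z), p (R P)\<rbrakk>\<^sub>m \<cdot> ?a = (\<lbrakk>Ide M (Q Z), p (R P)\<rbrakk>\<^sub>m \<cdot> k (Q Z) (R P)) \<cdot> Qm ?uq"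
    by (simp del: k(4))
  also have "\<dots> = \<lbrakk>Ide M (Q Z), q P\<rbrakk>\<^sub>m \<cdot> ?u \<cdot> p (Q Y)"
    using pm_natural[of ?uq "\<lbrakk>Q Z, R P\<rbrakk>"] uq by simp
  also have "\<dots> = \<lbrakk>Ide M (Q Z), q P \<cdot> p P \<cdot> s\<rbrakk>\<^sub>m \<cdot> ?u \<cdot> p (Q Y)"
    using s(4) by simp
  also have "q P \<cdot> p P \<cdot> s = (p (R P) \<cdot> Qm (q P)) \<cdot> s"
    by (simp add: pm_natural)
  also have "\<lbrakk>Ide M (Q Z), \<dots>\<rbrakk>\<^sub>m \<cdot> ?u \<cdot> p (Q Y) = \<lbrakk>Ide M (Q Z), p (R P)\<rbrakk>\<^sub>m \<cdot> ?b"
    by simp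
  finally have ab: "\<gamma> M \<lbrakk>?a, Ide M ?V\<rbrakk>\<^sub>m = \<gamma> M \<lbrakk>?b, Ide M ?V\<rbrakk>\<^sub>m"
    by (intro \<gamma>_hom_cong[where t = "\<lbrakk>Ide M (Q Z), p (R P)\<rbrakk>\<^sub>m"]) simp_all
  let ?t = "\<lbrakk>?v, Ide M ?V\<rbrakk>\<^sub>m \<cdot> L (Q Z) (Q P) (R W)" and ?X = "hr ?ud (Ide H ?V) \<bullet> Lc SR Z P W"
  let ?q = "\<gamma> M \<lbrakk>Qm (q P), Ide M (R W)\<rbrakk>\<^sub>m" and ?p = "\<gamma> M \<lbrakk>Qm (p Y), Ide M (R ?V)\<rbrakk>\<^sub>m"
  have "(?p \<bullet> ?X) \<bullet> ?q = (?p \<bullet> hr ?ud (Ide H ?V)) \<bullet> (Lc SR Z P W \<bullet> ?q)"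
    by simp
  also have "\<dots> = \<gamma> M \<lbrakk>Ide M (Q (Q Y)), q ?V\<rbrakk>\<^sub>m \<bullet> \<gamma> M \<lbrakk>?a, Ide M ?V\<rbrakk>\<^sub>m \<bullet> \<gamma> M (L (Q Z) (Q (R P)) (R W))"
    unfolding hud Lc_SR_eq[OF assms(2) PO assms(3)] by simp
  also have "\<dots> = \<gamma> M \<lbrakk>Ide M (Q (Q Y)), q ?V\<rbrakk>\<^sub>m \<bullet> \<gamma> M \<lbrakk>p (Q Y), Ide M ?V\<rbrakk>\<^sub>m \<bullet>
      \<gamma> M (\<lbrakk>?v, Ide M ?V\<rbrakk>\<^sub>m \<cdot> (\<lbrakk>\<lbrakk>Ide M (Q Z), Qm (q P)\<rbrakk>\<^sub>m, Ide M ?V\<rbrakk>\<^sub>m \<cdot> L (Q Z) (Q (R P)) (R W)))"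
    unfolding ab by simp
  also have "\<lbrakk>\<lbrakk>Ide M (Q Z), Qm (q P)\<rbrakk>\<^sub>m, Ide M ?V\<rbrakk>\<^sub>m \<cdot> L (Q Z) (Q (R P)) (R W) = L (Q Z) (Q P) (R W) \<cdot> \<lbrakk>Qm (q P), Ide M (R W)\<rbrakk>\<^sub>m"
    by (rule Lc_natural1) (simp_all add: Hom_def)
  \<comment> \<open>In the form \<open>Qm (p Y)\<close> this factor matches \<open>?p\<close>, which
    is cancelled below.\<close>
  also have "\<gamma> M \<lbrakk>p (Q Y), Ide M ?V\<rbrakk>\<^sub>m = \<gamma> M \<lbrakk>Qm (p Y), Ide M ?V\<rbrakk>\<^sub>m"
    by (simp add: \<gamma>_Qp)
  also have "\<gamma> M \<lbrakk>Ide M (Q (Q Y)), q ?V\<rbrakk>\<^sub>m \<bullet> \<gamma> M \<lbrakk>Qm (p Y), Ide M ?V\<rbrakk>\<^sub>m \<bullet>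
      \<gamma> M (\<lbrakk>?v, Ide M ?V\<rbrakk>\<^sub>m \<cdot> L (Q Z) (Q P) (R W) \<cdot> \<lbrakk>Qm (q P), Ide M (R W)\<rbrakk>\<^sub>m)
    = (?p \<bullet> \<gamma> M (\<lbrakk>Ide M (Q Y), q ?V\<rbrakk>\<^sub>m \<cdot> ?t)) \<bullet> ?q"
    by simp
  finally have "(?p \<bullet> ?X) \<bullet> ?q = (?p \<bullet> \<gamma> M (\<lbrakk>Ide M (Q Y), q ?V\<rbrakk>\<^sub>m \<cdot> ?t)) \<bullet> ?q" .
  from H.iso_epi[OF _ this] have "?p \<bullet> ?X = ?p \<bullet> \<gamma> M (\<lbrakk>Ide M (Q Y), q ?V\<rbrakk>\<^sub>m \<cdot> ?t)"
    by simp
  from H.iso_mono[OF _ this] have 1: "?X = \<gamma> M (\<lbrakk>Ide M (Q Y), q ?V\<rbrakk>\<^sub>m \<cdot> ?t)"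
    by simp
  have "?t = \<lbrakk>?u, Ide M ?V\<rbrakk>\<^sub>m \<cdot> (\<lbrakk>\<lbrakk>Ide M (Q Z), s\<rbrakk>\<^sub>m, Ide M ?V\<rbrakk>\<^sub>m \<cdot> L (Q Z) (Q P) (R W))"
    by simp
  also have "\<lbrakk>\<lbrakk>Ide M (Q Z), s\<rbrakk>\<^sub>m, Ide M ?V\<rbrakk>\<^sub>m \<cdot> L (Q Z) (Q P) (R W) = L (Q Z) P (R W) \<cdot> \<lbrakk>s, Ide M (R W)\<rbrakk>\<^sub>m"
    by (rule Lc_natural1) (simp_all add: Hom_def)
  finally show ?thesis unfolding 1 by simp
qed

text \<open>On the cofibrant object \<open>P\<close> the map \<open>p P\<close> has a section
  \<open>s\<close>. It makes the derived associator the image of a map of \<open>M\<close>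
  (\<open>al\<close>), so the composite with \<open>h\<close> gets a representative through
  \<open>?m\<close>, and \<open>\<phi>_asc\<close> applies to \<open>?n\<close>. Then
  \<open>t_SR\<close> recognises the result as the derived \<open>t\<close>.\<close>

lemma \<phi>d_asc:
  assumes [simp]: "X \<in> Obj M" "Y \<in> Obj M" "Z \<in> Obj M" "W \<in> Obj M"
    and h [simp]: "h \<in> Arr H" "Dom H h = Q X \<otimes> Q (Q Y \<otimes> Q Z)" "Cod H h = W"
  shows "\<phi>d X Y \<lbrakk>Q Z, R W\<rbrakk> (\<phi>d (Q X \<otimes> Q Y) Z W (h \<bullet> \<alpha>l X Y Z))
    = hr (\<phi>d Y Z (Q Y \<otimes> Q Z) (Ide H (Q Y \<otimes> Q Z))) (Ide H \<lbrakk>Q Z, R W\<rbrakk>) \<bullet> Lc SR Z (Q Y \<otimes> Q Z) W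
      \<bullet> \<phi>d X (Q Y \<otimes> Q Z) W h"
proof -
  define P where "P = Q Y \<otimes> Q Z"
  let ?V = "\<lbrakk>Q Z, R W\<rbrakk>" and ?E = "Ide M (Q X)" and ?XY = "Q X \<otimes> Q Y"
  have P [simp]: "cofibrant M P" "P \<in> Obj M" by (simp_all add: P_def)
  note [simp] = P_def[symmetric]
  obtain s where s [simp]: "s \<in> Arr M" "Dom M s = P" "Cod M s = Q P" "p P \<cdot> s = Ide M P"
    using lift_cofibrant[of P "p P" "Ide M P"] by auto
  note hP = h(2)[folded P_def]
  obtain h' where h' [simp]: "h' \<in> Arr M" "Dom M h' = Q X \<otimes> Q P" "Cod M h' = R W" and eh: "\<gamma> M (q W) \<bullet> h = \<gamma> M h'"
    using \<phi>d_lift[OF assms(1) P(2) h(1) hP h(3)] by metis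
  let ?n = "h' \<cdot> (?E \<otimes>\<^sub>m s)"
  let ?m = "?n \<cdot> \<alpha> (Q X) (Q Y) (Q Z)"
  have m0: "?n \<in> Arr M" "Dom M ?n = Q X \<otimes> (Q Y \<otimes> Q Z)" "Cod M ?n = R W" by simp_all
  have m [simp]: "?m \<in> Arr M" "Dom M ?m = ?XY \<otimes> Q Z" "Cod M ?m = R W" using m0 by simp_all
  have "\<gamma> M (?E \<otimes>\<^sub>m p P) \<bullet> \<alpha>l X Y Z
    = \<gamma> M (?E \<otimes>\<^sub>m p P) \<bullet> \<gamma> M ((?E \<otimes>\<^sub>m s) \<cdot> \<alpha> (Q X) (Q Y) (Q Z) \<cdot> (p ?XY \<otimes>\<^sub>m Ide M (Q Z)))"
    using \<alpha>l_eq[of X Y Z] by simp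
  from H.iso_mono[OF _ this] have al: "\<alpha>l X Y Z = \<gamma> M ((?E \<otimes>\<^sub>m s) \<cdot> \<alpha> (Q X) (Q Y) (Q Z) \<cdot> (p ?XY \<otimes>\<^sub>m Ide M (Q Z)))"
    by simp
  have "\<gamma> M (q W) \<bullet> (h \<bullet> \<alpha>l X Y Z) = (\<gamma> M (q W) \<bullet> h) \<bullet> \<alpha>l X Y Z" by simp
  also have "\<dots> = \<gamma> M (?m \<cdot> (p ?XY \<otimes>\<^sub>m Ide M (Q Z)))" unfolding eh al by simp
  finally have "\<phi>d ?XY Z W (h \<bullet> \<alpha>l X Y Z) \<bullet> \<gamma> M (p ?XY) = \<gamma> M (\<phi> (Q ?XY) (Q Z) (R W) (?m \<cdot> (p ?XY \<otimes>\<^sub>m Ide M (Q Z))))"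
    by (intro \<phi>d_eq(1)) simp_all
  also have "\<phi> (Q ?XY) (Q Z) (R W) (?m \<cdot> (p ?XY \<otimes>\<^sub>m Ide M (Q Z))) = \<phi> ?XY (Q Z) (R W) ?m \<cdot> p ?XY"
    by (rule \<phi>_pre1) (use m in simp_all)
  finally have "\<phi>d ?XY Z W (h \<bullet> \<alpha>l X Y Z) \<bullet> \<gamma> M (p ?XY) = \<gamma> M (\<phi> ?XY (Q Z) (R W) ?m) \<bullet> \<gamma> M (p ?XY)"
    using m by (simp del: assoc)
  from H.iso_epi[OF _ this] have "\<phi>d ?XY Z W (h \<bullet> \<alpha>l X Y Z) = \<gamma> M (\<phi> ?XY (Q Z) (R W) ?m)"
    using m by (simp del: assoc)
  then have "\<phi>d X Y ?V (\<phi>d ?XY Z W (h \<bullet> \<alpha>l X Y Z)) \<bullet> \<gamma> M (p X)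
    = \<gamma> M (\<phi> (Q X) (Q Y) (R ?V) (q ?V \<cdot> \<phi> ?XY (Q Z) (R W) ?m))"
    using m by (intro \<phi>d_eq(1)) (simp_all del: assoc)
  also have "\<phi> (Q X) (Q Y) (R ?V) (q ?V \<cdot> \<phi> ?XY (Q Z) (R W) ?m)
    = \<lbrakk>Ide M (Q Y), q ?V\<rbrakk>\<^sub>m \<cdot> \<phi> (Q X) (Q Y) ?V (\<phi> ?XY (Q Z) (R W) ?m)"
    by (rule \<phi>_post) (use m in \<open>simp_all del: assoc\<close>)
  also have "\<phi> (Q X) (Q Y) ?V (\<phi> ?XY (Q Z) (R W) ?m)
    = \<lbrakk>\<phi> (Q Y) (Q Z) P (Ide M P), Ide M ?V\<rbrakk>\<^sub>m \<cdot> L (Q Z) P (R W) \<cdot> \<phi> (Q X) P (R W) ?n"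
    unfolding P_def by (rule \<phi>_asc) (use m0 in \<open>simp_all add: Hom_def\<close>)
  also have "\<phi> (Q X) P (R W) ?n = \<lbrakk>s, Ide M (R W)\<rbrakk>\<^sub>m \<cdot> \<phi> (Q X) (Q P) (R W) h'"
    by (rule \<phi>_pre2) simp_all
  finally have 1: "\<phi>d X Y ?V (\<phi>d ?XY Z W (h \<bullet> \<alpha>l X Y Z)) \<bullet> \<gamma> M (p X)
    = \<gamma> M (\<lbrakk>Ide M (Q Y), q ?V\<rbrakk>\<^sub>m \<cdot> \<lbrakk>\<phi> (Q Y) (Q Z) P (Ide M P), Ide M ?V\<rbrakk>\<^sub>m \<cdot> L (Q Z) P (R W) \<cdot>
        \<lbrakk>s, Ide M (R W)\<rbrakk>\<^sub>m \<cdot> \<phi> (Q X) (Q P) (R W) h')" .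
  have [simp]: "\<phi> (Q Y) (Q Z) P (Ide M P) \<in> Arr M" "Dom M (\<phi> (Q Y) (Q Z) P (Ide M P)) = Q Y"
      "Cod M (\<phi> (Q Y) (Q Z) P (Ide M P)) = \<lbrakk>Q Z, P\<rbrakk>"
    using \<phi>_arr[of "Q Y" "Q Z" "Ide M P" P] by simp_all
  let ?ud = "\<phi>d Y Z P (Ide H P)"
  have [simp]: "?ud \<in> Arr H" "Dom H ?ud = Y" "Cod H ?ud = \<lbrakk>Q Z, R P\<rbrakk>"
    using \<phi>d_arr[of Y Z "Ide H P" P] by simp_all
  have "(hr ?ud (Ide H ?V) \<bullet> Lc SR Z P W \<bullet> \<phi>d X P W h) \<bullet> \<gamma> M (p X)
    = (hr ?ud (Ide H ?V) \<bullet> Lc SR Z P W) \<bullet> (\<phi>d X P W h \<bullet> \<gamma> M (p X))"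
    by simp
  also have "\<dots> = \<phi>d X Y ?V (\<phi>d ?XY Z W (h \<bullet> \<alpha>l X Y Z)) \<bullet> \<gamma> M (p X)"
    unfolding 1 t_SR[OF assms(2,3,4) P_def s] \<phi>d_eq(1)[OF assms(1) P(2) assms(4) h' eh] by simp
  finally have "\<phi>d X Y ?V (\<phi>d ?XY Z W (h \<bullet> \<alpha>l X Y Z)) \<bullet> \<gamma> M (p X)
    = (hr ?ud (Ide H ?V) \<bullet> Lc SR Z P W \<bullet> \<phi>d X P W h) \<bullet> \<gamma> M (p X)" by (rule sym)
  from H.iso_epi[OF _ this] show ?thesis
    unfolding P_def[symmetric] by simp
qed

theorem tensor_hom_adjunction_Ho: "tensor_hom_adjunction H TL SR \<phi>d"
proof (intro tensor_hom_adjunction.intro tensor_hom_adjunction_axioms.intro hom_functor.intro hom_functor_axioms.intro)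
  show "skew_monoidal H TL" by (rule skew_monoidal_left_derived)
  show "category H" by (rule category_Ho)
  show "cat_functor (prod_cat (op_cat H) H) H (ihom SR)" by (rule SR_functor)
  show "hr (hr (Ide H X) g) (Ide H (fobj (ihom SR) (X, Z))) \<bullet> Lc SR X Y Z = Lc SR X Y' Z \<bullet> hr g (Ide H Z)"
    if "X \<in> Obj H" "g \<in> Hom H Y' Y" "Z \<in> Obj H" for X g Y Y' Z
    using Lc_SR_natural1[of g X Z] that by (simp add: Hom_def)
  show "\<phi>d X' Y' Z' (c \<bullet> f \<bullet> tl a b) = hr b c \<bullet> \<phi>d X Y Z f \<bullet> a"
    if "a \<in> Hom H X' X" "b \<in> Hom H Y' Y" "c \<in> Hom H Z Z'" "f \<in> Hom H (fobj (tensor TL) (X, Y)) Z" for a b c f X X' Y Y' Z Z'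
    using \<phi>d_natural[of a X' X b Y' Y c Z Z' f] that by simp
  show "bij_betw (\<phi>d X Y Z) (Hom H (fobj (tensor TL) (X, Y)) Z) (Hom H X (fobj (ihom SR) (Y, Z)))"
    if "X \<in> Obj H" "Y \<in> Obj H" "Z \<in> Obj H" for X Y Z
    using \<phi>d_bij[of X Y Z] that by simp
  show "\<phi>d (tunit TL) X Y (f \<bullet> lun TL X) = hr (Ide H X) f \<bullet> jc SR X" if "f \<in> Hom H X Y" for f X Y
    using \<phi>d_lun[of X f Y] Ho_Obj[of f] that by (auto simp: Hom_def)
  show "g \<bullet> run TL X = ic SR Y \<bullet> \<phi>d X (tunit TL) Y g"
    if "X \<in> Obj H" "Y \<in> Obj H" "g \<in> Hom H (fobj (tensor TL) (X, tunit TL)) Y" for X Y g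
    using \<phi>d_run[of X Y g] that by (simp add: Hom_def)
  show "\<phi>d X Y (fobj (ihom SR) (Z, W)) (\<phi>d (fobj (tensor TL) (X, Y)) Z W (h \<bullet> \<alpha>l X Y Z))
    = hr (\<phi>d Y Z (fobj (tensor TL) (Y, Z)) (Ide H (fobj (tensor TL) (Y, Z)))) (Ide H (fobj (ihom SR) (Z, W)))
      \<bullet> Lc SR Z (fobj (tensor TL) (Y, Z)) W \<bullet> \<phi>d X (fobj (tensor TL) (Y, Z)) W h"
    if "X \<in> Obj H" "Y \<in> Obj H" "Z \<in> Obj H" "W \<in> Obj H"
      "h \<in> Hom H (fobj (tensor TL) (X, fobj (tensor TL) (Y, Z))) W" for X Y Z W h
    using \<phi>d_asc[of X Y Z W h] that by (simp add: Hom_def)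
  show "jc SR X \<in> Hom H (cunit SR) (fobj (ihom SR) (X, X))" if "X \<in> Obj H" for X
    using that by (simp add: Hom_def jc_SR flip: unit_eq)
qed (simp_all add: Hom_def)

end

text \<open>Apart from repackaging, the difference lies in the bracketing of
  \<open>\<phi>_asc\<close>: there \<open>t\<close> is a composite of its own, here everything is
  bracketed to the right. Associativity requires the types of the unit and of the transpose of
  \<open>h\<close>.\<close>

lemma (in monoidal_skew_closed) tensor_hom_adjunction: "tensor_hom_adjunction C T S \<phi>"
proof (intro tensor_hom_adjunction.intro tensor_hom_adjunction_axioms.intro hom_functor.intro hom_functor_axioms.intro)
  fix X Y Z W h assume "X \<in> Obj C" "Y \<in> Obj C" "Z \<in> Obj C" "W \<in> Obj C" and h: "h \<in> Hom C (X \<otimes> (Y \<otimes> Z)) W"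
  note [simp] = this(1-4)
  have o [simp]: "\<lbrakk>V, V'\<rbrakk> \<in> Obj C" if "V \<in> Obj C" "V' \<in> Obj C" for V V'
    using cat_functor.fobj_in[OF ihom_functor, of "(V, V')"] that by simp
  have u: "\<phi> Y Z (Y \<otimes> Z) (Ide C (Y \<otimes> Z)) \<in> Hom C Y \<lbrakk>Z, Y \<otimes> Z\<rbrakk>"
    using bij_betwE[OF \<phi>_bij[of Y Z "Y \<otimes> Z"]] Ide_in[of "Y \<otimes> Z"] by simp
  have "\<lbrakk>\<phi> Y Z (Y \<otimes> Z) (Ide C (Y \<otimes> Z)), Ide C \<lbrakk>Z, W\<rbrakk>\<rbrakk>\<^sub>m \<in> Hom C \<lbrakk>\<lbrakk>Z, Y \<otimes> Z\<rbrakk>, \<lbrakk>Z, W\<rbrakk>\<rbrakk> \<lbrakk>Y, \<lbrakk>Z, W\<rbrakk>\<rbrakk>"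
    by (rule cat_functor.farr_in[OF ihom_functor]) (use u Ide_in in simp)
  moreover have "\<phi> X (Y \<otimes> Z) W h \<in> Hom C X \<lbrakk>Y \<otimes> Z, W\<rbrakk>"
    using bij_betwE[OF \<phi>_bij[of X "Y \<otimes> Z" W]] h by simp
  ultimately show "\<phi> X Y \<lbrakk>Z, W\<rbrakk> (\<phi> (X \<otimes> Y) Z W (h \<cdot> asc T X Y Z))
    = \<lbrakk>\<phi> Y Z (Y \<otimes> Z) (Ide C (Y \<otimes> Z)), Ide C \<lbrakk>Z, W\<rbrakk>\<rbrakk>\<^sub>m \<cdot> Lc S Z (Y \<otimes> Z) W \<cdot> \<phi> X (Y \<otimes> Z) W h"
    using \<phi>_asc[OF _ _ _ _ h] Comp_assoc Lc_in[of Z "Y \<otimes> Z" W] by (simp add: Let_def)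
qed (fact skew_monoidal_axioms category_axioms ihom_functor unit_eq Lc_in ic_in jc_in Lc_natural1
    \<phi>_bij \<phi>_natural \<phi>_lun \<phi>_run)+

theorem theorem5p11:
  fixes M :: "('o, 'm) model"
    and T :: "('o, 'm) skew_mon"
    and S :: "('o, 'm) skew_clo"
    and \<phi> :: "'o \<Rightarrow> 'o \<Rightarrow> 'o \<Rightarrow> 'm \<Rightarrow> 'm"
    and k :: "'o \<Rightarrow> 'o \<Rightarrow> 'm"
    and e :: 'm
  assumes "model_category M"
    and "monoidal_skew_closed M T S \<phi>"
    and "axiom_MC M T"
    and "is_k_choice M S k"
    and "is_e_choice M S e"
  shows "monoidal_skew_closed (Ho M) (left_derived M T) (right_derived M S k e) (phi_d M T \<phi>)"
proof -
  have "derived_structures M T S \<phi> k e"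
    using assms monoidal_skew_closed.tensor_hom_adjunction[OF assms(2)]
    by (intro derived_structures.intro derived_structures_axioms.intro monoidal_model_category.intro
        monoidal_model_category_axioms.intro)
  then show ?thesis
    by (intro tensor_hom_adjunction.monoidal_skew_closed derived_structures.tensor_hom_adjunction_Ho)
qed

end
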